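(* Let $h:\mathbb R^n\to\mathbb R^n$ be a smooth regular diffeomorphism, let $0\le1-\rho\le\delta\le\rho\le1$, $\delta<1$, $\tau>0$, $m\in\mathbb R$, and let $p(x,\xi,x')\in C^\tau S^m_{\rho,\delta}(\mathbb R^n,\mathbb R^n\times\mathbb R^n)$ with operator $P=p(X,D_x,X')$. Then the operator $A:\mathscr S(\mathbb R^n)\to C^0(\mathbb R^n)$ given by $$\big(A(u\circ h)\big)(y)=(Pu)(h(y))$$ is a pseudodifferential operator of the class $\mathrm{OP}\,C^\tau S^m_{\rho,\delta}(\mathbb R^n,\mathbb R^n\times\mathbb R^n)$. For $r>0$ sufficiently small, the symbol $$a(y,\eta,y')=\sum_{j=1}^\infty\varphi_j(h(y))\,p\big(h(y),\Xi_h(y,y')^{-T}\eta,h(y')\big)\,\psi_j(h(y'))\,|\det\Xi_h(y,y')|^{-1}\,|\det Dh(y')|$$ is well defined and satisfies $A\equiv a(Y,D_y,Y')\mod \mathrm{OP}\,C^\tau S^{-\infty}(\mathbb R^n,\mathbb R^n\times\mathbb R^n)$, where $$\Xi_h(y,y')=\int_0^1 Dh\big(y'+\theta(y-y')\big)\,d\theta .$$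
   Context: $\langle\xi\rangle=(1+|\xi|^2)^{1/2}$; $C^0(\mathbb R^n)$ is the space of bounded continuous functions. $C^\tau(\mathbb R^n)=C^{\lfloor\tau\rfloor,\tau-\lfloor\tau\rfloor}(\mathbb R^n)$ is the Hölder space with its usual norm (for $\tau\in\mathbb N$: bounded derivatives up to order $\tau$). $C^\tau S^m_{\rho,\delta}(\mathbb R^n,\mathbb R^n\times\mathbb R^n)$: functions $p(x,\xi,y)$, $C^\tau$ in $x$ and smooth in $(\xi,y)$, such that for all $\alpha,\beta\in\mathbb N_0^n$ there is $C_{\alpha\beta}$ with $\|\partial_\xi^\alpha\partial_y^\beta p(\cdot,\xi,y)\|_{C^\tau}\le C_{\alpha\beta}\langle\xi\rangle^{m-\rho|\alpha|+\delta(\tau+|\beta|)}$ and $|\partial_\xi^\alpha\partial_y^\beta p(x,\xi,y)|\le C_{\alpha\beta}\langle\xi\rangle^{m-\rho|\alpha|+\delta|\beta|}$. $C^\tau S^{-\infty}$ is the intersection over all $m\in\mathbb R$. The operator $p(X,D_x,X')$ (also written $p(X,D_x,Y)$) is $u\mapsto\mathrm{O_s}\text{-}\iint e^{i(x-y)\cdot\xi}p(x,\xi,y)u(y)\,dy\,\frac{d\xi}{(2\pi)^n}$, an oscillatory integral, i.e. (after $y\mapsto x+y$) the limit as $\epsilon\to0$ of the integrals with the extra factor $\chi(\epsilon\xi,\epsilon y)$, $\chi\in\mathscr S(\mathbb R^{2n})$, $\chi(0,0)=1$. $\mathrm{OP}$ of a symbol class is the set of the corresponding operators, and $\equiv$ modulo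 a class means that the difference lies in that class. A smooth regular diffeomorphism is a $C^\infty$-diffeomorphism $h$ all of whose partial derivatives of order $\ge1$ are bounded and for which there is $C>0$ with $C^{-1}\le|\det Dh(y)|\le C$ for all $y$. $Dh$ is the Jacobian matrix; $M^{-T}$ is the inverse transpose of $M$. Let $\{\gamma_j\}_{j\in\mathbb N}=\mathbb Z^n$. For $r>0$, $\{(\varphi_j,\psi_j)\}_{j\in\mathbb N}\subset C_0^\infty(\mathbb R^n)^2$ denotes a family with: $\sum_j\varphi_j=1$; $\operatorname{supp}\varphi_j\subset B_{r\sqrt n}(r\gamma_j)\subset\operatorname{supp}\psi_j\subset B_{3r\sqrt n}(r\gamma_j)$; $\psi_j=1$ on $B_{2r\sqrt n}(r\gamma_j)$; $|\partial^\beta\varphi_j|\le c_{\varphi,\beta}r^{-|\beta|}$ and $|\partial^\beta\psi_j|\le c_{\psi,\beta}r^{-|\beta|}$ with constants independent of $j$ and $r$. Terms of the sum defining $a$ are understood to be $0$ where $\varphi_j(h(y))\psi_j(h(y'))=0$. *)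

theory Defs
  imports "HOL-Analysis.Analysis"
begin

section \<open>Partial derivatives, smoothness, Hoelder spaces\<close>

text \<open>
  A multi-index is a list of basis vectors \<open>\<alpha> \<in> lists Basis\<close> and \<open>|\<alpha>|\<close> is its length:
  \<open>[b\<^sub>1, \<dots>, b\<^sub>k]\<close> stands for the multi-index that counts the occurrences of each coordinate
  direction. The order of the list is irrelevant for the functions of class \<open>C\<^sup>k\<close> to which
  derivatives of order at most \<open>k\<close> are applied.
\<close>

definition pderiv_dir :: "'a \<Rightarrow> ('a::euclidean_space \<Rightarrow> 'b::real_normed_vector) \<Rightarrow> 'a \<Rightarrow> 'b" where
  "pderiv_dir b f x = frechet_derivative f (at x) b"

definition mpderiv :: "'a list \<Rightarrow> ('a::euclidean_space \<Rightarrow> 'b::real_normed_vector) \<Rightarrow> 'a \<Rightarrow> 'b" where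
  "mpderiv \<alpha> f = foldr pderiv_dir \<alpha> f"

definition C_k :: "nat \<Rightarrow> ('a::euclidean_space \<Rightarrow> 'b::real_normed_vector) \<Rightarrow> bool" where
  "C_k k f \<longleftrightarrow> (\<forall>\<alpha>\<in>lists Basis.
     (length \<alpha> < k \<longrightarrow> mpderiv \<alpha> f differentiable_on UNIV) \<and>
     (length \<alpha> \<le> k \<longrightarrow> continuous_on UNIV (mpderiv \<alpha> f)))"

definition smooth :: "('a::euclidean_space \<Rightarrow> 'b::real_normed_vector) \<Rightarrow> bool" where
  "smooth f \<longleftrightarrow> (\<forall>k. C_k k f)"

definition hoelder_space :: "real \<Rightarrow> ('a::euclidean_space \<Rightarrow> complex) set" where
  "hoelder_space \<tau> = {f. C_k (nat \<lfloor>\<tau>\<rfloor>) f \<and>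
     (\<forall>\<alpha>\<in>lists Basis. length \<alpha> \<le> nat \<lfloor>\<tau>\<rfloor> \<longrightarrow> bounded (range (mpderiv \<alpha> f))) \<and>
     (frac \<tau> \<noteq> 0 \<longrightarrow> (\<forall>\<alpha>\<in>lists Basis. length \<alpha> = nat \<lfloor>\<tau>\<rfloor> \<longrightarrow>
        (\<exists>L. \<forall>x y. norm (mpderiv \<alpha> f x - mpderiv \<alpha> f y) \<le> L * dist x y powr frac \<tau>)))}"

text \<open>
  The norm takes maxima rather than sums over multi-indices (an equivalent norm), so that it does
  not depend on how often a multi-index is represented by a list. It is meaningful on
  \<open>hoelder_space \<tau>\<close> only, where the suprema are finite.
\<close>

definition hoelder_norm :: "real \<Rightarrow> ('a::euclidean_space \<Rightarrow> complex) \<Rightarrow> real" where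
  "hoelder_norm \<tau> f =
     (SUP (\<alpha>, x) \<in> {\<alpha> \<in> lists Basis. length \<alpha> \<le> nat \<lfloor>\<tau>\<rfloor>} \<times> UNIV. norm (mpderiv \<alpha> f x)) +
     (if frac \<tau> = 0 then 0
      else (SUP (\<alpha>, x, y) \<in> {(\<alpha>, x, y). \<alpha> \<in> lists Basis \<and> length \<alpha> = nat \<lfloor>\<tau>\<rfloor> \<and> x \<noteq> y}.
              norm (mpderiv \<alpha> f x - mpderiv \<alpha> f y) / dist x y powr frac \<tau>))"

definition schwartz_space :: "('a::euclidean_space \<Rightarrow> complex) set" where
  "schwartz_space = {u. smooth u \<and>
     (\<forall>\<alpha>\<in>lists Basis. \<forall>N::nat. bounded (range (\<lambda>x. (1 + norm x) ^ N *\<^sub>R mpderiv \<alpha> u x)))}"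

section \<open>Double symbols with limited smoothness\<close>

type_synonym 'n dsymbol = "real ^ 'n \<Rightarrow> real ^ 'n \<Rightarrow> real ^ 'n \<Rightarrow> complex"

definition japanese_bracket :: "'a::real_normed_vector \<Rightarrow> real" where
  "japanese_bracket \<xi> = sqrt (1 + (norm \<xi>)\<^sup>2)"

definition dsymbol_deriv ::
    "(real ^ 'n) list \<Rightarrow> (real ^ 'n) list \<Rightarrow> 'n::finite dsymbol \<Rightarrow> 'n dsymbol" where
  "dsymbol_deriv \<alpha> \<beta> p x \<xi> y = mpderiv \<alpha> (\<lambda>\<xi>'. mpderiv \<beta> (\<lambda>y'. p x \<xi>' y') y) \<xi>"

text \<open>\<open>CS \<tau> m \<rho> \<delta>\<close> is the class \<open>C\<^sup>\<tau>S\<^sup>m\<^bsub>\<rho>,\<delta>\<^esub>(\<real>\<^sup>n, \<real>\<^sup>n \<times> \<real>\<^sup>n)\<close>.\<close>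

definition CS :: "real \<Rightarrow> real \<Rightarrow> real \<Rightarrow> real \<Rightarrow> 'n::finite dsymbol set" where
  "CS \<tau> m \<rho> \<delta> = {p.
     (\<forall>x. smooth (\<lambda>(\<xi>, y). p x \<xi> y)) \<and>
     (\<forall>\<alpha>\<in>lists Basis. \<forall>\<beta>\<in>lists Basis. \<exists>C. \<forall>\<xi> y.
        (\<lambda>x. dsymbol_deriv \<alpha> \<beta> p x \<xi> y) \<in> hoelder_space \<tau> \<and>
        hoelder_norm \<tau> (\<lambda>x. dsymbol_deriv \<alpha> \<beta> p x \<xi> y)
          \<le> C * japanese_bracket \<xi> powr (m - \<rho> * length \<alpha> + \<delta> * (\<tau> + length \<beta>)) \<and>
        (\<forall>x. norm (dsymbol_deriv \<alpha> \<beta> p x \<xi> y)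
          \<le> C * japanese_bracket \<xi> powr (m - \<rho> * length \<alpha> + \<delta> * length \<beta>)))}"

text \<open>The intersection does not depend on \<open>\<rho>\<close> and \<open>\<delta>\<close>, which are kept as parameters.\<close>

definition CS_minus_infinity :: "real \<Rightarrow> real \<Rightarrow> real \<Rightarrow> 'n::finite dsymbol set" where
  "CS_minus_infinity \<tau> \<rho> \<delta> = (\<Inter>m. CS \<tau> m \<rho> \<delta>)"

section \<open>Oscillatory integrals and operators\<close>

text \<open>
  \<open>has_osc_integral a l\<close>: the oscillatory integral of \<open>e\<^sup>-\<^sup>i\<^sup>y\<^sup>\<cdot>\<^sup>\<xi> a(\<xi>, y)\<close> over \<open>(\<xi>, y)\<close> is \<open>l\<close>; the limit is
  required to exist and to be the same for every cut-off \<open>\<kappa>\<close>.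
\<close>

definition has_osc_integral ::
    "(real ^ 'n::finite \<Rightarrow> real ^ 'n \<Rightarrow> complex) \<Rightarrow> complex \<Rightarrow> bool" where
  "has_osc_integral a l \<longleftrightarrow>
     (\<forall>\<kappa>\<in>schwartz_space. \<kappa> (0, 0) = 1 \<longrightarrow>
        (\<forall>\<epsilon>>0. integrable lborel
           (\<lambda>(\<xi>, y). \<kappa> (\<epsilon> *\<^sub>R \<xi>, \<epsilon> *\<^sub>R y) * cis (- (y \<bullet> \<xi>)) * a \<xi> y)) \<and>
        ((\<lambda>\<epsilon>. integral\<^sup>L lborel
           (\<lambda>(\<xi>, y). \<kappa> (\<epsilon> *\<^sub>R \<xi>, \<epsilon> *\<^sub>R y) * cis (- (y \<bullet> \<xi>)) * a \<xi> y))
           \<longlongrightarrow> l) (at_right 0))"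

definition osc_integral :: "(real ^ 'n::finite \<Rightarrow> real ^ 'n \<Rightarrow> complex) \<Rightarrow> complex" where
  "osc_integral a = (THE l. has_osc_integral a l)"

text \<open>
  \<open>pdo p\<close> is \<open>p(X, D\<^sub>x, X')\<close>. The translation \<open>y \<mapsto> x + y\<close> has been carried out, which turns the
  phase \<open>(x - y) \<cdot> \<xi>\<close> into \<open>- y \<cdot> \<xi>\<close>.
\<close>

definition pdo ::
    "'n::finite dsymbol \<Rightarrow> (real ^ 'n \<Rightarrow> complex) \<Rightarrow> real ^ 'n \<Rightarrow> complex" where
  "pdo p u x = osc_integral (\<lambda>\<xi> y. p x \<xi> (x + y) * u (x + y)) / (2 * of_real pi) ^ CARD('n)"

text \<open>Operators act on the Schwartz space; their values on other functions are disregarded.\<close>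

definition OP ::
    "'n::finite dsymbol set \<Rightarrow> ((real ^ 'n \<Rightarrow> complex) \<Rightarrow> real ^ 'n \<Rightarrow> complex) set" where
  "OP S = {T. \<exists>q\<in>S. \<forall>u\<in>schwartz_space. T u = pdo q u}"

definition op_equiv_mod ::
    "((real ^ 'n \<Rightarrow> complex) \<Rightarrow> real ^ 'n \<Rightarrow> complex) \<Rightarrow>
     ((real ^ 'n \<Rightarrow> complex) \<Rightarrow> real ^ 'n \<Rightarrow> complex) \<Rightarrow>
     ((real ^ 'n::finite \<Rightarrow> complex) \<Rightarrow> real ^ 'n \<Rightarrow> complex) set \<Rightarrow> bool" where
  "op_equiv_mod A B \<R> \<longleftrightarrow> (\<lambda>u x. A u x - B u x) \<in> \<R>"

section \<open>Change of variables\<close>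

definition smooth_regular_diffeo :: "(real ^ 'n::finite \<Rightarrow> real ^ 'n) \<Rightarrow> bool" where
  "smooth_regular_diffeo h \<longleftrightarrow>
     bij h \<and> smooth h \<and> smooth (inv h) \<and>
     (\<forall>\<alpha>\<in>lists Basis. 1 \<le> length \<alpha> \<longrightarrow> bounded (range (mpderiv \<alpha> h))) \<and>
     (\<exists>C>0. \<forall>y. inverse C \<le> \<bar>det (jacobian h (at y))\<bar> \<and> \<bar>det (jacobian h (at y))\<bar> \<le> C)"

definition Xi :: "(real ^ 'n::finite \<Rightarrow> real ^ 'n) \<Rightarrow> real ^ 'n \<Rightarrow> real ^ 'n \<Rightarrow> real ^ 'n ^ 'n" where
  "Xi h y y' = integral {0..1} (\<lambda>\<theta>::real. jacobian h (at (y' + \<theta> *\<^sub>R (y - y'))))"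

definition supp :: "('a::topological_space \<Rightarrow> 'b::zero) \<Rightarrow> 'a set" where
  "supp f = closure {x. f x \<noteq> 0}"

definition lattice_enumeration :: "(nat \<Rightarrow> real ^ 'n::finite) \<Rightarrow> bool" where
  "lattice_enumeration \<gamma> \<longleftrightarrow> bij_betw \<gamma> UNIV {z. \<forall>i. z $ i \<in> \<int>}"

text \<open>
  The bounds \<open>c\<^sub>\<phi>\<close>, \<open>c\<^sub>\<psi>\<close> (indexed by multi-indices) are arguments, so that they can be fixed before
  \<open>r\<close> is chosen. Compactness of the supports follows from their inclusion in a ball.
\<close>

definition adapted_partition ::
    "(nat \<Rightarrow> real ^ 'n::finite) \<Rightarrow> ((real ^ 'n) list \<Rightarrow> real) \<Rightarrow> ((real ^ 'n) list \<Rightarrow> real) \<Rightarrow> real \<Rightarrow>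
     (nat \<Rightarrow> real ^ 'n \<Rightarrow> complex) \<Rightarrow> (nat \<Rightarrow> real ^ 'n \<Rightarrow> complex) \<Rightarrow> bool" where
  "adapted_partition \<gamma> c\<^sub>\<phi> c\<^sub>\<psi> r \<phi> \<psi> \<longleftrightarrow>
     (\<forall>x. (\<lambda>j. \<phi> j x) sums 1) \<and>
     (\<forall>j. smooth (\<phi> j) \<and> smooth (\<psi> j) \<and>
        supp (\<phi> j) \<subseteq> ball (r *\<^sub>R \<gamma> j) (r * sqrt CARD('n)) \<and>
        ball (r *\<^sub>R \<gamma> j) (r * sqrt CARD('n)) \<subseteq> supp (\<psi> j) \<and>
        supp (\<psi> j) \<subseteq> ball (r *\<^sub>R \<gamma> j) (3 * r * sqrt CARD('n)) \<and>
        (\<forall>x \<in> ball (r *\<^sub>R \<gamma> j) (2 * r * sqrt CARD('n)). \<psi> j x = 1) \<and>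
        (\<forall>\<beta>\<in>lists Basis. \<forall>x.
           norm (mpderiv \<beta> (\<phi> j) x) \<le> c\<^sub>\<phi> \<beta> * r powr (- real (length \<beta>)) \<and>
           norm (mpderiv \<beta> (\<psi> j) x) \<le> c\<^sub>\<psi> \<beta> * r powr (- real (length \<beta>))))"

text \<open>
  A term whose cut-off factor vanishes is \<open>0\<close> even if the matrix \<open>Xi h y y'\<close> is singular there.
\<close>

definition transformed_symbol_term ::
    "(real ^ 'n \<Rightarrow> real ^ 'n) \<Rightarrow> (nat \<Rightarrow> real ^ 'n \<Rightarrow> complex) \<Rightarrow> (nat \<Rightarrow> real ^ 'n \<Rightarrow> complex) \<Rightarrow>
     'n::finite dsymbol \<Rightarrow> nat \<Rightarrow> 'n dsymbol" where
  "transformed_symbol_term h \<phi> \<psi> p j y \<eta> y' =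
     \<phi> j (h y) * p (h y) (transpose (matrix_inv (Xi h y y')) *v \<eta>) (h y') * \<psi> j (h y')
       * of_real (inverse \<bar>det (Xi h y y')\<bar>) * of_real \<bar>det (jacobian h (at y'))\<bar>"

definition transformed_symbol ::
    "(real ^ 'n \<Rightarrow> real ^ 'n) \<Rightarrow> (nat \<Rightarrow> real ^ 'n \<Rightarrow> complex) \<Rightarrow> (nat \<Rightarrow> real ^ 'n \<Rightarrow> complex) \<Rightarrow>
     'n::finite dsymbol \<Rightarrow> 'n dsymbol" where
  "transformed_symbol h \<phi> \<psi> p y \<eta> y' = (\<Sum>j. transformed_symbol_term h \<phi> \<psi> p j y \<eta> y')"

end

(*
 A double symbol is regarded as a map x => (xi, y) => complex and its class is characterised
 coinductively by bounds on all first derivatives; this makes the class visibly closed under sums,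
 products and changes of variables. Since h y - h y' = Xi_h(y,y') (y - y'), the substitution
 x' = h y', xi = Xi_h(y,y')^{-T} eta turns the part of the oscillatory integral near the diagonal,
 where Xi_h is invertible, into the operator with symbol a; it is justified for a family of cut-offs
 that is continuous up to the parameter 0, where no cut-off is left. Away from the diagonal,
 integration by parts in xi lowers the order of the symbol arbitrarily, so that the operator has a
 smooth rapidly decreasing kernel F, and exp(-i (y - y') . eta) kappa(eta) F(y,y') with a Schwartz
 function kappa of integral 1 is a symbol of order minus infinity with the same operator.
*)
theory Submission
 imports Defs
begin


section \<open>Calculus of iterated partial derivatives\<close>

text \<open>The regularity in x is finite and \<open>CS\<close> bounds only orders 0 and \<tau>. A
  class that sees single derivatives needs all intermediate orders in x and derivatives in any
  sequence; Landau-Kolmogorov interpolation and a theorem on mixed derivatives supply them. The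
  orders enter in three places: 1 - \<rho> <= \<delta> makes the class invariant under linear maps
  of the covariable that depend on x and y, \<delta> < 1 lets each integration by parts in y gain
  decay in xi, and \<rho> > 0, a consequence of 1 - \<rho> <= \<delta> <= \<rho>, lets each
  integration by parts in xi lower the order off the diagonal. The obstacle is that Xi_h may be
  singular away from the diagonal. It is replaced by a matrix that is invertible everywhere and
  equals Xi_h wherever the cut-off of the symbol is nonzero. This takes a second cut-off, which the
  given family provides at scale 4 r; scale r / 4 provides a third one for the remainder. The
  supremum of the second cut-off is bounded independently of r, so that r can be chosen
  last.\<close>

lemma pderiv_dir_eq:
 "(f has_derivative f') (at x) ==> pderiv_dir b f x = f' b"
 unfolding pderiv_dir_def using frechet_derivative_at by metis

lemma pderiv_dir_linear:
 assumes "f differentiable (at x)"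
 shows "linear (%v. pderiv_dir v f x)"
 unfolding pderiv_dir_def using assms by (rule linear_frechet_derivative)

lemma pderiv_dir_expand:
 fixes f :: "'a::euclidean_space => 'b::real_normed_vector"
 assumes "f differentiable (at x)"
 shows "pderiv_dir v f x = (\<Sum>b\<in>Basis. (v \<bullet> b) *\<^sub>R pderiv_dir b f x)"
proof -
 interpret linear "%v. pderiv_dir v f x" by (rule pderiv_dir_linear[OF assms])
 have "pderiv_dir v f x = pderiv_dir (\<Sum>b\<in>Basis. (v \<bullet> b) *\<^sub>R b) f x"
  by (simp add: euclidean_representation)
 then show ?thesis by (simp add: sum scale)
qed

lemma has_derivative_pderiv:
 fixes f :: "'a::euclidean_space => 'b::real_normed_vector"
 assumes "f differentiable (at x)"
 shows "(f has_derivative (%v. \<Sum>b\<in>Basis. (v \<bullet> b) *\<^sub>R pderiv_dir b f x)) (at x)"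
proof -
 have "(f has_derivative (%v. pderiv_dir v f x)) (at x)"
  using assms unfolding pderiv_dir_def by (simp add: frechet_derivative_works)
 moreover have "(%v. pderiv_dir v f x) = (%v. \<Sum>b\<in>Basis. (v \<bullet> b) *\<^sub>R pderiv_dir b f x)"
  by (rule ext) (rule pderiv_dir_expand[OF assms])
 ultimately show ?thesis by (simp only:)
qed

lemma has_derivative_pderiv':
 assumes "f differentiable (at x)"
 shows "(f has_derivative (%v. pderiv_dir v f x)) (at x)"
 using assms unfolding pderiv_dir_def by (simp add: frechet_derivative_works)

lemma differentiable_on_UNIV_D: "f differentiable_on UNIV ==> f differentiable (at x)"
 by (simp add: differentiable_on_def)

lemma has_derivative_differentiable_on:
 "(!!x. (f has_derivative f' x) (at x)) ==> f differentiable_on UNIV"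
 by (auto simp: differentiable_on_def differentiable_def)

lemma mpderiv_Nil [simp]: "mpderiv [] f = f"
 and mpderiv_Cons [simp]: "mpderiv (b # al) f = pderiv_dir b (mpderiv al f)"
 and mpderiv_append: "mpderiv (al @ \<beta>) f = mpderiv al (mpderiv \<beta> f)"
 by (simp_all add: mpderiv_def)

lemma pderiv_dir_const [simp]: "pderiv_dir b (%_. c) = (%_. 0)"
 by (rule ext, rule pderiv_dir_eq[where f' = "%_. 0"]) simp

lemma pderiv_dir_add:
 assumes "f differentiable_on UNIV" "g differentiable_on UNIV"
 shows "pderiv_dir b (%x. f x + g x) = (%x. pderiv_dir b f x + pderiv_dir b g x)"
 using assms
 by (intro ext pderiv_dir_eq[where f' = "%v. pderiv_dir v f x + pderiv_dir v g x" for x] has_derivative_add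
    has_derivative_pderiv' differentiable_on_UNIV_D)

lemma pderiv_dir_mult:
 fixes f g :: "'a::euclidean_space => 'b::real_normed_algebra"
 assumes "f differentiable_on UNIV" "g differentiable_on UNIV"
 shows "pderiv_dir b (%x. f x * g x) = (%x. f x * pderiv_dir b g x + pderiv_dir b f x * g x)"
 using assms
 by (intro ext pderiv_dir_eq[where f' = "%v. f x * pderiv_dir v g x + pderiv_dir v f x * g x" for x]
    has_derivative_mult has_derivative_pderiv' differentiable_on_UNIV_D)

lemma pderiv_dir_bounded_linear:
 assumes "bounded_linear L" "f differentiable_on UNIV"
 shows "pderiv_dir b (%x. L (f x)) = (%x. L (pderiv_dir b f x))"
proof
 fix x
 have "((%x. L (f x)) has_derivative (%v. L (pderiv_dir v f x))) (at x)"
  using assms(2) by (intro bounded_linear.has_derivative[OF assms(1)] has_derivative_pderiv' differentiable_on_UNIV_D)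
 then show "pderiv_dir b (%x. L (f x)) x = L (pderiv_dir b f x)"
  by (rule pderiv_dir_eq)
qed

lemma pderiv_dir_of_bounded_linear:
 assumes "bounded_linear L"
 shows "pderiv_dir b L = (%_. L b)"
 using bounded_linear.has_derivative[OF assms has_derivative_ident]
 by (intro ext pderiv_dir_eq[where f' = L]) simp

lemma pderiv_dir_compose:
 fixes f :: "'b::euclidean_space => 'c::real_normed_vector" and g :: "'a::euclidean_space => 'b"
 assumes "f differentiable_on UNIV" "g differentiable_on UNIV"
 shows "pderiv_dir b (%x. f (g x)) = (%x. \<Sum>i\<in>Basis. (pderiv_dir b g x \<bullet> i) *\<^sub>R pderiv_dir i f (g x))"
proof (intro ext)
 fix x
 have "((%x. f (g x)) has_derivative (%v. pderiv_dir (pderiv_dir v g x) f (g x))) (at x)"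
  using assms
  by (intro has_derivative_compose[of g _ x UNIV f] has_derivative_pderiv' differentiable_on_UNIV_D)
 then have "pderiv_dir b (%x. f (g x)) x = pderiv_dir (pderiv_dir b g x) f (g x)"
  by (rule pderiv_dir_eq)
 also have "\<dots> = (\<Sum>i\<in>Basis. (pderiv_dir b g x \<bullet> i) *\<^sub>R pderiv_dir i f (g x))"
  using assms by (intro pderiv_dir_expand differentiable_on_UNIV_D)
 finally show "pderiv_dir b (%x. f (g x)) x = \<dots>" .
qed

lemma differentiable_on_compose_UNIV:
 assumes "f differentiable_on UNIV" "g differentiable_on UNIV"
 shows "(%x. f (g x)) differentiable_on UNIV"
 using differentiable_chain_within[of g _ UNIV f] assms
 by (auto simp: differentiable_on_def o_def intro: differentiable_within_subset)

lemma differentiable_on_bounded_linear: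
 assumes "bounded_linear L" "f differentiable_on UNIV"
 shows "(%x. L (f x)) differentiable_on UNIV"
 using assms(2) unfolding differentiable_on_def differentiable_def
 by (auto intro: bounded_linear.has_derivative[OF assms(1)])

lemma bounded_linear_differentiable_on:
 "bounded_linear L ==> L differentiable_on UNIV"
 using differentiable_on_bounded_linear[of L "%x. x"] by simp

text \<open>One scheme for several classes: a trivial \<open>Q\<close> gives smooth functions,
  boundedness gives \<open>Cb\<close>, and \<open>rapid\<close> and \<open>moderate\<close> give
  Schwartz functions and their multipliers.\<close>

definition all_derivs :: "(('a => 'b) => bool) => ('a::euclidean_space => 'b::real_normed_vector) => bool" where
 "all_derivs Q f \<longleftrightarrow> (\<forall>al\<in>lists Basis. mpderiv al f differentiable_on UNIV & Q (mpderiv al f))"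

text \<open>A set of functions that is stable under first partial derivatives contains all iterated
  derivatives of its members, so the property has to be checked on the members only. This replaces
  explicit formulas for higher derivatives of products and compositions.\<close>

lemma all_derivs_coinduct:
 assumes "X f"
  and base: "!!f. X f ==> f differentiable_on UNIV & Q f"
  and step: "!!f b. X f ==> b \<in> Basis ==> X (pderiv_dir b f)"
 shows "all_derivs Q f"
proof -
 have "X (mpderiv al f)" if "al \<in> lists Basis" for al
  using that by (induction al) (auto intro: assms(1) step)
 then show ?thesis unfolding all_derivs_def using base by blast
qed

lemma all_derivs_pderiv:
 assumes "all_derivs Q f" "b \<in> Basis"
 shows "all_derivs Q (pderiv_dir b f)"
proof -
 have "mpderiv al (pderiv_dir b f) = mpderiv (al @ [b]) f" for al
  by (simp add: mpderiv_append)
 then show ?thesis using assms unfolding all_derivs_def by auto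
qed

lemma all_derivsD: "all_derivs Q f ==> f differentiable_on UNIV" "all_derivs Q f ==> Q f"
 unfolding all_derivs_def by (auto dest: bspec[where x = "[]"])

lemma all_derivs_add:
 assumes "all_derivs Q f" "all_derivs Q g" and Q: "!!f g. Q f ==> Q g ==> Q (%x. f x + g x)"
 shows "all_derivs Q (%x. f x + g x)"
proof (rule all_derivs_coinduct[where X = "%k. \<exists>f g. all_derivs Q f & all_derivs Q g & k = (%x. f x + g x)"])
 show "\<exists>f' g'. all_derivs Q f' & all_derivs Q g' & (%x. f x + g x) = (%x. f' x + g' x)"
  using assms by blast
next
 fix k assume "\<exists>f g. all_derivs Q f & all_derivs Q g & k = (%x. f x + g x)"
 then show "k differentiable_on UNIV & Q k"
  by (auto intro!: Q differentiable_on_add dest: all_derivsD)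
next
 fix k b assume "\<exists>f g. all_derivs Q f & all_derivs Q g & k = (%x. f x + g x)" "b \<in> (Basis :: 'a set)"
 then obtain f g where "all_derivs Q f" "all_derivs Q g" "k = (%x. f x + g x)" by blast
 with \<open>b \<in> Basis\<close> show "\<exists>f g. all_derivs Q f & all_derivs Q g & pderiv_dir b k = (%x. f x + g x)"
  by (intro exI[of _ "pderiv_dir b f"] exI[of _ "pderiv_dir b g"])
   (simp add: all_derivs_pderiv all_derivsD(1) pderiv_dir_add)
qed

lemma all_derivs_bounded_linear:
 assumes "all_derivs Q f" "bounded_linear L" and Q: "!!f. Q f ==> P (%x. L (f x))"
 shows "all_derivs P (%x. L (f x))"
proof (rule all_derivs_coinduct[where X = "%k. \<exists>f. all_derivs Q f & k = (%x. L (f x))"])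
 show "\<exists>f'. all_derivs Q f' & (%x. L (f x)) = (%x. L (f' x))"
  using assms by blast
next
 fix k assume "\<exists>f. all_derivs Q f & k = (%x. L (f x))"
 then show "k differentiable_on UNIV & P k"
  by (auto intro!: Q differentiable_on_bounded_linear[OF assms(2)] dest: all_derivsD)
next
 fix k b assume "\<exists>f. all_derivs Q f & k = (%x. L (f x))" "b \<in> (Basis :: 'a set)"
 then obtain f where "all_derivs Q f" "k = (%x. L (f x))" by blast
 with \<open>b \<in> Basis\<close> show "\<exists>f. all_derivs Q f & pderiv_dir b k = (%x. L (f x))"
  by (intro exI[of _ "pderiv_dir b f"])
   (simp add: all_derivs_pderiv all_derivsD(1) pderiv_dir_bounded_linear[OF assms(2)])
qed

lemma smooth_iff: "smooth f \<longleftrightarrow> all_derivs (%_. True) f"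
proof
 assume s: "smooth f"
 have "mpderiv al f differentiable_on UNIV" if "al \<in> lists Basis" for al
  using s that unfolding smooth_def C_k_def by (metis lessI)
 then show "all_derivs (%_. True) f" by (simp add: all_derivs_def)
next
 assume "all_derivs (%_. True) f"
 then show "smooth f"
  unfolding smooth_def C_k_def all_derivs_def
  by (auto intro: differentiable_imp_continuous_on)
qed

section \<open>Functions with bounded derivatives of all orders\<close>

abbreviation Cb :: "('a::euclidean_space => 'b::real_normed_vector) => bool" where
 "Cb \<equiv> all_derivs (%f. bounded (range f))"

lemma Cb_D: "Cb f ==> f differentiable_on UNIV" "Cb f ==> bounded (range f)"
 "Cb f ==> continuous_on S f"
 using all_derivsD differentiable_imp_continuous_on continuous_on_subset by blast+

lemma Cb_boundE:
 assumes "Cb f" obtains C where "C > 0" "!!x. norm (f x) <= C"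
 using Cb_D(2)[OF assms] by (auto simp: bounded_pos)

lemma Cb_pderiv: "Cb f ==> b \<in> Basis ==> Cb (pderiv_dir b f)"
 by (rule all_derivs_pderiv)

lemma Cb_const: "Cb (%_. c)"
proof (rule all_derivs_coinduct[where X = "%f. \<exists>c. f = (%_. c)"])
 show "\<exists>c'. (%_. c) = (%_. c')" by blast
 show "f differentiable_on UNIV & bounded (range f)" if "\<exists>c. f = (%_. c)" for f :: "'a => 'b"
  using that by (auto simp: image_constant_conv)
 show "\<exists>c. pderiv_dir b f = (%_. c)" if "\<exists>c. f = (%_. c)" for f :: "'a => 'b" and b
  using that by auto
qed

lemma Cb_add: "Cb f ==> Cb g ==> Cb (%x. f x + g x)"
 by (rule all_derivs_add) (auto intro: bounded_plus_comp)

lemma Cb_sum: "(!!i. i \<in> I ==> Cb (f i)) ==> Cb (%x. \<Sum>i\<in>I. f i x)"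
 by (induction I rule: infinite_finite_induct) (auto intro: Cb_const Cb_add)

lemma bounded_range_bounded_linear:
 assumes "bounded_linear L" "bounded (range f)" shows "bounded (range (%x. L (f x)))"
 using bounded_linear_image[OF assms(2,1)] by (simp add: image_image)

lemma Cb_bounded_linear:
 assumes "bounded_linear L" "Cb f" shows "Cb (%x. L (f x))"
 using assms(2,1) by (rule all_derivs_bounded_linear) (rule bounded_range_bounded_linear[OF assms(1)])

lemma Cb_uminus: "Cb f ==> Cb (%x. - f x)"
 by (rule Cb_bounded_linear[OF bounded_linear_minus[OF bounded_linear_ident]])

lemma Cb_diff: "Cb f ==> Cb g ==> Cb (%x. f x - g x)"
 using Cb_add[OF _ Cb_uminus] by fastforce

section \<open>Algebras of functions with bounded derivatives\<close>

inductive alg :: "(('a => 'b::ring_1) => bool) => ('a => 'b) => bool" for X where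
 alg_gen: "X f ==> alg X f"
| alg_const: "alg X (%_. c)"
| alg_add: "alg X f ==> alg X g ==> alg X (%x. f x + g x)"
| alg_mult: "alg X f ==> alg X g ==> alg X (%x. f x * g x)"

lemma alg_sum: "(!!i. i \<in> I ==> alg X (f i)) ==> alg X (%x. \<Sum>i\<in>I. f i x)"
 by (induction I rule: infinite_finite_induct) (auto intro: alg_const alg_add)

text \<open>Coinduction up to the algebra generated by the candidates: it suffices to bound the
 generators and to express their first derivatives.\<close>

lemma Cb_coinduct_alg:
 fixes f :: "'a::euclidean_space => 'b::real_normed_algebra_1"
 assumes "alg (%g. X g \<or> Cb g) f"
  and base: "!!f. X f ==> f differentiable_on UNIV & bounded (range f)"
  and step: "!!f b. X f ==> b \<in> Basis ==> alg (%g. X g \<or> Cb g) (pderiv_dir b f)"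
 shows "Cb f"
proof -
 define A where "A = alg (%g. X g \<or> Cb g)"
 have bdd: "f differentiable_on UNIV & bounded (range f)" if "A f" for f
  using that unfolding A_def
 proof induction
  case (alg_gen f) then show ?case using base Cb_D by blast
 next
  case (alg_const c) then show ?case by (auto simp: image_constant_conv)
 next
  case (alg_add f g) then show ?case by (auto intro: bounded_plus_comp)
 next
  case (alg_mult f g)
  then obtain C D where "!!x. norm (f x) <= C" "!!x. norm (g x) <= D"
   by (auto simp: bounded_iff)
  then have "norm (f x * g x) <= C * D" for x
   by (meson mult_mono norm_ge_zero norm_mult_ineq order_trans)
  with alg_mult show ?case by (auto simp: bounded_iff)
 qed
 have "A (pderiv_dir b f)" if "A f" "b \<in> Basis" for f b
  using that unfolding A_def
 proof induction
  case (alg_gen f) then show ?case using step Cb_pderiv by (metis alg.alg_gen)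
 next
  case (alg_const c) then show ?case by (simp add: alg.alg_const)
 next
  case (alg_add f g)
  then show ?case using bdd[unfolded A_def] by (simp add: pderiv_dir_add alg.alg_add)
 next
  case (alg_mult f g)
  then show ?case using bdd[unfolded A_def] by (simp add: pderiv_dir_mult alg.alg_add alg.alg_mult)
 qed
 moreover have "A f" using assms(1) by (simp add: A_def)
 ultimately show ?thesis using bdd by (intro all_derivs_coinduct[where X = A]) auto
qed

lemma Cb_mult:
 fixes f g :: "'a::euclidean_space => 'b::real_normed_algebra_1"
 assumes "Cb f" "Cb g" shows "Cb (%x. f x * g x)"
 by (rule Cb_coinduct_alg[where X = "%_. False"]) (use assms in \<open>auto intro: alg.intros\<close>)

lemma Cb_prod:
 fixes f :: "'i => 'a::euclidean_space => 'b::{real_normed_algebra_1,comm_ring_1}"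
 shows "(!!i. i \<in> I ==> Cb (f i)) ==> Cb (%x. \<Prod>i\<in>I. f i x)"
 by (induction I rule: infinite_finite_induct) (auto intro: Cb_const Cb_mult)

text \<open>The derivative of 1/f is a polynomial in 1/f and a first derivative of \<open>f\<close>,
  so 1/f is the only candidate that has to be added; the lower bound \<open>c\<close> keeps it
  bounded.\<close>

lemma Cb_inverse:
 fixes f :: "'a::euclidean_space => 'b::real_normed_field"
 assumes f: "Cb f" and c: "c > 0" "!!x. norm (f x) >= c"
 shows "Cb (%x. inverse (f x))"
proof (rule Cb_coinduct_alg[where X = "%g. g = (%x. inverse (f x))"])
 have nz: "f x ~= 0" for x using c(2)[of x] c(1) by auto
 have der: "((%x. inverse (f x)) has_derivative
   (%v. - (inverse (f x) * pderiv_dir v f x * inverse (f x)))) (at x)" for x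
  using nz Cb_D(1)[OF f] by (intro Deriv.has_derivative_inverse has_derivative_pderiv' differentiable_on_UNIV_D)
 show "g differentiable_on UNIV & bounded (range g)" if "g = (%x. inverse (f x))" for g
 proof
  show "g differentiable_on UNIV" unfolding that by (rule has_derivative_differentiable_on[OF der])
  have "norm (inverse (f x)) <= inverse c" for x
   using c by (simp add: norm_inverse le_imp_inverse_le)
  then show "bounded (range g)" unfolding that by (auto simp: bounded_iff)
 qed
 show "alg (%g. g = (%x. inverse (f x)) \<or> Cb g) (pderiv_dir b g)"
  if "g = (%x. inverse (f x))" "b \<in> Basis" for g b
 proof -
  let ?Y = "%g. g = (%x. inverse (f x)) \<or> Cb g"
  have "alg ?Y (%x. inverse (f x))" "alg ?Y (pderiv_dir b f)" "alg ?Y (%_. - 1)"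
   using Cb_pderiv[OF f \<open>b \<in> Basis\<close>] by (auto intro: alg_gen alg_const)
  from alg_mult[OF this(3) alg_mult[OF alg_mult[OF this(1,2)] this(1)]]
  moreover have "pderiv_dir b (%x. inverse (f x)) = (%x. - (inverse (f x) * pderiv_dir b f x * inverse (f x)))"
   using pderiv_dir_eq[OF der] by (simp add: fun_eq_iff)
  ultimately show ?thesis unfolding that(1) by simp
 qed
qed (auto intro: alg_gen)

text \<open>The maps that may be substituted into functions of class \<open>Cb\<close>. The map
  itself may be unbounded, which admits linear maps and diffeomorphisms of the whole space.\<close>

definition bder :: "('a::euclidean_space => 'b::euclidean_space) => bool" where
 "bder g \<longleftrightarrow> g differentiable_on UNIV & (\<forall>b\<in>Basis. Cb (pderiv_dir b g))"

lemma bder_bounded_linear: "bounded_linear L ==> bder L"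
 by (auto simp: bder_def pderiv_dir_of_bounded_linear Cb_const bounded_linear_differentiable_on)

lemma Cb_inner: "Cb f ==> Cb (%x. f x \<bullet> i)"
 by (rule Cb_bounded_linear[OF bounded_linear_inner_left])

lemma Cb_componentwise:
 fixes f :: "'a::euclidean_space => 'b::euclidean_space"
 assumes "!!i. i \<in> Basis ==> Cb (%x. f x \<bullet> i)" shows "Cb f"
proof -
 have "Cb (%x. \<Sum>i\<in>Basis. (f x \<bullet> i) *\<^sub>R i)"
  using assms by (intro Cb_sum Cb_bounded_linear[OF bounded_linear_scaleR_left])
 then show ?thesis by (simp add: euclidean_representation)
qed

lemma Cb_of_real: "Cb f ==> Cb (%x. of_real (f x) :: 'b::real_normed_algebra_1)"
 by (rule Cb_bounded_linear[OF bounded_linear_of_real])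

text \<open>By the chain rule a derivative of c o g is a sum of products of a bounded coefficient
  coming from \<open>g\<close> with a function of the same form, built on a derivative of
  \<open>c\<close>.\<close>

lemma Cb_compose:
 fixes c :: "'b::euclidean_space => 'c::real_normed_algebra_1" and g :: "'a::euclidean_space => 'b"
 assumes "Cb c" "bder g" shows "Cb (%x. c (g x))"
proof (rule Cb_coinduct_alg[where X = "%k. \<exists>c::'b => 'c. Cb c & k = (%x. c (g x))"])
 show "alg (%k. (\<exists>c::'b => 'c. Cb c & k = (%x. c (g x))) \<or> Cb k) (%x. c (g x))"
  using assms(1) by (intro alg_gen) blast
next
 fix k assume "\<exists>c::'b => 'c. Cb c & k = (%x. c (g x))"
 then obtain c :: "'b => 'c" where c: "Cb c" "k = (%x. c (g x))" by blast
 have "bounded (range k)"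
  using Cb_D(2)[OF c(1)] unfolding c(2) by (rule bounded_subset) auto
 with c assms(2) show "k differentiable_on UNIV & bounded (range k)"
  by (auto simp: bder_def intro: differentiable_on_compose_UNIV Cb_D)
next
 fix k and b :: 'a assume "\<exists>c::'b => 'c. Cb c & k = (%x. c (g x))" "b \<in> Basis"
 then obtain c :: "'b => 'c" where c: "Cb c" "k = (%x. c (g x))" by blast
 have "pderiv_dir b k = (%x. \<Sum>i\<in>Basis. of_real (pderiv_dir b g x \<bullet> i) * pderiv_dir i c (g x))"
  unfolding c(2) using c(1) assms(2) by (subst pderiv_dir_compose) (auto simp: bder_def scaleR_conv_of_real Cb_D)
 moreover have "alg (%k. (\<exists>c. Cb c & k = (%x. c (g x))) \<or> Cb k) (%x. \<Sum>i\<in>Basis. of_real (pderiv_dir b g x \<bullet> i) * pderiv_dir i c (g x))"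
 proof (intro alg_sum alg_mult)
  fix i :: 'b assume i: "i \<in> Basis"
  show "alg (%k. (\<exists>c. Cb c & k = (%x. c (g x))) \<or> Cb k) (%x. of_real (pderiv_dir b g x \<bullet> i) :: 'c)"
   using assms(2) \<open>b \<in> Basis\<close> by (intro alg_gen disjI2 Cb_of_real Cb_inner) (auto simp: bder_def)
  show "alg (%k. (\<exists>c. Cb c & k = (%x. c (g x))) \<or> Cb k) (%x. pderiv_dir i c (g x))"
   using Cb_pderiv[OF c(1) i] by (intro alg_gen disjI1) blast
 qed
 ultimately show "alg (%k. (\<exists>c. Cb c & k = (%x. c (g x))) \<or> Cb k) (pderiv_dir b k)" by simp
qed

lemma Cb_compose_vec:
 fixes c :: "'b::euclidean_space => 'c::euclidean_space" and g :: "'a::euclidean_space => 'b"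
 assumes "Cb c" "bder g" shows "Cb (%x. c (g x))"
 by (rule Cb_componentwise) (rule Cb_compose[OF Cb_inner[OF assms(1)] assms(2)])

lemma bder_compose:
 fixes f :: "'b::euclidean_space => 'c::euclidean_space" and g :: "'a::euclidean_space => 'b"
 assumes "bder f" "bder g" shows "bder (%x. f (g x))"
 unfolding bder_def
proof (intro conjI ballI)
 show "(%x. f (g x)) differentiable_on UNIV"
  using assms by (auto simp: bder_def intro: differentiable_on_compose_UNIV)
 fix b :: 'a assume b: "b \<in> Basis"
 have eq: "pderiv_dir b (%x. f (g x)) = (%x. \<Sum>i\<in>Basis. (pderiv_dir b g x \<bullet> i) *\<^sub>R pderiv_dir i f (g x))"
  using assms by (subst pderiv_dir_compose) (auto simp: bder_def)
 show "Cb (pderiv_dir b (%x. f (g x)))"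
 proof (rule Cb_componentwise)
  fix j :: 'c assume "j \<in> Basis"
  have "Cb (%x. \<Sum>i\<in>Basis. (pderiv_dir b g x \<bullet> i) * (pderiv_dir i f (g x) \<bullet> j))"
  proof (intro Cb_sum Cb_mult)
   fix i :: 'b assume "i \<in> Basis"
   then show "Cb (%x. pderiv_dir b g x \<bullet> i)" "Cb (%x. pderiv_dir i f (g x) \<bullet> j)"
    using assms b Cb_compose_vec[OF _ assms(2)] by (auto simp: bder_def intro: Cb_inner)
  qed
  then show "Cb (%x. pderiv_dir b (%x. f (g x)) x \<bullet> j)"
   by (simp add: eq inner_sum_left)
 qed
qed

lemma bder_add: "bder f ==> bder g ==> bder (%x. f x + g x)"
 by (auto simp: bder_def pderiv_dir_add Cb_add)

lemma bder_minus: "bder f ==> bder (%x. - f x)"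
 by (auto simp: bder_def pderiv_dir_bounded_linear[OF bounded_linear_minus[OF bounded_linear_ident]] Cb_uminus)

lemma bder_diff: "bder f ==> bder g ==> bder (%x. f x - g x)"
 using bder_add[of f "%x. - g x"] bder_minus[of g] by simp

lemma bder_Pair:
 assumes "bder f" "bder g" shows "bder (%x. (f x, g x))"
proof -
 have "bder (%x. (f x, 0) + (0, g x))"
  by (intro bder_add bder_compose[OF bder_bounded_linear[of "%x. (x, 0)"] assms(1)]
   bder_compose[OF bder_bounded_linear[of "%x. (0, x)"] assms(2)])
   (intro bounded_linear_Pair bounded_linear_ident bounded_linear_zero)+
 then show ?thesis by simp
qed

lemma bder_fst: "bder g ==> bder (%x. fst (g x))" and bder_snd: "bder g ==> bder (%x. snd (g x))"
 by (rule bder_compose[OF bder_bounded_linear], rule bounded_linear_fst bounded_linear_snd, assumption)+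

lemma bder_ident: "bder (%x. x)"
 by (rule bder_bounded_linear) (rule bounded_linear_ident)

lemma Cb_imp_bder: "Cb f ==> bder f"
 by (simp add: bder_def Cb_D Cb_pderiv)

text \<open>A function with bounded gradient is Lipschitz.\<close>

lemma pderiv_bound_lipschitz:
 fixes f :: "'a::euclidean_space => 'b::real_normed_vector"
 assumes d: "f differentiable_on UNIV" and C: "!!b x. b \<in> Basis ==> norm (pderiv_dir b f x) <= C"
 shows "norm (f x - f y) <= C * DIM('a) * norm (x - y)"
proof (rule differentiable_bound[where S = UNIV and f' = "%x v. \<Sum>b\<in>Basis. (v \<bullet> b) *\<^sub>R pderiv_dir b f x"])
 fix x
 show "(f has_derivative (%v. \<Sum>b\<in>Basis. (v \<bullet> b) *\<^sub>R pderiv_dir b f x)) (at x within UNIV)"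
  by (rule has_derivative_at_withinI[OF has_derivative_pderiv[OF differentiable_on_UNIV_D[OF d]]])
 show "onorm (%v. \<Sum>b\<in>Basis. (v \<bullet> b) *\<^sub>R pderiv_dir b f x) <= C * DIM('a)"
 proof (rule onorm_le)
  fix v
  have "norm (\<Sum>b\<in>Basis. (v \<bullet> b) *\<^sub>R pderiv_dir b f x) <= (\<Sum>b\<in>(Basis::'a set). norm v * C)"
   using C by (intro order_trans[OF norm_sum] sum_mono) (auto intro!: mult_mono simp: Basis_le_norm)
  then show "norm (\<Sum>b\<in>Basis. (v \<bullet> b) *\<^sub>R pderiv_dir b f x) <= C * DIM('a) * norm v"
   by (simp add: algebra_simps)
 qed
qed auto

lemma Cb_lipschitz:
 fixes f :: "'a::euclidean_space => 'b::real_normed_vector"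
 assumes "f differentiable_on UNIV" "!!b. b \<in> Basis ==> Cb (pderiv_dir b f)"
 obtains L where "L > 0" "!!x y. norm (f x - f y) <= L * norm (x - y)"
proof -
 have "\<exists>C>0. \<forall>x. norm (pderiv_dir b f x) <= C" if "b \<in> Basis" for b :: 'a
  using Cb_boundE[OF assms(2)[OF that]] by metis
 then obtain C where C: "!!b x. b \<in> Basis ==> C b > 0 & norm (pderiv_dir b f x) <= C b" by metis
 define D where "D = (\<Sum>b\<in>(Basis::'a set). C b)"
 have "C b <= D" if "b \<in> Basis" for b :: 'a
  unfolding D_def by (rule member_le_sum) (use that C in \<open>auto simp: less_imp_le\<close>)
 then have D: "norm (pderiv_dir b f x) <= D" if "b \<in> Basis" for b x
  using that C order_trans by blast
 have "D > 0" unfolding D_def by (rule sum_pos) (auto simp: C)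
 with pderiv_bound_lipschitz[OF assms(1) D] show ?thesis
  by (intro that[of "D * DIM('a)"]) auto
qed

lemma bder_lipschitz:
 assumes "bder f" obtains L where "L > 0" "!!x y. norm (f x - f y) <= L * norm (x - y)"
 using Cb_lipschitz assms unfolding bder_def by metis

lemma finite_uniform_bound:
 fixes F :: "'i => 's => real"
 assumes "finite I" "!!i. i \<in> I ==> \<exists>C. \<forall>s. Q s --> F i s <= C"
 shows "\<exists>C. \<forall>i\<in>I. \<forall>s. Q s --> F i s <= C"
proof -
 have "\<forall>i\<in>I. \<exists>C. \<forall>s. Q s --> F i s <= C" using assms(2) by blast
 from bchoice[OF this] obtain C where C: "!!i s. i \<in> I ==> Q s ==> F i s <= C i" by blast
 have "C i <= (\<Sum>i\<in>I. \<bar>C i\<bar>)" if "i \<in> I" for i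
  using member_le_sum[OF that, of "%i. \<bar>C i\<bar>"] assms(1) by simp
 with C show ?thesis by (meson order_trans)
qed


section \<open>Schwartz functions\<close>

lemma differentiable_on_sum_UNIV:
 "(!!i. i \<in> I ==> f i differentiable_on UNIV) ==> (%x. \<Sum>i\<in>I. f i x) differentiable_on UNIV"
 by (induction I rule: infinite_finite_induct) auto

text \<open>By the Leibniz rule the derivatives of f g are sums of products of derivatives of the
  factors. The sums are coded as nonempty lists of pairs, because \<open>R\<close> is closed under
  addition while nothing is assumed about the zero function.\<close>

lemma all_derivs_mult:
 fixes f g :: "'a::euclidean_space => 'b::real_normed_algebra"
 assumes "all_derivs P f" "all_derivs Q g"
  and PQ: "!!f g. P f ==> Q g ==> R (%x. f x * g x)"
  and R: "!!f g. R f ==> R g ==> R (%x. f x + g x)"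
 shows "all_derivs R (%x. f x * g x)"
proof -
 have *: "all_derivs R k" if "set fs ~= {}" "\<forall>(f, g) \<in> set fs. all_derivs P f & all_derivs Q g"
  "k = (%x. \<Sum>(f, g)\<leftarrow>fs. f x * g x)" for k fs
 proof (rule all_derivs_coinduct[where X = "%k. \<exists>fs. fs ~= [] & (\<forall>(f, g) \<in> set fs. all_derivs P f & all_derivs Q g) \<and>
  k = (%x. \<Sum>(f, g)\<leftarrow>fs. f x * g x)"])
  show "\<exists>fs. fs ~= [] & (\<forall>(f, g) \<in> set fs. all_derivs P f & all_derivs Q g) \<and>
  k = (%x. \<Sum>(f, g)\<leftarrow>fs. f x * g x)" using that by auto
 next
  fix k
  assume "\<exists>fs. fs ~= [] & (\<forall>(f, g) \<in> set fs. all_derivs P f & all_derivs Q g) \<and>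
  k = (%x. \<Sum>(f, g)\<leftarrow>fs. f x * g x)"
  then obtain fs where fs: "fs ~= []" "\<forall>(f, g) \<in> set fs. all_derivs P f & all_derivs Q g"
   and k: "k = (%x. \<Sum>(f, g)\<leftarrow>fs. f x * g x)" by blast
  have "(%x. \<Sum>(f, g)\<leftarrow>fs. f x * g x) differentiable_on UNIV & R (%x. \<Sum>(f, g)\<leftarrow>fs. f x * g x)"
   using fs
  proof (induction fs rule: list_nonempty_induct)
   case (single fg)
   then show ?case by (cases fg) (auto intro!: PQ differentiable_on_mult dest: all_derivsD)
  next
   case (cons fg fs)
   then show ?case by (cases fg) (auto intro!: R PQ differentiable_on_mult differentiable_on_add dest: all_derivsD)
  qed
  then show "k differentiable_on UNIV & R k" by (simp only: k)
 next
  fix k and b :: 'a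
  assume "\<exists>fs. fs ~= [] & (\<forall>(f, g) \<in> set fs. all_derivs P f & all_derivs Q g) \<and>
  k = (%x. \<Sum>(f, g)\<leftarrow>fs. f x * g x)" and b: "b \<in> Basis"
  then obtain fs where fs: "fs ~= []" "\<forall>(f, g) \<in> set fs. all_derivs P f & all_derivs Q g"
   and k: "k = (%x. \<Sum>(f, g)\<leftarrow>fs. f x * g x)" by blast
  define ds where "ds = concat (map (%(f, g). [(f, pderiv_dir b g), (pderiv_dir b f, g)]) fs)"
  have "(%x. \<Sum>(f, g)\<leftarrow>fs. f x * g x) differentiable_on UNIV \<and>
   pderiv_dir b (%x. \<Sum>(f, g)\<leftarrow>fs. f x * g x) = (%x. \<Sum>(f, g)\<leftarrow>ds. f x * g x)"
   unfolding ds_def using fs(2)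
  proof (induction fs)
   case (Cons fg fs)
   obtain f g where fg: "fg = (f, g)" by fastforce
   with Cons have d: "f differentiable_on UNIV" "g differentiable_on UNIV"
    by (auto dest: all_derivsD)
   with Cons show ?case
    by (auto simp: fg pderiv_dir_add pderiv_dir_mult differentiable_on_mult differentiable_on_add add.assoc)
  qed auto
  moreover have "ds ~= []" "\<forall>(f, g) \<in> set ds. all_derivs P f & all_derivs Q g"
   using fs b unfolding ds_def by (cases fs; fastforce intro: all_derivs_pderiv)+
  ultimately show "\<exists>fs. fs ~= [] & (\<forall>(f, g) \<in> set fs. all_derivs P f & all_derivs Q g) \<and>
  pderiv_dir b k = (%x. \<Sum>(f, g)\<leftarrow>fs. f x * g x)"
   by (intro exI[of _ ds]) (simp add: k)
 qed
 show ?thesis by (rule *[of "[(f, g)]"]) (use assms in auto)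
qed

definition rapid :: "('a::real_normed_vector => 'b::real_normed_vector) => bool" where
 "rapid f \<longleftrightarrow> (\<forall>N::nat. \<exists>C. \<forall>x. (1 + norm x) ^ N * norm (f x) <= C)"

definition moderate :: "('a::real_normed_vector => 'b::real_normed_vector) => bool" where
 "moderate f \<longleftrightarrow> (\<exists>(N::nat) C. \<forall>x. norm (f x) <= C * (1 + norm x) ^ N)"

abbreviation "Sch \<equiv> all_derivs rapid"
text \<open>Slowly increasing smooth functions, the multipliers of the Schwartz space.\<close>

abbreviation "OM \<equiv> all_derivs moderate"

lemma schwartz_iff: "u \<in> schwartz_space \<longleftrightarrow> Sch u"
proof -
 have "bounded (range (%x. (1 + norm x) ^ N *\<^sub>R f x)) \<longleftrightarrow> (\<exists>C. \<forall>x. (1 + norm x) ^ N * norm (f x) <= C)"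
  for f :: "'a => complex" and N :: nat
  by (simp add: bounded_iff)
 then show ?thesis
  unfolding schwartz_space_def smooth_iff all_derivs_def rapid_def mem_Collect_eq by blast
qed

lemma rapid_add:
 fixes f g :: "'a::real_normed_vector => 'b::real_normed_vector"
 assumes "rapid f" "rapid g" shows "rapid (%x. f x + g x)"
 unfolding rapid_def
proof
 fix N :: nat
 obtain C D where C: "!!x. (1 + norm x) ^ N * norm (f x) <= C" "!!x. (1 + norm x) ^ N * norm (g x) <= D"
  using assms unfolding rapid_def by metis
 have "(1 + norm x) ^ N * norm (f x + g x) <= C + D" for x
 proof -
  have "(1 + norm x) ^ N * norm (f x + g x) <= (1 + norm x) ^ N * (norm (f x) + norm (g x))"
   by (intro mult_left_mono norm_triangle_ineq) auto
  also have "\<dots> <= C + D" using C[of x] by (simp add: distrib_left)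
  finally show ?thesis .
 qed
 then show "\<exists>C. \<forall>x. (1 + norm x) ^ N * norm (f x + g x) <= C" by blast
qed

lemma rapid_moderate_mult:
 fixes f g :: "'a::real_normed_vector => 'b::real_normed_algebra"
 assumes "moderate f" "rapid g" shows "rapid (%x. f x * g x)"
 unfolding rapid_def
proof
 fix N :: nat
 obtain M C where C: "!!x. norm (f x) <= C * (1 + norm x) ^ M"
  using assms(1) unfolding moderate_def by auto
 obtain D where D: "!!x. (1 + norm x) ^ (N + M) * norm (g x) <= D"
  using assms(2) unfolding rapid_def by auto
 have C0: "C >= 0" using C[of 0] norm_ge_zero[of "f 0"] by (simp del: norm_ge_zero)
 have "(1 + norm x) ^ N * norm (f x * g x) <= C * D" for x
 proof -
  have "norm (f x * g x) <= C * (1 + norm x) ^ M * norm (g x)"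
   by (rule order_trans[OF norm_mult_ineq]) (intro mult_right_mono C, auto)
  then have "(1 + norm x) ^ N * norm (f x * g x) <= (1 + norm x) ^ N * (C * (1 + norm x) ^ M * norm (g x))"
   by (intro mult_left_mono) auto
  also have "\<dots> = C * ((1 + norm x) ^ (N + M) * norm (g x))"
   by (simp add: power_add mult_ac)
  also have "\<dots> <= C * D" using D C0 by (intro mult_left_mono) auto
  finally show ?thesis .
 qed
 then show "\<exists>C. \<forall>x. (1 + norm x) ^ N * norm (f x * g x) <= C" by blast
qed

lemma moderate_add:
 fixes f g :: "'a::real_normed_vector => 'b::real_normed_vector"
 assumes "moderate f" "moderate g" shows "moderate (%x. f x + g x)"
proof -
 obtain M N C D where C: "!!x. norm (f x) <= C * (1 + norm x) ^ M" and D: "!!x. norm (g x) <= D * (1 + norm x) ^ N"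
  using assms unfolding moderate_def by metis
 have C0: "C >= 0" "D >= 0" using C[of 0] D[of 0] norm_ge_zero[of "f 0"] norm_ge_zero[of "g 0"]
  by (simp_all del: norm_ge_zero)
 have "norm (f x + g x) <= (C + D) * (1 + norm x) ^ (M + N)" for x
 proof -
  have "C * (1 + norm x) ^ M <= C * (1 + norm x) ^ (M + N)" "D * (1 + norm x) ^ N <= D * (1 + norm x) ^ (M + N)"
   using C0 by (intro mult_left_mono power_increasing; auto)+
  then show ?thesis using norm_triangle_ineq[of "f x" "g x"] C[of x] D[of x]
   by (simp add: distrib_right)
 qed
 then show ?thesis unfolding moderate_def by blast
qed

lemma moderate_mult:
 fixes f g :: "'a::real_normed_vector => 'b::real_normed_algebra"
 assumes "moderate f" "moderate g" shows "moderate (%x. f x * g x)"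
proof -
 obtain M N C D where C: "!!x. norm (f x) <= C * (1 + norm x) ^ M" and D: "!!x. norm (g x) <= D * (1 + norm x) ^ N"
  using assms unfolding moderate_def by metis
 have C0: "C >= 0" using C[of 0] norm_ge_zero[of "f 0"] by (simp del: norm_ge_zero)
 have "norm (f x * g x) <= (C * D) * (1 + norm x) ^ (M + N)" for x
  using mult_mono[OF C[of x] D[of x]] C0 norm_mult_ineq[of "f x" "g x"]
  by (simp add: power_add mult_ac)
 then show ?thesis unfolding moderate_def by blast
qed

lemma bounded_moderate: "bounded (range f) ==> moderate f"
 unfolding moderate_def by (rule exI[of _ 0]) (auto simp: bounded_iff)

lemma Cb_OM: "Cb f ==> OM f"
 unfolding all_derivs_def using bounded_moderate by blast

lemma OM_add: "OM f ==> OM g ==> OM (%x. f x + g x)"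
 by (rule all_derivs_add) (auto intro: moderate_add)

lemma OM_mult:
 fixes f g :: "'a::euclidean_space => 'b::real_normed_algebra"
 shows "OM f ==> OM g ==> OM (%x. f x * g x)"
 by (rule all_derivs_mult[where P = moderate and Q = moderate]) (auto intro: moderate_add moderate_mult)

lemma OM_bounded_linear:
 fixes L :: "'a::euclidean_space => 'b::real_normed_vector"
 assumes L: "bounded_linear L" shows "OM L"
proof (rule all_derivs_coinduct[where X = "%f. f = L \<or> (\<exists>c. f = (%_. c))"])
 show "f differentiable_on UNIV & moderate f" if "f = L \<or> (\<exists>c. f = (%_. c))" for f :: "'a => 'b"
  using that
 proof
  assume "f = L"
  obtain K where K: "!!x. norm (L x) <= norm x * K" "0 <= K"
   using bounded_linear.nonneg_bounded[OF L] by auto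
  have "norm (L x) <= K * (1 + norm x) ^ 1" for x
   using K(1)[of x] K(2) by (simp add: algebra_simps)
  then have "moderate L" unfolding moderate_def by blast
  with \<open>f = L\<close> show ?thesis by (simp add: bounded_linear_differentiable_on[OF L])
 next
  assume "\<exists>c. f = (%_. c)"
  then show ?thesis by (auto intro!: bounded_moderate simp: image_constant_conv)
 qed
 show "pderiv_dir b f = L \<or> (\<exists>c. pderiv_dir b f = (%_. c))" if "f = L \<or> (\<exists>c. f = (%_. c))" for f :: "'a => 'b" and b
  using that pderiv_dir_of_bounded_linear[OF L, of b] pderiv_dir_const[of b] by blast
qed auto

lemma Sch_add: "Sch f ==> Sch g ==> Sch (%x. f x + g x)"
 by (rule all_derivs_add) (auto intro: rapid_add)

lemma OM_Sch_mult:
 fixes f g :: "'a::euclidean_space => 'b::real_normed_algebra"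
 shows "OM f ==> Sch g ==> Sch (%x. f x * g x)"
 by (rule all_derivs_mult[where P = moderate and Q = rapid]) (auto intro: rapid_add rapid_moderate_mult)

lemma Cb_Sch_mult:
 fixes f g :: "'a::euclidean_space => 'b::real_normed_algebra"
 shows "Cb f ==> Sch g ==> Sch (%x. f x * g x)"
 by (intro OM_Sch_mult Cb_OM)

lemma OM_coord: "OM (%x. of_real (x \<bullet> b) :: 'b::real_normed_algebra_1)"
 by (rule OM_bounded_linear)
  (rule bounded_linear_compose[OF bounded_linear_of_real bounded_linear_inner_left])

lemma rapid_bounded: "rapid f ==> bounded (range f)"
 unfolding rapid_def bounded_iff by (drule spec[of _ 0]) auto

lemma Sch_Cb: "Sch f ==> Cb f"
 unfolding all_derivs_def using rapid_bounded by blast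

lemma Sch_bound:
 assumes "Sch u" obtains C where "C > 0" "!!x. norm (u x) <= C / (1 + norm x) ^ N"
proof -
 obtain C where C: "!!x. (1 + norm x) ^ N * norm (u x) <= C"
  using all_derivsD(2)[OF assms] unfolding rapid_def by metis
 have "norm (u x) <= (\<bar>C\<bar> + 1) / (1 + norm x) ^ N" for x
 proof -
  have p: "(1 + norm x) ^ N > 0" by (intro zero_less_power) (simp add: add_pos_nonneg)
  show ?thesis using C[of x] p by (simp add: pos_le_divide_eq mult.commute)
 qed
 then show ?thesis by (intro that[of "\<bar>C\<bar> + 1"]) auto
qed

lemma Sch_pderiv: "Sch f ==> b \<in> Basis ==> Sch (pderiv_dir b f)"
 by (rule all_derivs_pderiv)

definition gauss :: "'a::euclidean_space => complex" where
 "gauss x = of_real (exp (- (x \<bullet> x)))"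

lemma gauss_derivative:
 "(gauss has_derivative (%v. of_real (- 2 * (x \<bullet> v)) * gauss x)) (at x)"
 unfolding gauss_def
 by (auto intro!: derivative_eq_intros simp: fun_eq_iff inner_commute algebra_simps)

text \<open>Since 1 + s <= exp s, the product is at most exp (N s - s^2), and completing the square
  gives the maximum N^2 / 4 of the exponent.\<close>

lemma rapid_gauss: "rapid (gauss :: 'a::euclidean_space => complex)"
 unfolding rapid_def
proof (intro allI exI)
 fix N :: nat and x :: 'a
 let ?s = "norm x"
 have "(1 + ?s) ^ N <= exp ?s ^ N" by (intro power_mono exp_ge_add_one_self) auto
 then have "(1 + ?s) ^ N * norm (gauss x) <= exp (real N * ?s) * exp (- ?s\<^sup>2)"
  by (simp add: gauss_def exp_of_nat_mult power2_norm_eq_inner mult_right_mono)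
 also have "\<dots> = exp (real N * ?s - ?s\<^sup>2)" by (simp add: exp_add[symmetric])
 also have "real N * ?s - ?s\<^sup>2 <= (real N)\<^sup>2 / 4"
  using zero_le_power2[of "?s - real N / 2"] by (simp add: power2_diff power_divide algebra_simps)
 finally show "(1 + ?s) ^ N * norm (gauss x) <= exp ((real N)\<^sup>2 / 4)" by simp
qed

text \<open>Each derivative of the Gaussian is the Gaussian times a slowly increasing factor, and
  products of this form are stable under differentiation.\<close>

lemma Sch_gauss: "Sch (gauss :: 'a::euclidean_space => complex)"
proof (rule all_derivs_coinduct[where X = "%f. \<exists>c. OM c & f = (%x. c x * gauss x)"])
 show "\<exists>c. OM c & (gauss :: 'a => complex) = (%x. c x * gauss x)"
  by (intro exI[of _ "%_. 1"]) (auto intro: Cb_OM Cb_const)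
 have dg: "(gauss :: 'a => complex) differentiable_on UNIV"
  using gauss_derivative by (rule has_derivative_differentiable_on)
 show "f differentiable_on UNIV & rapid f" if "\<exists>c. OM c & f = (%x. c x * gauss x)" for f :: "'a => complex"
  using that dg by (auto intro!: differentiable_on_mult rapid_moderate_mult rapid_gauss dest: all_derivsD)
 show "\<exists>c. OM c & pderiv_dir b f = (%x. c x * gauss x)"
  if f: "\<exists>c. OM c & f = (%x. c x * gauss x)" and b: "b \<in> Basis" for f :: "'a => complex" and b
 proof -
  from f obtain c where c: "OM c" "f = (%x. c x * gauss x)" by (elim exE conjE)
  have "pderiv_dir b f = (%x. c x * pderiv_dir b gauss x + pderiv_dir b c x * gauss x)"
   unfolding c(2) by (rule pderiv_dir_mult[OF all_derivsD(1)[OF c(1)] dg])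
  also have "\<dots> = (%x. (c x * ((- 2) * of_real (x \<bullet> b)) + pderiv_dir b c x) * gauss x)"
   by (simp add: pderiv_dir_eq[OF gauss_derivative] algebra_simps)
  finally show ?thesis
   using OM_add[OF OM_mult[OF c(1) OM_mult[OF Cb_OM[OF Cb_const] OM_coord]] all_derivs_pderiv[OF c(1) b]]
   by blast
 qed
qed

lemma gauss_0: "gauss 0 = 1" by (simp add: gauss_def)

text \<open>A family that contains v o g for Schwartz \<open>v\<close> and is preserved by the chain
  rule when \<open>g\<close> has bounded derivatives.\<close>

inductive gspan :: "('a::euclidean_space => 'b::euclidean_space) => ('a => complex) => bool" for g where
 gspan_gen: "Cb c ==> Sch w ==> gspan g (%x. c x * w (g x))"
| gspan_add: "gspan g f ==> gspan g k ==> gspan g (%x. f x + k x)"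

lemma gspan_sum:
 assumes "!!i. i \<in> I ==> gspan g (f i)" "finite I" "I ~= {}" shows "gspan g (%x. \<Sum>i\<in>I. f i x)"
 using assms(2,3,1) by (induction rule: finite_ne_induct) (simp_all add: gspan_add)

text \<open>The growth condition turns decay in g x into decay in x. Derivatives stay in
  \<open>gspan\<close>, whose coefficients are bounded.\<close>

lemma Sch_compose:
 fixes v :: "'b::euclidean_space => complex" and g :: "'a::euclidean_space => 'b"
 assumes v: "Sch v" and g: "bder g" and C: "!!x. 1 + norm x <= C * (1 + norm (g x))"
 shows "Sch (%x. v (g x))"
proof -
 have C0: "C >= 0" 
 proof (rule ccontr)
  assume "\<not> C >= 0"
  then have "C * (1 + norm (g 0)) < 0" by (intro mult_neg_pos) (auto simp: add_pos_nonneg)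
  with C[of 0] show False by simp
 qed
 have rap: "rapid (%x. w (g x))" if w: "rapid w" for w :: "'b => complex"
  unfolding rapid_def
 proof
  fix N :: nat
  obtain D where D: "!!x. (1 + norm x) ^ N * norm (w x) <= D" using w unfolding rapid_def by metis
  have "(1 + norm x) ^ N * norm (w (g x)) <= C ^ N * D" for x
  proof -
   have "(1 + norm x) ^ N * norm (w (g x)) <= (C * (1 + norm (g x))) ^ N * norm (w (g x))"
    using C by (intro mult_right_mono power_mono) auto
   also have "\<dots> = C ^ N * ((1 + norm (g x)) ^ N * norm (w (g x)))" by (simp add: power_mult_distrib)
   also have "\<dots> <= C ^ N * D" using D C0 by (intro mult_left_mono) auto
   finally show ?thesis .
  qed
  then show "\<exists>C. \<forall>x. (1 + norm x) ^ N * norm (w (g x)) <= C" by blast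
 qed
 have der: "pderiv_dir b (%x. c x * w (g x)) = (%x. (\<Sum>i\<in>Basis. (c x * of_real (pderiv_dir b g x \<bullet> i)) * pderiv_dir i w (g x)) + pderiv_dir b c x * w (g x))"
  and dif: "(%x. c x * w (g x)) differentiable_on UNIV"
  if "Cb c" "Sch w" for b :: 'a and c :: "'a => complex" and w :: "'b => complex"
 proof -
  have d: "c differentiable_on UNIV" "w differentiable_on UNIV" "g differentiable_on UNIV"
   using that g by (auto simp: bder_def dest: all_derivsD)
  show "(%x. c x * w (g x)) differentiable_on UNIV"
   by (rule differentiable_on_mult[OF d(1) differentiable_on_compose_UNIV[OF d(2,3)]])
  have "pderiv_dir b (%x. c x * w (g x)) = (%x. c x * pderiv_dir b (%x. w (g x)) x + pderiv_dir b c x * w (g x))"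
   by (rule pderiv_dir_mult[OF d(1) differentiable_on_compose_UNIV[OF d(2,3)]])
  then show "pderiv_dir b (%x. c x * w (g x)) = (%x. (\<Sum>i\<in>Basis. (c x * of_real (pderiv_dir b g x \<bullet> i)) * pderiv_dir i w (g x)) + pderiv_dir b c x * w (g x))"
   by (simp add: pderiv_dir_compose[OF d(2,3)] scaleR_conv_of_real sum_distrib_left mult.assoc)
 qed
 have gd: "f differentiable_on UNIV" if "gspan g f" for f
  using that by induction (auto simp: dif)
 have "Sch k" if "gspan g k" for k
  using that
 proof (rule all_derivs_coinduct[where X = "gspan g"])
  show "f differentiable_on UNIV & rapid f" if "gspan g f" for f
   using that
  proof induction
   case (gspan_gen c w)
   have "rapid (%x. c x * w (g x))"
    using gspan_gen by (intro rapid_moderate_mult rap bounded_moderate) (auto dest: all_derivsD)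
   with dif[OF gspan_gen] show ?case by blast
  qed (auto intro: rapid_add)
  show "gspan g (pderiv_dir b f)" if "gspan g f" and b: "b \<in> Basis" for f b
   using that(1)
  proof induction
   case (gspan_gen c w)
   have gb: "Cb (%x. complex_of_real (pderiv_dir b g x \<bullet> i))" for i
    using g b by (intro Cb_of_real Cb_inner) (auto simp: bder_def)
   show ?case unfolding der[OF gspan_gen]
    by (intro gspan.gspan_add gspan_sum gspan.gspan_gen Cb_mult gb gspan_gen Sch_pderiv Cb_pderiv b) auto
  next
   case (gspan_add f k)
   from pderiv_dir_add[OF gd gd, OF gspan_add(1,2)] gspan_add show ?case by (simp add: gspan.gspan_add)
  qed
 qed
 moreover have "gspan g (%x. 1 * v (g x))" by (intro gspan_gen Cb_const v)
 ultimately show ?thesis by simp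
qed


section \<open>Integrals over Euclidean space\<close>

text \<open>The shells j <= |x| < j + 1 are enlarged to balls of radius j + 1 and these to cubes of
  volume (2 (j + 1))^n. The exponent n + 2 absorbs this volume and leaves the convergent series of 1
  / (j + 1)^2.\<close>

lemma integrable_decay:
 "integrable lborel (%x::'a::euclidean_space. 1 / (1 + norm x) ^ (DIM('a) + 2))"
proof (rule integrableI_bounded)
 let ?d = "DIM('a)"
 let ?w = "%x::'a. 1 / (1 + norm x) ^ (?d + 2)"
 show "?w \<in> borel_measurable lborel" by measurable
 let ?F = "%j (x::'a). ennreal (1 / (1 + real j) ^ (?d + 2)) * indicator (cball 0 (real j + 1)) x"
 have "ennreal (norm (?w x)) <= (\<Sum>j. ?F j x)" for x
 proof -
  define j where "j = nat \<lfloor>norm x\<rfloor>"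
  have j: "real j <= norm x" "norm x <= real j + 1" unfolding j_def by simp_all
  have "?w x <= 1 / (1 + real j) ^ (?d + 2)"
   using j by (intro divide_left_mono power_mono mult_pos_pos zero_less_power) (auto simp: add_pos_nonneg)
  then have "ennreal (norm (?w x)) <= ?F j x" using j by (auto simp: indicator_def intro!: ennreal_leI)
  also have "\<dots> = (\<Sum>j\<in>{j}. ?F j x)" by (simp only: sum.insert finite.emptyI empty_iff not_False_eq_True sum.empty add_0_right)
  also have "\<dots> <= (\<Sum>j. ?F j x)" by (rule sum_le_suminf) auto
  finally show ?thesis .
 qed
 then have "(\<integral>\<^sup>+x. ennreal (norm (?w x)) \<partial>lborel) <= (\<integral>\<^sup>+x. (\<Sum>j. ?F j x) \<partial>lborel)"
  by (intro nn_integral_mono) auto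
 also have "\<dots> = (\<Sum>j. \<integral>\<^sup>+x. ?F j x \<partial>lborel)"
  by (intro nn_integral_suminf borel_measurable_times_ennreal borel_measurable_indicator borel_measurable_const) auto
 also have "\<dots> <= (\<Sum>j. ennreal (2 ^ ?d * (1 / (real (Suc j)) ^ 2)))"
 proof (rule suminf_le)
  fix j
  let ?R = "real j + 1"
  have "cball (0::'a) ?R \<subseteq> cbox (- (?R *\<^sub>R One)) (?R *\<^sub>R One)"
  proof
   fix x :: 'a assume "x \<in> cball 0 ?R"
   then have "\<bar>x \<bullet> i\<bar> <= ?R" if "i \<in> Basis" for i using Basis_le_norm[OF that, of x] by auto
   then show "x \<in> cbox (- (?R *\<^sub>R One)) (?R *\<^sub>R One)"
    by (auto simp: mem_box abs_le_iff; smt (verit, best))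
  qed
  then have "emeasure lborel (cball (0::'a) ?R) <= emeasure lborel (cbox (- (?R *\<^sub>R One)) (?R *\<^sub>R One :: 'a))"
   by (intro emeasure_mono) auto
  also have "\<dots> = ennreal ((2 * ?R) ^ ?d)"
   by (subst emeasure_lborel_cbox) (auto simp: algebra_simps)
  finally have e: "emeasure lborel (cball (0::'a) ?R) <= ennreal ((2 * ?R) ^ ?d)" .
  have "(\<integral>\<^sup>+x. ?F j x \<partial>lborel) = ennreal (1 / (1 + real j) ^ (?d + 2)) * emeasure lborel (cball (0::'a) ?R)"
   by (rule nn_integral_cmult_indicator) auto
  also have "\<dots> <= ennreal (1 / (1 + real j) ^ (?d + 2)) * ennreal ((2 * ?R) ^ ?d)"
   by (intro mult_left_mono e) auto
  also have "\<dots> = ennreal (1 / (1 + real j) ^ (?d + 2) * (2 * ?R) ^ ?d)"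
   by (rule ennreal_mult[symmetric]) auto
  also have "1 / (1 + real j) ^ (?d + 2) * (2 * ?R) ^ ?d = 2 ^ ?d * (1 / (real (Suc j)) ^ 2)"
  proof -
   have "?R > 0" by simp
   then have "1 / ?R ^ (?d + 2) * (2 ^ ?d * ?R ^ ?d) = 2 ^ ?d * (1 / ?R ^ 2)"
    by (simp only: power_add) (simp add: divide_simps)
   then show ?thesis by (simp only: power_mult_distrib of_nat_Suc add.commute[of 1])
  qed
  finally show "(\<integral>\<^sup>+x. ?F j x \<partial>lborel) <= ennreal (2 ^ ?d * (1 / (real (Suc j)) ^ 2))" .
 qed auto
 also have "\<dots> < \<infinity>"
 proof -
  have "summable (%j. 1 / real j ^ 2)" using inverse_power_summable[of 2, where 'a = real]
   by (simp add: inverse_eq_divide)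
  then have "summable (%j. 1 / (real (Suc j)) ^ 2)" by (subst summable_Suc_iff[of "%j. 1 / real j ^ 2"])
  then have "summable (%j. 2 ^ ?d * (1 / (real (Suc j)) ^ 2))" by (rule summable_mult)
  then show ?thesis
   by (subst suminf_ennreal2) auto
 qed
 finally show "(\<integral>\<^sup>+x. ennreal (norm (?w x)) \<partial>lborel) < \<infinity>" .
qed

text \<open>The integrable majorant that is used for the integrals over the whole space.\<close>

definition dw :: "'a::euclidean_space => real" where
 "dw x = 1 / (1 + norm x) ^ (DIM('a) + 2)"

lemma dw_nonneg [simp]: "dw x >= 0" and dw_pos: "dw x > 0"
 by (auto simp: dw_def add_pos_nonneg)


lemma integrable_dw: "integrable lborel (dw :: 'a::euclidean_space => real)"
 using integrable_decay[where 'a = 'a] by (simp add: dw_def[abs_def])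

lemma integrable_cmult_dw: "integrable lborel (%x::'a::euclidean_space. C * dw x)"
 by (intro integrable_mult_right integrable_dw)

lemma dw_shift: "norm (y :: 'a::euclidean_space) <= 1 ==> dw (x + y) <= 2 ^ (DIM('a) + 2) * dw x"
proof -
 assume y: "norm y <= 1"
 have "norm x <= norm (x + y) + 1" using norm_triangle_ineq4[of "x + y" y] y by simp
 moreover from this norm_ge_zero[of "x + y"] have "norm x <= 1 + 2 * norm (x + y)" by linarith
 ultimately have "(1 + norm x) ^ (DIM('a) + 2) <= (2 * (1 + norm (x + y))) ^ (DIM('a) + 2)"
  by (intro power_mono) auto
 moreover have "(1 + norm x) ^ (DIM('a) + 2) > 0" "(1 + norm (x + y)) ^ (DIM('a) + 2) > 0"
  by (auto intro!: zero_less_power simp: add_pos_nonneg)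
 ultimately show ?thesis
  unfolding dw_def power_mult_distrib by (simp add: field_simps)
qed

lemma continuous_integrable:
 fixes f :: "'a::euclidean_space => 'b::euclidean_space"
 assumes "continuous_on UNIV f" "!!x. norm (f x) <= C * dw x"
 shows "integrable lborel f"
 by (rule Bochner_Integration.integrable_bound[OF integrable_cmult_dw[of C]])
  (use assms in \<open>auto intro!: borel_measurable_continuous_onI order_trans[OF assms(2) abs_ge_self]\<close>)

lemma integral_translation:
 fixes f :: "'a::euclidean_space => 'b::euclidean_space"
 assumes "f \<in> borel_measurable borel"
 shows "integral\<^sup>L lborel (%x. f (x + t)) = integral\<^sup>L lborel f"
proof -
 have "integral\<^sup>L lborel f = integral\<^sup>L (distr lborel borel ((+) t)) f"
  by (simp add: lborel_distr_plus)
 also have "\<dots> = integral\<^sup>L lborel (%x. f (t + x))"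
  using assms by (intro integral_distr) auto
 finally show ?thesis by (simp add: add.commute)
qed

lemma integrable_translation:
 fixes f :: "'a::euclidean_space => 'b::euclidean_space"
 assumes "integrable lborel f"
 shows "integrable lborel (%x. f (x + t))"
proof -
 have "integrable (distr lborel borel ((+) t)) f" using assms by (simp add: lborel_distr_plus)
 then have "integrable lborel (%x. f (t + x))"
  by (subst (asm) integrable_distr_eq) (use assms in auto)
 then show ?thesis by (simp add: add.commute)
qed

lemma line_has_derivative:
 assumes "f differentiable (at (x + s *\<^sub>R b))"
 shows "((%s. f (x + s *\<^sub>R b)) has_derivative (%r. r *\<^sub>R pderiv_dir b f (x + s *\<^sub>R b))) (at s within S)"
proof -
 have "((%s. x + s *\<^sub>R b) has_derivative (%s. s *\<^sub>R b)) (at s within S)"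
  by (auto intro!: derivative_eq_intros)
 from has_derivative_compose[OF this has_derivative_pderiv'[OF assms]]
 show ?thesis by (simp add: linear_scale[OF pderiv_dir_linear[OF assms]])
qed

lemma difference_quotient_tendsto:
 assumes d: "f differentiable (at x)" and t: "!!n::nat. 0 < t n" "t \<longlonglongrightarrow> 0"
 shows "(%n. (f (x + t n *\<^sub>R b) - f x) /\<^sub>R t n) \<longlonglongrightarrow> pderiv_dir b f x"
proof -
 have "((%s. f (x + s *\<^sub>R b)) has_derivative (%r. r *\<^sub>R pderiv_dir b f (x + 0 *\<^sub>R b))) (at 0)"
  by (rule line_has_derivative) (use d in simp)
 then have "((%s. (f (x + s *\<^sub>R b) - (f x + s *\<^sub>R pderiv_dir b f x)) /\<^sub>R \<bar>s\<bar>) \<longlongrightarrow> 0) (at 0)"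
  by (simp add: has_derivative_at2 divide_inverse)
 then have "((%s. norm ((f (x + s *\<^sub>R b) - (f x + s *\<^sub>R pderiv_dir b f x)) /\<^sub>R \<bar>s\<bar>)) \<longlongrightarrow> 0) (at 0)"
  by (rule tendsto_norm_zero)
 moreover have "\<forall>\<^sub>F s in at 0. norm ((f (x + s *\<^sub>R b) - (f x + s *\<^sub>R pderiv_dir b f x)) /\<^sub>R \<bar>s\<bar>)
   = norm ((f (x + s *\<^sub>R b) - f x) /\<^sub>R s - pderiv_dir b f x)"
  unfolding eventually_at_filter
 proof (intro always_eventually allI impI)
  fix s :: real assume "s ~= 0"
  then have "(f (x + s *\<^sub>R b) - f x) /\<^sub>R s - pderiv_dir b f x = (f (x + s *\<^sub>R b) - (f x + s *\<^sub>R pderiv_dir b f x)) /\<^sub>R s"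
   by (simp add: scaleR_diff_right algebra_simps)
  then show "norm ((f (x + s *\<^sub>R b) - (f x + s *\<^sub>R pderiv_dir b f x)) /\<^sub>R \<bar>s\<bar>)
   = norm ((f (x + s *\<^sub>R b) - f x) /\<^sub>R s - pderiv_dir b f x)" by simp
 qed
 ultimately have "((%s. norm ((f (x + s *\<^sub>R b) - f x) /\<^sub>R s - pderiv_dir b f x)) \<longlongrightarrow> 0) (at 0)"
  by (rule Lim_transform_eventually)
 then have "((%s. (f (x + s *\<^sub>R b) - f x) /\<^sub>R s) \<longlongrightarrow> pderiv_dir b f x) (at 0)"
  by (simp add: tendsto_norm_zero_iff Lim_null[symmetric] LIM_zero_iff)
 then show ?thesis
  using t(2) less_imp_neq[OF t(1)] by (auto simp: tendsto_at_iff_sequentially o_def dest!: spec[of _ t])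
qed

text \<open>Translation invariance makes the integral of every difference quotient vanish.\<close>

lemma integral_pderiv_zero:
 fixes f :: "'a::euclidean_space => complex"
 assumes d: "f differentiable_on UNIV" and b: "b \<in> Basis"
  and c: "continuous_on UNIV (pderiv_dir b f)"
  and C: "!!x. norm (f x) <= C * dw x" "!!x. norm (pderiv_dir b f x) <= C * dw x"
 shows "integral\<^sup>L lborel (pderiv_dir b f) = 0"
proof -
 define t where "t n = 1 / real (Suc n)" for n
 have t: "0 < t n" "t n <= 1" for n by (auto simp: t_def)
 have t0: "t \<longlonglongrightarrow> 0" unfolding t_def by (rule LIMSEQ_Suc[OF lim_1_over_n])
 define D where "D n x = (f (x + t n *\<^sub>R b) - f x) /\<^sub>R t n" for n x
 have cf: "continuous_on UNIV f" using d by (rule differentiable_imp_continuous_on)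
 have fm: "f \<in> borel_measurable borel" using cf by (rule borel_measurable_continuous_onI)
 have fi: "integrable lborel f" by (rule continuous_integrable[OF cf C(1)])
 have C0: "C >= 0" using C(1)[of 0] norm_ge_zero[of "f 0"] dw_pos[of "0::'a"]
  by (meson mult_neg_pos not_le order_trans)
 \<comment> \<open>Mean value inequality along the segment from x to x + t b. All step sizes are at
   most 1, so \<open>dw_shift\<close> compares the weight on the segment with its value at x,
   uniformly in n.\<close>
 have bound: "norm (D n x) <= C * 2 ^ (DIM('a) + 2) * dw x" for n x
 proof -
  have "norm (f (x + t n *\<^sub>R b) - f (x + 0 *\<^sub>R b)) <= (C * 2 ^ (DIM('a) + 2) * dw x) * norm (t n - 0)"
  proof (rule differentiable_bound[where S = "{0..t n}" and f' = "%s r. r *\<^sub>R pderiv_dir b f (x + s *\<^sub>R b)"])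
   fix s assume s: "s \<in> {0..t n}"
   show "((%s. f (x + s *\<^sub>R b)) has_derivative (%r. r *\<^sub>R pderiv_dir b f (x + s *\<^sub>R b))) (at s within {0..t n})"
    by (rule line_has_derivative[OF differentiable_on_UNIV_D[OF d]])
   have "norm (s *\<^sub>R b) <= 1" using s t(2)[of n] b by (auto intro: order_trans)
   then have "C * dw (x + s *\<^sub>R b) <= C * (2 ^ (DIM('a) + 2) * dw x)"
    by (intro mult_left_mono dw_shift C0)
   with C(2)[of "x + s *\<^sub>R b"]
   have *: "norm (pderiv_dir b f (x + s *\<^sub>R b)) <= C * 2 ^ (DIM('a) + 2) * dw x" by (simp add: mult.assoc)
   show "onorm (%r. r *\<^sub>R pderiv_dir b f (x + s *\<^sub>R b)) <= C * 2 ^ (DIM('a) + 2) * dw x"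
    by (rule onorm_le) (use mult_right_mono[OF *] in \<open>auto simp: mult.commute\<close>)
  qed (use t[of n] in auto)
  then show ?thesis using t[of n] by (simp add: D_def divide_simps mult_ac)
 qed
 have lim: "(%n. D n x) \<longlonglongrightarrow> pderiv_dir b f x" for x
  unfolding D_def by (rule difference_quotient_tendsto[OF differentiable_on_UNIV_D[OF d] t(1) t0])
 have "(%n. integral\<^sup>L lborel (D n)) \<longlonglongrightarrow> integral\<^sup>L lborel (pderiv_dir b f)"
 proof (rule integral_dominated_convergence[where w = "%x. C * 2 ^ (DIM('a) + 2) * dw x"])
  show "D n \<in> borel_measurable lborel" for n unfolding D_def using fm by measurable
  show "pderiv_dir b f \<in> borel_measurable lborel"
   using borel_measurable_continuous_onI[OF c] by simp
 qed (use bound lim in \<open>auto intro: integrable_dw\<close>)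
 moreover have "integral\<^sup>L lborel (D n) = 0" for n
 proof -
  have "integral\<^sup>L lborel (D n) = (integral\<^sup>L lborel (%x. f (x + t n *\<^sub>R b)) - integral\<^sup>L lborel f) /\<^sub>R t n"
   unfolding D_def
   by (subst integral_scaleR_right, subst Bochner_Integration.integral_diff[OF integrable_translation[OF fi] fi]) auto
  then show ?thesis by (simp add: integral_translation[OF fm])
 qed
 ultimately show ?thesis by (simp add: LIMSEQ_const_iff)
qed

section \<open>Integrals that depend on a parameter\<close>

lemma continuous_at_integral:
 fixes f :: "'a::euclidean_space => 's => complex"
 assumes r: "r > 0" and m: "!!x. f x \<in> borel_measurable M"
  and W: "integrable M W" "!!x s. x \<in> ball x0 r ==> s \<in> space M ==> norm (f x s) <= W s"
  and c: "!!s. s \<in> space M ==> continuous (at x0) (%x. f x s)"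
 shows "continuous (at x0) (%x. integral\<^sup>L M (f x))"
 unfolding continuous_at_sequentially
proof (intro allI impI)
 fix X assume X: "X \<longlonglongrightarrow> x0"
 obtain N where N: "!!n. n >= N ==> dist (X n) x0 < r"
  using X r unfolding lim_sequentially by blast
 have "(%n. integral\<^sup>L M (f (X (n + N)))) \<longlonglongrightarrow> integral\<^sup>L M (f x0)"
 proof (rule integral_dominated_convergence[OF m m W(1)])
  show "AE s in M. (%n. f (X (n + N)) s) \<longlonglongrightarrow> f x0 s"
  proof (rule AE_I2)
   fix s assume "s \<in> space M"
   then have "((%x. f x s) \<circ> X) \<longlonglongrightarrow> f x0 s" using c X continuous_at_sequentially by blast
   then show "(%n. f (X (n + N)) s) \<longlonglongrightarrow> f x0 s" 
    unfolding o_def by (rule LIMSEQ_ignore_initial_segment)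
  qed
  show "AE s in M. norm (f (X (n + N)) s) <= W s" for n
   using N[of "n + N"] by (intro AE_I2 W(2)) (auto simp: dist_commute)
 qed
 then show "((%x. integral\<^sup>L M (f x)) \<circ> X) \<longlonglongrightarrow> integral\<^sup>L M (f x0)"
  unfolding o_def by (rule LIMSEQ_offset)
qed

lemma pderiv_bound_lipschitz_ball:
 fixes f :: "'a::euclidean_space => 'b::real_normed_vector"
 assumes d: "!!x. x \<in> ball x0 r ==> f differentiable (at x)"
  and C: "!!b x. b \<in> Basis ==> x \<in> ball x0 r ==> norm (pderiv_dir b f x) <= C"
  and xy: "x \<in> ball x0 r" "y \<in> ball x0 r"
 shows "norm (f x - f y) <= C * DIM('a) * norm (x - y)"
proof (rule differentiable_bound[where S = "ball x0 r" and f' = "%x v. \<Sum>b\<in>Basis. (v \<bullet> b) *\<^sub>R pderiv_dir b f x"])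
 fix x assume x: "x \<in> ball x0 r"
 show "(f has_derivative (%v. \<Sum>b\<in>Basis. (v \<bullet> b) *\<^sub>R pderiv_dir b f x)) (at x within ball x0 r)"
  by (rule has_derivative_at_withinI[OF has_derivative_pderiv[OF d[OF x]]])
 show "onorm (%v. \<Sum>b\<in>Basis. (v \<bullet> b) *\<^sub>R pderiv_dir b f x) <= C * DIM('a)"
 proof (rule onorm_le)
  fix v
  have "norm (\<Sum>b\<in>Basis. (v \<bullet> b) *\<^sub>R pderiv_dir b f x) <= (\<Sum>b\<in>(Basis::'a set). norm v * C)"
   using C x by (intro order_trans[OF norm_sum] sum_mono) (auto intro!: mult_mono simp: Basis_le_norm)
  then show "norm (\<Sum>b\<in>Basis. (v \<bullet> b) *\<^sub>R pderiv_dir b f x) <= C * DIM('a) * norm v"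
   by (simp add: algebra_simps)
 qed
qed (use xy in auto)

text \<open>The first-order remainder of the integrand, divided by |y - x0|, tends to 0 pointwise.
  By the mean value inequality on the ball the increment and its linear part contribute DIM W each,
  so 2 DIM W is a majorant.\<close>

lemma has_derivative_integral:
 fixes f :: "'a::euclidean_space => 's => complex"
 assumes r: "r > 0"
  and i: "!!x. integrable M (f x)"
  and d: "!!x s. x \<in> ball x0 r ==> s \<in> space M ==> (%x. f x s) differentiable (at x)"
  and m: "!!b. b \<in> Basis ==> (%s. pderiv_dir b (%x. f x s) x0) \<in> borel_measurable M"
  and W: "integrable M W"
   "!!b x s. b \<in> Basis ==> x \<in> ball x0 r ==> s \<in> space M ==> norm (pderiv_dir b (%x. f x s) x) <= W s"
 shows "((%x. integral\<^sup>L M (f x)) has_derivative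
  (%v. \<Sum>b\<in>Basis. (v \<bullet> b) *\<^sub>R integral\<^sup>L M (%s. pderiv_dir b (%x. f x s) x0))) (at x0)"
proof -
 define g where "g b s = pderiv_dir b (%x. f x s) x0" for b s
 have x0: "x0 \<in> ball x0 r" using r by simp
 have gi: "integrable M (g b)" if "b \<in> Basis" for b
  unfolding g_def by (rule Bochner_Integration.integrable_bound[OF W(1) m[OF that]])
   (intro AE_I2, use W(2)[OF that x0] in \<open>auto intro: order_trans[OF _ abs_ge_self]\<close>)
 show ?thesis unfolding g_def[symmetric]
 proof (rule has_derivativeI)
  show "bounded_linear (%v. \<Sum>b\<in>Basis. (v \<bullet> b) *\<^sub>R integral\<^sup>L M (g b))"
   by (intro bounded_linear_sum bounded_linear_scaleR_const bounded_linear_inner_left)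
  define e where "e y s = (f y s - f x0 s - (\<Sum>b\<in>Basis. ((y - x0) \<bullet> b) *\<^sub>R g b s)) /\<^sub>R norm (y - x0)" for y s
  have "((%y. integral\<^sup>L M (e y)) \<longlongrightarrow> 0) (at x0)"
   unfolding tendsto_at_iff_sequentially
  proof (intro allI impI)
   fix X assume X': "\<forall>i. X i \<in> UNIV - {x0}" and X: "X \<longlonglongrightarrow> x0"
   obtain N where N: "!!n. n >= N ==> dist (X n) x0 < r"
    using X r unfolding lim_sequentially by blast
   have "(%n. integral\<^sup>L M (e (X (n + N)))) \<longlonglongrightarrow> integral\<^sup>L M (%s. 0)"
   proof (rule integral_dominated_convergence[where w = "%s. 2 * DIM('a) * W s"])
    show "e (X (n + N)) \<in> borel_measurable M" for n
     unfolding e_def using borel_measurable_integrable[OF i] borel_measurable_integrable[OF gi]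
     by (intro borel_measurable_scaleR borel_measurable_diff borel_measurable_sum) auto
    show "AE s in M. (%n. e (X (n + N)) s) \<longlonglongrightarrow> 0"
    proof (rule AE_I2)
     fix s assume "s \<in> space M"
     then have "((%x. f x s) has_derivative (%v. \<Sum>b\<in>Basis. (v \<bullet> b) *\<^sub>R g b s)) (at x0)"
      unfolding g_def using d[OF x0] by (intro has_derivative_pderiv)
     then have "((%y. e y s) \<longlongrightarrow> 0) (at x0)"
      unfolding e_def has_derivative_at_within by (simp add: divide_inverse_commute)
     then have "(%n. e (X n) s) \<longlonglongrightarrow> 0"
      using X X' unfolding tendsto_at_iff_sequentially o_def by blast
     then show "(%n. e (X (n + N)) s) \<longlonglongrightarrow> 0" by (rule LIMSEQ_ignore_initial_segment)
    qed
    show "AE s in M. norm (e (X (n + N)) s) <= 2 * DIM('a) * W s" for n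
    proof (rule AE_I2)
     fix s assume s: "s \<in> space M"
     let ?y = "X (n + N)"
     have y: "?y \<in> ball x0 r" "?y ~= x0" using N[of "n + N"] X' by (auto simp: dist_commute)
     have "norm (f ?y s - f x0 s) <= W s * DIM('a) * norm (?y - x0)"
      by (rule pderiv_bound_lipschitz_ball[OF d[OF _ s] W(2)[OF _ _ s] y(1) x0])
     moreover have "norm (\<Sum>b\<in>Basis. ((?y - x0) \<bullet> b) *\<^sub>R g b s) <= (\<Sum>b\<in>(Basis::'a set). norm (?y - x0) * W s)"
      unfolding g_def using W(2)[OF _ x0 s]
      by (intro order_trans[OF norm_sum] sum_mono) (auto intro!: mult_mono simp: Basis_le_norm)
     ultimately have "norm (f ?y s - f x0 s - (\<Sum>b\<in>Basis. ((?y - x0) \<bullet> b) *\<^sub>R g b s)) <= 2 * DIM('a) * W s * norm (?y - x0)"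
      by (intro order_trans[OF norm_triangle_ineq4]) (simp add: algebra_simps)
     then show "norm (e ?y s) <= 2 * DIM('a) * W s"
      using y(2) by (simp add: e_def divide_simps mult_ac)
    qed
    show "integrable M (%s. 2 * DIM('a) * W s)" using W(1) by simp
   qed simp
   then show "((%y. integral\<^sup>L M (e y)) \<circ> X) \<longlonglongrightarrow> 0"
    unfolding o_def by (intro LIMSEQ_offset[where k = N and f = "%n. integral\<^sup>L M (e (X n))"]) simp
  qed
  moreover have "integral\<^sup>L M (e y) = (integral\<^sup>L M (f y) - integral\<^sup>L M (f x0) - (\<Sum>b\<in>Basis. ((y - x0) \<bullet> b) *\<^sub>R integral\<^sup>L M (g b))) /\<^sub>R norm (y - x0)" for y
   unfolding e_def using i gi by (simp add: Bochner_Integration.integral_diff Bochner_Integration.integral_sum)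
  ultimately show "((%y. (integral\<^sup>L M (f y) - integral\<^sup>L M (f x0) - (\<Sum>b\<in>Basis. ((y - x0) \<bullet> b) *\<^sub>R integral\<^sup>L M (g b))) /\<^sub>R norm (y - x0)) \<longlongrightarrow> 0) (at x0)"
   by simp
 qed
qed

lemma pderiv_integral:
 fixes f :: "'a::euclidean_space => 's => complex"
 assumes "r > 0"
  and "!!x. integrable M (f x)"
  and "!!x s. x \<in> ball x0 r ==> s \<in> space M ==> (%x. f x s) differentiable (at x)"
  and "!!b. b \<in> Basis ==> (%s. pderiv_dir b (%x. f x s) x0) \<in> borel_measurable M"
  and "integrable M W"
   "!!b x s. b \<in> Basis ==> x \<in> ball x0 r ==> s \<in> space M ==> norm (pderiv_dir b (%x. f x s) x) <= W s"
 shows "(%x. integral\<^sup>L M (f x)) differentiable (at x0)"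
  and "b \<in> Basis ==> pderiv_dir b (%x. integral\<^sup>L M (f x)) x0 = integral\<^sup>L M (%s. pderiv_dir b (%x. f x s) x0)"
proof -
 note D = has_derivative_integral[OF assms]
 show "(%x. integral\<^sup>L M (f x)) differentiable (at x0)" using D by (auto simp: differentiable_def)
 assume b: "b \<in> Basis"
 have "pderiv_dir b (%x. integral\<^sup>L M (f x)) x0 = (\<Sum>c\<in>Basis. (b \<bullet> c) *\<^sub>R integral\<^sup>L M (%s. pderiv_dir c (%x. f x s) x0))"
  by (rule pderiv_dir_eq[OF D])
 also have "\<dots> = (\<Sum>c\<in>Basis. if c = b then integral\<^sup>L M (%s. pderiv_dir c (%x. f x s) x0) else 0)"
  using b by (intro sum.cong refl) (auto simp: inner_Basis)
 finally show "pderiv_dir b (%x. integral\<^sup>L M (f x)) x0 = integral\<^sup>L M (%s. pderiv_dir b (%x. f x s) x0)"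
  using b by simp
qed

text \<open>The constant in the majorant may depend on the base point, because the weights of a
  symbol are bounded only locally in xi.\<close>

lemma pderiv_integral_dw:
 fixes f :: "'a::euclidean_space => 'v::euclidean_space => complex"
 assumes int: "!!x. integrable lborel (f x)" and d: "!!x s. (%x. f x s) differentiable (at x)"
  and m: "!!b x. b \<in> Basis ==> (%s. pderiv_dir b (%x. f x s) x) \<in> borel_measurable borel"
  and K: "!!b x0. b \<in> Basis ==> \<exists>K. \<forall>x\<in>ball x0 1. \<forall>s. norm (pderiv_dir b (%x. f x s) x) <= K * dw s"
 shows "(%x. integral\<^sup>L lborel (f x)) differentiable_on UNIV"
  and "b \<in> Basis ==> pderiv_dir b (%x. integral\<^sup>L lborel (f x)) = (%x. \<integral>s. pderiv_dir b (%x. f x s) x \<partial>lborel)"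
proof -
 have "\<exists>K. \<forall>b\<in>Basis. \<forall>x\<in>ball x0 1. \<forall>s. norm (pderiv_dir b (%x. f x s) x) <= K * dw s" for x0
 proof -
  have "\<forall>b\<in>Basis. \<exists>K. \<forall>x\<in>ball x0 1. \<forall>s. norm (pderiv_dir b (%x. f x s) x) <= K * dw s" using K by blast
  from bchoice[OF this] obtain K where K: "!!b x s. b \<in> Basis ==> x \<in> ball x0 1 ==> norm (pderiv_dir b (%x. f x s) x) <= K b * dw s" by blast
  show ?thesis
  proof (intro exI ballI allI)
   fix b x :: 'a and s :: 'v assume b: "b \<in> Basis" and x: "x \<in> ball x0 1"
   have "K b <= \<bar>K b\<bar>" by simp
   also have "\<dots> <= (\<Sum>b\<in>(Basis :: 'a set). \<bar>K b\<bar>)" using b by (intro member_le_sum) auto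
   finally show "norm (pderiv_dir b (%x. f x s) x) <= (\<Sum>b\<in>(Basis :: 'a set). \<bar>K b\<bar>) * dw s"
    by (intro order_trans[OF K[OF b x] mult_right_mono]) (simp_all add: dw_def)
  qed
 qed
 then obtain K where K: "!!x0 b x s. b \<in> Basis ==> x \<in> ball x0 1 ==> norm (pderiv_dir b (%x. f x s) x) <= K x0 * dw s" by metis
 have m': "(%s. pderiv_dir b (%x. f x s) x) \<in> borel_measurable lborel" if "b \<in> Basis" for b x using m[OF that] by simp
 have "(%x. integral\<^sup>L lborel (f x)) differentiable (at x0)" for x0
  by (rule pderiv_integral(1)[where r = 1 and W = "%s. K x0 * dw s", OF zero_less_one int d m' integrable_cmult_dw K])
 then show "(%x. integral\<^sup>L lborel (f x)) differentiable_on UNIV" by (simp add: differentiable_on_def)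
 assume b: "b \<in> Basis"
 show "pderiv_dir b (%x. integral\<^sup>L lborel (f x)) = (%x. \<integral>s. pderiv_dir b (%x. f x s) x \<partial>lborel)"
 proof
  show "pderiv_dir b (%x. integral\<^sup>L lborel (f x)) x0 = (\<integral>s. pderiv_dir b (%x. f x s) x0 \<partial>lborel)" for x0
   by (rule pderiv_integral(2)[where r = 1 and W = "%s. K x0 * dw s", OF zero_less_one int d m' integrable_cmult_dw K b])
 qed
qed


section \<open>Symbols of limited regularity in the first variable\<close>

abbreviation "jb \<equiv> japanese_bracket"

lemma jb_ge_1: "1 <= jb xi" and jb_pos [simp]: "0 < jb xi" and jb_nonneg [simp]: "0 <= jb xi"
 and jb_ge_norm: "norm xi <= jb xi" and jb_le: "jb xi <= 1 + norm xi" and le_jb: "1 + norm xi <= 2 * jb xi"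
proof -
 show 1: "1 <= jb xi" by (simp add: japanese_bracket_def)
 then show "0 < jb xi" "0 <= jb xi" by simp_all
 show 2: "norm xi <= jb xi" unfolding japanese_bracket_def by (rule real_le_rsqrt) simp
 show "jb xi <= 1 + norm xi" unfolding japanese_bracket_def
  by (rule real_le_lsqrt) (auto simp: power2_eq_square algebra_simps)
 show "1 + norm xi <= 2 * jb xi" using 1 2 by simp
qed

lemma jb_powr_mono: "a <= b ==> jb xi powr a <= jb xi powr b"
 by (rule powr_mono[OF _ jb_ge_1])

lemma jb_powr_pos [simp]: "0 < jb xi powr a" "jb xi powr a ~= 0"
 by (simp_all add: less_imp_neq[OF jb_pos, symmetric])

lemma jb_powr_equiv:
 assumes "K >= 1" "jb a <= K * jb b" "jb b <= K * jb a"
 shows "jb a powr w <= K powr \<bar>w\<bar> * jb b powr w"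
proof (cases "w >= 0")
 case True
 then have "jb a powr w <= (K * jb b) powr w" using assms by (intro powr_mono2) auto
 then show ?thesis using True assms by (simp add: powr_mult)
next
 case False
 have "jb b / K <= jb a" using assms by (simp add: divide_le_eq mult.commute)
 moreover have "jb b / K > 0" using assms by simp
 ultimately have "jb a powr w <= (jb b / K) powr w" using False by (intro powr_mono2') auto
 also have "\<dots> = K powr \<bar>w\<bar> * jb b powr w"
  using assms False by (simp add: powr_divide powr_minus_divide)
 finally show ?thesis .
qed

lemma continuous_on_jb [continuous_intros]:
 "continuous_on S f ==> continuous_on S (%x. jb (f x))"
 unfolding japanese_bracket_def by (intro continuous_intros)

lemma continuous_on_jb_powr [continuous_intros]:
 "continuous_on S f ==> continuous_on S (%x. jb (f x) powr a)"
 by (intro continuous_on_powr continuous_on_jb continuous_on_const) (auto simp: less_imp_neq[OF jb_pos, symmetric])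

text \<open>min 1 t <= t powr th with t = d l. This is how a uniform bound and a Lipschitz bound are
  combined into a Hoelder bound.\<close>

lemma hoelder_min:
 fixes a :: real
 assumes "0 <= th" "th <= 1" "0 <= d" "0 < l" "0 <= A" "a <= A" "a <= A * (d * l)"
 shows "a <= A * (d powr th * l powr th)"
proof (cases "d = 0")
 case False
 with assms have t: "d * l > 0" by simp
 have "a <= A * (d * l) powr th"
 proof (cases "d * l >= 1")
  case True
  then have "1 <= (d * l) powr th" using assms by (simp add: ge_one_powr_ge_zero)
  then have "A * 1 <= A * (d * l) powr th" using assms by (intro mult_left_mono)
  with assms show ?thesis by simp
 next
  case False
  then have "(d * l) powr 1 <= (d * l) powr th" using t assms by (intro powr_mono') auto
  then have "A * (d * l) <= A * (d * l) powr th" using t assms by (intro mult_left_mono) auto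
  with assms show ?thesis by simp
 qed
 then show ?thesis using assms by (simp add: powr_mult)
qed (use assms in auto)

text \<open>The change of order caused by one derivative in the direction \<open>b\<close>. On basis
  vectors of the product, \<open>fst b = 0\<close> singles out the y directions.\<close>

definition wt :: "real => real => 'v::euclidean_space \<times> 'y::euclidean_space => real" where
 "wt \<rho> \<delta> b = (if fst b = 0 then \<delta> else - \<rho>)"

definition dZ :: "'z::euclidean_space => ('x => 'z => complex) => 'x => 'z => complex" where
 "dZ b f x z = pderiv_dir b (f x) z"

definition dX :: "'x::euclidean_space => ('x => 'z => complex) => 'x => 'z => complex" where
 "dX b f x z = pderiv_dir b (%x. f x z) x"

definition sbd :: "real => ('x => 'v::euclidean_space \<times> 'y::euclidean_space => complex) => bool" where
 "sbd w f \<longleftrightarrow> (\<exists>C\<ge>0. \<forall>x z. norm (f x z) <= C * jb (fst z) powr w)"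

text \<open>For th = 0 this follows from \<open>sbd\<close> (lemma \<open>shol_zero\<close>): 0 powr
  0 = 0 occurs only where the left-hand side vanishes. Integer \<tau> therefore needs no separate
  class.\<close>

definition shol :: "real => real => ('x::metric_space => 'v::euclidean_space \<times> 'y::euclidean_space => complex) => bool" where
 "shol th w f \<longleftrightarrow> (\<exists>C\<ge>0. \<forall>x x' z. norm (f x z - f x' z) <= C * (dist x x' powr th * jb (fst z) powr w))"

text \<open>The Hoelder condition is imposed at every order in x, not only at the top one, so that
  products and compositions can be treated one order at a time.\<close>

definition sbase :: "real => real => nat => real =>
  ('x::euclidean_space => 'v::euclidean_space \<times> 'y::euclidean_space => complex) => bool" where
 "sbase th \<delta> k w f \<longleftrightarrow> (\<forall>x. f x differentiable_on UNIV) & (\<forall>z. continuous_on UNIV (%x. f x z)) \<and>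
  (k > 0 --> (\<forall>z. (%x. f x z) differentiable_on UNIV)) & sbd w f & shol th (w + \<delta> * th) f"

text \<open>With \<open>\<tau> = k + th\<close>, \<open>symb th \<rho> \<delta> k w\<close> is \<open>C\<^sup>\<tau>S\<^sup>w\<^bsub>\<rho>,\<delta>\<^esub>\<close> with the pair \<open>(xi, y)\<close> as second argument.
 A derivative in \<open>x\<close> costs \<open>\<delta>\<close>, just as one in \<open>y\<close>; for the intermediate orders this is what
 interpolation gives.\<close>

coinductive symb :: "real => real => real => nat => real =>
  ('x::euclidean_space => 'v::euclidean_space \<times> 'y::euclidean_space => complex) => bool"
 for th \<rho> \<delta> where
 symbI: "sbase th \<delta> k w f ==> (!!b. b \<in> Basis ==> symb th \<rho> \<delta> k (w + wt \<rho> \<delta> b) (dZ b f)) ==>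
  (!!b. k > 0 ==> b \<in> Basis ==> symb th \<rho> \<delta> (k - 1) (w + \<delta>) (dX b f)) ==> symb th \<rho> \<delta> k w f"

lemma symbD:
 assumes "symb th \<rho> \<delta> k w f"
 shows symb_base: "sbase th \<delta> k w f"
  and symb_dZ: "!!b. b \<in> Basis ==> symb th \<rho> \<delta> k (w + wt \<rho> \<delta> b) (dZ b f)"
  and symb_dX: "!!b. k > 0 ==> b \<in> Basis ==> symb th \<rho> \<delta> (k - 1) (w + \<delta>) (dX b f)"
  and symb_diff: "f x differentiable_on UNIV"
  and symb_cont_x: "continuous_on UNIV (%x. f x z)"
  and symb_diff_x: "k > 0 ==> (%x. f x z) differentiable_on UNIV"
  and symb_sbd: "sbd w f" and symb_shol: "shol th (w + \<delta> * th) f"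
proof -
 show "sbase th \<delta> k w f" using assms by cases
 then show "f x differentiable_on UNIV" "continuous_on UNIV (%x. f x z)" "sbd w f" "shol th (w + \<delta> * th) f"
  "k > 0 ==> (%x. f x z) differentiable_on UNIV"
  unfolding sbase_def by blast+
 show "b \<in> Basis ==> symb th \<rho> \<delta> k (w + wt \<rho> \<delta> b) (dZ b f)" for b using assms by cases
 show "k > 0 ==> b \<in> Basis ==> symb th \<rho> \<delta> (k - 1) (w + \<delta>) (dX b f)" for b using assms by cases
qed

lemma sbd_E:
 assumes "sbd w f" obtains C where "C >= 0" "!!x z. norm (f x z) <= C * jb (fst z) powr w"
 using assms unfolding sbd_def by metis

lemma symb_bound:
 assumes "symb th \<rho> \<delta> k w f" obtains C where "C >= 0" "!!x z. norm (f x z) <= C * jb (fst z) powr w"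
 using symb_sbd[OF assms] by (rule sbd_E) blast

lemma sbd_mono: assumes "sbd w f" "w <= w'" shows "sbd w' f"
proof -
 obtain C where C: "C >= 0" "!!x z. norm (f x z) <= C * jb (fst z) powr w" using assms(1) by (rule sbd_E) blast
 have "norm (f x z) <= C * jb (fst z) powr w'" for x z
  by (rule order_trans[OF C(2)]) (intro mult_left_mono jb_powr_mono assms C)
 with C(1) show ?thesis unfolding sbd_def by blast
qed

lemma shol_mono: assumes "shol th w f" "w <= w'" shows "shol th w' f"
proof -
 obtain C where C: "C >= 0" "!!x x' z. norm (f x z - f x' z) <= C * (dist x x' powr th * jb (fst z) powr w)"
  using assms(1) unfolding shol_def by blast
 have "norm (f x z - f x' z) <= C * (dist x x' powr th * jb (fst z) powr w')" for x x' z
  by (rule order_trans[OF C(2)]) (intro mult_left_mono jb_powr_mono assms C, simp)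
 with C(1) show ?thesis unfolding shol_def by blast
qed

lemma sbase_mono:
 "sbase th \<delta> k w f ==> k' <= k ==> w <= w' ==> sbase th \<delta> k' w' f"
 unfolding sbase_def by (auto intro: sbd_mono shol_mono[of th "w + \<delta> * th"])

lemma symb_mono:
 assumes "symb th \<rho> \<delta> k w f" "k' <= k" "w <= w'" shows "symb th \<rho> \<delta> k' w' f"
 using assms
proof (coinduction arbitrary: k w k' w' f)
 case (symb k w k' w' f)
 show ?case
 proof (intro exI conjI allI impI)
  show "sbase th \<delta> k' w' f" using symb sbase_mono symb_base by blast
  fix b :: "'b \<times> 'c" assume "b \<in> Basis"
  then show "(\<exists>ka wa k'a w'a fa. k' = k'a & w' + wt \<rho> \<delta> b = w'a & dZ b f = fa & symb th \<rho> \<delta> ka wa fa & k'a <= ka & wa <= w'a) \<or> symb th \<rho> \<delta> k' (w' + wt \<rho> \<delta> b) (dZ b f)"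
   using symb symb_dZ[OF symb(1) \<open>b \<in> Basis\<close>]
   by (intro disjI1 exI[of _ k] exI[of _ "w + wt \<rho> \<delta> b"] exI[of _ k'] exI[of _ "w' + wt \<rho> \<delta> b"] exI[of _ "dZ b f"]) auto
 next
  fix b :: 'a assume k': "0 < k'" and "b \<in> Basis"
  with symb have "symb th \<rho> \<delta> (k - 1) (w + \<delta>) (dX b f)" by (intro symb_dX[OF symb(1)]) auto
  with symb k' show "(\<exists>k w k'a w'a fa. k' - 1 = k'a & w' + \<delta> = w'a & dX b f = fa & symb th \<rho> \<delta> k w fa & k'a <= k & w <= w'a) \<or> symb th \<rho> \<delta> (k' - 1) (w' + \<delta>) (dX b f)"
   by (intro disjI1 exI[of _ "k - 1"] exI[of _ "w + \<delta>"] exI[of _ "k' - 1"] exI[of _ "w' + \<delta>"] exI[of _ "dX b f"]) auto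
 qed auto
qed

text \<open>The graded counterpart of \<open>alg\<close>: orders add under multiplication. Weakening
  of order and regularity is built into the rules, so that summands of different orders can be
  brought to a common one.\<close>

inductive salg :: "(nat => real => ('x => 'z => complex) => bool) => nat => real => ('x => 'z => complex) => bool"
 for X where
 salg_gen: "X k w f ==> k' <= k ==> w <= w' ==> salg X k' w' f"
| salg_zero: "salg X k w (%x z. 0)"
| salg_add: "salg X k w f ==> salg X k w g ==> salg X k w (%x z. f x z + g x z)"
| salg_mult: "salg X k w1 f ==> salg X k w2 g ==> w1 + w2 <= w ==> salg X k w (%x z. f x z * g x z)"

lemma salg_mono: "salg X k w f ==> k' <= k ==> w <= w' ==> salg X k' w' f"
proof (induction arbitrary: w' k' rule: salg.induct)
 case (salg_gen k w f k1 w1)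
 show ?case by (rule salg.salg_gen[where X = X, OF salg_gen(1)]) (use salg_gen in auto)
next
 case (salg_mult k w1 f w2 g w)
 show ?case
 proof (rule salg.salg_mult)
  show "salg X k' w1 f" "salg X k' w2 g" using salg_mult by auto
  show "w1 + w2 <= w'" using salg_mult by auto
 qed
qed (auto intro: salg.intros)

lemma salg_sum: "(!!i. i \<in> I ==> salg X k w (f i)) ==> salg X k w (%x z. \<Sum>i\<in>I. f i x z)"
 by (induction I rule: infinite_finite_induct) (auto intro: salg.intros)

lemma sbase_zero: "sbase th \<delta> k w (%x z. 0)"
 by (auto simp: sbase_def sbd_def shol_def intro!: exI[of _ 0])

lemma sbase_add:
 assumes "sbase th \<delta> k w f" "sbase th \<delta> k w g" shows "sbase th \<delta> k w (%x z. f x z + g x z)"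
proof -
 obtain C D where C: "C >= 0" "!!x z. norm (f x z) <= C * jb (fst z) powr w"
  and D: "D >= 0" "!!x z. norm (g x z) <= D * jb (fst z) powr w"
  using assms unfolding sbase_def sbd_def by blast
 obtain C' D' where C': "C' >= 0" "!!x x' z. norm (f x z - f x' z) <= C' * (dist x x' powr th * jb (fst z) powr (w + \<delta> * th))"
  and D': "D' >= 0" "!!x x' z. norm (g x z - g x' z) <= D' * (dist x x' powr th * jb (fst z) powr (w + \<delta> * th))"
  using assms unfolding sbase_def shol_def by blast
 have "norm (f x z + g x z) <= (C + D) * jb (fst z) powr w" for x z
  using norm_triangle_ineq[of "f x z" "g x z"] C(2)[of x z] D(2)[of x z] by (simp add: distrib_right)
 then have "sbd w (%x z. f x z + g x z)" unfolding sbd_def using C(1) D(1) by (intro exI[of _ "C + D"]) auto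
 moreover have "norm ((f x z + g x z) - (f x' z + g x' z)) <= (C' + D') * (dist x x' powr th * jb (fst z) powr (w + \<delta> * th))" for x x' z
  using norm_triangle_ineq[of "f x z - f x' z" "g x z - g x' z"] C'(2)[of x z x'] D'(2)[of x z x'] 
  by (simp add: distrib_right add_diff_add)
 then have "shol th (w + \<delta> * th) (%x z. f x z + g x z)" unfolding shol_def using C'(1) D'(1) by (intro exI[of _ "C' + D'"]) auto
 ultimately show ?thesis using assms unfolding sbase_def by (auto intro!: continuous_intros)
qed

lemma sbase_mult:
 assumes "sbase th \<delta> k w1 f" "sbase th \<delta> k w2 g" shows "sbase th \<delta> k (w1 + w2) (%x z. f x z * g x z)"
proof -
 obtain C D where C: "C >= 0" "!!x z. norm (f x z) <= C * jb (fst z) powr w1"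
  and D: "D >= 0" "!!x z. norm (g x z) <= D * jb (fst z) powr w2"
  using assms unfolding sbase_def sbd_def by blast
 obtain C' D' where C': "C' >= 0" "!!x x' z. norm (f x z - f x' z) <= C' * (dist x x' powr th * jb (fst z) powr (w1 + \<delta> * th))"
  and D': "D' >= 0" "!!x x' z. norm (g x z - g x' z) <= D' * (dist x x' powr th * jb (fst z) powr (w2 + \<delta> * th))"
  using assms unfolding sbase_def shol_def by blast
 have "norm (f x z * g x z) <= (C * D) * jb (fst z) powr (w1 + w2)" for x z
  using mult_mono[OF C(2)[of x z] D(2)[of x z]] C(1) by (simp add: norm_mult powr_add mult_ac)
 then have "sbd (w1 + w2) (%x z. f x z * g x z)" unfolding sbd_def using C(1) D(1) by (intro exI[of _ "C * D"]) auto
 moreover have "norm (f x z * g x z - f x' z * g x' z) <= (C' * D + C * D') * (dist x x' powr th * jb (fst z) powr (w1 + w2 + \<delta> * th))" for x x' z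
 proof -
  have "f x z * g x z - f x' z * g x' z = (f x z - f x' z) * g x z + f x' z * (g x z - g x' z)" by (simp add: algebra_simps)
  then have "norm (f x z * g x z - f x' z * g x' z) <= norm (f x z - f x' z) * norm (g x z) + norm (f x' z) * norm (g x z - g x' z)"
   by (metis norm_triangle_ineq norm_mult)
  also have "\<dots> <= (C' * (dist x x' powr th * jb (fst z) powr (w1 + \<delta> * th))) * (D * jb (fst z) powr w2) +
   (C * jb (fst z) powr w1) * (D' * (dist x x' powr th * jb (fst z) powr (w2 + \<delta> * th)))"
   using C C' D D' by (intro add_mono mult_mono) auto
  also have "\<dots> = (C' * D + C * D') * (dist x x' powr th * jb (fst z) powr (w1 + w2 + \<delta> * th))"
   by (simp add: powr_add algebra_simps)
  finally show ?thesis .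
 qed
 then have "shol th (w1 + w2 + \<delta> * th) (%x z. f x z * g x z)" unfolding shol_def 
  using C'(1) D'(1) C(1) D(1) by (intro exI[of _ "C' * D + C * D'"]) auto
 ultimately show ?thesis using assms unfolding sbase_def by (auto intro!: continuous_intros)
qed

lemma dZ_add: "(!!x. f x differentiable_on UNIV) ==> (!!x. g x differentiable_on UNIV) ==>
  dZ b (%x z. f x z + g x z) = (%x z. dZ b f x z + dZ b g x z)"
 by (simp add: dZ_def pderiv_dir_add fun_eq_iff)

lemma dZ_mult: "(!!x. f x differentiable_on UNIV) ==> (!!x. g x differentiable_on UNIV) ==>
  dZ b (%x z. f x z * g x z) = (%x z. f x z * dZ b g x z + dZ b f x z * g x z)"
 by (simp add: dZ_def pderiv_dir_mult fun_eq_iff)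

lemma dX_add: "(!!z. (%x. f x z) differentiable_on UNIV) ==> (!!z. (%x. g x z) differentiable_on UNIV) ==>
  dX b (%x z. f x z + g x z) = (%x z. dX b f x z + dX b g x z)"
 by (simp add: dX_def pderiv_dir_add fun_eq_iff)

lemma dX_mult: "(!!z. (%x. f x z) differentiable_on UNIV) ==> (!!z. (%x. g x z) differentiable_on UNIV) ==>
  dX b (%x z. f x z * g x z) = (%x z. f x z * dX b g x z + dX b f x z * g x z)"
 by (simp add: dX_def pderiv_dir_mult fun_eq_iff)

text \<open>Coinduction up to sums, products and monotonicity.\<close>

theorem symb_coinduct_alg:
 fixes X :: "nat => real => ('x::euclidean_space => 'v::euclidean_space \<times> 'y::euclidean_space => complex) => bool"
  and th \<rho> \<delta> :: real
 defines "Y \<equiv> (%k w f. X k w f \<or> symb th \<rho> \<delta> k w f)"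
 assumes f: "salg Y k w f"
  and base: "!!k w f. X k w f ==> sbase th \<delta> k w f"
  and stepZ: "!!k w f b. X k w f ==> b \<in> Basis ==> salg Y k (w + wt \<rho> \<delta> b) (dZ b f)"
  and stepX: "!!k w f b. X k w f ==> k > 0 ==> b \<in> Basis ==> salg Y (k - 1) (w + \<delta>) (dX b f)"
 shows "symb th \<rho> \<delta> k w f"
proof -
 have B: "sbase th \<delta> k w f" if "salg Y k w f" for k w f
  using that
 proof induction
  case (salg_gen k w f k' w')
  then show ?case unfolding Y_def using base symb_base sbase_mono by blast
 next
  case (salg_mult k w1 f w2 g w)
  then show ?case using sbase_mult sbase_mono by blast
 qed (auto intro: sbase_zero sbase_add)
 have DZ: "salg Y k (w + wt \<rho> \<delta> b) (dZ b f)" if "salg Y k w f" "b \<in> Basis" for k w f b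
  using that
 proof induction
  case (salg_gen k w f k' w')
  have "salg Y k (w + wt \<rho> \<delta> b) (dZ b f)"
   using salg_gen(1)[unfolded Y_def]
  proof
   assume "X k w f" then show ?thesis using stepZ salg_gen by blast
  next
   assume "symb th \<rho> \<delta> k w f"
   then have "Y k (w + wt \<rho> \<delta> b) (dZ b f)" unfolding Y_def using symb_dZ salg_gen by blast
   then show ?thesis by (rule salg.salg_gen) auto
  qed
  then show ?case using salg_gen by (auto intro: salg_mono)
 next
  case (salg_zero k w)
  then show ?case using salg.salg_zero by (simp add: dZ_def[abs_def])
 next
  case (salg_add k w f g)
  then show ?case using B[unfolded sbase_def] by (subst dZ_add) (auto intro: salg.salg_add)
 next
  case (salg_mult k w1 f w2 g w)
  have "salg Y k (w + wt \<rho> \<delta> b) (%x z. f x z * dZ b g x z)"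
   by (rule salg.salg_mult[OF salg_mult(1) salg_mult.IH(2)]) (use salg_mult in auto)
  moreover have "salg Y k (w + wt \<rho> \<delta> b) (%x z. dZ b f x z * g x z)"
   by (rule salg.salg_mult[OF salg_mult.IH(1) salg_mult(2)]) (use salg_mult in auto)
  ultimately show ?case using B[unfolded sbase_def] salg_mult by (subst dZ_mult) (auto intro: salg.salg_add)
 qed
 have DX: "salg Y (k - 1) (w + \<delta>) (dX b f)" if "salg Y k w f" "k > 0" "b \<in> Basis" for k w f b
  using that
 proof induction
  case (salg_gen k w f k' w')
  have "salg Y (k - 1) (w + \<delta>) (dX b f)"
   using salg_gen(1)[unfolded Y_def]
  proof
   assume "X k w f" then show ?thesis using stepX salg_gen by (metis gr0I le_zero_eq)
  next
   assume "symb th \<rho> \<delta> k w f"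
   then have "Y (k - 1) (w + \<delta>) (dX b f)" unfolding Y_def using symb_dX salg_gen by (metis gr0I le_zero_eq)
   then show ?thesis by (rule salg.salg_gen) auto
  qed
  then show ?case by (rule salg_mono) (use salg_gen in auto)
 next
  case (salg_zero k w)
  then show ?case using salg.salg_zero by (simp add: dX_def[abs_def])
 next
  case (salg_add k w f g)
  then show ?case using B[unfolded sbase_def] by (subst dX_add) (auto intro: salg.salg_add)
 next
  case (salg_mult k w1 f w2 g w)
  have "salg Y (k - 1) (w + \<delta>) (%x z. f x z * dX b g x z)"
   by (rule salg.salg_mult[OF salg_mono[OF salg_mult(1)] salg_mult.IH(2)]) (use salg_mult in auto)
  moreover have "salg Y (k - 1) (w + \<delta>) (%x z. dX b f x z * g x z)"
   by (rule salg.salg_mult[OF salg_mult.IH(1) salg_mono[OF salg_mult(2)]]) (use salg_mult in auto)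
  ultimately show ?case using B[unfolded sbase_def] salg_mult by (subst dX_mult) (auto intro: salg.salg_add)
 qed
 show ?thesis
 proof (rule symb.coinduct[of "salg Y", OF f], goal_cases)
  case (1 k w f)
  show ?case
  proof (intro exI[of _ k] exI[of _ w] exI[of _ f] conjI allI impI disjI1)
   show "sbase th \<delta> k w f" by (rule B[OF 1])
   show "salg Y k (w + wt \<rho> \<delta> b) (dZ b f)" if "b \<in> Basis" for b by (rule DZ[OF 1 that])
   show "salg Y (k - 1) (w + \<delta>) (dX b f)" if "0 < k" "b \<in> Basis" for b by (rule DX[OF 1 that])
  qed (rule refl)+
 qed
qed

lemma symb_salg:
 assumes "salg (symb th \<rho> \<delta>) k w f" shows "symb th \<rho> \<delta> k w f"
 by (rule symb_coinduct_alg[where X = "%_ _ _. False"]) (use assms in auto)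

lemma symb_add: "symb th \<rho> \<delta> k w f ==> symb th \<rho> \<delta> k w g ==> symb th \<rho> \<delta> k w (%x z. f x z + g x z)"
 by (rule symb_salg, rule salg_add; rule salg_gen[where k = k and w = w]) simp_all

lemma symb_sum: "(!!i. i \<in> I ==> symb th \<rho> \<delta> k w (f i)) ==> symb th \<rho> \<delta> k w (%x z. \<Sum>i\<in>I. f i x z)"
 by (rule symb_salg, rule salg_sum, rule salg_gen[where k = k and w = w]) simp_all

lemma symb_mult: "symb th \<rho> \<delta> k w1 f ==> symb th \<rho> \<delta> k w2 g ==> w1 + w2 <= w ==>
  symb th \<rho> \<delta> k w (%x z. f x z * g x z)"
 by (rule symb_salg, rule salg_mult[of _ k w1 f w2 g];
   (rule salg_gen[where k = k and w = w1] salg_gen[where k = k and w = w2])?; simp)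

lemma symb_zero: "symb th \<rho> \<delta> k w (%x z. 0)"
 by (rule symb_salg[OF salg_zero])


lemma jb_nonzero [simp]: "jb xi ~= 0"
 by (rule less_imp_neq[OF jb_pos, symmetric])

section \<open>Joint regularity of symbols in both arguments\<close>

lemma sum_Basis_prod:
 fixes F :: "'a::euclidean_space \<times> 'b::euclidean_space => 'c::comm_monoid_add"
 shows "(\<Sum>i\<in>Basis. F i) = (\<Sum>u\<in>Basis. F (u, 0)) + (\<Sum>v\<in>Basis. F (0, v))"
 unfolding Basis_prod_def
 by (subst sum.union_disjoint) (auto simp: sum.reindex inj_on_def)

lemma pderiv_dir_fst:
 assumes "G differentiable (at (x, z))"
 shows "pderiv_dir (u, 0) G (x, z) = pderiv_dir u (%x. G (x, z)) x"
proof -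
 have "((%x. (x, z)) has_derivative (%u. (u, 0))) (at x)" by (auto intro!: derivative_eq_intros)
 from has_derivative_compose[OF this has_derivative_pderiv'[OF assms]]
 show ?thesis by (rule pderiv_dir_eq[symmetric])
qed

lemma pderiv_dir_snd:
 assumes "G differentiable (at (x, z))"
 shows "pderiv_dir (0, u) G (x, z) = pderiv_dir u (%z. G (x, z)) z"
proof -
 have "((%z. (x, z)) has_derivative (%u. (0, u))) (at z)" by (auto intro!: derivative_eq_intros)
 from has_derivative_compose[OF this has_derivative_pderiv'[OF assms]]
 show ?thesis by (rule pderiv_dir_eq[symmetric])
qed

lemma differentiable_on_componentwise_UNIV:
 fixes f :: "'a::real_normed_vector => 'b::euclidean_space"
 assumes "!!i. i \<in> Basis ==> (%x. f x \<bullet> i) differentiable_on UNIV"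
 shows "f differentiable_on UNIV"
 using assms by (auto simp: differentiable_on_def differentiable_componentwise_within[of f])

lemma jb_powr_locally_bounded:
 fixes z0 :: "'v::euclidean_space \<times> 'y::euclidean_space"
 obtains M where "M > 0" "!!z. z \<in> ball z0 1 ==> jb (fst z) powr w <= M"
proof -
 have "compact ((%z. jb (fst z) powr w) ` cball z0 1)"
  by (intro compact_continuous_image continuous_intros compact_cball)
 then have "bounded ((%z. jb (fst z) powr w) ` cball z0 1)" by (rule compact_imp_bounded)
 then have "\<exists>M>0. \<forall>z\<in>cball z0 1. jb (fst z) powr w <= M" by (simp add: bounded_pos)
 then obtain M where "M > 0" "\<forall>z\<in>cball z0 1. jb (fst z) powr w <= M" by blast
 then show ?thesis using ball_subset_cball[of z0 1] by (intro that[of M]) blast+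
qed

text \<open>Near z0 the z-derivatives are bounded uniformly in x. The resulting Lipschitz bound in
  z, uniform in x, is combined with continuity in x at the fixed point z0.\<close>

lemma symb_joint_cont_at:
 fixes f :: "'x::euclidean_space => 'v::euclidean_space \<times> 'y::euclidean_space => complex"
 assumes f: "symb th \<rho> \<delta> k w f"
 shows "continuous (at (x0, z0)) (%p. f (fst p) (snd p))"
proof -
 have "\<exists>M>0. \<forall>x. \<forall>z\<in>ball z0 1. norm (dZ b f x z) <= M" if b: "b \<in> Basis" for b
 proof -
  obtain C where C: "C >= 0" "!!x z. norm (dZ b f x z) <= C * jb (fst z) powr (w + wt \<rho> \<delta> b)"
   using symb_bound[OF symb_dZ[OF f b]] by blast
  obtain M where M: "M > 0" "!!z. z \<in> ball z0 1 ==> jb (fst z) powr (w + wt \<rho> \<delta> b) <= M"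
   using jb_powr_locally_bounded by blast
  have "norm (dZ b f x z) <= (C + 1) * M" if z: "z \<in> ball z0 1" for x z
  proof -
   have "C * jb (fst z) powr (w + wt \<rho> \<delta> b) <= (C + 1) * M"
    using C(1) M(2)[OF z] by (intro mult_mono) auto
   with C(2) order_trans show ?thesis by blast
  qed
  with C(1) M(1) show ?thesis by (intro exI[of _ "(C + 1) * M"]) auto
 qed
 then obtain M where M: "!!b x z. b \<in> Basis ==> z \<in> ball z0 1 ==> M b > 0 & norm (dZ b f x z) <= M b"
  by metis
 define L where "L = (\<Sum>b\<in>(Basis :: ('v \<times> 'y) set). M b)"
 have z0: "z0 \<in> ball z0 1" by simp
 have MbL: "M b <= L" if "b \<in> Basis" for b
  unfolding L_def using M[OF _ z0] that by (intro member_le_sum) (auto simp: less_imp_le)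
 have lip: "norm (f x z - f x z0) <= L * DIM('v \<times> 'y) * norm (z - z0)" if z: "z \<in> ball z0 1" for x z
 proof (rule pderiv_bound_lipschitz_ball[OF _ _ z z0])
  show "f x differentiable (at y)" for y by (rule differentiable_on_UNIV_D[OF symb_diff[OF f]])
  show "norm (pderiv_dir b (f x) y) <= L" if "b \<in> Basis" "y \<in> ball z0 1" for b y
   using M[OF that, of x] MbL[OF that(1)] by (simp add: dZ_def)
 qed
 have "((%p. f (fst p) (snd p) - f x0 z0) \<longlongrightarrow> 0) (at (x0, z0))"
 proof (rule Lim_null_comparison)
  show "\<forall>\<^sub>F p in at (x0, z0). norm (f (fst p) (snd p) - f x0 z0) \<le>
   L * DIM('v \<times> 'y) * norm (snd p - z0) + norm (f (fst p) z0 - f x0 z0)"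
   unfolding eventually_at
  proof (intro exI[of _ 1] conjI ballI impI)
   fix p assume "p ~= (x0, z0) & dist p (x0, z0) < 1"
   then have "snd p \<in> ball z0 1"
    using dist_snd_le[of p "(x0, z0)"] by (auto simp: dist_commute)
   from lip[OF this, of "fst p"] show "norm (f (fst p) (snd p) - f x0 z0) \<le>
   L * DIM('v \<times> 'y) * norm (snd p - z0) + norm (f (fst p) z0 - f x0 z0)"
    using norm_triangle_ineq[of "f (fst p) (snd p) - f (fst p) z0" "f (fst p) z0 - f x0 z0"] by simp
  qed simp
  have 1: "((%p. snd p - z0) \<longlongrightarrow> 0) (at (x0, z0))"
   using tendsto_snd[OF tendsto_ident_at[of "(x0, z0)" UNIV]] by (simp add: LIM_zero)
  have "continuous (at x0) (%x. f x z0)"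
   using symb_cont_x[OF f, of z0] by (simp add: continuous_on_eq_continuous_at)
  then have "isCont ((%x. f x z0) \<circ> fst) (x0, z0)"
   by (intro continuous_at_compose continuous_fst) (auto intro: continuous_ident)
  then have 2: "((%p. f (fst p) z0 - f x0 z0) \<longlongrightarrow> 0) (at (x0, z0))"
   by (simp add: isCont_def o_def LIM_zero)
  show "((%p. L * DIM('v \<times> 'y) * norm (snd p - z0) + norm (f (fst p) z0 - f x0 z0)) \<longlongrightarrow> 0) (at (x0, z0))"
   using tendsto_add[OF tendsto_mult_left[OF tendsto_norm_zero[OF 1]] tendsto_norm_zero[OF 2]] by simp
 qed
 then show ?thesis by (simp add: isCont_def LIM_zero_iff)
qed

lemma symb_joint_cont:
 assumes "symb th \<rho> \<delta> k w f" "continuous_on S a" "continuous_on S b"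
 shows "continuous_on S (%t. f (a t) (b t))"
proof -
 have "continuous_on UNIV (%p. f (fst p) (snd p))"
  using symb_joint_cont_at[OF assms(1)] by (auto simp: continuous_on_eq_continuous_at)
 from continuous_on_compose2[OF this continuous_on_Pair[OF assms(2,3)]] show ?thesis by simp
qed

text \<open>Differentiability in x together with a jointly continuous derivative in z suffices. The
  z-derivative is jointly continuous because each \<open>dZ b f\<close> is itself a symbol.\<close>

lemma symb_joint_diff:
 fixes f :: "'x::euclidean_space => 'v::euclidean_space \<times> 'y::euclidean_space => complex"
 assumes f: "symb th \<rho> \<delta> k w f" and k: "k > 0"
 shows "(%(x, z). f x z) differentiable_on UNIV"
proof -
 define F where "F x z = Blinfun (%v. \<Sum>b\<in>Basis. (v \<bullet> b) *\<^sub>R dZ b f x z)" for x z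
 have F: "blinfun_apply (F x z) = (%v. \<Sum>b\<in>Basis. (v \<bullet> b) *\<^sub>R dZ b f x z)" for x z
  unfolding F_def
  by (intro bounded_linear_Blinfun_apply bounded_linear_sum bounded_linear_scaleR_const bounded_linear_inner_left)
 have Fc: "continuous_on UNIV (%(x, z). F x z)"
 proof (rule continuous_on_blinfun_componentwise)
  fix i :: "'v \<times> 'y" assume i: "i \<in> Basis"
  have "F x z i = dZ i f x z" for x z
  proof -
   have "(\<Sum>b\<in>Basis. (i \<bullet> b) *\<^sub>R dZ b f x z) = (\<Sum>b\<in>Basis. if b = i then dZ b f x z else 0)"
    using i by (intro sum.cong refl) (auto simp: inner_Basis)
   then show ?thesis using i by (simp add: F)
  qed
  moreover have "continuous_on UNIV (%p. dZ i f (fst p) (snd p))"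
   by (intro symb_joint_cont[OF symb_dZ[OF f i]] continuous_intros)
  ultimately show "continuous_on UNIV (%p. blinfun_apply (case p of (x, z) => F x z) i)"
   by (simp add: split_beta)
 qed
 have "((%(x, z). f x z) has_derivative (%(tx, tz). pderiv_dir tx (%x. f x z) x + F x z tz)) (at (x, z) within UNIV \<times> UNIV)" for x z
 proof (rule has_derivative_partialsI)
  show "((%x. f x z) has_derivative (%tx. pderiv_dir tx (%x. f x z) x)) (at x within UNIV)"
   by (rule has_derivative_pderiv'[OF differentiable_on_UNIV_D[OF symb_diff_x[OF f k]]])
  show "(f x has_derivative blinfun_apply (F x z)) (at z within UNIV)" for x z
   using has_derivative_pderiv[OF differentiable_on_UNIV_D[OF symb_diff[OF f]]]
   by (simp add: F dZ_def)
  show "continuous (at (x, z) within UNIV \<times> UNIV) (%(x, z). F x z)"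
   using Fc continuous_on_eq_continuous_at[OF open_UNIV] by (metis UNIV_I UNIV_Times_UNIV)
 qed auto
 then show ?thesis by (auto simp: differentiable_on_def differentiable_def)
qed

section \<open>Elementary symbols\<close>

text \<open>Type (1, 0) is the most restrictive type, so coefficients and coordinates are treated
  there once. \<open>symb_compose\<close> also relies on this sharper form for the components of the
  substitution.\<close>

lemma symb_param_mono:
 assumes "symb th 1 0 k w f" "\<rho> <= 1" "0 <= \<delta>" "0 <= th"
 shows "symb th \<rho> \<delta> k w f"
proof (rule symb_coinduct_alg[where X = "symb th 1 0"])
 show "salg (%k w f. symb th 1 0 k w f \<or> symb th \<rho> \<delta> k w f) k w f"
  by (rule salg_gen[where k = k and w = w]) (use assms in auto)
 fix k w and f :: "'a => 'b \<times> 'c => complex" assume f: "symb th 1 0 k w f"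
 show "sbase th \<delta> k w f" using symb_base[OF f] shol_mono[of th w f "w + \<delta> * th"] assms by (auto simp: sbase_def)
 show "salg (%k w f. symb th 1 0 k w f \<or> symb th \<rho> \<delta> k w f) k (w + wt \<rho> \<delta> b) (dZ b f)" if "b \<in> Basis" for b
  by (rule salg_gen[where k = k and w = "w + wt 1 0 b"]) (use symb_dZ[OF f that] assms in \<open>auto simp: wt_def\<close>)
 show "salg (%k w f. symb th 1 0 k w f \<or> symb th \<rho> \<delta> k w f) (k - 1) (w + \<delta>) (dX b f)" if "k > 0" "b \<in> Basis" for b
  by (rule salg_gen[where k = "k - 1" and w = "w + 0"]) (use symb_dX[OF f that] assms in auto)
qed

text \<open>Fixing the first argument frees its slot for another variable, which below carries the
  cut-off parameter. The result is constant in that variable and hence of every regularity.\<close>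

lemma symb_freeze_x:
 assumes "symb th \<rho> \<delta> k w f" shows "symb th' \<rho> \<delta> k' w (%t z. f x0 z)"
proof (rule symb_coinduct_alg[where X = "%k' w g. \<exists>f. symb th \<rho> \<delta> k w f & g = (%t z. f x0 z)"])
 let ?Y = "%k' w g. (\<exists>f. symb th \<rho> \<delta> k w f & g = (%t z. f x0 z)) \<or> symb th' \<rho> \<delta> k' w g"
 show "salg ?Y k' w (%t z. f x0 z)" by (rule salg_gen[where k = k' and w = w]) (use assms in auto)
 fix k' w and g :: "'d => 'b \<times> 'c => complex" assume "\<exists>f. symb th \<rho> \<delta> k w f & g = (%t z. f x0 z)"
 then obtain f where f: "symb th \<rho> \<delta> k w f" and g: "g = (%t z. f x0 z)" by auto
 show "sbase th' \<delta> k' w g"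
  unfolding sbase_def g
 proof (intro conjI)
  obtain C where "C >= 0" "!!x z. norm (f x z) <= C * jb (fst z) powr w" using symb_bound[OF f] by blast
  then show "sbd w (%t z. f x0 z)" unfolding sbd_def by blast
  show "shol th' (w + \<delta> * th') (%t z. f x0 z)" unfolding shol_def by (rule exI[of _ 0]) simp
 qed (use symb_diff[OF f, of x0] in auto)
 show "salg ?Y k' (w + wt \<rho> \<delta> b) (dZ b g)" if "b \<in> Basis" for b
  by (rule salg_gen[where k = k' and w = "w + wt \<rho> \<delta> b"])
   (use symb_dZ[OF f that] in \<open>auto simp: g dZ_def[abs_def]\<close>)
 show "salg ?Y (k' - 1) (w + \<delta>) (dX b g)" for b
  unfolding g dX_def by (simp add: salg_zero)
qed

lemma Cb_hoelder:
 fixes c :: "'a::euclidean_space => complex"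
 assumes "Cb c" "0 <= th" "th <= 1"
 obtains C where "C >= 0" "!!x y. norm (c x - c y) <= C * dist x y powr th"
proof -
 obtain C where C: "C > 0" "!!x. norm (c x) <= C" by (rule Cb_boundE[OF assms(1)]) blast
 obtain L where L: "L > 0" "!!x y. norm (c x - c y) <= L * norm (x - y)"
  using bder_lipschitz[OF Cb_imp_bder[OF assms(1)]] by blast
 have "norm (c x - c y) <= (2 * C + L) * (dist x y powr th * 1 powr th)" for x y
 proof (rule hoelder_min)
  show "norm (c x - c y) <= 2 * C + L"
   using norm_triangle_ineq4[of "c x" "c y"] C(2)[of x] C(2)[of y] L(1) by linarith
  have "L * norm (x - y) <= (2 * C + L) * norm (x - y)" using C(1) by (intro mult_right_mono) auto
  with L(2)[of x y] show "norm (c x - c y) <= (2 * C + L) * (dist x y * 1)" by (simp add: dist_norm)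
 qed (use assms C L in auto)
 with C(1) L(1) show ?thesis by (intro that[of "2 * C + L"]) auto
qed

lemma symb_Cb_classical:
 fixes c :: "'x::euclidean_space \<times> 'y::euclidean_space => complex"
 assumes "Cb c" "0 <= th" "th <= 1"
 shows "symb th 1 0 k 0 (%x z::'v::euclidean_space \<times> 'y. c (x, snd z))"
proof (rule symb_coinduct_alg[where X = "%k w f. w = 0 & (\<exists>c. Cb c & f = (%x z::'v \<times> 'y. c (x, snd z)))"])
 let ?X = "%k::nat. %w::real. %f. w = 0 & (\<exists>c. Cb c & f = (%(x::'x) (z::'v \<times> 'y). c (x, snd z)))"
 let ?Y = "%k w f. ?X k w f \<or> symb th 1 0 k w f"
 show "salg ?Y k 0 (%x z. c (x, snd z))" by (rule salg_gen[where k = k and w = 0]) (use assms in auto)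
 fix k w and f :: "'x => 'v \<times> 'y => complex" assume "?X k w f"
 then obtain c where c: "Cb c" and f: "f = (%x z. c (x, snd z))" and w: "w = 0" by auto
 have dc: "c differentiable (at p)" for p using Cb_D(1)[OF c] by (rule differentiable_on_UNIV_D)
 have dz: "((%z::'v \<times> 'y. c (x, snd z)) has_derivative (%v. pderiv_dir (0, snd v) c (x, snd z))) (at z)" for x z
  by (rule has_derivative_compose[OF _ has_derivative_pderiv'[OF dc]]) (auto intro!: derivative_eq_intros)
 have dx: "((%x. c (x, y)) has_derivative (%v. pderiv_dir (v, 0) c (x, y))) (at x)" for x y
  by (rule has_derivative_compose[OF _ has_derivative_pderiv'[OF dc]]) (auto intro!: derivative_eq_intros)
 obtain C where C: "C > 0" "!!x. norm (c x) <= C" by (rule Cb_boundE[OF c]) blast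
 obtain D where D: "D >= 0" "!!x y. norm (c x - c y) <= D * dist x y powr th"
  by (rule Cb_hoelder[OF c assms(2,3)]) blast
 show "sbase th 0 k w f"
  unfolding sbase_def w f
 proof (intro conjI allI impI)
  show "(%z::'v \<times> 'y. c (x, snd z)) differentiable_on UNIV" for x by (rule has_derivative_differentiable_on[OF dz])
  show "(%x. c (x, snd z)) differentiable_on UNIV" for z :: "'v \<times> 'y" by (rule has_derivative_differentiable_on[OF dx])
  then show "continuous_on UNIV (%x. c (x, snd z))" for z :: "'v \<times> 'y" by (rule differentiable_imp_continuous_on)
  show "sbd 0 (%x z::'v \<times> 'y. c (x, snd z))" unfolding sbd_def using C by (auto intro!: exI[of _ C])
  have "norm (c (x, snd z) - c (x', snd z)) <= D * (dist x x' powr th * jb (fst z) powr (0 + 0 * th))" for x x' and z :: "'v \<times> 'y"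
   using D(2)[of "(x, snd z)" "(x', snd z)"] by (simp add: dist_Pair_Pair)
  then show "shol th (0 + 0 * th) (%x z::'v \<times> 'y. c (x, snd z))" unfolding shol_def using D(1) by blast
 qed
 show "salg ?Y k (w + wt 1 0 b) (dZ b f)" if b: "b \<in> Basis" for b
 proof -
  have eq: "dZ b f = (%x z. pderiv_dir (0, snd b) c (x, snd z))"
   unfolding dZ_def f using pderiv_dir_eq[OF dz] by (simp add: fun_eq_iff)
  show ?thesis
  proof (cases "fst b = 0")
   case True
   then have "(0, snd b) \<in> (Basis :: ('x \<times> 'y) set)" using b by (auto simp: Basis_prod_def)
   then show ?thesis unfolding eq w
    using Cb_pderiv[OF c] True by (intro salg_gen[where k = k and w = 0]) (auto simp: wt_def)
  next
   case False
   then have "snd b = 0" using b by (auto simp: Basis_prod_def)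
   then have "dZ b f = (%x z. 0)" unfolding eq using linear_0[OF pderiv_dir_linear[OF dc]] by (simp add: zero_prod_def)
   then show ?thesis by (simp add: salg_zero)
  qed
 qed
 show "salg ?Y (k - 1) (w + 0) (dX b f)" if b: "b \<in> Basis" for b
 proof -
  have eq: "dX b f = (%x z. pderiv_dir (b, 0) c (x, snd z))"
   unfolding dX_def f using pderiv_dir_eq[OF dx] by (simp add: fun_eq_iff)
  have "(b, 0) \<in> (Basis :: ('x \<times> 'y) set)" using b by (auto simp: Basis_prod_def)
  then show ?thesis unfolding eq w
   using Cb_pderiv[OF c] by (intro salg_gen[where k = "k - 1" and w = 0]) auto
 qed
qed

lemma symb_coord_classical:
 assumes "l \<in> Basis" "0 <= th" "th <= 1"
 shows "symb th 1 0 k 1 (%(x::'x::euclidean_space) (z::'v::euclidean_space \<times> 'y::euclidean_space). complex_of_real (fst z \<bullet> l))"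
proof (rule symb_coinduct_alg[where X = "%k w f. w = 1 & f = (%x z. complex_of_real (fst z \<bullet> l))"])
 let ?f = "%(x::'x) (z::'v \<times> 'y). complex_of_real (fst z \<bullet> l)"
 let ?X = "%k::nat. %w::real. %f. w = 1 & f = ?f"
 let ?Y = "%k w f. ?X k w f \<or> symb th 1 0 k w f"
 show "salg ?Y k 1 ?f" by (rule salg_gen[where k = k and w = 1]) auto
 fix k w f assume "?X k w f"
 then have w: "w = 1" and f: "f = ?f" by auto
 have L: "bounded_linear (%z::'v \<times> 'y. complex_of_real (fst z \<bullet> l))"
  by (intro bounded_linear_compose[OF bounded_linear_of_real] bounded_linear_compose[OF bounded_linear_inner_left] bounded_linear_fst)
 have "norm (fst z \<bullet> l) <= jb (fst z)" for z :: "'v \<times> 'y"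
  using Basis_le_norm[OF assms(1), of "fst z"] jb_ge_norm[of "fst z"] by simp
 then show "sbase th 0 k w f"
  unfolding sbase_def w f
  by (auto simp: sbd_def shol_def bounded_linear_differentiable_on[OF L] intro: exI[of _ 1] exI[of _ 0])
 show "salg ?Y k (w + wt 1 0 b) (dZ b f)" if b: "b \<in> Basis" for b
 proof -
  have eq: "dZ b f = (%x z. complex_of_real (fst b \<bullet> l))"
   unfolding dZ_def f using pderiv_dir_of_bounded_linear[OF L] by (simp add: fun_eq_iff)
  have "symb th 1 0 k 0 (%(x::'x) (z::'v \<times> 'y). complex_of_real (fst b \<bullet> l))"
   using symb_Cb_classical[OF Cb_const assms(2,3)] .
  then show ?thesis unfolding eq w
   by (intro salg_gen[where k = k and w = 0]) (auto simp: wt_def)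
 qed
 show "salg ?Y (k - 1) (w + 0) (dX b f)" for b
  unfolding f dX_def by (simp add: salg_zero)
qed

lemma jb_scale:
 assumes "1 <= K" "norm a <= K * norm b" shows "jb a <= K * jb b"
proof -
 have "(norm a)\<^sup>2 <= (K * norm b)\<^sup>2" using assms by (intro power_mono) auto
 moreover have "1 <= K\<^sup>2" using assms(1) by (simp add: one_le_power)
 ultimately have "1 + (norm a)\<^sup>2 <= K\<^sup>2 * (1 + (norm b)\<^sup>2)" by (simp add: power_mult_distrib algebra_simps)
 then have "sqrt (1 + (norm a)\<^sup>2) <= sqrt (K\<^sup>2 * (1 + (norm b)\<^sup>2))" by simp
 then show ?thesis unfolding japanese_bracket_def using assms(1) by (simp add: real_sqrt_mult)
qed

section \<open>Invariance of the classes under changes of variables\<close>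

locale symbols =
 fixes th \<rho> \<delta> :: real
 assumes theta: "0 <= th" "th <= 1"
  and orders: "\<rho> <= 1" "1 - \<rho> <= \<delta>" "\<delta> <= \<rho>" "\<delta> < 1"
begin

lemma delta_nonneg: "0 <= \<delta>" and rho_pos: "0 < \<rho>"
 using orders by auto

lemma symb_Cb:
 "Cb c ==> symb th \<rho> \<delta> k 0 (%x z. c (x, snd z))"
 by (rule symb_param_mono[OF symb_Cb_classical]) (use theta orders in auto)

lemma symb_coord:
 "l \<in> Basis ==> symb th \<rho> \<delta> k 1 (%x z. complex_of_real (fst z \<bullet> l))"
 by (rule symb_param_mono[OF symb_coord_classical]) (use theta orders in auto)

lemma symb_const: "symb th \<rho> \<delta> k 0 (%x z. c)"
 using symb_Cb[OF Cb_const] .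

lemma symb_cmult: "symb th \<rho> \<delta> k w f ==> symb th \<rho> \<delta> k w (%x z. c * f x z)"
 by (rule symb_mult[OF symb_const]) auto

text \<open>Along the change of variables \<open>(x, \<eta>, y) \<mapsto> (\<sigma> x, \<beta> x y \<eta>, h y)\<close>, a derivative that falls on
 \<open>\<beta>\<close> turns \<open>\<partial>\<^sub>xi g\<close> into a term of order \<open>w + 1 - \<rho> <= w + \<delta>\<close>.\<close>

theorem symb_compose:
 fixes g :: "'x2::euclidean_space => 'v2::euclidean_space \<times> 'y2::euclidean_space => complex"
  and \<sigma> :: "'x::euclidean_space => 'x2" and h :: "'y::euclidean_space => 'y2"
  and \<beta> :: "'x => 'y => 'v::euclidean_space => 'v2"
 assumes g: "symb th \<rho> \<delta> k w g" and \<sigma>: "bder \<sigma>" and h: "bder h"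
  and B: "!!i l. i \<in> Basis ==> l \<in> Basis ==> Cb (B i l :: 'x \<times> 'y => real)"
  and \<beta>: "!!x y \<eta> i. i \<in> Basis ==> \<beta> x y \<eta> \<bullet> i = (\<Sum>l\<in>Basis. B i l (x, y) * (\<eta> \<bullet> l))"
  and K: "K >= 1" "!!x y \<eta>. norm (\<beta> x y \<eta>) <= K * norm \<eta>" "!!x y \<eta>. norm \<eta> <= K * norm (\<beta> x y \<eta>)"
 shows "symb th \<rho> \<delta> k w (%x z. g (\<sigma> x) (\<beta> x (snd z) (fst z), h (snd z)))"
proof -
 define \<tau> where "\<tau> x z = (\<beta> x (snd z) (fst z), h (snd z))" for x and z :: "'v \<times> 'y"
 define U where "U i x z = complex_of_real (\<beta> x (snd z) (fst z) \<bullet> i)" for i x and z :: "'v \<times> 'y"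
 have U: "symb th 1 0 k 1 (U i)" if "i \<in> Basis" for i k
 proof -
  have "symb th 1 0 k 1 (%x z::'v \<times> 'y. \<Sum>l\<in>Basis. complex_of_real (B i l (x, snd z)) * complex_of_real (fst z \<bullet> l))"
  proof (rule symb_sum, rule symb_mult)
   fix l :: 'v assume "l \<in> Basis"
   with that show "symb th 1 0 k 0 (%x z::'v \<times> 'y. complex_of_real (B i l (x, snd z)))"
    using symb_Cb_classical[OF Cb_of_real[OF B] theta] by blast
   show "symb th 1 0 k 1 (%x z::'v \<times> 'y. complex_of_real (fst z \<bullet> l))"
    using symb_coord_classical[OF \<open>l \<in> Basis\<close> theta] .
  qed simp
  then show ?thesis unfolding U_def[abs_def] \<beta>[OF that] by simp
 qed
 have hd: "h differentiable_on UNIV" and \<sigma>d: "\<sigma> differentiable_on UNIV" using h \<sigma> by (auto simp: bder_def)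
 have hsnd: "((%z::'v \<times> 'y. h (snd z)) has_derivative (%v. pderiv_dir (snd v) h (snd z))) (at z)" for z
  by (rule has_derivative_compose[OF _ has_derivative_pderiv'[OF differentiable_on_UNIV_D[OF hd]]])
   (auto intro!: derivative_eq_intros)
 have Re_inner: "bounded_linear (%c::complex. Re c)" by (rule bounded_linear_Re)
 have \<beta>U: "\<beta> x (snd z) (fst z) \<bullet> i = Re (U i x z)" for i x z by (simp add: U_def)
 have \<beta>dz: "(%z. \<beta> x (snd z) (fst z)) differentiable_on UNIV" for x
  by (rule differentiable_on_componentwise_UNIV)
   (simp only: \<beta>U, rule differentiable_on_bounded_linear[OF Re_inner symb_diff[OF U]])
 have \<beta>dx: "(%x. \<beta> x (snd z) (fst z)) differentiable_on UNIV" for z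
  by (rule differentiable_on_componentwise_UNIV)
   (simp only: \<beta>U, rule differentiable_on_bounded_linear[OF Re_inner symb_diff_x[OF U[where k = 1]]], simp_all)
 have \<tau>dz: "\<tau> x differentiable_on UNIV" for x
 proof (rule has_derivative_differentiable_on)
  show "(\<tau> x has_derivative (%v. (pderiv_dir v (%z. \<beta> x (snd z) (fst z)) z, pderiv_dir (snd v) h (snd z)))) (at z)" for z
   unfolding \<tau>_def
   by (rule has_derivative_Pair[OF has_derivative_pderiv'[OF differentiable_on_UNIV_D[OF \<beta>dz]] hsnd])
 qed
 have \<tau>dz': "pderiv_dir b (\<tau> x) z = (pderiv_dir b (%z. \<beta> x (snd z) (fst z)) z, pderiv_dir (snd b) h (snd z))" for b x z
  unfolding \<tau>_def
  by (rule pderiv_dir_eq[OF has_derivative_Pair[OF has_derivative_pderiv'[OF differentiable_on_UNIV_D[OF \<beta>dz]] hsnd]])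
 have \<tau>dx0: "((%x. \<tau> x z) has_derivative (%v. (pderiv_dir v (%x. \<beta> x (snd z) (fst z)) x, 0))) (at x)" for x z
  unfolding \<tau>_def
  by (rule has_derivative_Pair[OF has_derivative_pderiv'[OF differentiable_on_UNIV_D[OF \<beta>dx]]]) simp
 have \<tau>dx: "(%x. \<tau> x z) differentiable_on UNIV" for z
  by (rule has_derivative_differentiable_on[OF \<tau>dx0])
 have \<tau>dx': "pderiv_dir b (%x. \<tau> x z) x = (pderiv_dir b (%x. \<beta> x (snd z) (fst z)) x, 0)" for b x z
  by (rule pderiv_dir_eq[OF \<tau>dx0])
 have bl: "bounded_linear (%v::'v2. complex_of_real (v \<bullet> i))" for i
  by (rule bounded_linear_compose[OF bounded_linear_of_real bounded_linear_inner_left])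
 have dZU: "complex_of_real (pderiv_dir b (%z. \<beta> x (snd z) (fst z)) z \<bullet> i) = dZ b (U i) x z" for b x z i
  unfolding dZ_def U_def by (rule fun_cong[OF pderiv_dir_bounded_linear[OF bl \<beta>dz], symmetric])
 have dXU: "complex_of_real (pderiv_dir b (%x. \<beta> x (snd z) (fst z)) x \<bullet> i) = dX b (U i) x z" for b x z i
  unfolding dX_def U_def by (rule fun_cong[OF pderiv_dir_bounded_linear[OF bl \<beta>dx], symmetric])
 \<comment> \<open>The order of the coefficient makes up for the order \<open>wt i\<close> of the
   factor \<open>dZ i g\<close>, so that each product has order w + \<open>wt b\<close>. In the
   mixed case, a y derivative of a covariable component, the coefficient has order 1 <= \<delta> +
   \<rho>.\<close>
 have coefZ: "symb th \<rho> \<delta> k (wt \<rho> \<delta> b - wt \<rho> \<delta> i) (%x z. complex_of_real (pderiv_dir b (\<tau> x) z \<bullet> i))"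
  if b: "b \<in> Basis" and i: "i \<in> Basis" for b i k
 proof (cases "fst i = 0")
  case False
  then have i': "snd i = 0" "fst i \<in> Basis" using i by (auto simp: Basis_prod_def)
  have "symb th \<rho> \<delta> k (1 + wt 1 0 b) (dZ b (U (fst i)))"
   by (rule symb_param_mono[OF symb_dZ[OF U[OF i'(2)] b]]) (use orders delta_nonneg theta in auto)
  then have "symb th \<rho> \<delta> k (wt \<rho> \<delta> b - wt \<rho> \<delta> i) (dZ b (U (fst i)))"
   by (rule symb_mono) (use False orders in \<open>auto simp: wt_def\<close>)
  moreover have "complex_of_real (pderiv_dir b (\<tau> x) z \<bullet> i) = dZ b (U (fst i)) x z" for x z
   using i' by (simp add: \<tau>dz' inner_prod_def dZU[symmetric])
  ultimately show ?thesis by simp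
 next
  case True
  then have i': "snd i \<in> Basis" using i by (auto simp: Basis_prod_def)
  have eq: "pderiv_dir b (\<tau> x) z \<bullet> i = pderiv_dir (snd b) h (snd z) \<bullet> snd i" for x z
   using True by (simp add: \<tau>dz' inner_prod_def)
  show ?thesis
  proof (cases "fst b = 0")
   case b0: True
   then have "snd b \<in> Basis" using b by (auto simp: Basis_prod_def)
   then have c1: "Cb (%y. complex_of_real (pderiv_dir (snd b) h y \<bullet> snd i))"
    using h by (intro Cb_of_real Cb_inner) (auto simp: bder_def)
   have "Cb (%p::'x \<times> 'y. complex_of_real (pderiv_dir (snd b) h (snd p) \<bullet> snd i))"
    by (rule Cb_compose[OF c1 bder_bounded_linear[OF bounded_linear_snd]])
   from symb_Cb[OF this] show ?thesis unfolding eq using True b0 by (simp add: wt_def)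
  next
   case False
   then have "snd b = 0" using b by (auto simp: Basis_prod_def)
   then have "pderiv_dir (snd b) h y = 0" for y
    using linear_0[OF pderiv_dir_linear[OF differentiable_on_UNIV_D[OF hd]]] by simp
   then show ?thesis unfolding eq by (simp add: symb_zero)
  qed
 qed
 have jb1: "jb (fst (\<tau> x z)) <= K * jb (fst z)" and jb2: "jb (fst z) <= K * jb (fst (\<tau> x z))" for x z
  using K by (auto simp: \<tau>_def intro!: jb_scale)
 have jbp: "jb (fst (\<tau> x z)) powr a <= K powr \<bar>a\<bar> * jb (fst z) powr a" for x z a
  by (rule jb_powr_equiv[OF K(1) jb1 jb2])
 have bnd: "\<exists>C\<ge>0. \<forall>x x' z. norm (g x (\<tau> x' z)) <= C * jb (fst z) powr w" if g: "symb th \<rho> \<delta> k w g" for g :: "'x2 => 'v2 \<times> 'y2 => complex" and k w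
 proof -
  obtain C where C: "C >= 0" "!!x z. norm (g x z) <= C * jb (fst z) powr w" using symb_bound[OF g] by blast
  have "norm (g x (\<tau> x' z)) <= C * K powr \<bar>w\<bar> * jb (fst z) powr w" for x x' z
   using C(2)[of x "\<tau> x' z"] mult_left_mono[OF jbp C(1), of x' z w] by (simp add: mult.assoc)
  then show ?thesis using C(1) by (intro exI[of _ "C * K powr \<bar>w\<bar>"]) auto
 qed
 show ?thesis unfolding \<tau>_def[symmetric]
 proof (rule symb_coinduct_alg[where X = "%k w f. \<exists>g. symb th \<rho> \<delta> k w g & f = (%x z. g (\<sigma> x) (\<tau> x z))"])
  let ?X = "%k w f. \<exists>g. symb th \<rho> \<delta> k w g & f = (%x z. g (\<sigma> x) (\<tau> x z))"
  let ?Y = "%k w f. ?X k w f \<or> symb th \<rho> \<delta> k w f"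
  show "salg ?Y k w (%x z. g (\<sigma> x) (\<tau> x z))" by (rule salg_gen[where k = k and w = w]) (use g in auto)
  fix k w f assume "?X k w f"
  then obtain g where g: "symb th \<rho> \<delta> k w g" and f: "f = (%x z. g (\<sigma> x) (\<tau> x z))" by auto
  note gd = symb_diff[OF g]
  show "salg ?Y k (w + wt \<rho> \<delta> b) (dZ b f)" if b: "b \<in> Basis" for b
  proof -
   have "dZ b f = (%x z. \<Sum>i\<in>Basis. complex_of_real (pderiv_dir b (\<tau> x) z \<bullet> i) * dZ i g (\<sigma> x) (\<tau> x z))"
    unfolding f dZ_def by (simp add: pderiv_dir_compose[OF gd \<tau>dz] scaleR_conv_of_real)
   moreover have "salg ?Y k (w + wt \<rho> \<delta> b) (%x z. \<Sum>i\<in>Basis. complex_of_real (pderiv_dir b (\<tau> x) z \<bullet> i) * dZ i g (\<sigma> x) (\<tau> x z))"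
   proof (rule salg_sum, rule salg_mult)
    fix i :: "'v2 \<times> 'y2" assume i: "i \<in> Basis"
    show "salg ?Y k (wt \<rho> \<delta> b - wt \<rho> \<delta> i) (%x z. complex_of_real (pderiv_dir b (\<tau> x) z \<bullet> i))"
     by (rule salg_gen[where k = k and w = "wt \<rho> \<delta> b - wt \<rho> \<delta> i"]) (use coefZ[OF b i] in auto)
    show "salg ?Y k (w + wt \<rho> \<delta> i) (%x z. dZ i g (\<sigma> x) (\<tau> x z))"
     by (rule salg_gen[where k = k and w = "w + wt \<rho> \<delta> i"]) (use symb_dZ[OF g i] in auto)
   qed simp
   ultimately show ?thesis by simp
  qed
  have pair_d: "(%x. (\<sigma> x, \<tau> x z)) differentiable_on UNIV" for z
   by (rule has_derivative_differentiable_on[OF has_derivative_Pair[OF has_derivative_pderiv'[OF differentiable_on_UNIV_D[OF \<sigma>d]] has_derivative_pderiv'[OF differentiable_on_UNIV_D[OF \<tau>dx]]]])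
  have pair_d': "pderiv_dir b (%x. (\<sigma> x, \<tau> x z)) x = (pderiv_dir b \<sigma> x, pderiv_dir b (%x. \<tau> x z) x)" for b x z
   by (rule pderiv_dir_eq[OF has_derivative_Pair[OF has_derivative_pderiv'[OF differentiable_on_UNIV_D[OF \<sigma>d]] has_derivative_pderiv'[OF differentiable_on_UNIV_D[OF \<tau>dx]]]])
  show "salg ?Y (k - 1) (w + \<delta>) (dX b f)" if k: "k > 0" and b: "b \<in> Basis" for b
  proof -
   note G = symb_joint_diff[OF g k]
   have "pderiv_dir b (%x. (%(x, z). g x z) (\<sigma> x, \<tau> x z)) x = (\<Sum>j\<in>Basis. complex_of_real (pderiv_dir b \<sigma> x \<bullet> j) * dX j g (\<sigma> x) (\<tau> x z)) +
    (\<Sum>i\<in>Basis. complex_of_real (pderiv_dir b (%x. \<tau> x z) x \<bullet> i) * dZ i g (\<sigma> x) (\<tau> x z))" for x z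
    unfolding pderiv_dir_compose[OF G pair_d] sum_Basis_prod pair_d'
    by (simp add: pderiv_dir_fst[OF differentiable_on_UNIV_D[OF G]] pderiv_dir_snd[OF differentiable_on_UNIV_D[OF G]]
      dX_def dZ_def scaleR_conv_of_real)
   moreover have "(\<Sum>i\<in>Basis. complex_of_real (pderiv_dir b (%x. \<tau> x z) x \<bullet> i) * dZ i g (\<sigma> x) (\<tau> x z)) =
     (\<Sum>i\<in>Basis. dX b (U i) x z * dZ (i, 0) g (\<sigma> x) (\<tau> x z))" for x z
    unfolding sum_Basis_prod by (simp add: \<tau>dx' dXU)
   ultimately have eq: "dX b f = (%x z. (\<Sum>j\<in>Basis. complex_of_real (pderiv_dir b \<sigma> x \<bullet> j) * dX j g (\<sigma> x) (\<tau> x z)) +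
    (\<Sum>i\<in>Basis. dX b (U i) x z * dZ (i, 0) g (\<sigma> x) (\<tau> x z)))"
    unfolding f dX_def by (simp add: fun_eq_iff)
   show ?thesis unfolding eq
   proof (rule salg_add)
    show "salg ?Y (k - 1) (w + \<delta>) (%x z. \<Sum>j\<in>Basis. complex_of_real (pderiv_dir b \<sigma> x \<bullet> j) * dX j g (\<sigma> x) (\<tau> x z))"
    proof (rule salg_sum, rule salg_mult)
     fix j :: 'x2 assume j: "j \<in> Basis"
     have "Cb (%x. complex_of_real (pderiv_dir b \<sigma> x \<bullet> j))"
      using \<sigma> b by (intro Cb_of_real Cb_inner) (auto simp: bder_def)
     from Cb_compose[OF this bder_bounded_linear[OF bounded_linear_fst]]
     have "symb th \<rho> \<delta> (k - 1) 0 (%x (z::'v \<times> 'y). complex_of_real (pderiv_dir b \<sigma> x \<bullet> j))"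
      using symb_Cb by force
     then show "salg ?Y (k - 1) 0 (%x z. complex_of_real (pderiv_dir b \<sigma> x \<bullet> j))"
      by (intro salg_gen[where k = "k - 1" and w = 0]) auto
     show "salg ?Y (k - 1) (w + \<delta>) (%x z. dX j g (\<sigma> x) (\<tau> x z))"
      by (rule salg_gen[where k = "k - 1" and w = "w + \<delta>"]) (use symb_dX[OF g k j] in auto)
    qed simp
    show "salg ?Y (k - 1) (w + \<delta>) (%x z. \<Sum>i\<in>Basis. dX b (U i) x z * dZ (i, 0) g (\<sigma> x) (\<tau> x z))"
    proof (rule salg_sum, rule salg_mult)
     fix i :: 'v2 assume i: "i \<in> Basis"
     then have i0: "(i, 0) \<in> (Basis :: ('v2 \<times> 'y2) set)" by (auto simp: Basis_prod_def)
     have "symb th \<rho> \<delta> (k - 1) (1 + 0) (dX b (U i))"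
      by (rule symb_param_mono[OF symb_dX[OF U[OF i] k b]]) (use orders delta_nonneg theta in auto)
     then show "salg ?Y (k - 1) 1 (dX b (U i))"
      by (intro salg_gen[where k = "k - 1" and w = 1]) auto
     have "wt \<rho> \<delta> (i, 0 :: 'y2) = - \<rho>" using i nonzero_Basis by (auto simp: wt_def)
     then have "symb th \<rho> \<delta> k (w - \<rho>) (dZ (i, 0) g)" using symb_dZ[OF g i0] by simp
     then show "salg ?Y (k - 1) (w - \<rho>) (%x z. dZ (i, 0) g (\<sigma> x) (\<tau> x z))"
      by (intro salg_gen[where k = k and w = "w - \<rho>"] disjI1) auto
    qed (use orders in auto)
   qed
  qed
  show "sbase th \<delta> k w f"
   unfolding sbase_def
  proof (intro conjI allI impI)
   show "f x differentiable_on UNIV" for x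
    unfolding f by (rule differentiable_on_compose_UNIV[OF gd \<tau>dz])
   show "continuous_on UNIV (%x. f x z)" for z
    unfolding f by (rule symb_joint_cont[OF g differentiable_imp_continuous_on[OF \<sigma>d] differentiable_imp_continuous_on[OF \<tau>dx]])
   show "(%x. f x z) differentiable_on UNIV" if "k > 0" for z
    using differentiable_on_compose_UNIV[OF symb_joint_diff[OF g that] pair_d[of z]] by (simp add: f)
   obtain C where C: "C >= 0" "!!x x' z. norm (g x (\<tau> x' z)) <= C * jb (fst z) powr w" using bnd[OF g] by blast
   then show "sbd w f" unfolding sbd_def f by blast
   obtain C1 where C1: "C1 >= 0" "!!x x' z. norm (g x z - g x' z) <= C1 * (dist x x' powr th * jb (fst z) powr (w + \<delta> * th))"
    using symb_shol[OF g] unfolding shol_def by blast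
   obtain L where L: "L > 0" "!!x y. norm (\<sigma> x - \<sigma> y) <= L * norm (x - y)" by (rule bder_lipschitz[OF \<sigma>]) blast
   have first: "norm (g (\<sigma> x) (\<tau> x z) - g (\<sigma> x') (\<tau> x z)) <= (C1 * (L powr th * K powr \<bar>w + \<delta> * th\<bar>)) * (dist x x' powr th * jb (fst z) powr (w + \<delta> * th))" for x x' z
   proof -
    have "dist (\<sigma> x) (\<sigma> x') powr th <= (L * dist x x') powr th"
     using L(2)[of x x'] theta by (intro powr_mono2) (auto simp: dist_norm)
    also have "\<dots> = L powr th * dist x x' powr th" using L(1) by (simp add: powr_mult)
    finally have "dist (\<sigma> x) (\<sigma> x') powr th * jb (fst (\<tau> x z)) powr (w + \<delta> * th) \<le>
     (L powr th * dist x x' powr th) * (K powr \<bar>w + \<delta> * th\<bar> * jb (fst z) powr (w + \<delta> * th))"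
     using jbp by (intro mult_mono) auto
    then have "C1 * (dist (\<sigma> x) (\<sigma> x') powr th * jb (fst (\<tau> x z)) powr (w + \<delta> * th)) <= 
     C1 * ((L powr th * dist x x' powr th) * (K powr \<bar>w + \<delta> * th\<bar> * jb (fst z) powr (w + \<delta> * th)))"
     using C1(1) by (intro mult_left_mono)
    with C1(2)[of "\<sigma> x" "\<tau> x z" "\<sigma> x'"] show ?thesis by (simp add: mult_ac)
   qed
   have "\<exists>D\<ge>0. \<forall>x x' z. norm (dX b (U i) x z * dZ (i, 0) g x' (\<tau> x z)) <= D * jb (fst z) powr (w + 1 - \<rho>)"
    if b: "b \<in> Basis" and i: "i \<in> Basis" for b i
   proof -
    have i0: "(i, 0) \<in> (Basis :: ('v2 \<times> 'y2) set)" using i by (auto simp: Basis_prod_def)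
    obtain C where C: "C >= 0" "!!x z. norm (dX b (U i) x z) <= C * jb (fst z) powr (1 + 0)"
     using symb_bound[OF symb_dX[OF U[OF i, of 1] _ b]] by auto
    have "wt \<rho> \<delta> (i, 0 :: 'y2) = - \<rho>" using i nonzero_Basis by (auto simp: wt_def)
    then obtain D where D: "D >= 0" "!!x x' z. norm (dZ (i, 0) g x (\<tau> x' z)) <= D * jb (fst z) powr (w - \<rho>)"
     using bnd[OF symb_dZ[OF g i0]] by auto
    have "norm (dX b (U i) x z * dZ (i, 0) g x' (\<tau> x z)) <= (C * D) * jb (fst z) powr (w + 1 - \<rho>)" for x x' z
    proof -
     have "norm (dX b (U i) x z * dZ (i, 0) g x' (\<tau> x z)) <= (C * jb (fst z) powr (1 + 0)) * (D * jb (fst z) powr (w - \<rho>))"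
      unfolding norm_mult by (rule mult_mono[OF C(2) D(2)]) (use C(1) in auto)
     also have "\<dots> = (C * D) * jb (fst z) powr ((1 + 0) + (w - \<rho>))" by (simp only: powr_add mult_ac)
     finally show ?thesis by (simp add: algebra_simps)
    qed
    then show ?thesis using C(1) D(1) by (intro exI[of _ "C * D"]) auto
   qed
   then obtain D where D: "!!b i. b \<in> Basis ==> i \<in> Basis ==> D b i >= 0"
    "!!b i x x' z. b \<in> Basis ==> i \<in> Basis ==> norm (dX b (U i) x z * dZ (i, 0) g x' (\<tau> x z)) <= D b i * jb (fst z) powr (w + 1 - \<rho>)"
    by metis
   define E where "E = (\<Sum>b\<in>Basis. \<Sum>i\<in>Basis. D b i)"
   have E0: "E >= 0" unfolding E_def using D(1) by (intro sum_nonneg)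
   have lip: "norm (g x0 (\<tau> x z) - g x0 (\<tau> x' z)) <= (E * jb (fst z) powr (w + 1 - \<rho>)) * DIM('x) * norm (x - x')" for x0 x x' z
   proof (rule pderiv_bound_lipschitz)
    show "(%x. g x0 (\<tau> x z)) differentiable_on UNIV" by (rule differentiable_on_compose_UNIV[OF gd \<tau>dx])
    fix b x assume b: "b \<in> (Basis :: 'x set)"
    have "pderiv_dir b (%x. g x0 (\<tau> x z)) x = (\<Sum>i\<in>Basis. dX b (U i) x z * dZ (i, 0) g x0 (\<tau> x z))"
     unfolding pderiv_dir_compose[OF gd \<tau>dx] sum_Basis_prod by (simp add: \<tau>dx' dXU[symmetric] dZ_def scaleR_conv_of_real)
    also have "norm \<dots> <= (\<Sum>i\<in>Basis. D b i * jb (fst z) powr (w + 1 - \<rho>))"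
     using D(2)[OF b] by (intro order_trans[OF norm_sum] sum_mono)
    also have "\<dots> = (\<Sum>i\<in>Basis. D b i) * jb (fst z) powr (w + 1 - \<rho>)" by (rule sum_distrib_right[symmetric])
    also have "\<dots> <= E * jb (fst z) powr (w + 1 - \<rho>)"
     unfolding E_def using D(1) b by (intro mult_right_mono member_le_sum) (auto intro: sum_nonneg)
    finally show "norm (pderiv_dir b (%x. g x0 (\<tau> x z)) x) <= E * jb (fst z) powr (w + 1 - \<rho>)" .
   qed
   define A where "A = 2 * C + E * DIM('x)"
   have A0: "A >= 0" using C(1) E0 by (simp add: A_def)
   \<comment> \<open>Moving only the substituted second argument has a sup bound of order w and the
     Lipschitz bound \<open>lip\<close> of order w + 1 - \<rho>. Interpolation gives w + (1 -
     \<rho>) th <= w + \<delta> th.\<close>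
   have second: "norm (g x0 (\<tau> x z) - g x0 (\<tau> x' z)) <= A * (dist x x' powr th * jb (fst z) powr (w + \<delta> * th))" for x0 x x' z
   proof -
    let ?j = "jb (fst z)"
    have "norm (g x0 (\<tau> x z) - g x0 (\<tau> x' z)) <= (A * ?j powr w) * (dist x x' powr th * (?j powr (1 - \<rho>)) powr th)"
    proof (rule hoelder_min[OF theta])
     have "norm (g x0 (\<tau> x z) - g x0 (\<tau> x' z)) <= 2 * C * ?j powr w"
      using norm_triangle_ineq4[of "g x0 (\<tau> x z)" "g x0 (\<tau> x' z)"] C(2)[of x0 x z] C(2)[of x0 x' z] by linarith
     also have "\<dots> <= A * ?j powr w" using E0 by (intro mult_right_mono) (auto simp: A_def)
     finally show "norm (g x0 (\<tau> x z) - g x0 (\<tau> x' z)) <= A * ?j powr w" .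
     have "?j powr (w + 1 - \<rho>) = ?j powr w * ?j powr (1 - \<rho>)" by (simp add: powr_add[symmetric] algebra_simps)
     then have "(E * ?j powr (w + 1 - \<rho>)) * DIM('x) * norm (x - x') = (E * DIM('x)) * (?j powr w * (dist x x' * ?j powr (1 - \<rho>)))"
      by (simp add: dist_norm mult_ac)
     also have "\<dots> <= A * (?j powr w * (dist x x' * ?j powr (1 - \<rho>)))"
      using C(1) by (intro mult_right_mono) (auto simp: A_def)
     finally show "norm (g x0 (\<tau> x z) - g x0 (\<tau> x' z)) <= A * ?j powr w * (dist x x' * ?j powr (1 - \<rho>))"
      using lip[of x0 x z x'] by (simp add: mult.assoc)
    qed (use A0 in auto)
    also have "\<dots> = A * (dist x x' powr th * ?j powr (w + (1 - \<rho>) * th))" by (simp add: powr_powr powr_add mult_ac)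
    also have "\<dots> <= A * (dist x x' powr th * ?j powr (w + \<delta> * th))"
     using A0 orders theta by (intro mult_left_mono jb_powr_mono add_left_mono mult_right_mono) auto
    finally show ?thesis .
   qed
   have "norm (f x z - f x' z) <= (C1 * (L powr th * K powr \<bar>w + \<delta> * th\<bar>) + A) * (dist x x' powr th * jb (fst z) powr (w + \<delta> * th))" for x x' z
    using norm_triangle_ineq[of "g (\<sigma> x) (\<tau> x z) - g (\<sigma> x') (\<tau> x z)" "g (\<sigma> x') (\<tau> x z) - g (\<sigma> x') (\<tau> x' z)"] first[of x z x'] second[of "\<sigma> x'" x z x']
    unfolding f by (simp add: distrib_right)
   then show "shol th (w + \<delta> * th) f" unfolding shol_def
    using C1(1) A0 by (intro exI[of _ "C1 * (L powr th * K powr \<bar>w + \<delta> * th\<bar>) + A"]) auto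
  qed
 qed
qed

end


section \<open>The symbol classes of the statement\<close>

lemma mpderiv_fst:
 assumes "all_derivs Q F" "al \<in> lists Basis"
 shows "mpderiv al (%xi. F (xi, y)) = (%xi. mpderiv (map (%a. (a, 0)) al) F (xi, y))"
 using assms(2)
proof (induction al)
 case (Cons b al)
 have "map (%a. (a, 0)) al \<in> lists Basis" using Cons by (auto simp: Basis_prod_def)
 then have d: "mpderiv (map (%a. (a, 0)) al) F differentiable (at z)" for z
  using assms(1) by (auto simp: all_derivs_def intro: differentiable_on_UNIV_D)
 from Cons show ?case by (simp add: pderiv_dir_fst[OF d])
qed simp

lemma mpderiv_snd:
 assumes "all_derivs Q F" "al \<in> lists Basis"
 shows "mpderiv al (%y. F (xi, y)) = (%y. mpderiv (map (Pair 0) al) F (xi, y))"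
 using assms(2)
proof (induction al)
 case (Cons b al)
 have "map (Pair 0) al \<in> lists Basis" using Cons by (auto simp: Basis_prod_def)
 then have d: "mpderiv (map (Pair 0) al) F differentiable (at z)" for z
  using assms(1) by (auto simp: all_derivs_def intro: differentiable_on_UNIV_D)
 from Cons show ?case by (simp add: pderiv_dir_snd[OF d])
qed simp

lemma all_derivs_mpderiv:
 assumes "all_derivs Q F" "al \<in> lists Basis" shows "all_derivs Q (mpderiv al F)"
 using assms(2) by (induction al) (auto intro: assms(1) all_derivs_pderiv)

definition unc :: "('x => 'v => 'y => complex) => 'x => 'v \<times> 'y => complex" where
 "unc p x z = p x (fst z) (snd z)"

definition mZ :: "'z::euclidean_space list => ('x => 'z => complex) => 'x => 'z => complex" where
 "mZ \<mu> f x = mpderiv \<mu> (f x)"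

definition mX :: "'x::euclidean_space list => ('x => 'z => complex) => 'x => 'z => complex" where
 "mX \<gamma> f x z = mpderiv \<gamma> (%x. f x z) x"

text \<open>One list of directions in the product space, with the xi derivatives outermost as in
  \<open>dsymbol_deriv\<close>.\<close>

definition zlist :: "'v list => 'y list => ('v::euclidean_space \<times> 'y::euclidean_space) list" where
 "zlist al \<beta> = map (%a. (a, 0)) al @ map (Pair 0) \<beta>"

lemma zlist_Basis: "al \<in> lists Basis ==> \<beta> \<in> lists Basis ==> zlist al \<beta> \<in> lists Basis"
 by (auto simp: zlist_def Basis_prod_def)

lemma mZ_Cons: "mZ (b # \<mu>) f = dZ b (mZ \<mu> f)" and mX_Cons: "mX (a # \<gamma>) f = dX a (mX \<gamma> f)"
 and mZ_Nil: "mZ [] f = f" and mX_Nil: "mX [] f = f"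
 by (simp_all add: mZ_def dZ_def mX_def dX_def fun_eq_iff mpderiv_def)

lemma dsymbol_deriv_eq:
 fixes p :: "'n::finite dsymbol"
 assumes "smooth (unc p x)" "al \<in> lists Basis" "\<beta> \<in> lists Basis"
 shows "dsymbol_deriv al \<beta> p x xi y = mZ (zlist al \<beta>) (unc p) x (xi, y)"
proof -
 note s = assms(1)[unfolded smooth_iff]
 have b: "map (Pair 0) \<beta> \<in> lists (Basis :: ((real ^ 'n) \<times> (real ^ 'n)) set)"
  using assms(3) by (auto simp: Basis_prod_def)
 have "dsymbol_deriv al \<beta> p x xi y = mpderiv al (%xi. mpderiv (map (Pair 0) \<beta>) (unc p x) (xi, y)) xi"
  unfolding dsymbol_deriv_def using mpderiv_snd[OF s assms(3)] by (simp add: unc_def)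
 also have "\<dots> = mpderiv (map (%a. (a, 0)) al) (mpderiv (map (Pair 0) \<beta>) (unc p x)) (xi, y)"
  using mpderiv_fst[OF all_derivs_mpderiv[OF s b] assms(2)] by simp
 finally show ?thesis by (simp add: mZ_def zlist_def mpderiv_append)
qed

lemma symb_mZ:
 assumes "symb th \<rho> \<delta> k w f" "\<mu> \<in> lists Basis"
 shows "symb th \<rho> \<delta> k (w + (\<Sum>b\<leftarrow>\<mu>. wt \<rho> \<delta> b)) (mZ \<mu> f)"
 using assms(2)
proof (induction \<mu>)
 case (Cons b \<mu>)
 then have "symb th \<rho> \<delta> k (w + (\<Sum>b\<leftarrow>\<mu>. wt \<rho> \<delta> b) + wt \<rho> \<delta> b) (dZ b (mZ \<mu> f))"
  by (intro symb_dZ) auto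
 then show ?case by (simp add: mZ_Cons algebra_simps)
qed (use assms in \<open>simp add: mZ_Nil\<close>)

lemma wt_zlist:
 assumes "al \<in> lists Basis" "\<beta> \<in> lists Basis"
 shows "(\<Sum>b\<leftarrow>zlist al \<beta>. wt \<rho> \<delta> b) = - \<rho> * length al + \<delta> * length \<beta>"
proof -
 have "(\<Sum>b\<leftarrow>al. wt \<rho> \<delta> (b, 0 :: 'b)) = - \<rho> * length al"
  using assms(1) nonzero_Basis by (induction al) (auto simp: wt_def algebra_simps)
 moreover have "(\<Sum>b\<leftarrow>\<beta>. wt \<rho> \<delta> (0 :: 'a, b)) = \<delta> * length \<beta>"
  by (induction \<beta>) (auto simp: wt_def algebra_simps)
 ultimately show ?thesis by (simp add: zlist_def o_def)
qed

lemma symb_mX: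
 assumes "symb th \<rho> \<delta> k w f" "\<gamma> \<in> lists Basis" "length \<gamma> <= k"
 shows "symb th \<rho> \<delta> (k - length \<gamma>) (w + \<delta> * length \<gamma>) (mX \<gamma> f)"
 using assms(2,3)
proof (induction \<gamma>)
 case (Cons b \<gamma>)
 then have "symb th \<rho> \<delta> (k - length \<gamma> - 1) (w + \<delta> * length \<gamma> + \<delta>) (dX b (mX \<gamma> f))"
  by (intro symb_dX) auto
 then show ?case by (simp add: mX_Cons algebra_simps)
qed (use assms in \<open>simp add: mX_Nil\<close>)

lemma symb_smooth:
 assumes "symb th \<rho> \<delta> k w f" shows "smooth (f x)"
 unfolding smooth_iff
proof (rule all_derivs_coinduct[where X = "%g. \<exists>w f. symb th \<rho> \<delta> k w f & g = f x"])
 show "\<exists>w f'. symb th \<rho> \<delta> k w f' & f x = f' x" using assms by blast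
 show "g differentiable_on UNIV & True" if "\<exists>w f. symb th \<rho> \<delta> k w f & g = f x" for g
  using that symb_diff by blast
 show "\<exists>w f. symb th \<rho> \<delta> k w f & pderiv_dir b g = f x" if g: "\<exists>w f. symb th \<rho> \<delta> k w f & g = f x" and "b \<in> Basis" for g b
 proof -
  obtain w f where "symb th \<rho> \<delta> k w f" "g = f x" using g by blast
  then show ?thesis using symb_dZ[OF _ \<open>b \<in> Basis\<close>] by (intro exI[of _ "w + wt \<rho> \<delta> b"] exI[of _ "dZ b f"]) (auto simp: dZ_def)
 qed
qed

text \<open>A derivative of order j <= k in x has order w + \<delta> j <= w + \<delta> \<tau>. At
  the top order the Hoelder quotient adds \<delta> th, and k + th = \<tau> gives exactly w +
  \<delta> \<tau>.\<close>

lemma symb_hoelder: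
 fixes f :: "'x::euclidean_space => 'v::euclidean_space \<times> 'y::euclidean_space => complex"
 assumes f: "symb (frac \<tau>) \<rho> \<delta> (nat \<lfloor>\<tau>\<rfloor>) w f" and \<tau>: "\<tau> >= 0" and \<delta>: "\<delta> >= 0"
 obtains C where "C >= 0" "!!z. (%x. f x z) \<in> hoelder_space \<tau>"
  "!!z. hoelder_norm \<tau> (%x. f x z) <= C * jb (fst z) powr (w + \<delta> * \<tau>)"
  "!!x z. norm (f x z) <= C * jb (fst z) powr w"
proof -
 let ?k = "nat \<lfloor>\<tau>\<rfloor>" and ?th = "frac \<tau>"
 let ?L = "{\<gamma> \<in> lists (Basis :: 'x set). length \<gamma> <= ?k}"
 have finL: "finite ?L" using finite_lists_length_le[OF finite_Basis, of ?k] by (rule rev_finite_subset) auto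
 have k\<tau>: "real ?k + ?th = \<tau>" "real ?k <= \<tau>" using \<tau> by (simp_all add: frac_def of_nat_nat)
 define Q where "Q \<gamma> C \<longleftrightarrow> C >= 0 & (\<forall>x z. norm (mX \<gamma> f x z) <= C * jb (fst z) powr (w + \<delta> * \<tau>)) \<and>
  (length \<gamma> = ?k --> (\<forall>x x' z. norm (mX \<gamma> f x z - mX \<gamma> f x' z) <= C * (dist x x' powr ?th * jb (fst z) powr (w + \<delta> * \<tau>))))"
  for \<gamma> C
 have "\<exists>C. Q \<gamma> C" if \<gamma>: "\<gamma> \<in> ?L" for \<gamma>
 proof -
  have s: "symb ?th \<rho> \<delta> (?k - length \<gamma>) (w + \<delta> * length \<gamma>) (mX \<gamma> f)" using \<gamma> by (intro symb_mX f) auto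
  have "sbd (w + \<delta> * \<tau>) (mX \<gamma> f)"
   by (rule sbd_mono[OF symb_sbd[OF s]]) (use \<gamma> k\<tau> \<delta> in \<open>auto intro!: mult_left_mono\<close>)
  then obtain C where C: "C >= 0" "!!x z. norm (mX \<gamma> f x z) <= C * jb (fst z) powr (w + \<delta> * \<tau>)" by (rule sbd_E) blast
  obtain D where D: "D >= 0" "!!x x' z. norm (mX \<gamma> f x z - mX \<gamma> f x' z) <= D * (dist x x' powr ?th * jb (fst z) powr (w + \<delta> * length \<gamma> + \<delta> * ?th))"
   using symb_shol[OF s] unfolding shol_def by blast
  have e: "w + \<delta> * length \<gamma> + \<delta> * ?th = w + \<delta> * \<tau>" if "length \<gamma> = ?k"
   using that k\<tau>(1) by (metis add.assoc distrib_left)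
  have 1: "C * a <= (C + D) * a" and 2: "D * a <= (C + D) * a" if "a >= 0" for a
   using C(1) D(1) that by (auto intro!: mult_right_mono)
  have a: "norm (mX \<gamma> f x z) <= (C + D) * jb (fst z) powr (w + \<delta> * \<tau>)" for x z
   by (rule order_trans[OF C(2) 1]) simp
  have b: "norm (mX \<gamma> f x z - mX \<gamma> f x' z) <= (C + D) * (dist x x' powr ?th * jb (fst z) powr (w + \<delta> * \<tau>))" if "length \<gamma> = ?k" for x x' z
   using order_trans[OF D(2) 2] e[OF that] by simp
  have "Q \<gamma> (C + D)" unfolding Q_def using C(1) D(1) a b by (intro conjI allI impI) auto
  then show ?thesis ..
 qed
 then obtain C0 where Q: "!!\<gamma>. \<gamma> \<in> ?L ==> Q \<gamma> (C0 \<gamma>)" by metis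
 obtain C where C: "!!\<gamma>. \<gamma> \<in> ?L ==> C \<gamma> >= 0"
  "!!\<gamma> x z. \<gamma> \<in> ?L ==> norm (mX \<gamma> f x z) <= C \<gamma> * jb (fst z) powr (w + \<delta> * \<tau>)"
  "!!\<gamma> x x' z. \<gamma> \<in> ?L ==> length \<gamma> = ?k ==> norm (mX \<gamma> f x z - mX \<gamma> f x' z) <= C \<gamma> * (dist x x' powr ?th * jb (fst z) powr (w + \<delta> * \<tau>))"
  by (rule that[of C0]; drule Q; unfold Q_def; blast)
 define D where "D = (\<Sum>\<gamma>\<in>?L. C \<gamma>)"
 have D0: "D >= 0" unfolding D_def using C(1) by (intro sum_nonneg)
 have CD: "C \<gamma> <= D" if "\<gamma> \<in> ?L" for \<gamma>
  unfolding D_def using that C(1) finL by (intro member_le_sum) auto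
 have D1: "norm (mX \<gamma> f x z) <= D * jb (fst z) powr (w + \<delta> * \<tau>)" if "\<gamma> \<in> ?L" for \<gamma> x z
  by (rule order_trans[OF C(2)[OF that]]) (intro mult_right_mono CD that, simp)
 have D2: "norm (mX \<gamma> f x z - mX \<gamma> f x' z) <= D * jb (fst z) powr (w + \<delta> * \<tau>) * dist x x' powr ?th"
  if "\<gamma> \<in> ?L" "length \<gamma> = ?k" for \<gamma> x x' z
 proof -
  have "norm (mX \<gamma> f x z - mX \<gamma> f x' z) <= D * (dist x x' powr ?th * jb (fst z) powr (w + \<delta> * \<tau>))"
   by (rule order_trans[OF C(3)[OF that]]) (intro mult_right_mono CD that, simp)
  then show ?thesis by (simp add: mult_ac)
 qed
 obtain E where E: "E >= 0" "!!x z. norm (f x z) <= E * jb (fst z) powr w" using symb_bound[OF f] by blast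
 show ?thesis
 proof (rule that[of "2 * D + E"])
  show "2 * D + E >= 0" using D0 E by simp
  show "norm (f x z) <= (2 * D + E) * jb (fst z) powr w" for x z
   by (rule order_trans[OF E(2)]) (intro mult_right_mono, use D0 in auto)
  show "(%x. f x z) \<in> hoelder_space \<tau>" for z
   unfolding hoelder_space_def C_k_def mem_Collect_eq
  proof (intro conjI ballI impI)
   fix al :: "'x list" assume al: "al \<in> lists Basis"
   { assume l: "length al < ?k"
    then have "symb ?th \<rho> \<delta> (?k - length al) (w + \<delta> * length al) (mX al f)" using al by (intro symb_mX f) auto
    from symb_diff_x[OF this, of z] l show "mpderiv al (%x. f x z) differentiable_on UNIV" by (simp add: mX_def[abs_def]) }
   { assume l: "length al <= ?k"
    then have "symb ?th \<rho> \<delta> (?k - length al) (w + \<delta> * length al) (mX al f)" using al by (intro symb_mX f) auto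
    from symb_cont_x[OF this, of z] show "continuous_on UNIV (mpderiv al (%x. f x z))" by (simp add: mX_def[abs_def])
    show "bounded (range (mpderiv al (%x. f x z)))"
     using D1[of al _ z] al l unfolding bounded_iff mX_def by blast }
   { assume l: "length al = ?k"
    show "\<exists>L. \<forall>x y. norm (mpderiv al (%x. f x z) x - mpderiv al (%x. f x z) y) <= L * dist x y powr ?th"
     using D2[of al _ z] al l unfolding mX_def by auto }
  qed
  fix z :: "'v \<times> 'y"
  let ?J = "D * jb (fst z) powr (w + \<delta> * \<tau>)"
  have J0: "?J >= 0" using D0 by simp
  have s1: "(SUP (al, x) \<in> ?L \<times> UNIV. norm (mpderiv al (%x. f x z) x)) <= ?J"
  proof (rule cSUP_least)
   show "?L \<times> (UNIV :: 'x set) ~= {}" by (auto intro: exI[of _ "[]"])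
   show "(case t of (al, x) => norm (mpderiv al (%x. f x z) x)) <= ?J" if "t \<in> ?L \<times> UNIV" for t
    using D1[of "fst t" "snd t" z] that by (cases t) (simp add: mX_def)
  qed
  have s2: "(SUP (al, x, y) \<in> {(al, x, y). al \<in> lists Basis & length al = ?k & x ~= y}.
       norm (mpderiv al (%x. f x z) x - mpderiv al (%x. f x z) y) / dist x y powr ?th) <= ?J"
  proof (rule cSUP_least)
   obtain b where b: "b \<in> (Basis :: 'x set)" using nonempty_Basis by blast
   have "(replicate ?k b, 0, b) \<in> {(al, x, y). al \<in> lists Basis & length al = ?k & x ~= y}"
    using b nonzero_Basis[OF b] by auto
   then show "{(al::'x list, x::'x, y). al \<in> lists Basis & length al = ?k & x ~= y} ~= {}" by blast
   fix t :: "'x list \<times> 'x \<times> 'x" assume t: "t \<in> {(al, x, y). al \<in> lists Basis & length al = ?k & x ~= y}"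
   obtain al x y where txy: "t = (al, x, y)" by (cases t)
   with t D2[of al x z y] show "(case t of (al, x, y) => norm (mpderiv al (%x. f x z) x - mpderiv al (%x. f x z) y) / dist x y powr ?th) <= ?J"
    by (simp add: mX_def divide_le_eq)
  qed
  have "hoelder_norm \<tau> (%x. f x z) <= ?J + ?J"
   unfolding hoelder_norm_def using s1 s2 J0 by (intro add_mono) auto
  also have "\<dots> <= (2 * D + E) * jb (fst z) powr (w + \<delta> * \<tau>)" using E by (simp add: distrib_right)
  finally show "hoelder_norm \<tau> (%x. f x z) <= (2 * D + E) * jb (fst z) powr (w + \<delta> * \<tau>)" .
 qed
qed

theorem symb_imp_CS:
 fixes p :: "'n::finite dsymbol"
 assumes p: "symb (frac \<tau>) \<rho> \<delta> (nat \<lfloor>\<tau>\<rfloor>) m (unc p)" and \<tau>: "\<tau> >= 0" and \<delta>: "\<delta> >= 0"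
 shows "p \<in> CS \<tau> m \<rho> \<delta>"
 unfolding CS_def mem_Collect_eq
proof (intro conjI allI ballI)
 have sm: "smooth (unc p x)" for x by (rule symb_smooth[OF p])
 then show "smooth (%(xi, y). p x xi y)" for x by (simp add: unc_def[abs_def] split_beta')
 fix al \<beta> :: "(real ^ 'n) list" assume ab: "al \<in> lists Basis" "\<beta> \<in> lists Basis"
 have s: "symb (frac \<tau>) \<rho> \<delta> (nat \<lfloor>\<tau>\<rfloor>) (m - \<rho> * length al + \<delta> * length \<beta>) (mZ (zlist al \<beta>) (unc p))"
  using symb_mZ[OF p zlist_Basis[OF ab]] by (simp add: wt_zlist[OF ab] algebra_simps)
 obtain C where C: "!!z. (%x. mZ (zlist al \<beta>) (unc p) x z) \<in> hoelder_space \<tau>"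
  "!!z. hoelder_norm \<tau> (%x. mZ (zlist al \<beta>) (unc p) x z) <= C * jb (fst z) powr (m - \<rho> * length al + \<delta> * length \<beta> + \<delta> * \<tau>)"
  "!!x z. norm (mZ (zlist al \<beta>) (unc p) x z) <= C * jb (fst z) powr (m - \<rho> * length al + \<delta> * length \<beta>)"
  by (rule symb_hoelder[OF s \<tau> \<delta>]) blast
 have e: "m - \<rho> * length al + \<delta> * length \<beta> + \<delta> * \<tau> = m - \<rho> * length al + \<delta> * (\<tau> + length \<beta>)" by (simp add: algebra_simps)
 show "\<exists>C. \<forall>xi y. (%x. dsymbol_deriv al \<beta> p x xi y) \<in> hoelder_space \<tau> \<and>
    hoelder_norm \<tau> (%x. dsymbol_deriv al \<beta> p x xi y)
     <= C * japanese_bracket xi powr (m - \<rho> * length al + \<delta> * (\<tau> + length \<beta>)) \<and>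
    (\<forall>x. norm (dsymbol_deriv al \<beta> p x xi y)
     <= C * japanese_bracket xi powr (m - \<rho> * length al + \<delta> * length \<beta>))"
  unfolding dsymbol_deriv_eq[OF sm ab]
 proof (intro exI[of _ C] allI conjI)
  fix xi y :: "real ^ 'n" and x
  show "(%x. mZ (zlist al \<beta>) (unc p) x (xi, y)) \<in> hoelder_space \<tau>" by (rule C(1))
  show "hoelder_norm \<tau> (%x. mZ (zlist al \<beta>) (unc p) x (xi, y)) <= C * jb xi powr (m - \<rho> * length al + \<delta> * (\<tau> + length \<beta>))"
   using C(2)[of "(xi, y)"] unfolding e by simp
  show "norm (mZ (zlist al \<beta>) (unc p) x (xi, y)) <= C * jb xi powr (m - \<rho> * length al + \<delta> * length \<beta>)"
   using C(3)[of x "(xi, y)"] by simp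
 qed
qed

subsection \<open>Interpolation in Hoelder spaces\<close>

text \<open>\<mu> is the smallest scale at or above l with M K <= A \<mu>^K, and the hypothesis
  \<open>IH\<close> applies at this scale. If \<mu> exceeds l, then \<open>top\<close> with a step
  of size 1 / \<mu> absorbs half of M K and forces \<mu> <= 8 C l.\<close>

lemma landau_step:
 fixes M :: "nat => real"
 assumes C: "C >= 1" and A: "A > 0" and l: "l > 0" and K: "K >= 1" and th: "0 < th" "th <= 1"
  and IH: "!!\<mu> j. \<mu> > 0 ==> M K <= A * \<mu> ^ K ==> j <= K ==> M j <= C * A * \<mu> ^ j"
  and top: "!!s. s > 0 ==> M K <= 2 * M (K - 1) / s + s powr th * T"
  and T: "T <= A * l powr (real K + th)"
  and j: "j <= K"
 shows "M j <= C * (8 * C) ^ K * A * l ^ j"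
proof -
 define \<mu> where "\<mu> = max l (if M K > 0 then (M K / A) powr (1 / K) else 0)"
 have pw: "((M K / A) powr (1 / K)) ^ K = M K / A" if "M K > 0"
 proof -
  have "((M K / A) powr (1 / K)) ^ K = ((M K / A) powr (1 / K)) powr real K"
   by (rule powr_realpow[symmetric]) (use that A in auto)
  also have "\<dots> = M K / A" unfolding powr_powr using that A K by simp
  finally show ?thesis .
 qed
 have \<mu>0: "\<mu> > 0" using l by (simp add: \<mu>_def)
 have MK: "M K <= A * \<mu> ^ K"
 proof (cases "M K <= 0")
  case True then show ?thesis using A \<mu>0 by (meson less_imp_le mult_pos_pos order_trans zero_less_power)
 next
  case False
  then have "M K / A = ((M K / A) powr (1 / K)) ^ K" using pw by simp
  also have "\<dots> <= \<mu> ^ K" using False by (intro power_mono) (auto simp: \<mu>_def)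
  finally show ?thesis using A by (simp add: divide_le_eq mult.commute)
 qed
 have "\<mu> <= 8 * C * l"
 proof (cases "\<mu> = l")
  case True then show ?thesis using C l by simp
 next
  case False
  then have p: "M K > 0" and m: "\<mu> = (M K / A) powr (1 / K)" using l by (auto simp: \<mu>_def max_def split: if_splits)
  have eq: "M K = A * \<mu> ^ K" unfolding m pw[OF p] using A by simp
  \<comment> \<open>This step makes 2 M (K - 1) / s at most A \<mu>^K / 2, half of the left-hand
    side.\<close>
  define s where "s = 4 * C / \<mu>"
  have s: "s > 0" using C \<mu>0 by (simp add: s_def)
  have "M (K - 1) <= C * A * \<mu> ^ (K - 1)" using IH[OF \<mu>0 MK, of "K - 1"] by simp
  then have "2 * M (K - 1) / s <= 2 * (C * A * \<mu> ^ (K - 1)) / s" using s by (intro divide_right_mono) auto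
  also have "\<dots> = A * \<mu> ^ K / 2" using C \<mu>0 K by (simp add: s_def field_simps power_eq_if)
  finally have "A * \<mu> ^ K <= A * \<mu> ^ K / 2 + s powr th * T" using top[OF s] eq by linarith
  moreover have "s powr th * T <= s powr th * (A * l powr (real K + th))" by (intro mult_left_mono T) auto
  ultimately have "A * (\<mu> ^ K / 2) <= A * (s powr th * l powr (real K + th))" by (simp add: mult_ac)
  then have "\<mu> ^ K / 2 <= s powr th * l powr (real K + th)" using A by (simp only: mult_le_cancel_left_pos)
  then have "\<mu> powr real K <= 2 * ((4 * C) powr th / \<mu> powr th) * l powr (real K + th)"
   using \<mu>0 C by (simp add: s_def powr_divide powr_realpow mult_ac)
  then have "\<mu> powr (real K + th) <= 2 * (4 * C) powr th * l powr (real K + th)"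
   using \<mu>0 by (simp add: powr_add field_simps)
  \<comment> \<open>2 <= 2 powr (K + th) because K >= 1; the 2 merges with the 4 of the step size
    into the 8 of the claim.\<close>
  also have "2 * (4 * C) powr th <= (8 * C) powr (real K + th)"
  proof -
   have "(2::real) = 2 powr 1" by simp
   also have "\<dots> <= 2 powr (real K + th)" using K th by (intro powr_mono) auto
   finally have "2 * (4 * C) powr th <= 2 powr (real K + th) * (4 * C) powr (real K + th)"
    using C K th by (intro mult_mono powr_mono) auto
   also have "\<dots> = (8 * C) powr (real K + th)" using C by (simp add: powr_mult[symmetric])
   finally show ?thesis .
  qed
  finally have "\<mu> powr (real K + th) <= (8 * C * l) powr (real K + th)"
   using C l by (simp add: powr_mult mult_right_mono)
  moreover have "(8 * C * l) powr (real K + th) < \<mu> powr (real K + th)" if "8 * C * l < \<mu>"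
   using that th C l by (intro powr_less_mono2) auto
  ultimately show ?thesis by linarith
 qed
 have "M j <= C * A * \<mu> ^ j" by (rule IH[OF \<mu>0 MK j])
 also have "\<dots> <= C * A * (8 * C * l) ^ j"
  using C A \<mu>0 \<open>\<mu> <= 8 * C * l\<close> by (intro mult_left_mono power_mono) auto
 also have "\<dots> = C * A * (8 * C) ^ j * l ^ j" by (simp add: power_mult_distrib)
 also have "\<dots> <= C * A * (8 * C) ^ K * l ^ j"
  using C A l j by (intro mult_right_mono mult_left_mono power_increasing) auto
 finally show ?thesis by (simp add: mult_ac)
qed

text \<open>The Landau-Kolmogorov inequality for an abstract sequence of sup norms: the two extreme
  orders control the intermediate ones with the same scaling. The induction step is
  \<open>landau_step\<close> with th = 1, where M (Suc K) plays the role of the Hoelder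
  seminorm.\<close>

lemma landau_seq:
 "\<exists>C\<ge>1. \<forall>A l (M :: nat => real). A > 0 --> l > 0 --> M 0 <= A \<longrightarrow>
  (\<forall>j s. 1 <= j --> j < K --> s > 0 --> M j <= 2 * M (j - 1) / s + s * M (j + 1)) \<longrightarrow>
  M K <= A * l ^ K --> (\<forall>j\<le>K. M j <= C * A * l ^ j)"
proof (induction K)
 case 0
 show ?case by (rule exI[of _ 1]) auto
next
 case (Suc K)
 show ?case
 proof (cases "K = 0")
  case True
  then show ?thesis by (intro exI[of _ 1]) (auto simp: le_Suc_eq)
 next
  case False
  from Suc.IH obtain C where C: "C >= 1" and IH: "!!A l M j. A > 0 ==> l > 0 ==> M 0 <= A ==>
   (!!j s. 1 <= j ==> j < K ==> s > 0 ==> M j <= 2 * M (j - 1) / s + s * M (j + 1)) ==>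
   M K <= A * l ^ K ==> j <= K ==> M j <= C * A * (l::real) ^ j"
   by (metis (no_types, lifting))
  have C1: "C * (8 * C) ^ K >= 1" using C mult_mono[of 1 C 1 "(8 * C) ^ K"] one_le_power[of "8 * C" K] by auto
  show ?thesis
  proof (intro exI[of _ "C * (8 * C) ^ K"] conjI allI impI)
   fix A l :: real and M :: "nat => real" and j
   assume A: "A > 0" "l > 0" "M 0 <= A" and j: "j <= Suc K" and MS: "M (Suc K) <= A * l ^ Suc K"
    and rec: "\<forall>j s. 1 <= j --> j < Suc K --> s > 0 --> M j <= 2 * M (j - 1) / s + s * M (j + 1)"
   show "M j <= C * (8 * C) ^ K * A * l ^ j"
   proof (cases "j = Suc K")
    case True
    have "1 * (A * l ^ Suc K) <= (C * (8 * C) ^ K) * (A * l ^ Suc K)" using A by (intro mult_right_mono[OF C1]) auto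
    with MS True show ?thesis by (simp add: mult_ac)
   next
    case j': False
    show ?thesis
    proof (rule landau_step[OF C A(1,2), where th = 1 and T = "M (Suc K)"])
     show "M j <= C * A * \<mu> ^ j" if "\<mu> > 0" "M K <= A * \<mu> ^ K" "j <= K" for \<mu> j
      by (rule IH[of A \<mu> M j]) (use that A rec in auto)
     show "M K <= 2 * M (K - 1) / s + s powr 1 * M (Suc K)" if "s > 0" for s
      using rec that False by auto
     show "M (Suc K) <= A * l powr (real K + 1)" using MS A by (simp add: powr_add powr_realpow mult_ac)
    qed (use False j j' in auto)
   qed
  qed (use C1 in auto)
 qed
qed


text \<open>Mean value inequality for f (x + t b) - t c as a function of t. The slope c = 0 gives a
  Lipschitz bound, and the derivative at x gives a first-order remainder.\<close>

lemma directional_bound: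
 assumes d: "!!t. 0 <= t ==> t <= s ==> f differentiable (at (x + t *\<^sub>R b))"
  and C: "!!t. 0 <= t ==> t <= s ==> norm (pderiv_dir b f (x + t *\<^sub>R b) - c) <= C" and s: "s >= 0"
 shows "norm (f (x + s *\<^sub>R b) - f x - s *\<^sub>R c) <= C * s"
proof -
 have "norm ((f (x + s *\<^sub>R b) - s *\<^sub>R c) - (f (x + 0 *\<^sub>R b) - 0 *\<^sub>R c)) <= C * norm (s - 0)"
 proof (rule differentiable_bound[where S = "{0..s}" and f' = "%t r. r *\<^sub>R (pderiv_dir b f (x + t *\<^sub>R b) - c)"])
  fix t assume t: "t \<in> {0..s}"
  then have "((%t. f (x + t *\<^sub>R b)) has_derivative (%r. r *\<^sub>R pderiv_dir b f (x + t *\<^sub>R b))) (at t within {0..s})"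
   by (intro line_has_derivative d) auto
  then show "((%t. f (x + t *\<^sub>R b) - t *\<^sub>R c) has_derivative (%r. r *\<^sub>R (pderiv_dir b f (x + t *\<^sub>R b) - c))) (at t within {0..s})"
   by (auto intro!: derivative_eq_intros simp: scaleR_diff_right)
  show "onorm (%r. r *\<^sub>R (pderiv_dir b f (x + t *\<^sub>R b) - c)) <= C"
  proof (rule onorm_le)
   show "norm (r *\<^sub>R (pderiv_dir b f (x + t *\<^sub>R b) - c)) <= C * norm r" for r
    using mult_left_mono[OF C[of t], of "norm r"] t by (simp add: mult.commute)
  qed
 qed (use s in auto)
 then show ?thesis using s by (simp add: algebra_simps)
qed

text \<open>The increment over a step s is at most 2 M and differs from s times the derivative by at
  most E s, where E bounds the oscillation of the derivative on the segment.\<close>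

lemma landau_directional:
 assumes d: "f differentiable_on UNIV" and M: "!!x. norm (f x) <= M"
  and E: "!!t. 0 <= t ==> t <= s ==> norm (pderiv_dir b f (x + t *\<^sub>R b) - pderiv_dir b f x) <= E" and s: "s > 0"
 shows "norm (pderiv_dir b f x) <= 2 * M / s + E"
proof -
 have "norm (f (x + s *\<^sub>R b) - f x - s *\<^sub>R pderiv_dir b f x) <= E * s"
  by (rule directional_bound) (use d E s in \<open>auto intro: differentiable_on_UNIV_D\<close>)
 then have "norm (s *\<^sub>R pderiv_dir b f x) <= E * s + norm (f (x + s *\<^sub>R b) - f x)"
  using norm_triangle_ineq3[of "s *\<^sub>R pderiv_dir b f x" "f (x + s *\<^sub>R b) - f x"] by (simp add: norm_minus_commute)
 also have "\<dots> <= E * s + 2 * M" using norm_triangle_ineq4[of "f (x + s *\<^sub>R b)" "f x"] M[of "x + s *\<^sub>R b"] M[of x] by simp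
 finally show ?thesis using s by (simp add: field_simps)
qed

text \<open>\<open>l\<close> is a frequency scale: a derivative costs a factor l and the Hoelder
  seminorm l powr th. In the application A is a multiple of a power of jb xi and l = jb xi powr
  \<delta>, so the constant has to be uniform in \<open>A\<close> and \<open>l\<close>.\<close>

theorem hoelder_interpolation:
 fixes \<tau> :: real
 assumes \<tau>: "\<tau> >= 0"
 obtains C where "C >= 0"
  "!!(f :: 'a::euclidean_space => complex) A l \<gamma> x. f \<in> hoelder_space \<tau> ==> A > 0 ==> l > 0 ==>
   (!!x. norm (f x) <= A) ==> hoelder_norm \<tau> f <= A * l powr \<tau> ==> \<gamma> \<in> lists Basis ==> length \<gamma> <= nat \<lfloor>\<tau>\<rfloor> ==>
   norm (mpderiv \<gamma> f x) <= C * A * l ^ length \<gamma>"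
  "!!(f :: 'a::euclidean_space => complex) A l \<gamma> x y. f \<in> hoelder_space \<tau> ==> A > 0 ==> l > 0 ==>
   (!!x. norm (f x) <= A) ==> hoelder_norm \<tau> f <= A * l powr \<tau> ==> \<gamma> \<in> lists Basis ==> length \<gamma> <= nat \<lfloor>\<tau>\<rfloor> ==>
   norm (mpderiv \<gamma> f x - mpderiv \<gamma> f y) <= C * A * l ^ length \<gamma> * (dist x y powr frac \<tau> * l powr frac \<tau>)"
proof -
 let ?k = "nat \<lfloor>\<tau>\<rfloor>" and ?th = "frac \<tau>"
 let ?L = "%j. {\<gamma> \<in> lists (Basis :: 'a set). length \<gamma> = j}"
 let ?Lk = "{\<gamma> \<in> lists (Basis :: 'a set). length \<gamma> <= ?k}"
 have k\<tau>: "real ?k + ?th = \<tau>" using \<tau> by (simp_all add: frac_def of_nat_nat)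
 have th: "0 <= ?th" "?th < 1" by (auto simp: frac_lt_1)
 have finLk: "finite ?Lk" using finite_lists_length_le[OF finite_Basis, of ?k] by (rule rev_finite_subset) auto
 obtain C1 where C1: "C1 >= 1" and seq: "!!A l (M :: nat => real) j. A > 0 ==> l > 0 ==> M 0 <= A ==>
  (!!j s. 1 <= j ==> j < ?k ==> s > 0 ==> M j <= 2 * M (j - 1) / s + s * M (j + 1)) ==>
  M ?k <= A * l ^ ?k ==> j <= ?k ==> M j <= C1 * A * l ^ j"
  using landau_seq[of ?k] by (metis (no_types, lifting))
 define C2 where "C2 = C1 * (8 * C1) ^ ?k"
 have C21: "C1 <= C2" "1 <= C2"
 proof -
  have "1 <= (8 * C1) ^ ?k" using C1 by (intro one_le_power) simp
  then have "C1 * 1 <= C2" unfolding C2_def using C1 by (intro mult_left_mono) auto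
  then show "C1 <= C2" "1 <= C2" using C1 by auto
 qed
 \<comment> \<open>The 2 comes from bounding a difference by twice the supremum, DIM from the
   Lipschitz constant in terms of first partial derivatives.\<close>
 define C where "C = (2 + DIM('a)) * C2"
 have "0 <= C2 * real DIM('a)" using C21 by simp
 moreover have Ce: "C = 2 * C2 + C2 * real DIM('a)" by (simp add: C_def algebra_simps)
 ultimately have C2C: "C2 <= C" "2 * C2 <= C" "DIM('a) * C2 <= C" "1 <= C" "0 <= C"
  using C21 unfolding Ce mult.commute[of "real DIM('a)"] by linarith+
 have main: "norm (mpderiv \<gamma> f x) <= C2 * A * l ^ length \<gamma> \<and>
   norm (mpderiv \<gamma> f x - mpderiv \<gamma> f y) <= C * A * l ^ length \<gamma> * (dist x y powr ?th * l powr ?th)"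
  if f: "f \<in> hoelder_space \<tau>" and A: "A > 0" and l: "l > 0" and fA: "!!x. norm (f x) <= A"
   and fN: "hoelder_norm \<tau> f <= A * l powr \<tau>" and \<gamma>: "\<gamma> \<in> lists Basis" "length \<gamma> <= ?k"
  for f :: "'a => complex" and A l \<gamma> x y
 proof -
  have fd: "mpderiv al f differentiable_on UNIV" if "al \<in> lists Basis" "length al < ?k" for al
   using f that by (auto simp: hoelder_space_def C_k_def)
  have fb: "bounded (range (mpderiv al f))" if "al \<in> ?Lk" for al
   using f that by (auto simp: hoelder_space_def)
  have bd: "bdd_above ((%(al, x). norm (mpderiv al f x)) ` (S \<times> UNIV))" if "S \<subseteq> ?Lk" for S
  proof -
   have "finite S" using that finLk by (rule finite_subset)
   then have "bounded (\<Union>al\<in>S. range (mpderiv al f))" using fb that by (intro bounded_UN) auto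
   then obtain B where "!!z. z \<in> (\<Union>al\<in>S. range (mpderiv al f)) ==> norm z <= B" unfolding bounded_iff by blast
   then show ?thesis by (intro bdd_aboveI[of _ B]) auto
  qed
  define M where "M j = (SUP (al, x) \<in> ?L j \<times> UNIV. norm (mpderiv al f x))" for j
  have M: "norm (mpderiv al f x) <= M j" if "al \<in> ?L j" "j <= ?k" for al x j
  proof -
   have "?L j \<subseteq> ?Lk" using that by auto
   from cSUP_upper[OF _ bd[OF this], of "(al, x)"] that show ?thesis unfolding M_def by auto
  qed
  have Lne: "?L j \<times> (UNIV :: 'a set) ~= {}" for j
  proof -
   obtain b where "b \<in> (Basis :: 'a set)" using nonempty_Basis by blast
   then have "replicate j b \<in> ?L j" by auto
   then show ?thesis by blast
  qed
  have Mle: "M j <= B" if "!!al x. al \<in> ?L j ==> norm (mpderiv al f x) <= B" for B j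
   unfolding M_def by (rule cSUP_least[OF Lne]) (use that in auto)
  have M0: "M j >= 0" if "j <= ?k" for j
  proof -
   obtain al where "al \<in> ?L j" using Lne[of j] by blast
   from M[OF this that, of 0] norm_ge_zero order_trans show ?thesis by blast
  qed
  have MA: "M 0 <= A" by (rule Mle) (use fA in auto)
  have rec: "M j <= 2 * M (j - 1) / s + s * M (j + 1)" if j: "1 <= j" "j < ?k" "s > 0" for j s
  proof (rule Mle)
   fix al x assume al: "al \<in> ?L j"
   with j obtain b al' where al': "al = b # al'" by (cases al) auto
   with al j have b: "b \<in> Basis" "al' \<in> ?L (j - 1)" by auto
   show "norm (mpderiv al f x) <= 2 * M (j - 1) / s + s * M (j + 1)"
    unfolding al' mpderiv_Cons
   proof (rule landau_directional[OF fd M _ j(3)])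
    fix t assume t: "0 <= t" "t <= s"
    have "norm (mpderiv al f (x + t *\<^sub>R b) - mpderiv al f x - t *\<^sub>R 0) <= M (j + 1) * t"
    proof (rule directional_bound)
     show "mpderiv al f differentiable (at (x + u *\<^sub>R b))" for u
      by (rule differentiable_on_UNIV_D[OF fd]) (use al j in auto)
     show "norm (pderiv_dir b (mpderiv al f) (x + u *\<^sub>R b) - 0) <= M (j + 1)" for u
      using M[of "b # al" "j + 1"] al b j by auto
    qed (use t in auto)
    also have "\<dots> <= s * M (j + 1)" using t M0[of "j + 1"] j by (simp add: mult.commute[of "M _"] mult_right_mono)
    finally show "norm (pderiv_dir b (mpderiv al' f) (x + t *\<^sub>R b) - pderiv_dir b (mpderiv al' f) x) <= s * M (j + 1)"
     by (simp add: al')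
   qed (use b j in auto)
  qed
  have Mk: "M j <= C2 * A * l ^ j" and top: "?th ~= 0 ==> al \<in> ?L ?k ==> norm (mpderiv al f x - mpderiv al f y) <= A * l powr \<tau> * dist x y powr ?th"
   if j: "j <= ?k" for j al x y
  proof -
   define N1 where "N1 = (SUP (al, x) \<in> ?Lk \<times> UNIV. norm (mpderiv al f x))"
   define N2 where "N2 = (SUP (al, x, y) \<in> {(al, x, y). al \<in> lists Basis & length al = ?k & x ~= y}.
       norm (mpderiv al f x - mpderiv al f y) / dist x y powr ?th)"
   have N: "N1 + (if ?th = 0 then 0 else N2) <= A * l powr \<tau>"
    using fN unfolding hoelder_norm_def N1_def N2_def .
   have N1: "norm (mpderiv al f x) <= N1" if "al \<in> ?Lk" for al x
    using cSUP_upper[OF _ bd[OF order_refl], of "(al, x)"] that unfolding N1_def by auto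
   have N10: "N1 >= 0" using order_trans[OF norm_ge_zero N1[of "[]" 0]] by simp
   have N2: "norm (mpderiv al f x - mpderiv al f y) <= N2 * dist x y powr ?th" if th0: "?th ~= 0" and al: "al \<in> ?L ?k" for al x y
   proof (cases "x = y")
    case False
    let ?S = "{(al, x, y). al \<in> lists (Basis :: 'a set) & length al = ?k & x ~= (y :: 'a)}"
    have "\<forall>al\<in>?L ?k. \<exists>L. \<forall>x y. norm (mpderiv al f x - mpderiv al f y) <= L * dist x y powr ?th"
     using f th0 by (auto simp: hoelder_space_def)
    then obtain L where L: "!!al x y. al \<in> ?L ?k ==> norm (mpderiv al f x - mpderiv al f y) <= L al * dist x y powr ?th"
     by metis
    have fin: "finite (?L ?k)" using finLk by (rule rev_finite_subset) auto
    have "bdd_above ((%(al, x, y). norm (mpderiv al f x - mpderiv al f y) / dist x y powr ?th) ` ?S)"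
    proof (rule bdd_aboveI[of _ "\<Sum>al\<in>?L ?k. \<bar>L al\<bar>"])
     fix t assume "t \<in> (%(al, x, y). norm (mpderiv al f x - mpderiv al f y) / dist x y powr ?th) ` ?S"
     then obtain al x y where t: "t = norm (mpderiv al f x - mpderiv al f y) / dist x y powr ?th" "al \<in> ?L ?k" "x ~= y" by auto
     have "t <= L al" using L[OF t(2), of x y] t by (simp add: divide_le_eq)
     also have "\<dots> <= \<bar>L al\<bar>" by simp
     also have "\<dots> <= (\<Sum>al\<in>?L ?k. \<bar>L al\<bar>)" using t(2) fin by (intro member_le_sum) auto
     finally show "t <= (\<Sum>al\<in>?L ?k. \<bar>L al\<bar>)" .
    qed
    from cSUP_upper[OF _ this, of "(al, x, y)"] False al
    have "norm (mpderiv al f x - mpderiv al f y) / dist x y powr ?th <= N2" unfolding N2_def by auto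
    then show ?thesis using False by (simp add: divide_le_eq)
   qed simp
   show "norm (mpderiv al f x - mpderiv al f y) <= A * l powr \<tau> * dist x y powr ?th" if "?th ~= 0" "al \<in> ?L ?k"
   proof -
    have "N2 <= A * l powr \<tau>" using N N10 that by simp
    from mult_right_mono[OF this, of "dist x y powr ?th"] N2[OF that, of x y] show ?thesis by simp
   qed
   show "M j <= C2 * A * l ^ j"
   \<comment> \<open>For integer \<tau> the norm bounds the derivatives of order k directly, and for
     k = 0 the sup bound is all there is; \<open>landau_seq\<close> covers both. Otherwise the
     derivatives of order k are reached only through their Hoelder seminorm, by
     \<open>landau_step\<close>.\<close>
   proof (cases "?th = 0 \<or> ?k = 0")
    case True
    have "M j <= C1 * A * l ^ j"
    proof (rule seq[where M = M, OF A l MA rec])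
     show "M ?k <= A * l ^ ?k"
     proof (cases "?k = 0")
      case False
      with True have th0: "?th = 0" by simp
      show ?thesis
      proof (rule Mle)
       fix al x assume "al \<in> ?L ?k"
       then have "norm (mpderiv al f x) <= A * l powr \<tau>" using N1[of al x] N th0 by auto
       moreover have "\<tau> = real ?k" using k\<tau> th0 by simp
       then have "l powr \<tau> = l ^ ?k" using l by (metis powr_realpow)
       ultimately show "norm (mpderiv al f x) <= A * l ^ ?k" by simp
      qed
     qed (use MA in simp)
    qed (use j in auto)
    also have "\<dots> <= C2 * A * l ^ j" using C21 A l by (intro mult_right_mono) auto
    finally show ?thesis .
   next
    case False
    show ?thesis unfolding C2_def
    proof (rule landau_step[where M = M and th = ?th and T = "A * l powr \<tau>", OF C1 A l])
     show "M i <= C1 * A * \<mu> ^ i" if "\<mu> > 0" "M ?k <= A * \<mu> ^ ?k" "i <= ?k" for \<mu> i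
      by (rule seq[where M = M, OF A that(1) MA rec that(2,3)])
     show "M ?k <= 2 * M (?k - 1) / s + s powr ?th * (A * l powr \<tau>)" if s: "s > 0" for s
     proof (rule Mle)
      fix al x assume al: "al \<in> ?L ?k"
      with False obtain b al' where al': "al = b # al'" by (cases al) auto
      with al False have b: "b \<in> Basis" "al' \<in> ?L (?k - 1)" by auto
      show "norm (mpderiv al f x) <= 2 * M (?k - 1) / s + s powr ?th * (A * l powr \<tau>)"
       unfolding al' mpderiv_Cons
      proof (rule landau_directional[OF fd M _ s])
       fix t assume t: "0 <= t" "t <= s"
       have N2': "N2 <= A * l powr \<tau>" using N N10 False by simp
       have "norm (mpderiv al f (x + t *\<^sub>R b) - mpderiv al f x) <= N2 * dist (x + t *\<^sub>R b) x powr ?th"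
        by (rule N2) (use al False in auto)
       also have "\<dots> <= (A * l powr \<tau>) * dist (x + t *\<^sub>R b) x powr ?th" by (intro mult_right_mono N2') simp
       also have "dist (x + t *\<^sub>R b) x = t" using b t by (simp add: dist_norm)
       also have "t powr ?th <= s powr ?th" using t th by (intro powr_mono2) auto
       finally show "norm (pderiv_dir b (mpderiv al' f) (x + t *\<^sub>R b) - pderiv_dir b (mpderiv al' f) x) <= s powr ?th * (A * l powr \<tau>)"
        using A l by (simp add: al' mult_ac mult_left_mono)
      qed (use b False in auto)
     qed
    qed (use False th k\<tau> j in auto)
   qed
  qed
  have b1: "norm (mpderiv \<gamma> f x) <= C2 * A * l ^ length \<gamma>" for x
   using M[of \<gamma> "length \<gamma>" x] Mk[OF \<gamma>(2)] \<gamma> by auto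
  have "norm (mpderiv \<gamma> f x - mpderiv \<gamma> f y) <= C * A * l ^ length \<gamma> * (dist x y powr ?th * l powr ?th)"
  proof (cases "length \<gamma> = ?k")
   case True
   show ?thesis
   proof (cases "?th = 0")
    \<comment> \<open>Here dist x y powr 0 is 1 for distinct points and 0 for x = y, where the
      left-hand side vanishes too.\<close>
    case t0: True
    show ?thesis
    proof (cases "x = y")
     case False
     have "norm (mpderiv \<gamma> f x - mpderiv \<gamma> f y) <= 2 * (C2 * A * l ^ length \<gamma>)"
      using norm_triangle_ineq4[of "mpderiv \<gamma> f x" "mpderiv \<gamma> f y"] b1[of x] b1[of y] by simp
     also have "\<dots> <= C * A * l ^ length \<gamma>" using mult_right_mono[OF C2C(2), of "A * l ^ length \<gamma>"] A l by (simp add: mult_ac)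
     finally show ?thesis unfolding t0 using False l by simp
    qed simp
   next
    case False
    have "norm (mpderiv \<gamma> f x - mpderiv \<gamma> f y) <= A * l powr \<tau> * dist x y powr ?th"
     by (rule top[OF order_refl False]) (use \<gamma> True in auto)
    also have "l powr \<tau> = l ^ length \<gamma> * l powr ?th" using k\<tau> True l by (metis powr_add powr_realpow)
    also have "A * (l ^ length \<gamma> * l powr ?th) * dist x y powr ?th = 1 * (A * l ^ length \<gamma> * (dist x y powr ?th * l powr ?th))" by (simp add: mult_ac)
    also have "\<dots> <= C * (A * l ^ length \<gamma> * (dist x y powr ?th * l powr ?th))" using C2C A l by (intro mult_right_mono) auto
    finally show ?thesis by (simp add: mult_ac)
   qed
  next
   case False
   with \<gamma> have lk: "length \<gamma> < ?k" by simp
   show ?thesis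
   proof (rule hoelder_min[OF th(1) less_imp_le[OF th(2)] _ l])
    have "norm (mpderiv \<gamma> f x - mpderiv \<gamma> f y) <= 2 * (C2 * A * l ^ length \<gamma>)"
     using norm_triangle_ineq4[of "mpderiv \<gamma> f x" "mpderiv \<gamma> f y"] b1[of x] b1[of y] by simp
    also have "\<dots> <= C * A * l ^ length \<gamma>" using mult_right_mono[OF C2C(2), of "A * l ^ length \<gamma>"] A l by (simp add: mult_ac)
    finally show "norm (mpderiv \<gamma> f x - mpderiv \<gamma> f y) <= C * A * l ^ length \<gamma>" .
    have "norm (mpderiv \<gamma> f x - mpderiv \<gamma> f y) <= (C2 * A * l ^ Suc (length \<gamma>)) * DIM('a) * norm (x - y)"
    proof (rule pderiv_bound_lipschitz)
     show "mpderiv \<gamma> f differentiable_on UNIV" using fd \<gamma> lk by blast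
     show "norm (pderiv_dir b (mpderiv \<gamma> f) x) <= C2 * A * l ^ Suc (length \<gamma>)" if "b \<in> Basis" for b x
      using M[of "b # \<gamma>" "Suc (length \<gamma>)" x] Mk[of "Suc (length \<gamma>)"] \<gamma> lk that by auto
    qed
    also have "\<dots> = (DIM('a) * C2) * (A * l ^ length \<gamma> * (dist x y * l))" by (simp add: dist_norm mult_ac)
    also have "\<dots> <= C * (A * l ^ length \<gamma> * (dist x y * l))" using C2C A l by (intro mult_right_mono) auto
    finally show "norm (mpderiv \<gamma> f x - mpderiv \<gamma> f y) <= C * A * l ^ length \<gamma> * (dist x y * l)" by (simp add: mult_ac)
   qed (use C2C A l in auto)
  qed
  with b1 show ?thesis by blast
 qed
 have main1: "norm (mpderiv \<gamma> f x) <= C * A * l ^ length \<gamma>"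
  if "f \<in> hoelder_space \<tau>" "A > 0" "l > 0" "!!x. norm (f x) <= A" "hoelder_norm \<tau> f <= A * l powr \<tau>" "\<gamma> \<in> lists Basis" "length \<gamma> <= ?k"
  for f :: "'a => complex" and A l \<gamma> x
 proof -
  have "norm (mpderiv \<gamma> f x) <= C2 * A * l ^ length \<gamma>" using main[OF that] by blast
  also have "\<dots> <= C * A * l ^ length \<gamma>" using C2C that by (intro mult_right_mono) auto
  finally show ?thesis .
 qed
 show thesis
  by (rule that[OF C2C(5) main1]) (use main in auto)
qed


subsection \<open>Interchanging derivatives\<close>

lemma has_derivative_quadratic:
 fixes g :: "'z::euclidean_space => complex"
 assumes q: "!!v. norm v < 1/2 ==> norm (g (z0 + v) - g z0 - (\<Sum>b\<in>Basis. (v \<bullet> b) *\<^sub>R G b)) <= C * (norm v)\<^sup>2"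
 shows "(g has_derivative (%v. \<Sum>b\<in>Basis. (v \<bullet> b) *\<^sub>R G b)) (at z0)"
 unfolding has_derivative_at
proof
 show "bounded_linear (%v. \<Sum>b\<in>Basis. (v \<bullet> b) *\<^sub>R G b)"
  by (intro bounded_linear_sum bounded_linear_scaleR_const bounded_linear_inner_left)
 show "(%v. norm (g (z0 + v) - g z0 - (\<Sum>b\<in>Basis. (v \<bullet> b) *\<^sub>R G b)) / norm v) \<midarrow>0\<rightarrow> 0"
 proof (rule Lim_null_comparison)
  show "\<forall>\<^sub>F v in at 0. norm (norm (g (z0 + v) - g z0 - (\<Sum>b\<in>Basis. (v \<bullet> b) *\<^sub>R G b)) / norm v) <= C * norm v"
   unfolding eventually_at
  proof (intro exI[of _ "1/2"] conjI ballI impI)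
   fix v :: 'z assume v: "v ~= 0 & dist v 0 < 1/2"
   then have "norm (g (z0 + v) - g z0 - (\<Sum>b\<in>Basis. (v \<bullet> b) *\<^sub>R G b)) <= (C * norm v) * norm v"
    using q[of v] by (simp add: power2_eq_square mult.assoc)
   with v show "norm (norm (g (z0 + v) - g z0 - (\<Sum>b\<in>Basis. (v \<bullet> b) *\<^sub>R G b)) / norm v) <= C * norm v"
    by (simp add: divide_le_eq)
  qed simp
  show "(%v::'z. C * norm v) \<midarrow>0\<rightarrow> 0" by (auto intro!: tendsto_eq_intros)
 qed
qed

text \<open>Mean value inequality twice: second derivatives bound the variation of the gradient,
  hence the gradient of F minus its linear part, on a ball whose radius is proportional to
  |v|.\<close>

lemma taylor_second_order:
 fixes F :: "'z::euclidean_space => complex"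
 assumes d: "F differentiable_on UNIV" "!!b. b \<in> Basis ==> pderiv_dir b F differentiable_on UNIV"
  and C: "!!b c z. b \<in> Basis ==> c \<in> Basis ==> z \<in> ball z0 1 ==> norm (pderiv_dir c (pderiv_dir b F) z) <= C"
  and v: "norm v < 1/2"
 shows "norm (F (z0 + v) - F z0 - (\<Sum>b\<in>Basis. (v \<bullet> b) *\<^sub>R pderiv_dir b F z0)) <= 2 * C * DIM('z) * DIM('z) * (norm v)\<^sup>2"
proof (cases "v = 0")
 case False
 obtain b0 where "b0 \<in> (Basis :: 'z set)" using nonempty_Basis by blast
 then have C0: "C >= 0" by (intro order_trans[OF norm_ge_zero C[of b0 b0 z0]]) auto
 \<comment> \<open>Twice the length of v puts z0 + v inside the open ball of radius r, and |v| < 1/2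
   keeps that ball inside the unit ball.\<close>
 define r where "r = 2 * norm v"
 have r: "0 < r" "r < 1" "norm v < r" using False v by (auto simp: r_def)
 define G where "G z = F z - (\<Sum>b\<in>Basis. ((z - z0) \<bullet> b) *\<^sub>R pderiv_dir b F z0)" for z
 have G': "(G has_derivative (%v. (\<Sum>b\<in>Basis. (v \<bullet> b) *\<^sub>R pderiv_dir b F z) - (\<Sum>b\<in>Basis. (v \<bullet> b) *\<^sub>R pderiv_dir b F z0))) (at z)" for z
 proof -
  have "bounded_linear (%v. \<Sum>b\<in>Basis. (v \<bullet> b) *\<^sub>R pderiv_dir b F z0)"
   by (intro bounded_linear_sum bounded_linear_scaleR_const bounded_linear_inner_left)
  from bounded_linear.has_derivative[OF this has_derivative_diff[OF has_derivative_ident has_derivative_const]]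
  have "((%z. \<Sum>b\<in>Basis. ((z - z0) \<bullet> b) *\<^sub>R pderiv_dir b F z0) has_derivative (%v. \<Sum>b\<in>Basis. (v \<bullet> b) *\<^sub>R pderiv_dir b F z0)) (at z)"
   by simp
  from has_derivative_diff[OF has_derivative_pderiv[OF differentiable_on_UNIV_D[OF d(1)]] this]
  show ?thesis unfolding G_def .
 qed
 have "norm (G (z0 + v) - G z0) <= (C * DIM('z) * r) * DIM('z) * norm ((z0 + v) - z0)"
 proof (rule pderiv_bound_lipschitz_ball[of z0 r G])
  show "G differentiable (at x)" for x using G' by (auto simp: differentiable_def)
  fix b x assume b: "b \<in> (Basis :: 'z set)" and x: "x \<in> ball z0 r"
  have "pderiv_dir b G x = pderiv_dir b F x - pderiv_dir b F z0"
   unfolding pderiv_dir_eq[OF G'] using pderiv_dir_expand[OF differentiable_on_UNIV_D[OF d(1)], of b] by simp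
  also have "norm \<dots> <= C * DIM('z) * norm (x - z0)"
   by (rule pderiv_bound_lipschitz_ball[of z0 1]) (use d(2) b C x r in \<open>auto intro: differentiable_on_UNIV_D\<close>)
  also have "\<dots> <= C * DIM('z) * r" using x C0 by (intro mult_left_mono) (auto simp: dist_norm norm_minus_commute)
  finally show "norm (pderiv_dir b G x) <= C * DIM('z) * r" .
 qed (use r in \<open>auto simp: dist_norm\<close>)
 moreover have "G (z0 + v) - G z0 = F (z0 + v) - F z0 - (\<Sum>b\<in>Basis. (v \<bullet> b) *\<^sub>R pderiv_dir b F z0)" by (simp add: G_def)
 ultimately show ?thesis by (simp add: r_def power2_eq_square mult_ac)
qed simp

text \<open>Both sides are limits of difference quotients in \<open>x\<close>; these satisfy a second order Taylor
 estimate in \<open>z\<close> that is uniform in the step size.\<close>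

lemma mixed_derivative:
 fixes f :: "'x::euclidean_space => 'z::euclidean_space => complex"
 assumes a: "a \<in> Basis"
  and dz: "f x0 differentiable_on UNIV" "!!x. f x differentiable_on UNIV" "!!b x. b \<in> Basis ==> dZ b f x differentiable_on UNIV"
  and dx: "!!z. (%x. f x z) differentiable_on UNIV" "!!b z. b \<in> Basis ==> (%x. dZ b f x z) differentiable_on UNIV"
   "!!b c z. b \<in> Basis ==> c \<in> Basis ==> (%x. dZ c (dZ b f) x z) differentiable_on UNIV"
  and C: "!!b c x z. b \<in> Basis ==> c \<in> Basis ==> x \<in> ball x0 1 ==> z \<in> ball z0 1 ==> norm (dX a (dZ c (dZ b f)) x z) <= C"
 shows "(dX a f x0 has_derivative (%v. \<Sum>b\<in>Basis. (v \<bullet> b) *\<^sub>R dX a (dZ b f) x0 z0)) (at z0)"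
proof (rule has_derivative_quadratic)
 fix v :: 'z assume v: "norm v < 1/2"
 \<comment> \<open>The denominator n + 2 keeps every step strictly below 1, so that the segments
   stay in the open unit ball even for n = 0.\<close>
 define s where "s n = 1 / real (Suc (Suc n))" for n
 have s: "0 < s n" "s n < 1" for n by (auto simp: s_def)
 have s0: "s \<longlonglongrightarrow> 0" unfolding s_def by (intro LIMSEQ_Suc[OF LIMSEQ_Suc[OF lim_1_over_n]])
 define F where "F n z = (f (x0 + s n *\<^sub>R a) z - f x0 z) /\<^sub>R s n" for n z
 have Fd: "((F n) has_derivative (%v. (pderiv_dir v (f (x0 + s n *\<^sub>R a)) z - pderiv_dir v (f x0) z) /\<^sub>R s n)) (at z)" for n z
  unfolding F_def by (intro has_derivative_scaleR_right has_derivative_diff has_derivative_pderiv' differentiable_on_UNIV_D dz)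
 have F1: "pderiv_dir b (F n) = (%z. (dZ b f (x0 + s n *\<^sub>R a) z - dZ b f x0 z) /\<^sub>R s n)" for b n
  using pderiv_dir_eq[OF Fd] by (simp add: dZ_def fun_eq_iff)
 have Fd1: "((%z. (dZ b f (x0 + s n *\<^sub>R a) z - dZ b f x0 z) /\<^sub>R s n) has_derivative (%v. (pderiv_dir v (dZ b f (x0 + s n *\<^sub>R a)) z - pderiv_dir v (dZ b f x0) z) /\<^sub>R s n)) (at z)"
  if "b \<in> Basis" for b n z
  using that by (intro has_derivative_scaleR_right has_derivative_diff has_derivative_pderiv' differentiable_on_UNIV_D dz)
 have F2: "pderiv_dir c (pderiv_dir b (F n)) z = (dZ c (dZ b f) (x0 + s n *\<^sub>R a) z - dZ c (dZ b f) x0 z) /\<^sub>R s n" if "b \<in> Basis" for b c n z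
  unfolding F1 using pderiv_dir_eq[OF Fd1[OF that]] by (simp add: dZ_def)
 have bound: "norm (F n (z0 + v) - F n z0 - (\<Sum>b\<in>Basis. (v \<bullet> b) *\<^sub>R pderiv_dir b (F n) z0)) <= 2 * C * DIM('z) * DIM('z) * (norm v)\<^sup>2" for n
 proof (rule taylor_second_order[OF _ _ _ v])
  show "F n differentiable_on UNIV" by (rule has_derivative_differentiable_on[OF Fd])
  show "pderiv_dir b (F n) differentiable_on UNIV" if "b \<in> Basis" for b
   unfolding F1 by (rule has_derivative_differentiable_on[OF Fd1[OF that]])
  fix b c z assume bc: "b \<in> (Basis :: 'z set)" "c \<in> (Basis :: 'z set)" and z: "z \<in> ball z0 1"
  have "norm (dZ c (dZ b f) (x0 + s n *\<^sub>R a) z - dZ c (dZ b f) x0 z - s n *\<^sub>R 0) <= C * s n"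
  proof (rule directional_bound)
   fix t assume t: "0 <= t" "t <= s n"
   show "(%x. dZ c (dZ b f) x z) differentiable (at (x0 + t *\<^sub>R a))"
    by (rule differentiable_on_UNIV_D[OF dx(3)[OF bc]])
   have "x0 + t *\<^sub>R a \<in> ball x0 1" using t s(2)[of n] a by (auto simp: dist_norm)
   from C[OF bc this z] show "norm (pderiv_dir a (%x. dZ c (dZ b f) x z) (x0 + t *\<^sub>R a) - 0) <= C"
    by (simp add: dX_def)
  qed (use s[of n] in auto)
  then show "norm (pderiv_dir c (pderiv_dir b (F n)) z) <= C"
   using s[of n] unfolding F2[OF bc(1)] by (simp add: divide_simps mult.commute)
 qed
 have lim: "(%n. (\<phi> (x0 + s n *\<^sub>R a) - \<phi> x0) /\<^sub>R s n) \<longlonglongrightarrow> pderiv_dir a \<phi> x0" if "\<phi> differentiable_on UNIV" for \<phi> :: "'x => complex"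
  by (rule difference_quotient_tendsto[OF differentiable_on_UNIV_D[OF that] s(1) s0])
 have "(%n. F n (z0 + v) - F n z0 - (\<Sum>b\<in>Basis. (v \<bullet> b) *\<^sub>R pderiv_dir b (F n) z0)) \<longlonglongrightarrow>
  dX a f x0 (z0 + v) - dX a f x0 z0 - (\<Sum>b\<in>Basis. (v \<bullet> b) *\<^sub>R dX a (dZ b f) x0 z0)"
  unfolding F1 F_def dX_def by (intro tendsto_intros lim dx)
 then show "norm (dX a f x0 (z0 + v) - dX a f x0 z0 - (\<Sum>b\<in>Basis. (v \<bullet> b) *\<^sub>R dX a (dZ b f) x0 z0)) <= 2 * C * DIM('z) * DIM('z) * (norm v)\<^sup>2"
  by (intro LIMSEQ_le_const2[OF tendsto_norm]) (use bound in auto)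
qed

text \<open>The function F (x + z) of two variables has the same first derivatives in x and in z, so
  symmetry of second derivatives is the case x0 = 0 of \<open>mixed_derivative\<close>.\<close>

lemma pderiv_dir_commute:
 fixes F :: "'z::euclidean_space => complex"
 assumes F: "smooth F" and ab: "a \<in> Basis" "b \<in> Basis"
 shows "pderiv_dir b (pderiv_dir a F) z = pderiv_dir a (pderiv_dir b F) z"
proof -
 note s = F[unfolded smooth_iff]
 define f where "f x z = F (x + z)" for x z :: 'z
 have sh: "((%z. G (x + z)) has_derivative (%v. pderiv_dir v G (x + z))) (at z)"
   "((%x. G (x + z)) has_derivative (%v. pderiv_dir v G (x + z))) (at x)" if "G differentiable_on UNIV" for G :: "'z => complex" and x z
 proof -
  have 1: "((%z. x + z) has_derivative (%v. v)) (at z)" "((%x. x + z) has_derivative (%v. v)) (at x)"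
   by (auto intro!: derivative_eq_intros)
  show "((%z. G (x + z)) has_derivative (%v. pderiv_dir v G (x + z))) (at z)"
   "((%x. G (x + z)) has_derivative (%v. pderiv_dir v G (x + z))) (at x)"
   using has_derivative_compose[OF 1(1) has_derivative_pderiv'[OF differentiable_on_UNIV_D[OF that]]]
    has_derivative_compose[OF 1(2) has_derivative_pderiv'[OF differentiable_on_UNIV_D[OF that]]] by simp_all
 qed
 have dZs: "dZ c (%x z. G (x + z)) = (%x z. pderiv_dir c G (x + z))"
  and dXs: "dX c (%x z. G (x + z)) = (%x z. pderiv_dir c G (x + z))"
  if "G differentiable_on UNIV" for G :: "'z => complex" and c
  unfolding dZ_def dX_def using pderiv_dir_eq[OF sh(1)[OF that]] pderiv_dir_eq[OF sh(2)[OF that]] by (simp_all add: fun_eq_iff)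
 note d0 = all_derivsD(1)[OF s]
 have d1: "pderiv_dir c F differentiable_on UNIV" if "c \<in> Basis" for c
  using all_derivsD(1)[OF all_derivs_pderiv[OF s that]] .
 have d2: "pderiv_dir c (pderiv_dir c' F) differentiable_on UNIV" if "c \<in> Basis" "c' \<in> Basis" for c c'
  using all_derivsD(1)[OF all_derivs_pderiv[OF all_derivs_pderiv[OF s that(2)] that(1)]] .
 have d3: "continuous_on UNIV (pderiv_dir a (pderiv_dir c (pderiv_dir c' F)))" if "c \<in> Basis" "c' \<in> Basis" for c c'
  using all_derivsD(1)[OF all_derivs_pderiv[OF all_derivs_pderiv[OF all_derivs_pderiv[OF s that(2)] that(1)] ab(1)]]
  by (rule differentiable_imp_continuous_on)
 \<comment> \<open>A point of the unit ball added to a point at distance below 1 from z lies within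
   distance 2 of z.\<close>
 have "\<exists>C. \<forall>y. y \<in> cball z 2 --> norm (pderiv_dir a (pderiv_dir (fst i) (pderiv_dir (snd i) F)) y) <= C" if "i \<in> Basis \<times> Basis" for i
 proof -
  let ?G = "pderiv_dir a (pderiv_dir (fst i) (pderiv_dir (snd i) F))"
  have "compact (?G ` cball z 2)" using that by (intro compact_continuous_image continuous_on_subset[OF d3]) auto
  then have "bounded (?G ` cball z 2)" by (rule compact_imp_bounded)
  then show ?thesis unfolding bounded_iff by blast
 qed
 note B = this
 have "\<exists>D. \<forall>i\<in>Basis \<times> Basis. \<forall>y. y \<in> cball z 2 --> norm (pderiv_dir a (pderiv_dir (fst i) (pderiv_dir (snd i) F)) y) <= D" by (rule finite_uniform_bound) (simp, rule B)
 then obtain D where "\<forall>i\<in>Basis \<times> Basis. \<forall>y. y \<in> cball z 2 --> norm (pderiv_dir a (pderiv_dir (fst i) (pderiv_dir (snd i) F)) y) <= D" by blast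
 then have D: "norm (pderiv_dir a (pderiv_dir c (pderiv_dir c' F)) y) <= D" if "c \<in> Basis" "c' \<in> Basis" "y \<in> cball z 2" for c c' y
  using that by (metis SigmaI fst_conv snd_conv)
 have "(dX a f 0 has_derivative (%v. \<Sum>c\<in>Basis. (v \<bullet> c) *\<^sub>R dX a (dZ c f) 0 z)) (at z)"
 proof (rule mixed_derivative[OF ab(1)])
  show "f x differentiable_on UNIV" "f 0 differentiable_on UNIV" for x unfolding f_def by (rule has_derivative_differentiable_on[OF sh(1)[OF d0]])+
  show "dZ c f x differentiable_on UNIV" if "c \<in> Basis" for c x
   unfolding f_def dZs[OF d0] by (rule has_derivative_differentiable_on[OF sh(1)[OF d1[OF that]]])
  show "(%x. f x z) differentiable_on UNIV" for z unfolding f_def by (rule has_derivative_differentiable_on[OF sh(2)[OF d0]])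
  show "(%x. dZ c f x z) differentiable_on UNIV" if "c \<in> Basis" for c z
   unfolding f_def dZs[OF d0] by (rule has_derivative_differentiable_on[OF sh(2)[OF d1[OF that]]])
  show "(%x. dZ c (dZ c' f) x z) differentiable_on UNIV" if "c' \<in> Basis" "c \<in> Basis" for c c' z
   unfolding f_def dZs[OF d0] dZs[OF d1[OF that(1)]] by (rule has_derivative_differentiable_on[OF sh(2)[OF d2[OF that(2,1)]]])
  fix c' c x y :: 'z assume cc: "c' \<in> (Basis :: 'z set)" "c \<in> (Basis :: 'z set)" and xy: "x \<in> ball 0 1" "y \<in> ball z 1"
  have "dist z (x + y) <= 2" using xy norm_triangle_ineq[of x "y - z"] by (simp add: dist_norm norm_minus_commute algebra_simps)
  then have "norm (pderiv_dir a (pderiv_dir c (pderiv_dir c' F)) (x + y)) <= D"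
   using D[OF cc(2,1), of "x + y"] by simp
  then show "norm (dX a (dZ c (dZ c' f)) x y) <= D"
   unfolding f_def dZs[OF d0] dZs[OF d1[OF cc(1)]] dXs[OF d2[OF cc(2,1)]] .
 qed
 from pderiv_dir_eq[OF this, of b] have "pderiv_dir b (pderiv_dir a F) z = (\<Sum>c\<in>Basis. (b \<bullet> c) *\<^sub>R pderiv_dir a (pderiv_dir c F) z)"
  unfolding f_def dZs[OF d0] dXs[OF d0] using dXs[OF d1] by simp
 also have "\<dots> = (\<Sum>c\<in>Basis. if c = b then pderiv_dir a (pderiv_dir c F) z else 0)"
  using ab by (intro sum.cong refl) (auto simp: inner_Basis)
 finally show ?thesis using ab by simp
qed

lemma mpderiv_commute:
 fixes F :: "'z::euclidean_space => complex"
 assumes F: "smooth F" and b: "b \<in> Basis" and al: "al \<in> lists Basis"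
 shows "pderiv_dir b (mpderiv al F) = mpderiv al (pderiv_dir b F)"
 using al
proof (induction al)
 case (Cons a al)
 then have "smooth (mpderiv al F)" using F all_derivs_mpderiv unfolding smooth_iff by blast
 from pderiv_dir_commute[OF this, of a b] Cons b show ?case by (simp add: fun_eq_iff)
qed simp

text \<open>The candidates for the coinduction are all derivatives of order \<gamma> in x of
  derivatives in xi and y. Interpolation between the two bounds of \<open>CS\<close> gives their
  estimates, and interchanging derivatives shows that the set of candidates is closed.\<close>

theorem CS_imp_symb:
 fixes p :: "'n::finite dsymbol"
 assumes p: "p \<in> CS \<tau> m \<rho> \<delta>" and \<tau>: "\<tau> >= 0" and \<delta>: "\<delta> >= 0"
 shows "symb (frac \<tau>) \<rho> \<delta> (nat \<lfloor>\<tau>\<rfloor>) m (unc p)"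
proof -
 let ?k = "nat \<lfloor>\<tau>\<rfloor>" and ?th = "frac \<tau>" and ?B = "Basis :: (real ^ 'n) set"
 let ?P = "%al \<beta>. mZ (zlist al \<beta>) (unc p)"
 let ?w = "%al \<beta>. m - \<rho> * length al + \<delta> * length \<beta>"
 have sm: "smooth (unc p x)" for x using p by (simp add: CS_def unc_def[abs_def] split_beta')
 obtain C where C: "C >= 0"
  and int1: "!!(f :: real ^ 'n => complex) A l \<gamma> x. f \<in> hoelder_space \<tau> ==> A > 0 ==> l > 0 ==>
   (!!x. norm (f x) <= A) ==> hoelder_norm \<tau> f <= A * l powr \<tau> ==> \<gamma> \<in> lists Basis ==> length \<gamma> <= ?k ==>
   norm (mpderiv \<gamma> f x) <= C * A * l ^ length \<gamma>"
  and int2: "!!(f :: real ^ 'n => complex) A l \<gamma> x y. f \<in> hoelder_space \<tau> ==> A > 0 ==> l > 0 ==>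
   (!!x. norm (f x) <= A) ==> hoelder_norm \<tau> f <= A * l powr \<tau> ==> \<gamma> \<in> lists Basis ==> length \<gamma> <= ?k ==>
   norm (mpderiv \<gamma> f x - mpderiv \<gamma> f y) <= C * A * l ^ length \<gamma> * (dist x y powr ?th * l powr ?th)"
  by (rule hoelder_interpolation[OF \<tau>]) blast
 have hs: "(%x. ?P al \<beta> x z) \<in> hoelder_space \<tau>" if ab: "al \<in> lists Basis" "\<beta> \<in> lists Basis" for al \<beta> z
 proof -
  have "(%x. dsymbol_deriv al \<beta> p x (fst z) (snd z)) \<in> hoelder_space \<tau>" using p ab unfolding CS_def by blast
  then show ?thesis by (simp add: dsymbol_deriv_eq[OF sm ab])
 qed
 have est: "\<exists>A. \<forall>z. A > 0 & hoelder_norm \<tau> (%x. ?P al \<beta> x z) <= A * jb (fst z) powr (?w al \<beta>) * (jb (fst z) powr \<delta>) powr \<tau> \<and>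
  (\<forall>x. norm (?P al \<beta> x z) <= A * jb (fst z) powr (?w al \<beta>))" if ab: "al \<in> lists Basis" "\<beta> \<in> lists Basis" for al \<beta>
 proof -
  from p ab obtain D where "\<forall>xi y. hoelder_norm \<tau> (%x. dsymbol_deriv al \<beta> p x xi y)
     <= D * jb xi powr (m - \<rho> * length al + \<delta> * (\<tau> + length \<beta>)) \<and>
    (\<forall>x. norm (dsymbol_deriv al \<beta> p x xi y) <= D * jb xi powr (?w al \<beta>))"
   unfolding CS_def mem_Collect_eq by meson
  then have D: "hoelder_norm \<tau> (%x. ?P al \<beta> x (xi, y))
     <= D * jb xi powr (m - \<rho> * length al + \<delta> * (\<tau> + length \<beta>)) \<and>
    (\<forall>x. norm (?P al \<beta> x (xi, y)) <= D * jb xi powr (?w al \<beta>))" for xi y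
   unfolding dsymbol_deriv_eq[OF sm ab] by blast
  have e: "jb xi powr (m - \<rho> * length al + \<delta> * (\<tau> + length \<beta>)) = jb xi powr (?w al \<beta>) * (jb xi powr \<delta>) powr \<tau>" for xi :: "real ^ 'n"
   unfolding powr_powr powr_add[symmetric] by (simp add: algebra_simps)
  \<comment> \<open>Interpolation requires a strictly positive bound, while the constant in
    \<open>CS\<close> carries no sign.\<close>
  have "D * a <= (\<bar>D\<bar> + 1) * a" if "a >= 0" for a using that by (intro mult_right_mono) auto
  then have "hoelder_norm \<tau> (%x. ?P al \<beta> x (xi, y)) <= (\<bar>D\<bar> + 1) * jb xi powr (?w al \<beta>) * (jb xi powr \<delta>) powr \<tau> \<and>
   (\<forall>x. norm (?P al \<beta> x (xi, y)) <= (\<bar>D\<bar> + 1) * jb xi powr (?w al \<beta>))" for xi y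
   using D[of xi y] unfolding e mult.assoc by (meson jb_powr_pos(1) less_imp_le mult_nonneg_nonneg order_trans powr_ge_zero)
  then show ?thesis by (intro exI[of _ "\<bar>D\<bar> + 1"]) auto
 qed
 define G where "G \<gamma> al \<beta> = mX \<gamma> (?P al \<beta>)" for \<gamma> al \<beta>
 have GC: "C_k ?k (%x. ?P al \<beta> x z)" if ab: "al \<in> lists Basis" "\<beta> \<in> lists Basis" for al \<beta> z
  using hs[OF that, of z] by (simp add: hoelder_space_def)
 have Gdx: "(%x. G \<gamma> al \<beta> x z) differentiable_on UNIV" if "al \<in> lists Basis" "\<beta> \<in> lists Basis" "\<gamma> \<in> lists Basis" "length \<gamma> < ?k" for \<gamma> al \<beta> z
  using GC[OF that(1,2), of z] that(3,4) unfolding G_def mX_def C_k_def by auto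
 have Gcx: "continuous_on UNIV (%x. G \<gamma> al \<beta> x z)" if "al \<in> lists Basis" "\<beta> \<in> lists Basis" "\<gamma> \<in> lists Basis" "length \<gamma> <= ?k" for \<gamma> al \<beta> z
  using GC[OF that(1,2), of z] that(3,4) unfolding G_def mX_def C_k_def by auto
 have Gb: "sbd (?w al \<beta> + \<delta> * length \<gamma>) (G \<gamma> al \<beta>)"
  and Gh: "shol ?th (?w al \<beta> + \<delta> * length \<gamma> + \<delta> * ?th) (G \<gamma> al \<beta>)"
  if ab: "al \<in> lists Basis" "\<beta> \<in> lists Basis" and \<gamma>: "\<gamma> \<in> lists Basis" "length \<gamma> <= ?k" for \<gamma> al \<beta>
 proof -
  obtain A where A: "!!z. A > 0 & hoelder_norm \<tau> (%x. ?P al \<beta> x z) <= A * jb (fst z) powr (?w al \<beta>) * (jb (fst z) powr \<delta>) powr \<tau> \<and>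
  (\<forall>x. norm (?P al \<beta> x z) <= A * jb (fst z) powr (?w al \<beta>))" using est[OF ab] by blast
  have A0: "A > 0" using A by blast
  have e1: "C * (A * jb xi powr (?w al \<beta>)) * (jb xi powr \<delta>) ^ length \<gamma> = (C * A) * jb xi powr (?w al \<beta> + \<delta> * length \<gamma>)" for xi :: "real ^ 'n"
   by (simp add: powr_add powr_powr[symmetric] powr_realpow mult_ac)
  have e2: "C * (A * jb xi powr (?w al \<beta>)) * (jb xi powr \<delta>) ^ length \<gamma> * (d * (jb xi powr \<delta>) powr ?th) =
   (C * A) * (d * jb xi powr (?w al \<beta> + \<delta> * length \<gamma> + \<delta> * ?th))" for xi :: "real ^ 'n" and d
   unfolding e1 by (simp add: powr_add powr_powr mult_ac)
  have "norm (G \<gamma> al \<beta> x z) <= (C * A) * jb (fst z) powr (?w al \<beta> + \<delta> * length \<gamma>)" for x z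
   unfolding e1[symmetric] G_def mX_def
   by (rule int1[OF hs[OF ab]]) (use A \<gamma> in auto)
  then show "sbd (?w al \<beta> + \<delta> * length \<gamma>) (G \<gamma> al \<beta>)" unfolding sbd_def using C A0 by (intro exI[of _ "C * A"]) auto
  have "norm (G \<gamma> al \<beta> x z - G \<gamma> al \<beta> x' z) <= (C * A) * (dist x x' powr ?th * jb (fst z) powr (?w al \<beta> + \<delta> * length \<gamma> + \<delta> * ?th))" for x x' z
   unfolding e2[symmetric] G_def mX_def
   by (rule int2[OF hs[OF ab]]) (use A \<gamma> in auto)
  then show "shol ?th (?w al \<beta> + \<delta> * length \<gamma> + \<delta> * ?th) (G \<gamma> al \<beta>)" unfolding shol_def using C A0 by (intro exI[of _ "C * A"]) auto
 qed
 \<comment> \<open>\<open>ins1\<close> and \<open>ins2\<close> insert the direction b into the list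
   for xi or for y. A new y derivative has to be moved past the xi derivatives, which is
   \<open>mpderiv_commute\<close>.\<close>
 define ins1 :: "(real ^ 'n) \<times> (real ^ 'n) => (real ^ 'n) list => (real ^ 'n) list"
  where "ins1 b al = (if fst b = 0 then al else fst b # al)" for b al
 define ins2 :: "(real ^ 'n) \<times> (real ^ 'n) => (real ^ 'n) list => (real ^ 'n) list"
  where "ins2 b \<beta> = (if fst b = 0 then snd b # \<beta> else \<beta>)" for b \<beta>
 have ins: "ins1 b al \<in> lists Basis" "ins2 b \<beta> \<in> lists Basis" if "b \<in> Basis" "al \<in> lists Basis" "\<beta> \<in> lists Basis" for b al \<beta>
  using that by (auto simp: ins1_def ins2_def Basis_prod_def)
 have PZ: "?P al \<beta> x differentiable_on UNIV" "dZ b (?P al \<beta>) = ?P (ins1 b al) (ins2 b \<beta>)"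
  if ab: "al \<in> lists Basis" "\<beta> \<in> lists Basis" and b: "b \<in> Basis" for al \<beta> b x
 proof -
  show "?P al \<beta> x differentiable_on UNIV"
   using sm[of x, unfolded smooth_iff] zlist_Basis[OF ab] by (simp add: mZ_def all_derivs_def)
  show "dZ b (?P al \<beta>) = ?P (ins1 b al) (ins2 b \<beta>)"
  proof (cases "fst b = 0")
   case False
   then have "b = (fst b, 0)" using b by (auto simp: Basis_prod_def)
   with False show ?thesis by (simp add: ins1_def ins2_def zlist_def mZ_Cons[symmetric])
  next
   case True
   then have b': "b = (0, snd b)" using b by (auto simp: Basis_prod_def)
   have m1: "map (%a. (a, 0)) al \<in> lists (Basis :: ((real ^ 'n) \<times> (real ^ 'n)) set)"
    and m2: "map (Pair 0) \<beta> \<in> lists (Basis :: ((real ^ 'n) \<times> (real ^ 'n)) set)" using ab by (auto simp: Basis_prod_def)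
   have "dZ b (?P al \<beta>) x = ?P (ins1 b al) (ins2 b \<beta>) x" for x
   proof -
    have "smooth (mpderiv (map (Pair 0) \<beta>) (unc p x))" using all_derivs_mpderiv[OF sm[unfolded smooth_iff] m2] by (simp add: smooth_iff)
    from mpderiv_commute[OF this b m1]
    have "dZ b (?P al \<beta>) x = mpderiv (map (%a. (a, 0)) al) (pderiv_dir b (mpderiv (map (Pair 0) \<beta>) (unc p x)))"
     by (simp add: mZ_def dZ_def[abs_def] zlist_def mpderiv_append)
    also have "\<dots> = ?P (ins1 b al) (ins2 b \<beta>) x"
     using True b' by (simp add: mZ_def ins1_def ins2_def zlist_def mpderiv_append)
    finally show ?thesis .
   qed
   then show ?thesis by blast
  qed
 qed
 \<comment> \<open>\<open>CS\<close> provides x-derivatives of z-derivatives but says nothing about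
   differentiability in z after differentiating in x. This is obtained by induction on \<gamma>, one
   application of \<open>mixed_derivative\<close> for each x-derivative.\<close>
 have GZ: "(\<forall>x. G \<gamma> al \<beta> x differentiable_on UNIV) & (\<forall>b\<in>Basis. dZ b (G \<gamma> al \<beta>) = G \<gamma> (ins1 b al) (ins2 b \<beta>))"
  if "\<gamma> \<in> lists Basis" "length \<gamma> <= ?k" "al \<in> lists Basis" "\<beta> \<in> lists Basis" for \<gamma> al \<beta>
  using that
 proof (induction \<gamma> arbitrary: al \<beta>)
  case Nil
  obtain b0 where "b0 \<in> (Basis :: ((real ^ 'n) \<times> (real ^ 'n)) set)" using nonempty_Basis by blast
  with Nil PZ show ?case by (auto simp: G_def mX_Nil)
 next
  case (Cons a \<gamma>)
  then have \<gamma>: "\<gamma> \<in> lists Basis" "length \<gamma> < ?k" "length \<gamma> <= ?k" and a: "a \<in> Basis"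
   and ab: "al \<in> lists Basis" "\<beta> \<in> lists Basis" by auto
  have Ga: "dX a (G \<gamma> al' \<beta>') = G (a # \<gamma>) al' \<beta>'" for al' \<beta>' by (simp add: G_def mX_Cons)
  have Zd: "!!x. G \<gamma> al' \<beta>' x differentiable_on UNIV" "!!b. b \<in> Basis ==> dZ b (G \<gamma> al' \<beta>') = G \<gamma> (ins1 b al') (ins2 b \<beta>')"
   if "al' \<in> lists Basis" "\<beta>' \<in> lists Basis" for al' \<beta>'
   using Cons.IH[OF \<gamma>(3) that] by auto
  have D: "(dX a (G \<gamma> al \<beta>) x0 has_derivative (%v. \<Sum>b\<in>Basis. (v \<bullet> b) *\<^sub>R dX a (dZ b (G \<gamma> al \<beta>)) x0 z0)) (at z0)" for x0 z0
  proof -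
   have "\<exists>D. \<forall>p. snd p \<in> ball z0 1 --> norm (dX a (dZ (snd i) (dZ (fst i) (G \<gamma> al \<beta>))) (fst p) (snd p)) <= D" if i: "i \<in> Basis \<times> Basis" for i
   proof -
    define b c where bcd: "b = fst i" "c = snd i"
    have bc: "b \<in> Basis" "c \<in> Basis" using i by (auto simp: bcd)
    let ?al = "ins1 c (ins1 b al)" and ?\<beta> = "ins2 c (ins2 b \<beta>)"
    have l: "?al \<in> lists Basis" "?\<beta> \<in> lists Basis" by (rule ins[OF bc(2) ins[OF bc(1) ab]])+
    have "sbd (?w ?al ?\<beta> + \<delta> * length (a # \<gamma>)) (G (a # \<gamma>) ?al ?\<beta>)"
     by (rule Gb[OF l]) (use \<gamma> a in auto)
    then obtain E where E: "E >= 0" "!!x z. norm (G (a # \<gamma>) ?al ?\<beta> x z) <= E * jb (fst z) powr (?w ?al ?\<beta> + \<delta> * length (a # \<gamma>))"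
     by (rule sbd_E) blast
    obtain M where M: "M > 0" "!!z. z \<in> ball z0 1 ==> jb (fst z) powr (?w ?al ?\<beta> + \<delta> * length (a # \<gamma>)) <= M"
     using jb_powr_locally_bounded by blast
    have "dX a (dZ c (dZ b (G \<gamma> al \<beta>))) = G (a # \<gamma>) ?al ?\<beta>"
     using Zd(2)[OF ab bc(1)] Zd(2)[OF _ _ bc(2), of "ins1 b al" "ins2 b \<beta>"] ins[OF bc(1) ab] by (simp add: Ga)
    moreover have "norm (G (a # \<gamma>) ?al ?\<beta> x z) <= E * M" if "z \<in> ball z0 1" for x z
     using E(2)[of x z] mult_left_mono[OF M(2)[OF that] E(1)] by linarith
    ultimately show ?thesis unfolding bcd by (intro exI[of _ "E * M"]) simp
   qed
   note B = this
   have "\<exists>E. \<forall>i\<in>Basis \<times> Basis. \<forall>p. snd p \<in> ball z0 1 --> norm (dX a (dZ (snd i) (dZ (fst i) (G \<gamma> al \<beta>))) (fst p) (snd p)) <= E" by (rule finite_uniform_bound) (simp, rule B)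
   then obtain E where "\<forall>i\<in>Basis \<times> Basis. \<forall>p. snd p \<in> ball z0 1 --> norm (dX a (dZ (snd i) (dZ (fst i) (G \<gamma> al \<beta>))) (fst p) (snd p)) <= E" by blast
   then have E: "norm (dX a (dZ c (dZ b (G \<gamma> al \<beta>))) x z) <= E" if "b \<in> Basis" "c \<in> Basis" "z \<in> ball z0 1" for b c x z
    using that by (metis SigmaI fst_conv snd_conv)
   show ?thesis
   proof (rule mixed_derivative[OF a])
    show "G \<gamma> al \<beta> x differentiable_on UNIV" "G \<gamma> al \<beta> x0 differentiable_on UNIV" for x by (rule Zd[OF ab])+
    show "dZ b (G \<gamma> al \<beta>) x differentiable_on UNIV" if "b \<in> Basis" for b x
     unfolding Zd(2)[OF ab that] by (rule Zd(1)[OF ins[OF that ab]])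
    show "(%x. G \<gamma> al \<beta> x z) differentiable_on UNIV" for z by (rule Gdx[OF ab \<gamma>(1,2)])
    show "(%x. dZ b (G \<gamma> al \<beta>) x z) differentiable_on UNIV" if "b \<in> Basis" for b z
     unfolding Zd(2)[OF ab that] by (rule Gdx[OF ins[OF that ab] \<gamma>(1,2)])
    show "(%x. dZ c (dZ b (G \<gamma> al \<beta>)) x z) differentiable_on UNIV" if "b \<in> Basis" "c \<in> Basis" for b c z
     unfolding Zd(2)[OF ab that(1)] Zd(2)[OF ins[OF that(1) ab] that(2)]
     by (rule Gdx[OF ins[OF that(2) ins[OF that(1) ab]] \<gamma>(1,2)])
    show "norm (dX a (dZ c (dZ b (G \<gamma> al \<beta>))) x z) <= E" if "b \<in> Basis" "c \<in> Basis" "z \<in> ball z0 1" for b c x z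
     by (rule E[OF that])
   qed
  qed
  show ?case
  proof (intro conjI allI ballI)
   show "G (a # \<gamma>) al \<beta> x differentiable_on UNIV" for x
    unfolding Ga[symmetric] by (rule has_derivative_differentiable_on[OF D])
   fix b :: "(real ^ 'n) \<times> (real ^ 'n)" assume b: "b \<in> Basis"
   have "dZ b (dX a (G \<gamma> al \<beta>)) x z = dX a (dZ b (G \<gamma> al \<beta>)) x z" for x z
   proof -
    have "dZ b (dX a (G \<gamma> al \<beta>)) x z = (\<Sum>c\<in>Basis. (b \<bullet> c) *\<^sub>R dX a (dZ c (G \<gamma> al \<beta>)) x z)"
     unfolding dZ_def[of b] by (rule pderiv_dir_eq[OF D])
    also have "\<dots> = (\<Sum>c\<in>Basis. if c = b then dX a (dZ c (G \<gamma> al \<beta>)) x z else 0)"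
     using b by (intro sum.cong refl) (auto simp: inner_Basis)
    finally show ?thesis using b by simp
   qed
   then show "dZ b (G (a # \<gamma>) al \<beta>) = G (a # \<gamma>) (ins1 b al) (ins2 b \<beta>)"
    unfolding Ga[symmetric] Zd(2)[OF ab b, symmetric] by blast
  qed
 qed
 let ?X = "%k w f. \<exists>\<gamma> al \<beta>. \<gamma> \<in> lists Basis & al \<in> lists Basis & \<beta> \<in> lists Basis & length \<gamma> + k = ?k \<and>
   w = ?w al \<beta> + \<delta> * length \<gamma> & f = G \<gamma> al \<beta>"
 let ?Y = "%k w f. ?X k w f \<or> symb ?th \<rho> \<delta> k w f"
 show ?thesis
 proof (rule symb_coinduct_alg[where X = ?X])
  have "unc p = G [] [] []" by (simp add: G_def mX_Nil zlist_def mZ_Nil)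
  then have "?X ?k m (unc p)" by (intro exI[of _ "[]"]) auto
  then show "salg ?Y ?k m (unc p)" by (intro salg_gen[where k = ?k and w = m]) auto
 next
  fix k w f assume "?X k w f"
  then obtain \<gamma> al \<beta> where l: "\<gamma> \<in> lists Basis" "al \<in> lists Basis" "\<beta> \<in> lists Basis" and k: "length \<gamma> + k = ?k"
   and w: "w = ?w al \<beta> + \<delta> * length \<gamma>" and f: "f = G \<gamma> al \<beta>" by blast
  have lk: "length \<gamma> <= ?k" using k by simp
  note gz = GZ[OF l(1) lk l(2,3)]
  show "sbase ?th \<delta> k w f"
   unfolding sbase_def f w
   using gz Gcx[OF l(2,3,1) lk] Gb[OF l(2,3,1) lk] Gh[OF l(2,3,1) lk] Gdx[OF l(2,3,1)] k by auto
  { fix b :: "(real ^ 'n) \<times> (real ^ 'n)" assume b: "b \<in> Basis"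
   then have "dZ b f = G \<gamma> (ins1 b al) (ins2 b \<beta>)" using gz by (simp add: f)
   moreover have "w + wt \<rho> \<delta> b = ?w (ins1 b al) (ins2 b \<beta>) + \<delta> * length \<gamma>"
    by (simp add: w ins1_def ins2_def wt_def algebra_simps)
   ultimately have "?X k (w + wt \<rho> \<delta> b) (dZ b f)" using l k ins[OF b l(2,3)] by blast
   then show "salg ?Y k (w + wt \<rho> \<delta> b) (dZ b f)" by (intro salg_gen[where k = k and w = "w + wt \<rho> \<delta> b"]) auto }
  { fix a :: "real ^ 'n" assume a: "a \<in> Basis" and k0: "k > 0"
   have "?X (k - 1) (w + \<delta>) (dX a f)"
    by (intro exI[of _ "a # \<gamma>"] exI[of _ al] exI[of _ \<beta>])
     (use l k k0 a in \<open>auto simp: w f G_def mX_Cons algebra_simps\<close>)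
   then show "salg ?Y (k - 1) (w + \<delta>) (dX a f)" by (intro salg_gen[where k = "k - 1" and w = "w + \<delta>"]) auto }
 qed
qed


section \<open>Oscillatory integrals\<close>

lemma integrable_dw_prod:
 "integrable (lborel \<Otimes>\<^sub>M lborel) (%p::'a::euclidean_space \<times> 'b::euclidean_space. dw (fst p) * dw (snd p))"
proof (rule lborel_pair.Fubini_integrable)
 show "(%p::'a \<times> 'b. dw (fst p) * dw (snd p)) \<in> borel_measurable (lborel \<Otimes>\<^sub>M lborel)"
  using borel_measurable_integrable[OF integrable_dw[where 'a = 'a]] borel_measurable_integrable[OF integrable_dw[where 'a = 'b]]
  by measurable
 have "(%x::'a. \<integral>y. norm (dw (fst (x, y)) * dw (snd (x, y :: 'b))) \<partial>lborel) = (%x. dw x * (\<integral>y. dw (y :: 'b) \<partial>lborel))"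
  by (simp add: norm_mult)
 then show "integrable lborel (%x::'a. \<integral>y. norm (dw (fst (x, y)) * dw (snd (x, y :: 'b))) \<partial>lborel)"
  using integrable_mult_left[OF integrable_dw] by simp
 show "AE x in lborel. integrable lborel (%y::'b. dw (fst (x :: 'a, y)) * dw (snd (x, y)))"
  by (simp add: integrable_dw)
qed

lemma continuous_integrable_prod:
 fixes g :: "'a::euclidean_space \<times> 'b::euclidean_space => complex"
 assumes "continuous_on UNIV g" "!!xi y. norm (g (xi, y)) <= C * (dw xi * dw y)"
 shows "integrable (lborel \<Otimes>\<^sub>M lborel) g"
proof (rule Bochner_Integration.integrable_bound[OF integrable_mult_right[OF integrable_dw_prod, of C]])
 show "g \<in> borel_measurable (lborel \<Otimes>\<^sub>M lborel)"
  using borel_measurable_continuous_onI[OF assms(1)] by (simp add: lborel_prod)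
 show "AE x in lborel \<Otimes>\<^sub>M lborel. norm (g x) <= norm (C * (dw (fst x) * dw (snd x)))"
  using assms(2) by (intro AE_I2) (metis abs_ge_self order_trans prod.collapse real_norm_def)
qed

text \<open>A Peetre-type inequality: 1 + |x| <= (1 + |y|) (1 + |x + y|).\<close>

lemma dw_shift_general: "dw (x + y :: 'a::euclidean_space) <= (1 + norm y) ^ (DIM('a) + 2) * dw x"
proof -
 have "norm x <= norm (x + y) + norm y" using norm_triangle_ineq4[of "x + y" y] by simp
 then have le: "1 + norm x <= (1 + norm y) * (1 + norm (x + y))"
 proof -
  assume "norm x <= norm (x + y) + norm y"
  moreover have "0 <= norm y * norm (x + y)" by simp
  ultimately show ?thesis unfolding distrib_left distrib_right by linarith
 qed
 have "(1 + norm x) ^ (DIM('a) + 2) <= ((1 + norm y) * (1 + norm (x + y))) ^ (DIM('a) + 2)"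
  by (intro power_mono le) auto
 moreover have "(1 + norm x) ^ (DIM('a) + 2) > 0" "(1 + norm (x + y)) ^ (DIM('a) + 2) > 0"
  by (auto intro!: zero_less_power simp: add_pos_nonneg)
 ultimately show ?thesis
  unfolding dw_def power_mult_distrib by (simp add: field_simps)
qed

lemma jb_powr_dw:
 assumes "a <= - real (DIM('v) + 2)"
 shows "jb (xi :: 'v::euclidean_space) powr a <= 2 ^ (DIM('v) + 2) * dw xi"
proof -
 have "jb xi powr a <= jb xi powr (- real (DIM('v) + 2))" by (rule jb_powr_mono[OF assms])
 also have "\<dots> = 1 / jb xi ^ (DIM('v) + 2)" using jb_pos[of xi] by (simp only: powr_minus_divide powr_realpow)
 also have "\<dots> <= 2 ^ (DIM('v) + 2) * dw xi"
 proof -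
  have "(1 + norm xi) ^ (DIM('v) + 2) <= (2 * jb xi) ^ (DIM('v) + 2)" by (intro power_mono le_jb) auto
  moreover have "(1 + norm xi) ^ (DIM('v) + 2) > 0" "jb xi ^ (DIM('v) + 2) > 0" by (auto intro!: zero_less_power simp: add_pos_nonneg)
  ultimately show ?thesis unfolding dw_def power_mult_distrib by (simp add: field_simps)
 qed
 finally show ?thesis .
qed

section \<open>The iterated integral behind the oscillatory integral\<close>

text \<open>A Fourier transform in y with an amplitude that depends on the frequency: the same xi
  occurs in the phase and in \<open>f\<close>.\<close>

definition FT :: "('x => 'v::euclidean_space \<times> 'v => complex) => ('v => complex) => 'x => 'v => complex" where
 "FT f v x xi = (\<integral>y. cis (- (y \<bullet> xi)) * f x (xi, y) * v y \<partial>lborel)"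

text \<open>For x0 = x this is (2 pi)^n times the value of the operator (\<open>pdo_eq_SI\<close>).
  The base point x0 of the phase is kept apart from the first argument of \<open>f\<close>, because
  that slot is also used for a cut-off parameter.\<close>

definition SI :: "('x => 'v::euclidean_space \<times> 'v => complex) => ('v => complex) => 'x => 'v => complex" where
 "SI f v x x0 = (\<integral>xi. cis (x0 \<bullet> xi) * FT f v x xi \<partial>lborel)"

lemma Sch_dw:
 assumes "Sch (v :: 'v::euclidean_space => complex)" obtains D where "D > 0" "!!y. norm (v y) <= D * dw y"
proof -
 obtain D where "D > 0" "!!y. norm (v y) <= D / (1 + norm y) ^ (DIM('v) + 2)"
  by (rule Sch_bound[OF assms, of "DIM('v) + 2"]) blast
 then show ?thesis by (intro that[of D]) (auto simp: dw_def)
qed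

lemma continuous_on_cis [continuous_intros]: "continuous_on S f ==> continuous_on S (%x. cis (f x))"
 unfolding cis_conv_exp by (intro continuous_intros)

context symbols
begin

lemma FT_integrand:
 fixes f :: "'x::euclidean_space => 'v::euclidean_space \<times> 'v => complex"
 assumes f: "symb th \<rho> \<delta> k w f" and v: "Sch v"
 obtains C where "C >= 0" "!!x xi y. norm (cis (- (y \<bullet> xi)) * f x (xi, y) * v y) <= C * jb xi powr w * dw y"
  "!!x xi. integrable lborel (%y. cis (- (y \<bullet> xi)) * f x (xi, y) * v y)"
proof -
 obtain C where C: "C >= 0" "!!x z. norm (f x z) <= C * jb (fst z) powr w" using symb_bound[OF f] by blast
 obtain D where D: "D > 0" "!!y. norm (v y) <= D * dw y" using Sch_dw[OF v] by blast
 have b: "norm (cis (- (y \<bullet> xi)) * f x (xi, y) * v y) <= (C * D) * jb xi powr w * dw y" for x xi y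
  using mult_mono[OF C(2)[of x "(xi, y)"] D(2)[of y]] C(1) by (simp add: norm_mult mult_ac)
 have i: "integrable lborel (%y. cis (- (y \<bullet> xi)) * f x (xi, y) * v y)" for x xi
 proof (rule continuous_integrable)
  show "continuous_on UNIV (%y. cis (- (y \<bullet> xi)) * f x (xi, y) * v y)"
   by (intro continuous_intros symb_joint_cont[OF f] Cb_D(3)[OF Sch_Cb[OF v]])
 qed (rule b)
 show ?thesis by (rule that[of "C * D"]) (use C(1) D(1) b i in auto)
qed

lemma FT_integrable:
 assumes "symb th \<rho> \<delta> k w f" "Sch v"
 shows "integrable lborel (%y. cis (- (y \<bullet> xi)) * f x (xi, y) * v y)"
 by (rule FT_integrand[OF assms]) blast

lemma FT_bound:
 fixes f :: "'x::euclidean_space => 'v::euclidean_space \<times> 'v => complex"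
 assumes "symb th \<rho> \<delta> k w f" "Sch v"
 shows "\<exists>C\<ge>0. \<forall>x xi. norm (FT f v x xi) <= C * jb xi powr w"
proof -
 obtain C where C: "C >= 0" "!!x xi y. norm (cis (- (y \<bullet> xi)) * f x (xi, y) * v y) <= C * jb xi powr w * dw y"
  by (rule FT_integrand[OF assms]) blast
 have "norm (FT f v x xi) <= C * (\<integral>y. dw (y :: 'v) \<partial>lborel) * jb xi powr w" for x xi
 proof -
  have "norm (FT f v x xi) <= (\<integral>y. C * jb xi powr w * dw (y :: 'v) \<partial>lborel)"
   unfolding FT_def by (rule Bochner_Integration.integral_norm_bound_integral[OF FT_integrable[OF assms] integrable_cmult_dw]) (use C in auto)
  then show ?thesis by (simp add: mult_ac)
 qed
 moreover have "(\<integral>y. dw (y :: 'v) \<partial>lborel) >= 0" by simp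
 ultimately show ?thesis using C(1) by (intro exI[of _ "C * (\<integral>y. dw (y :: 'v) \<partial>lborel)"]) auto
qed

lemma FT_cont:
 fixes f :: "'x::euclidean_space => 'v::euclidean_space \<times> 'v => complex"
 assumes f: "symb th \<rho> \<delta> k w f" and v: "Sch v" and a: "continuous_on S a" and b: "continuous_on S b"
 shows "continuous_on S (%t. FT f v (a t) (b t))"
proof -
 obtain C where C: "C >= 0" "!!x xi y. norm (cis (- (y \<bullet> xi)) * f x (xi, y) * v y) <= C * jb xi powr w * dw y"
  "!!x xi. integrable lborel (%y. cis (- (y \<bullet> xi)) * f x (xi, y) * v y)"
  by (rule FT_integrand[OF f v]) blast
 have "continuous (at p0) (%p. FT f v (fst p) (snd p))" for p0 :: "'x \<times> 'v"
 proof -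
  obtain M where M: "M > 0" "!!z. z \<in> ball (snd p0, 0 :: 'v) 1 ==> jb (fst z) powr w <= M"
   using jb_powr_locally_bounded by blast
  show ?thesis
  unfolding FT_def
 proof (rule continuous_at_integral[where r = 1])
  show "integrable lborel (%y::'v. C * M * dw y)" by (rule integrable_cmult_dw)
  fix p and y :: 'v assume p: "p \<in> ball p0 1"
  have "(snd p, 0) \<in> ball (snd p0, 0 :: 'v) 1"
   using p dist_snd_le[of p0 p] by (simp add: dist_Pair_Pair)
  from mult_left_mono[OF M(2)[OF this] C(1)] have "C * jb (snd p) powr w * dw y <= C * M * dw y"
   by (intro mult_right_mono) auto
  with C(2) order_trans show "norm (cis (- (y \<bullet> snd p)) * f (fst p) (snd p, y) * v y) <= C * M * dw y" by blast
 next
  fix y :: 'v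
  have "continuous_on UNIV (%p. cis (- (y \<bullet> snd p)) * f (fst p) (snd p, y) * v y)"
   by (intro continuous_intros symb_joint_cont[OF f])
  then show "continuous (at p0) (%p. cis (- (y \<bullet> snd p)) * f (fst p) (snd p, y) * v y)"
   using continuous_on_eq_continuous_at[OF open_UNIV] by blast
 qed (use borel_measurable_integrable[OF C(3)] in auto)
 qed
 then have "continuous_on UNIV (%p. FT f v (fst p) (snd p))" using continuous_on_eq_continuous_at[OF open_UNIV] by blast
 from continuous_on_compose2[OF this continuous_on_Pair[OF a b]] show ?thesis by simp
qed

lemma cis_line_derivative:
 "((%y. cis (- (y \<bullet> xi))) has_derivative (%v. - \<i> * of_real (v \<bullet> xi) * cis (- (y \<bullet> xi)))) (at y)"
proof -
 have "((%y. \<i> * complex_of_real (- (y \<bullet> xi))) has_derivative (%v. \<i> * complex_of_real (- (v \<bullet> xi)))) (at y)"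
  by (auto intro!: derivative_eq_intros)
 from has_derivative_compose[OF this DERIV_exp[unfolded has_field_derivative_def]] show ?thesis
  unfolding cis_conv_exp by (simp add: mult_ac)
qed

text \<open>The integral over y of a derivative vanishes. The derivative of the phase produces the
  factor xi_b, the other two terms arise from \<open>f\<close> and \<open>v\<close>.\<close>

lemma FT_by_parts:
 fixes f :: "'x::euclidean_space => 'v::euclidean_space \<times> 'v => complex"
 assumes f: "symb th \<rho> \<delta> k w f" and v: "Sch v" and b: "b \<in> Basis"
 shows "\<i> * of_real (xi \<bullet> b) * FT f v x xi = FT (dZ (0, b) f) v x xi + FT f (pderiv_dir b v) x xi"
proof -
 have b0: "(0, b) \<in> (Basis :: ('v \<times> 'v) set)" using b by (auto simp: Basis_prod_def)
 note f' = symb_dZ[OF f b0]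
 note v' = Sch_pderiv[OF v b]
 let ?g = "%y::'v. cis (- (y \<bullet> xi)) * f x (xi, y) * v y"
 let ?g1 = "%y::'v. cis (- (y \<bullet> xi)) * dZ (0, b) f x (xi, y) * v y"
 let ?g2 = "%y::'v. cis (- (y \<bullet> xi)) * f x (xi, y) * pderiv_dir b v y"
 obtain C where C: "C >= 0" "!!y. norm (?g y) <= C * jb xi powr w * dw y" "integrable lborel ?g"
  by (rule FT_integrand[OF f v]) blast
 obtain C1 where C1: "C1 >= 0" "!!y. norm (?g1 y) <= C1 * jb xi powr (w + wt \<rho> \<delta> (0 :: 'v, b)) * dw y" "integrable lborel ?g1"
  by (rule FT_integrand[OF f' v]) blast
 obtain C2 where C2: "C2 >= 0" "!!y. norm (?g2 y) <= C2 * jb xi powr w * dw y" "integrable lborel ?g2"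
  by (rule FT_integrand[OF f v']) blast
 have df: "((%y. f x (xi, y)) has_derivative (%u. pderiv_dir (0, u) (f x) (xi, y))) (at y)" for y
 proof -
  have "((%y. (xi, y)) has_derivative (%u. (0, u))) (at y)" by (auto intro!: derivative_eq_intros)
  from has_derivative_compose[OF this has_derivative_pderiv'[OF differentiable_on_UNIV_D[OF symb_diff[OF f]]]]
  show ?thesis .
 qed
 have dg: "(?g has_derivative (%u. cis (- (y \<bullet> xi)) * f x (xi, y) * pderiv_dir u v y +
   (cis (- (y \<bullet> xi)) * pderiv_dir (0, u) (f x) (xi, y) + - \<i> * of_real (u \<bullet> xi) * cis (- (y \<bullet> xi)) * f x (xi, y)) * v y)) (at y)" for y
  by (rule has_derivative_mult[OF has_derivative_mult[OF cis_line_derivative df] has_derivative_pderiv'[OF differentiable_on_UNIV_D[OF all_derivsD(1)[OF v]]]])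
 have pg: "pderiv_dir b ?g = (%y. ?g1 y + ?g2 y - \<i> * of_real (xi \<bullet> b) * ?g y)"
  using pderiv_dir_eq[OF dg, of b] by (auto simp: fun_eq_iff dZ_def algebra_simps inner_commute)
 let ?K = "C * jb xi powr w + C1 * jb xi powr (w + wt \<rho> \<delta> (0 :: 'v, b)) + C2 * jb xi powr w + norm (xi \<bullet> b) * (C * jb xi powr w)"
 have "integral\<^sup>L lborel (pderiv_dir b ?g) = 0"
 proof (rule integral_pderiv_zero[OF _ b, where C = ?K])
  show "?g differentiable_on UNIV" by (rule has_derivative_differentiable_on[OF dg])
  show "continuous_on UNIV (pderiv_dir b ?g)" unfolding pg
   by (intro continuous_intros symb_joint_cont[OF f] symb_joint_cont[OF f'] Cb_D(3)[OF Sch_Cb[OF v]] Cb_D(3)[OF Sch_Cb[OF v']])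
  fix y :: 'v
  have "C * jb xi powr w * dw y <= ?K * dw y" using C(1) C1(1) C2(1) by (intro mult_right_mono) auto
  with C(2)[of y] show "norm (?g y) <= ?K * dw y" by simp
  have "norm (pderiv_dir b ?g y) <= norm (?g1 y) + norm (?g2 y) + norm (xi \<bullet> b) * norm (?g y)"
   unfolding pg using norm_triangle_ineq4[of "?g1 y + ?g2 y" "\<i> * of_real (xi \<bullet> b) * ?g y"] norm_triangle_ineq[of "?g1 y" "?g2 y"]
   by (simp add: norm_mult)
  also have "\<dots> <= C1 * jb xi powr (w + wt \<rho> \<delta> (0 :: 'v, b)) * dw y + C2 * jb xi powr w * dw y + norm (xi \<bullet> b) * (C * jb xi powr w * dw y)"
   by (intro add_mono mult_left_mono C C1 C2) auto
  also have "\<dots> <= ?K * dw y" using C(1) by (simp add: algebra_simps)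
  finally show "norm (pderiv_dir b ?g y) <= ?K * dw y" .
 qed
 moreover have "integral\<^sup>L lborel (pderiv_dir b ?g) = FT (dZ (0, b) f) v x xi + FT f (pderiv_dir b v) x xi - \<i> * of_real (xi \<bullet> b) * FT f v x xi"
  unfolding pg FT_def
  by (subst Bochner_Integration.integral_diff, (intro Bochner_Integration.integrable_add C1(3) C2(3) integrable_mult_right C(3))+,
    subst Bochner_Integration.integral_add[OF C1(3) C2(3)], subst integral_mult_right_zero) simp
 ultimately show ?thesis by simp
qed

text \<open>Each integration by parts in y gains a factor 1 / jb xi and loses at most jb xi powr
  \<delta>, namely when the derivative falls on \<open>f\<close>.\<close>

lemma FT_decay_step:
 assumes "symb th \<rho> \<delta> k w f" "Sch v"
 shows "\<exists>C\<ge>0. \<forall>x xi. norm (FT f v x xi) <= C * jb xi powr (w - real j * (1 - \<delta>))"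
 using assms
proof (induction j arbitrary: w f v)
 case 0
 then show ?case using FT_bound by simp
next
 case (Suc j)
 let ?a = "w + \<delta> - real j * (1 - \<delta>)"
 obtain C where C: "C >= 0" "!!x xi. norm (FT f v x xi) <= C * jb xi powr (w - real j * (1 - \<delta>))"
  using Suc.IH[OF Suc.prems] by blast
 have "\<exists>C\<ge>0. \<forall>x xi. norm (of_real (xi \<bullet> b) * FT f v x xi) <= C * jb xi powr ?a" if b: "b \<in> Basis" for b
 proof -
  have b0: "(0, b) \<in> (Basis :: ('b \<times> 'b) set)" using b by (auto simp: Basis_prod_def)
  have "symb th \<rho> \<delta> k (w + \<delta>) (dZ (0, b) f)" using symb_dZ[OF Suc.prems(1) b0] by (simp add: wt_def)
  from Suc.IH[OF this Suc.prems(2)] obtain C1 where C1: "C1 >= 0" "!!x xi. norm (FT (dZ (0, b) f) v x xi) <= C1 * jb xi powr ?a" by blast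
  \<comment> \<open>\<open>f\<close> is regarded as a symbol of the larger order w + \<delta>, so
    that both terms of the partial integration have the exponent \<open>?a\<close>.\<close>
  have "symb th \<rho> \<delta> k (w + \<delta>) f" by (rule symb_mono[OF Suc.prems(1)]) (use delta_nonneg in auto)
  from Suc.IH[OF this Sch_pderiv[OF Suc.prems(2) b]] obtain C2 where C2: "C2 >= 0" "!!x xi. norm (FT f (pderiv_dir b v) x xi) <= C2 * jb xi powr ?a" by blast
  have "norm (of_real (xi \<bullet> b) * FT f v x xi) <= (C1 + C2) * jb xi powr ?a" for x xi
  proof -
   have "norm (of_real (xi \<bullet> b) * FT f v x xi) = norm (\<i> * of_real (xi \<bullet> b) * FT f v x xi)" by (simp add: norm_mult)
   also have "\<dots> <= norm (FT (dZ (0, b) f) v x xi) + norm (FT f (pderiv_dir b v) x xi)"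
    unfolding FT_by_parts[OF Suc.prems b] by (rule norm_triangle_ineq)
   also have "\<dots> <= (C1 + C2) * jb xi powr ?a" using C1(2)[of x xi] C2(2)[of x xi] by (simp add: distrib_right)
   finally show ?thesis .
  qed
  then show ?thesis using C1(1) C2(1) by (intro exI[of _ "C1 + C2"]) auto
 qed
 then obtain D where D: "!!b. b \<in> Basis ==> D b >= 0" "!!b x xi. b \<in> Basis ==> norm (of_real (xi \<bullet> b) * FT f v x xi) <= D b * jb xi powr ?a"
  by metis
 let ?E = "C + (\<Sum>b\<in>Basis. D b)"
 have "norm (FT f v x xi) <= ?E * jb xi powr (w - real (Suc j) * (1 - \<delta>))" for x xi
 proof -
  have "norm xi * norm (FT f v x xi) <= (\<Sum>b\<in>Basis. norm (xi \<bullet> b)) * norm (FT f v x xi)"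
   using norm_le_l1[of xi] by (intro mult_right_mono) auto
  also have "\<dots> = (\<Sum>b\<in>Basis. norm (of_real (xi \<bullet> b) * FT f v x xi))" by (simp add: sum_distrib_right norm_mult)
  also have "\<dots> <= (\<Sum>b\<in>Basis. D b * jb xi powr ?a)" by (intro sum_mono D)
  finally have 1: "norm xi * norm (FT f v x xi) <= (\<Sum>b\<in>Basis. D b) * jb xi powr ?a" by (simp add: sum_distrib_right)
  have "norm (FT f v x xi) <= C * jb xi powr ?a"
   by (rule order_trans[OF C(2)]) (intro mult_left_mono jb_powr_mono C, use delta_nonneg in auto)
  with 1 have "(1 + norm xi) * norm (FT f v x xi) <= ?E * jb xi powr ?a" by (simp add: distrib_right)
  then have "jb xi * norm (FT f v x xi) <= ?E * jb xi powr ?a"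
   using mult_right_mono[OF jb_le[of xi] norm_ge_zero[of "FT f v x xi"]] by linarith
  then have "norm (FT f v x xi) <= ?E * (jb xi powr ?a / jb xi)" by (simp add: field_simps)
  also have "jb xi powr ?a / jb xi = jb xi powr (?a - 1)" by (simp add: powr_diff)
  finally show ?thesis by (simp add: algebra_simps)
 qed
 moreover have "?E >= 0" using C(1) D(1) by (intro add_nonneg_nonneg sum_nonneg) auto
 ultimately show ?case by blast
qed

text \<open>Because \<delta> < 1, finitely many steps bring any order w below -(n + 2). The outer
  integral in \<open>SI\<close> then converges absolutely, with a bound uniform in x.\<close>

lemma FT_decay:
 fixes f :: "'x::euclidean_space => 'v::euclidean_space \<times> 'v => complex"
 assumes "symb th \<rho> \<delta> k w f" "Sch v"
 obtains C where "C >= 0" "!!x xi. norm (FT f v x xi) <= C * dw xi"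
proof -
 have "1 - \<delta> > 0" using orders by simp
 then obtain j :: nat where "real j * (1 - \<delta>) > w + real (DIM('v) + 2)" using reals_Archimedean3 by blast
 then have a: "w - real j * (1 - \<delta>) <= - real (DIM('v) + 2)" by simp
 obtain C where C: "C >= 0" "!!x xi. norm (FT f v x xi) <= C * jb xi powr (w - real j * (1 - \<delta>))"
  using FT_decay_step[OF assms] by blast
 have "norm (FT f v x xi) <= (C * 2 ^ (DIM('v) + 2)) * dw xi" for x xi
  using C(2)[of x xi] mult_left_mono[OF jb_powr_dw[OF a, of xi] C(1)] by (simp add: mult.assoc)
 then show ?thesis using C(1) by (intro that[of "C * 2 ^ (DIM('v) + 2)"]) auto
qed

lemma SI_integrable:
 assumes "symb th \<rho> \<delta> k w f" "Sch v"
 shows "integrable lborel (%xi. cis (x0 \<bullet> xi) * FT f v x xi)"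
proof -
 obtain C where C: "C >= 0" "!!x xi. norm (FT f v x xi) <= C * dw xi" using FT_decay[OF assms] by blast
 show ?thesis
  by (rule continuous_integrable[where C = C]) (intro continuous_intros FT_cont[OF assms], use C in \<open>simp add: norm_mult\<close>)
qed

lemma SI_cont:
 fixes f :: "'x::euclidean_space => 'v::euclidean_space \<times> 'v => complex"
 assumes f: "symb th \<rho> \<delta> k w f" and v: "Sch v" and a: "continuous_on S a" and b: "continuous_on S b"
 shows "continuous_on S (%t. SI f v (a t) (b t))"
proof -
 obtain C where C: "C >= 0" "!!x xi. norm (FT f v x xi) <= C * dw xi" using FT_decay[OF f v] by blast
 have "continuous (at p0) (%p. SI f v (fst p) (snd p))" for p0 :: "'x \<times> 'v"
  unfolding SI_def
 proof (rule continuous_at_integral[where r = 1])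
  show "integrable lborel (%xi::'v. C * dw xi)" by (rule integrable_cmult_dw)
  show "norm (cis (snd p \<bullet> xi) * FT f v (fst p) xi) <= C * dw xi" for p xi using C by (simp add: norm_mult)
  fix xi
  have "continuous_on UNIV (%p. cis (snd p \<bullet> xi) * FT f v (fst p) xi)"
   by (intro continuous_intros FT_cont[OF f v])
  then show "continuous (at p0) (%p. cis (snd p \<bullet> xi) * FT f v (fst p) xi)"
   using continuous_on_eq_continuous_at[OF open_UNIV] by blast
 qed (use borel_measurable_integrable[OF SI_integrable[OF f v]] in auto)
 then have "continuous_on UNIV (%p. SI f v (fst p) (snd p))" using continuous_on_eq_continuous_at[OF open_UNIV] by blast
 from continuous_on_compose2[OF this continuous_on_Pair[OF a b]] show ?thesis by simp
qed

lemma SI_bounded: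
 fixes f :: "'x::euclidean_space => 'v::euclidean_space \<times> 'v => complex"
 assumes "symb th \<rho> \<delta> k w f" "Sch v"
 obtains C where "!!x x0. norm (SI f v x x0) <= C"
proof -
 obtain C where C: "C >= 0" "!!x xi. norm (FT f v x xi) <= C * dw xi" using FT_decay[OF assms] by blast
 have "norm (SI f v x x0) <= (\<integral>xi. C * dw (xi :: 'v) \<partial>lborel)" for x x0
  unfolding SI_def
  by (rule Bochner_Integration.integral_norm_bound_integral[OF SI_integrable[OF assms] integrable_cmult_dw])
   (use C in \<open>simp add: norm_mult\<close>)
 then show ?thesis by (rule that)
qed

lemma SI_add:
 assumes f: "symb th \<rho> \<delta> k w f" and g: "symb th \<rho> \<delta> k w' g" and v: "Sch v"
 shows "SI (%x z. f x z + g x z) v x x0 = SI f v x x0 + SI g v x x0"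
proof -
 have "FT (%x z. f x z + g x z) v x xi = FT f v x xi + FT g v x xi" for xi
  unfolding FT_def using Bochner_Integration.integral_add[OF FT_integrable[OF f v] FT_integrable[OF g v]]
  by (simp add: algebra_simps)
 then show ?thesis unfolding SI_def
  using Bochner_Integration.integral_add[OF SI_integrable[OF f v] SI_integrable[OF g v]] by (simp add: algebra_simps)
qed

end

section \<open>Cut-offs and existence of the oscillatory integral\<close>

lemma shol_zero: "sbd w f ==> shol 0 w f"
proof -
 assume "sbd w f"
 then obtain C where C: "C >= 0" "!!x z. norm (f x z) <= C * jb (fst z) powr w" by (rule sbd_E) blast
 have "norm (f x z - f x' z) <= 2 * C * (dist x x' powr 0 * jb (fst z) powr w)" for x x' z
  using norm_triangle_ineq4[of "f x z" "f x' z"] C(2)[of x z] C(2)[of x' z] by (cases "x = x'") auto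
 then show "shol 0 w f" unfolding shol_def using C(1) by (intro exI[of _ "2 * C"]) auto
qed

text \<open>A cut-off with parameter \<open>\<epsilon> = e t\<close> is a symbol of order \<open>0\<close>, where \<open>t\<close> plays the role of
 the first variable. This makes the limit \<open>\<epsilon> \<rightarrow> 0\<close> an instance of continuity in that variable.\<close>

lemma symb_cutoff:
 fixes \<kappa> :: "'v::euclidean_space \<times> 'v => complex" and e :: "'x::euclidean_space => real"
 assumes \<kappa>: "Sch \<kappa>" and e: "continuous_on UNIV e" "!!t. 0 <= e t" "!!t. e t <= 1"
 shows "symb 0 1 0 0 0 (%t z. \<kappa> (e t *\<^sub>R fst z, e t *\<^sub>R (snd z - x0)))"
proof -
 \<comment> \<open>After j derivatives the factor (e t)^j has come out. It gives order -j uniformly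
   in t: (e t * jb xi)^j is at most (1 + |p|)^j for the argument p of \<kappa>, which the rapid
   decay of \<kappa> absorbs.\<close>
 define \<Phi> where "\<Phi> j \<kappa> t z = complex_of_real (e t ^ j) * \<kappa> (e t *\<^sub>R fst z, e t *\<^sub>R (snd z - x0))"
  for j :: nat and \<kappa> :: "'v \<times> 'v => complex" and t z
 let ?X = "%k w f. k = (0::nat) & (\<exists>j \<kappa>. Sch \<kappa> & w = - real j & f = \<Phi> j \<kappa>)"
 let ?Y = "%k w f. ?X k w f \<or> symb 0 1 0 k w f"
 have "symb 0 1 0 0 0 (\<Phi> 0 \<kappa>)"
 proof (rule symb_coinduct_alg[where X = ?X])
  show "salg ?Y 0 0 (\<Phi> 0 \<kappa>)" by (rule salg_gen[where k = 0 and w = 0]) (use \<kappa> in auto)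
  fix k w f assume "?X k w f"
  then obtain j \<kappa> where k: "k = 0" and \<kappa>: "Sch \<kappa>" and w: "w = - real j" and f: "f = \<Phi> j \<kappa>" by blast
  note \<kappa>d = all_derivsD(1)[OF \<kappa>]
  have inner: "((%z. (e t *\<^sub>R fst z, e t *\<^sub>R (snd z - x0))) has_derivative (%v. e t *\<^sub>R v)) (at z)" for t and z :: "'v \<times> 'v"
   by (auto intro!: derivative_eq_intros simp: prod_eq_iff)
  have der: "((f t) has_derivative (%v. complex_of_real (e t ^ j) * (e t *\<^sub>R pderiv_dir v \<kappa> (e t *\<^sub>R fst z, e t *\<^sub>R (snd z - x0))))) (at z)" for t z
  proof -
   have "((%z. \<kappa> (e t *\<^sub>R fst z, e t *\<^sub>R (snd z - x0))) has_derivative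
    (%v. pderiv_dir (e t *\<^sub>R v) \<kappa> (e t *\<^sub>R fst z, e t *\<^sub>R (snd z - x0)))) (at z)"
    by (rule has_derivative_compose[OF inner has_derivative_pderiv'[OF differentiable_on_UNIV_D[OF \<kappa>d]]])
   then show ?thesis unfolding f \<Phi>_def linear_scale[OF pderiv_dir_linear[OF differentiable_on_UNIV_D[OF \<kappa>d]]]
    by (rule has_derivative_mult_right)
  qed
  obtain C where C: "!!p. (1 + norm p) ^ j * norm (\<kappa> p) <= C" using all_derivsD(2)[OF \<kappa>] unfolding rapid_def by blast
  have C0: "C >= 0" by (rule order_trans[OF _ C[of 0]]) simp
  have "norm (f t z) <= C * jb (fst z) powr w" for t z
  proof -
   let ?p = "(e t *\<^sub>R fst z, e t *\<^sub>R (snd z - x0))"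
   have "e t * norm (fst z) <= norm ?p" using norm_fst_le[of "e t *\<^sub>R fst z" "e t *\<^sub>R (snd z - x0)"] e(2)[of t] by simp
   then have "e t * jb (fst z) <= 1 + norm ?p"
    using mult_left_mono[OF jb_le[of "fst z"] e(2)[of t]] e(3)[of t] by (simp add: distrib_left)
   then have "(e t * jb (fst z)) ^ j <= (1 + norm ?p) ^ j" using e(2) by (intro power_mono) auto
   then have "(e t * jb (fst z)) ^ j * norm (\<kappa> ?p) <= C" using C[of ?p] by (meson mult_right_mono norm_ge_zero order_trans)
   then have "norm (f t z) * jb (fst z) ^ j <= C" unfolding f \<Phi>_def using e(2)[of t] by (simp add: norm_mult power_mult_distrib mult_ac norm_power)
   then show ?thesis unfolding w using jb_pos[of "fst z"] by (simp only: powr_minus_divide powr_realpow) (simp add: pos_le_divide_eq)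
  qed
  then have sb: "sbd w f" unfolding sbd_def using C0 by blast
  show "sbase 0 0 k w f" unfolding sbase_def
  proof (intro conjI allI)
   show "f t differentiable_on UNIV" for t by (rule has_derivative_differentiable_on[OF der])
   show "continuous_on UNIV (%t. f t z)" for z unfolding f \<Phi>_def
    by (intro continuous_intros e(1) continuous_on_compose2[OF Cb_D(3)[OF Sch_Cb[OF \<kappa>]]]) auto
   show "shol 0 (w + 0 * 0) f" using shol_zero[OF sb] by simp
  qed (use k sb in auto)
  show "salg ?Y k (w + wt 1 0 b) (dZ b f)" if b: "b \<in> Basis" for b
  proof (rule salg_gen[where k = 0 and w = "- real (Suc j)"])
   have "dZ b f = \<Phi> (Suc j) (pderiv_dir b \<kappa>)"
    unfolding dZ_def \<Phi>_def using pderiv_dir_eq[OF der] by (auto simp: fun_eq_iff scaleR_conv_of_real mult_ac)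
   then show "?Y 0 (- real (Suc j)) (dZ b f)" using Sch_pderiv[OF \<kappa> b] by blast
  qed (use k in \<open>auto simp: w wt_def\<close>)
  show "salg ?Y (k - 1) (w + 0) (dX b f)" if "k > 0" for b using that k by simp
 qed
 then show ?thesis by (simp add: \<Phi>_def[abs_def])
qed

lemma cutoff_decay:
 fixes \<kappa> :: "'v::euclidean_space \<times> 'v => complex"
 assumes \<kappa>: "Sch \<kappa>" and \<epsilon>: "\<epsilon> > 0"
 obtains C where "C >= 0" "!!xi y. norm (\<kappa> (\<epsilon> *\<^sub>R xi, y)) <= C * (jb xi powr (- w) * dw xi)"
proof -
 obtain M :: nat where M: "w <= real M" using real_arch_simple by blast
 let ?N = "M + (DIM('v) + 2)"
 obtain C where C: "!!p. (1 + norm p) ^ ?N * norm (\<kappa> p) <= C" using all_derivsD(2)[OF \<kappa>] unfolding rapid_def by blast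
 have C0: "C >= 0" by (rule order_trans[OF _ C[of 0]]) simp
 \<comment> \<open>The minimum makes c (1 + |xi|) <= 1 + |p| hold for the constant term as well as
   for the norm.\<close>
 define c where "c = min 1 \<epsilon>"
 have c: "c > 0" "c <= 1" "c <= \<epsilon>" using \<epsilon> by (auto simp: c_def)
 have "norm (\<kappa> (\<epsilon> *\<^sub>R xi, y)) <= (C / c ^ ?N) * (jb xi powr (- w) * dw xi)" for xi y
 proof -
  let ?p = "(\<epsilon> *\<^sub>R xi, y)"
  have "\<epsilon> * norm xi <= norm ?p" using norm_fst_le[of "\<epsilon> *\<^sub>R xi" y] \<epsilon> by simp
  moreover have "c * norm xi <= \<epsilon> * norm xi" using c by (intro mult_right_mono) auto
  ultimately have "c * (1 + norm xi) <= 1 + norm ?p" using c by (simp add: distrib_left)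
  then have "(c * (1 + norm xi)) ^ ?N <= (1 + norm ?p) ^ ?N" using c by (intro power_mono) auto
  then have "(c * (1 + norm xi)) ^ ?N * norm (\<kappa> ?p) <= C" using C[of ?p] by (meson mult_right_mono norm_ge_zero order_trans)
  then have "norm (\<kappa> ?p) * (1 + norm xi) ^ M * (1 + norm xi) ^ (DIM('v) + 2) <= C / c ^ ?N"
   unfolding power_mult_distrib using c by (simp only: power_add[of "1 + norm xi"]) (simp add: field_simps)
  moreover have "jb xi powr w <= (1 + norm xi) ^ M"
  proof -
   have "jb xi powr w <= jb xi powr real M" by (rule jb_powr_mono[OF M])
   also have "\<dots> = jb xi ^ M" by (simp add: powr_realpow)
   also have "\<dots> <= (1 + norm xi) ^ M" by (intro power_mono jb_le) auto
   finally show ?thesis .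
  qed
  then have "norm (\<kappa> ?p) * jb xi powr w * (1 + norm xi) ^ (DIM('v) + 2) <= norm (\<kappa> ?p) * (1 + norm xi) ^ M * (1 + norm xi) ^ (DIM('v) + 2)"
   by (intro mult_right_mono mult_left_mono) auto
  ultimately have "norm (\<kappa> ?p) * jb xi powr w * (1 + norm xi) ^ (DIM('v) + 2) <= C / c ^ ?N" by linarith
  moreover have "(1 + norm xi) ^ (DIM('v) + 2) > 0" by (auto intro!: zero_less_power simp: add_pos_nonneg)
  ultimately have "norm (\<kappa> ?p) <= C / c ^ ?N / (jb xi powr w * (1 + norm xi) ^ (DIM('v) + 2))"
   by (subst pos_le_divide_eq) (auto simp: mult.assoc)
  also have "\<dots> = (C / c ^ ?N) * (jb xi powr (- w) * dw xi)" by (simp add: dw_def powr_minus_divide)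
  finally show ?thesis .
 qed
 then show ?thesis using C0 c by (intro that[of "C / c ^ ?N"]) auto
qed

context symbols
begin

text \<open>For 0 < \<epsilon> <= 1 Fubini and a translation in y identify the regularised integral
  with \<open>SI\<close> of a family of symbols at the parameter \<epsilon> b. The estimates for
  this family are uniform in the parameter, so \<open>SI\<close> is continuous at 0, where \<kappa>
  takes the value 1.\<close>

theorem has_osc_integral_symb:
 fixes f :: "'x::euclidean_space => (real ^ 'n::finite) \<times> (real ^ 'n) => complex"
 assumes f: "symb th \<rho> \<delta> k w f" and v: "Sch v"
 shows "has_osc_integral (%xi y. f x (xi, x0 + y) * v (x0 + y)) (SI f v x x0)"
 unfolding has_osc_integral_def
proof (intro ballI impI conjI allI)
 fix \<kappa> :: "(real ^ 'n) \<times> (real ^ 'n) => complex"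
 assume "\<kappa> \<in> schwartz_space" and \<kappa>0: "\<kappa> (0, 0) = 1"
 then have \<kappa>: "Sch \<kappa>" by (simp add: schwartz_iff)
 let ?I = "%\<epsilon>. %(xi, y). \<kappa> (\<epsilon> *\<^sub>R xi, \<epsilon> *\<^sub>R y) * cis (- (y \<bullet> xi)) * (f x (xi, x0 + y) * v (x0 + y))"
 obtain C where C: "C >= 0" "!!x z. norm (f x z) <= C * jb (fst z) powr w" using symb_bound[OF f] by blast
 obtain D where D: "D > 0" "!!y. norm (v y) <= D * dw y" using Sch_dw[OF v] by blast
 have int: "integrable (lborel \<Otimes>\<^sub>M lborel) (?I \<epsilon>)" if \<epsilon>: "\<epsilon> > 0" for \<epsilon>
 proof -
  obtain E where E: "E >= 0" "!!xi y. norm (\<kappa> (\<epsilon> *\<^sub>R xi, y)) <= E * (jb xi powr (- w) * dw xi)"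
   using cutoff_decay[OF \<kappa> \<epsilon>] by blast
  show ?thesis
  proof (rule continuous_integrable_prod)
   show "continuous_on UNIV (?I \<epsilon>)" unfolding split_beta
    by (intro continuous_intros symb_joint_cont[OF f] continuous_on_compose2[OF Cb_D(3)[OF Sch_Cb[OF \<kappa>]]]
      continuous_on_compose2[OF Cb_D(3)[OF Sch_Cb[OF v]]]) auto
   fix xi y :: "real ^ 'n"
   have "norm (?I \<epsilon> (xi, y)) <= (E * (jb xi powr (- w) * dw xi)) * ((C * jb xi powr w) * (D * dw (x0 + y)))"
    using mult_mono[OF E(2)[of xi "\<epsilon> *\<^sub>R y"] mult_mono[OF C(2)[of x "(xi, x0 + y)"] D(2)[of "x0 + y"]]] C(1) E(1)
    by (simp add: norm_mult)
   also have "\<dots> = (E * C * D) * dw xi * dw (x0 + y)" by (simp add: powr_minus field_simps)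
   also have "\<dots> <= (E * C * D) * dw xi * ((1 + norm x0) ^ (DIM(real ^ 'n) + 2) * dw y)"
    using dw_shift_general[of y x0] E(1) C(1) D(1) by (intro mult_left_mono) (auto simp: add.commute)
   finally show "norm (?I \<epsilon> (xi, y)) <= (E * C * D * (1 + norm x0) ^ (DIM(real ^ 'n) + 2)) * (dw xi * dw y)"
    by (simp add: mult_ac)
  qed
 qed
 then show "integrable lborel (?I \<epsilon>)" if "\<epsilon> > 0" for \<epsilon> using that by (simp add: lborel_prod)
 obtain b :: 'x where b: "b \<in> Basis" using nonempty_Basis by blast
 \<comment> \<open>Along a unit vector b this gives e (\<epsilon> b) = \<epsilon> for 0 <=
   \<epsilon> <= 1, and it stays continuous and within [0, 1] everywhere.\<close>
 define e where "e t = min 1 (norm t)" for t :: 'x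
 have e: "continuous_on UNIV e" "!!t. 0 <= e t" "!!t. e t <= 1" unfolding e_def by (auto intro!: continuous_intros)
 define g where "g t z = \<kappa> (e t *\<^sub>R fst z, e t *\<^sub>R (snd z - x0)) * f x z" for t z
 \<comment> \<open>The parameter enters only continuously, so the family lives in the class with th
   = 0 and k = 0.\<close>
 interpret z: symbols 0 \<rho> \<delta> by unfold_locales (use orders in auto)
 have g: "symb 0 \<rho> \<delta> 0 w g"
  unfolding g_def
  by (rule symb_mult[OF symb_param_mono[OF symb_cutoff[OF \<kappa> e]] symb_freeze_x[OF f]]) (use orders delta_nonneg in auto)
 have eq: "integral\<^sup>L lborel (?I \<epsilon>) = SI g v (\<epsilon> *\<^sub>R b) x0" if \<epsilon>: "0 < \<epsilon>" "\<epsilon> <= 1" for \<epsilon>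
 proof -
  have eb: "e (\<epsilon> *\<^sub>R b) = \<epsilon>" using \<epsilon> b by (simp add: e_def)
  have inner: "(\<integral>y. ?I \<epsilon> (xi, y) \<partial>lborel) = cis (x0 \<bullet> xi) * FT g v (\<epsilon> *\<^sub>R b) xi" for xi
  proof -
   let ?h = "%y. cis (x0 \<bullet> xi) * (cis (- (y \<bullet> xi)) * g (\<epsilon> *\<^sub>R b) (xi, y) * v y)"
   have "?h \<in> borel_measurable borel"
    by (intro borel_measurable_continuous_onI continuous_intros symb_joint_cont[OF g] Cb_D(3)[OF Sch_Cb[OF v]])
   from integral_translation[OF this, of x0]
   have "integral\<^sup>L lborel ?h = (\<integral>y. ?h (y + x0) \<partial>lborel)" by simp
   also have "(%y. ?h (y + x0)) = (%y. ?I \<epsilon> (xi, y))"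
   proof
    fix y
    have c: "cis (x0 \<bullet> xi) * cis (- ((y + x0) \<bullet> xi)) = cis (- (y \<bullet> xi))" by (simp add: cis_mult inner_add_left)
    have "?h (y + x0) = (cis (x0 \<bullet> xi) * cis (- ((y + x0) \<bullet> xi))) * (g (\<epsilon> *\<^sub>R b) (xi, y + x0) * v (y + x0))"
     by (simp only: mult.assoc)
    also have "\<dots> = ?I \<epsilon> (xi, y)" unfolding c g_def eb by (simp add: add.commute[of y x0])
    finally show "?h (y + x0) = ?I \<epsilon> (xi, y)" .
   qed
   finally show ?thesis unfolding FT_def by simp
  qed
  have "integral\<^sup>L lborel (?I \<epsilon>) = (\<integral>xi. (\<integral>y. ?I \<epsilon> (xi, y) \<partial>lborel) \<partial>lborel)"
   using lborel_pair.integral_fst'[OF int[OF \<epsilon>(1)]] by (simp add: lborel_prod)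
  also have "\<dots> = SI g v (\<epsilon> *\<^sub>R b) x0" unfolding SI_def by (simp only: inner)
  finally show ?thesis .
 qed
 have "g 0 = f x" by (simp add: g_def e_def \<kappa>0 fun_eq_iff)
 then have S0: "SI g v 0 x0 = SI f v x x0" by (simp add: SI_def FT_def)
 have "continuous_on UNIV (%\<epsilon>. SI g v (\<epsilon> *\<^sub>R b) x0)"
  by (intro z.SI_cont[OF g v] continuous_intros)
 then have "isCont (%\<epsilon>. SI g v (\<epsilon> *\<^sub>R b) x0) 0" by (simp add: continuous_on_eq_continuous_at)
 then have "((%\<epsilon>. SI g v (\<epsilon> *\<^sub>R b) x0) \<longlongrightarrow> SI f v x x0) (at_right 0)"
  using S0 tendsto_within_subset[of _ _ 0 UNIV "{0<..}"] by (auto simp: isCont_def)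
 moreover have "\<forall>\<^sub>F \<epsilon> in at_right (0::real). SI g v (\<epsilon> *\<^sub>R b) x0 = integral\<^sup>L lborel (?I \<epsilon>)"
  by (rule eventually_mono[OF eventually_at_right_real[OF zero_less_one]]) (use eq in auto)
 ultimately show "((%\<epsilon>. integral\<^sup>L lborel (?I \<epsilon>)) \<longlongrightarrow> SI f v x x0) (at_right 0)"
  by (rule Lim_transform_eventually)
qed

text \<open>The definite description in \<open>osc_integral\<close> requires uniqueness. The
  Gaussian is an admissible cut-off, and along it the limit is unique.\<close>

lemma pdo_eq_SI:
 fixes p :: "'n::finite dsymbol"
 assumes p: "symb th \<rho> \<delta> k w (unc p)" and u: "Sch u"
 shows "pdo p u x = SI (unc p) u x x / (2 * of_real pi) ^ CARD('n)"
proof -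
 let ?a = "%xi y. p x xi (x + y) * u (x + y)"
 have h: "has_osc_integral ?a (SI (unc p) u x x)"
  using has_osc_integral_symb[OF p u, of x x] by (simp add: unc_def)
 have g: "(gauss :: (real ^ 'n) \<times> (real ^ 'n) => complex) \<in> schwartz_space" "gauss (0 :: real ^ 'n, 0 :: real ^ 'n) = 1"
  using Sch_gauss gauss_0[where 'a = "(real ^ 'n) \<times> (real ^ 'n)"] by (auto simp: schwartz_iff zero_prod_def)
 have "l = SI (unc p) u x x" if "has_osc_integral ?a l" for l
 proof -
  have "((%\<epsilon>. integral\<^sup>L lborel
     (%(xi, y). gauss (\<epsilon> *\<^sub>R xi, \<epsilon> *\<^sub>R y) * cis (- (y \<bullet> xi)) * ?a xi y)) \<longlongrightarrow> l) (at_right 0)"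
   "((%\<epsilon>. integral\<^sup>L lborel
     (%(xi, y). gauss (\<epsilon> *\<^sub>R xi, \<epsilon> *\<^sub>R y) * cis (- (y \<bullet> xi)) * ?a xi y)) \<longlongrightarrow> SI (unc p) u x x) (at_right 0)"
   using bspec[OF that[unfolded has_osc_integral_def] g(1)] bspec[OF h[unfolded has_osc_integral_def] g(1)] g(2) by auto
  then show ?thesis by (intro tendsto_unique) auto
 qed
 with h have "osc_integral ?a = SI (unc p) u x x" unfolding osc_integral_def by (rule the_equality)
 then show ?thesis by (simp add: pdo_def)
qed

end


section \<open>Change of variables\<close>

text \<open>The library states the change of variables formula for well-ordered index types. A copy of
 the index type with an arbitrary well-order removes this restriction.\<close>

typedef 'n idx = "UNIV :: 'n set" by auto

instance idx :: (finite) finite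
proof
 have "(UNIV :: 'a idx set) = Abs_idx ` UNIV" by (metis Abs_idx_cases surj_def UNIV_I)
 then show "finite (UNIV :: 'a idx set)" by (metis finite finite_imageI)
qed

instantiation idx :: (finite) wellorder
begin

definition less_eq_idx :: "'a idx => 'a idx => bool" where
 "less_eq_idx x y \<longleftrightarrow> to_nat (Rep_idx x) <= to_nat (Rep_idx y)"

definition less_idx :: "'a idx => 'a idx => bool" where
 "less_idx x y \<longleftrightarrow> to_nat (Rep_idx x) < to_nat (Rep_idx y)"

instance
proof
 fix P :: "'a idx => bool" and a
 assume "!!x. (!!y. y < x ==> P y) ==> P x"
 note step = this
 show "P a"
 proof (rule measure_induct_rule[of "%x. to_nat (Rep_idx x)"])
  show "P x" if "!!y. to_nat (Rep_idx y) < to_nat (Rep_idx x) ==> P y" for x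
   by (rule step) (rule that, simp add: less_idx_def)
 qed
next
 fix x y :: "'a idx"
 assume "x <= y" "y <= x"
 then have "to_nat (Rep_idx x) = to_nat (Rep_idx y)" by (simp add: less_eq_idx_def)
 then show "x = y" by (simp add: Rep_idx_inject)
qed (simp_all only: less_eq_idx_def less_idx_def, linarith+)

end

lemma bij_Rep_idx: "bij Rep_idx"
 by (rule bijI') (auto simp: Rep_idx_inject intro: Abs_idx_inverse[symmetric])

lemma Basis_vec_range: "(Basis :: (real ^ 'n::finite) set) = range (%i. axis i 1)"
 by (auto simp: Basis_vec_def)

lemma prod_Basis_vec: "(\<Prod>b\<in>(Basis :: (real ^ 'n::finite) set). F b) = (\<Prod>i\<in>UNIV. F (axis i 1))"
 unfolding Basis_vec_range by (subst prod.reindex) (auto simp: inj_on_def axis_eq_axis)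

lemma sum_Basis_vec: "(\<Sum>b\<in>(Basis :: (real ^ 'n::finite) set). F b) = (\<Sum>i\<in>UNIV. F (axis i 1))"
 unfolding Basis_vec_range by (subst sum.reindex) (auto simp: inj_on_def axis_eq_axis)

definition toI :: "real ^ 'n::finite => real ^ 'n idx" where "toI x = (\<chi> i. x $ Rep_idx i)"
definition ofI :: "real ^ 'n idx => real ^ 'n::finite" where "ofI x = (\<chi> i. x $ Abs_idx i)"

lemma ofI_toI [simp]: "ofI (toI x) = x" and toI_ofI [simp]: "toI (ofI y) = y"
 by (simp_all add: toI_def ofI_def Abs_idx_inverse Rep_idx_inverse vec_eq_iff)

lemma linear_toI: "linear toI" and linear_ofI: "linear ofI"
 by (auto intro!: linearI simp: toI_def ofI_def vec_eq_iff)

lemma bounded_linear_toI: "bounded_linear toI" and bounded_linear_ofI: "bounded_linear ofI"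
 using linear_toI linear_ofI linear_conv_bounded_linear by blast+

lemma continuous_toI: "continuous_on S toI" and continuous_ofI: "continuous_on T ofI"
 using bounded_linear_toI bounded_linear_ofI by (auto intro: linear_continuous_on)

lemma toI_box: "toI -` box l u = box (ofI l) (ofI u)"
proof -
 have "(\<forall>i. l $ i < x $ Rep_idx i & x $ Rep_idx i < u $ i) \<longleftrightarrow> (\<forall>j. l $ Abs_idx j < x $ j & x $ j < u $ Abs_idx j)" for x
  by (metis Abs_idx_inverse Rep_idx_inverse UNIV_I)
 then show ?thesis unfolding set_eq_iff vimage_def mem_Collect_eq mem_box_cart toI_def ofI_def vec_lambda_beta by blast
qed

lemma distr_toI: "distr lborel borel toI = (lborel :: (real ^ 'n::finite idx) measure)"
proof (rule lborel_eqI[symmetric])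
 have m: "(toI :: real ^ 'n => real ^ 'n idx) \<in> borel_measurable lborel" unfolding measurable_lborel2 by (rule borel_measurable_continuous_onI[OF continuous_toI])
 fix l u :: "real ^ 'n idx" assume lu: "!!b. b \<in> Basis ==> l \<bullet> b <= u \<bullet> b"
 then have lu': "l $ i <= u $ i" for i using lu[of "axis i 1"] by (simp add: Basis_vec_range inner_axis)
 have "emeasure (distr lborel borel toI) (box l u) = emeasure lborel (box (ofI l) (ofI u))"
  using m by (simp add: emeasure_distr toI_box)
 also have "\<dots> = (\<Prod>b\<in>Basis. (ofI u - ofI l) \<bullet> b)"
  by (rule emeasure_lborel_box) (auto simp: Basis_vec_range inner_axis ofI_def lu')
 also have "(\<Prod>b\<in>Basis. (ofI u - ofI l) \<bullet> b) = (\<Prod>i\<in>UNIV. u $ Abs_idx i - l $ Abs_idx i)"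
  by (simp add: prod_Basis_vec inner_axis ofI_def)
 also have "\<dots> = (\<Prod>j\<in>UNIV. u $ j - l $ j)"
  using prod.reindex_bij_betw[OF bij_Rep_idx, of "%i. u $ Abs_idx i - l $ Abs_idx i"] by (simp add: Rep_idx_inverse)
 finally show "emeasure (distr lborel borel toI) (box l u) = (\<Prod>b\<in>Basis. (u - l) \<bullet> b)"
  by (simp add: prod_Basis_vec inner_axis)
qed simp

text \<open>Conjugation with the bijection of the index types carries permutations to permutations
  and preserves their sign.\<close>

lemma det_reindex:
 fixes M :: "real ^ 'n::finite ^ 'n"
 shows "det (\<chi> i j. M $ Rep_idx i $ Rep_idx j) = det M"
proof -
 let ?A = "UNIV :: 'n idx set" and ?B = "UNIV :: 'n set"
 let ?m = "map_permutation ?A Rep_idx"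
 have inj: "inj_on Rep_idx ?A" by (rule bij_is_inj[OF bij_Rep_idx])
 have bb: "bij_betw ?m {p. p permutes ?A} {p. p permutes ?B}"
 proof (rule bij_betwI[where g = "map_permutation ?B Abs_idx"])
  have bA: "bij_betw Abs_idx ?B ?A" by (rule bij_betwI[where g = Rep_idx]) (simp_all add: Abs_idx_inverse Rep_idx_inverse)
  show "?m \<in> {p. p permutes ?A} \<rightarrow> {p. p permutes ?B}"
   using map_permutation_permutes[OF bij_Rep_idx] by auto
  show "map_permutation ?B Abs_idx \<in> {p. p permutes ?B} \<rightarrow> {p. p permutes ?A}"
   using map_permutation_permutes[OF bA] by auto
  show "map_permutation ?B Abs_idx (?m p) = p" for p
  proof
   fix i
   have "map_permutation ?B Abs_idx (?m p) (Abs_idx (Rep_idx i)) = Abs_idx (?m p (Rep_idx i))"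
    by (rule map_permutation_apply) (use bA in \<open>auto simp: bij_betw_def\<close>)
   also have "?m p (Rep_idx i) = Rep_idx (p i)" by (rule map_permutation_apply[OF inj]) simp
   finally show "map_permutation ?B Abs_idx (?m p) i = p i" by (simp add: Rep_idx_inverse)
  qed
  show "?m (map_permutation ?B Abs_idx q) = q" for q
  proof
   fix i
   have "?m (map_permutation ?B Abs_idx q) (Rep_idx (Abs_idx i)) = Rep_idx (map_permutation ?B Abs_idx q (Abs_idx i))"
    by (rule map_permutation_apply[OF inj]) simp
   also have "map_permutation ?B Abs_idx q (Abs_idx i) = Abs_idx (q i)"
    by (rule map_permutation_apply) (use bA in \<open>auto simp: bij_betw_def\<close>)
   finally show "?m (map_permutation ?B Abs_idx q) i = q i" by (simp add: Abs_idx_inverse)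
  qed
 qed
 have "det M = (\<Sum>p | p permutes ?A. of_int (sign (?m p)) * (\<Prod>i\<in>?B. M $ i $ ?m p i))"
  unfolding det_def by (rule sum.reindex_bij_betw[OF bb, symmetric])
 also have "\<dots> = (\<Sum>p | p permutes ?A. of_int (sign p) * (\<Prod>i\<in>?A. M $ Rep_idx i $ Rep_idx (p i)))"
 proof (rule sum.cong[OF refl])
  fix p assume p: "p \<in> {p. p permutes ?A}"
  have "(\<Prod>i\<in>?B. M $ i $ ?m p i) = (\<Prod>i\<in>?A. M $ Rep_idx i $ ?m p (Rep_idx i))"
   by (rule prod.reindex_bij_betw[OF bij_Rep_idx, symmetric])
  also have "\<dots> = (\<Prod>i\<in>?A. M $ Rep_idx i $ Rep_idx (p i))"
   by (simp add: map_permutation_apply[OF inj])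
  finally show "of_int (sign (?m p)) * (\<Prod>i\<in>?B. M $ i $ ?m p i) = of_int (sign p) * (\<Prod>i\<in>?A. M $ Rep_idx i $ Rep_idx (p i))"
   using sign_map_permutation[OF inj, of p] p by simp
 qed
 finally show ?thesis by (simp add: det_def)
qed

section \<open>The substitution rule for integrals\<close>

text \<open>Lebesgue measure is determined by its values on boxes. The preimage of a box is mapped
  injectively onto a set of finite measure, so the measure formula for differentiable images
  applies, after conjugating g with \<open>toI\<close> and \<open>ofI\<close>.\<close>

lemma lborel_eq_distr_density:
 fixes g :: "real ^ 'n::finite => real ^ 'n"
 assumes g: "bij g" "g differentiable_on UNIV" and c: "continuous_on UNIV (%y. det (jacobian g (at y)))"
 shows "lborel = distr (density lborel (%y. ennreal \<bar>det (jacobian g (at y))\<bar>)) borel g"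
proof (rule lborel_eqI)
 let ?J = "%y. \<bar>det (jacobian g (at y))\<bar>"
 have gc: "continuous_on UNIV g" using g(2) by (rule differentiable_imp_continuous_on)
 have gm: "g \<in> borel_measurable borel" using gc by (rule borel_measurable_continuous_onI)
 have Jm: "?J \<in> borel_measurable borel" by (intro borel_measurable_continuous_onI continuous_intros c)
 fix l u :: "real ^ 'n" assume lu: "!!b. b \<in> Basis ==> l \<bullet> b <= u \<bullet> b"
 define S where "S = g -` box l u"
 have oS: "open S" unfolding S_def by (rule open_vimage[OF open_box gc])
 define S' where "S' = ofI -` S"
 have oS': "open S'" unfolding S'_def by (rule open_vimage[OF oS continuous_ofI])
 have im: "(%x. toI (g (ofI x))) ` S' = toI ` box l u"
 proof
  show "toI ` box l u \<subseteq> (%x. toI (g (ofI x))) ` S'"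
  proof (rule image_subsetI)
   fix z assume z: "z \<in> box l u"
   then have "toI (inv g z) \<in> S'" "toI (g (ofI (toI (inv g z)))) = toI z"
    using g(1) by (simp_all add: S'_def S_def bij_is_surj surj_f_inv_f)
   then show "toI z \<in> (%x. toI (g (ofI x))) ` S'" by (metis imageI)
  qed
 qed (auto simp: S'_def S_def)
 have im2: "toI ` box l u = box (toI l) (toI u)"
 proof -
  have "toI ` box l u = ofI -` box l u" by (auto simp: image_iff) (metis toI_ofI)
  also have "\<dots> = box (toI l) (toI u)"
  proof -
   have "(\<forall>i. l $ i < x $ Abs_idx i & x $ Abs_idx i < u $ i) \<longleftrightarrow> (\<forall>j. l $ Rep_idx j < x $ j & x $ j < u $ Rep_idx j)" for x
    by (metis Abs_idx_inverse Rep_idx_inverse UNIV_I)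
   then show ?thesis by (auto simp: toI_def ofI_def mem_box_cart)
  qed
  finally show ?thesis .
 qed
 have toI_le: "toI l \<bullet> b <= toI u \<bullet> b" if "b \<in> Basis" for b
 proof -
  obtain i where b: "b = axis i 1" using \<open>b \<in> Basis\<close> unfolding Basis_vec_range by blast
  show ?thesis using lu[of "axis (Rep_idx i) 1"] by (simp add: b inner_axis toI_def)
 qed
 let ?m = "\<Prod>b\<in>Basis. (toI u - toI l) \<bullet> b"
 have m: "?m = (\<Prod>b\<in>Basis. (u - l) \<bullet> b)"
  using prod.reindex_bij_betw[OF bij_Rep_idx, of "%i. u $ i - l $ i"]
  by (simp add: prod_Basis_vec inner_axis toI_def)
 let ?g' = "%x v. toI (jacobian g (at (ofI x)) *v ofI v)"
 have "((%x. \<bar>det (matrix (?g' x))\<bar>) has_integral ?m) S'"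
 proof (subst has_measure_differentiable_image[symmetric, where f = "%x. toI (g (ofI x))"])
  show "S' \<in> sets lebesgue" using oS' by (simp add: borel_open)
  show "((%x. toI (g (ofI x))) has_derivative ?g' x) (at x within S')" for x
  proof -
   have "(g has_derivative (%v. jacobian g (at (ofI x)) *v v)) (at (ofI x))"
    using differentiable_on_UNIV_D[OF g(2)] by (simp add: jacobian_works)
   from has_derivative_compose[OF bounded_linear.has_derivative[OF bounded_linear_ofI has_derivative_ident] this]
   show ?thesis by (rule bounded_linear.has_derivative[OF bounded_linear_toI])
  qed
  show "inj_on (%x. toI (g (ofI x))) S'"
   using g(1) by (intro inj_onI) (metis bij_def injD ofI_toI toI_ofI)
  show "(%x. toI (g (ofI x))) ` S' \<in> lmeasurable & measure lebesgue ((%x. toI (g (ofI x))) ` S') = ?m"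
   unfolding im im2 by (auto simp: measure_lborel_box_eq toI_le)
 qed
 moreover have "det (matrix (?g' x)) = det (jacobian g (at (ofI x)))" for x :: "real ^ 'n idx"
 proof -
  have ax: "ofI (axis j (1 :: real)) = axis (Rep_idx j) 1" for j :: "'n idx"
   by (auto simp: ofI_def axis_def vec_eq_iff Abs_idx_inverse Rep_idx_inverse)
  have "matrix (?g' x) $ i $ j = jacobian g (at (ofI x)) $ Rep_idx i $ Rep_idx j" for i j :: "'n idx"
   by (simp add: ax matrix_def toI_def matrix_vector_mult_basis column_def)
  then have "matrix (?g' x) = (\<chi> i j. jacobian g (at (ofI x)) $ Rep_idx i $ Rep_idx j)"
   by (simp add: vec_eq_iff)
  then show ?thesis by (simp add: det_reindex)
 qed
 ultimately have "((%x. ?J (ofI x)) has_integral ?m) S'" by simp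
 from nn_integral_has_integral_lebesgue[OF _ this]
 have "ennreal ?m = integral\<^sup>N lborel (%x. ennreal (indicator S' x * ?J (ofI x)))" by simp
 also have "\<dots> = integral\<^sup>N (distr lborel borel toI) (%x. ennreal (indicator S' x * ?J (ofI x)))"
  by (simp add: distr_toI)
 also have "\<dots> = integral\<^sup>N lborel (%y. ennreal (indicator S' (toI y) * ?J (ofI (toI y))))"
 proof (rule nn_integral_distr)
  show "toI \<in> lborel \<rightarrow>\<^sub>M borel" unfolding measurable_lborel2 by (rule borel_measurable_continuous_onI[OF continuous_toI])
  have [measurable]: "S' \<in> sets borel" using oS' by simp
  have [measurable]: "(%x. ?J (ofI x)) \<in> borel_measurable borel"
   by (intro borel_measurable_continuous_onI continuous_intros continuous_on_compose2[OF c] continuous_ofI) auto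
  show "(%x. ennreal (indicator S' x * ?J (ofI x))) \<in> borel_measurable (distr lborel borel toI)" unfolding measurable_distr_eq1 by measurable
 qed
 also have "\<dots> = integral\<^sup>N lborel (%y. ennreal (?J y) * indicator S y)"
  by (intro nn_integral_cong) (auto simp: indicator_def S'_def)
 also have "\<dots> = emeasure (density lborel (%y. ennreal (?J y))) S"
  using Jm oS by (subst emeasure_density) auto
 also have "\<dots> = emeasure (distr (density lborel (%y. ennreal (?J y))) borel g) (box l u)"
  using gm by (subst emeasure_distr) (auto simp: S_def)
 finally show "emeasure (distr (density lborel (%y. ennreal (?J y))) borel g) (box l u) = ennreal (\<Prod>b\<in>Basis. (u - l) \<bullet> b)"
  by (simp only: m)
qed simp

theorem integral_change_of_variables_lborel:
 fixes g :: "real ^ 'n::finite => real ^ 'n" and f :: "real ^ 'n => complex"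
 assumes g: "bij g" "g differentiable_on UNIV" and c: "continuous_on UNIV (%y. det (jacobian g (at y)))"
  and f: "f \<in> borel_measurable borel"
 shows "integral\<^sup>L lborel f = integral\<^sup>L lborel (%y. of_real \<bar>det (jacobian g (at y))\<bar> * f (g y))"
proof -
 let ?J = "%y. \<bar>det (jacobian g (at y))\<bar>"
 have gm: "g \<in> borel_measurable borel"
  using differentiable_imp_continuous_on[OF g(2)] by (rule borel_measurable_continuous_onI)
 have Jm: "?J \<in> borel_measurable borel" by (intro borel_measurable_continuous_onI continuous_intros c)
 have "integral\<^sup>L lborel f = integral\<^sup>L (distr (density lborel (%y. ennreal (?J y))) borel g) f"
  using lborel_eq_distr_density[OF g c] by simp
 also have "\<dots> = integral\<^sup>L (density lborel (%y. ennreal (?J y))) (%y. f (g y))"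
  using gm f by (intro integral_distr) auto
 also have "\<dots> = integral\<^sup>L lborel (%y. ?J y *\<^sub>R f (g y))"
  using gm f Jm by (intro integral_density) auto
 finally show ?thesis by (simp add: scaleR_conv_of_real)
qed

section \<open>Smooth regular diffeomorphisms\<close>

lemma Cb_nth: "Cb f ==> Cb (%x. f x $ i)"
 by (rule Cb_bounded_linear[OF bounded_linear_vec_nth])

lemma Cb_det:
 assumes "!!i j. Cb (%x. M x $ i $ j :: real)"
 shows "Cb (%x. det (M x :: real ^ 'n::finite ^ 'n))"
 unfolding det_def by (intro Cb_sum Cb_mult Cb_const Cb_prod assms)

lemma matrix_inv_right: "invertible A ==> A ** matrix_inv A = mat 1"
 and matrix_inv_left: "invertible A ==> matrix_inv A ** A = mat 1"
 unfolding invertible_def matrix_inv_def by (metis (mono_tags, lifting) someI_ex)+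

text \<open>Cramer's rule with a unit vector on the right. It writes the entries of the inverse
  through determinants, operations under which \<open>Cb\<close> is closed.\<close>

lemma matrix_inv_cofactor:
 fixes A :: "real ^ 'n::finite ^ 'n"
 assumes "det A ~= 0"
 shows "matrix_inv A $ k $ l = det (\<chi> i j. if j = k then axis l 1 $ i else A $ i $ j) * inverse (det A)"
proof -
 have inv: "invertible A" using assms by (simp add: invertible_det_nz)
 have "A *v (matrix_inv A *v axis l 1) = axis l 1"
  using matrix_inv_right[OF inv] by (simp add: matrix_vector_mul_assoc)
 then have "matrix_inv A *v axis l 1 = (\<chi> k. det (\<chi> i j. if j = k then axis l 1 $ i else A $ i $ j) / det A)"
  using cramer[OF assms] by blast
 moreover have "(matrix_inv A *v axis l 1) $ k = matrix_inv A $ k $ l"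
  by (simp add: matrix_vector_mult_basis column_def)
 ultimately show ?thesis by (simp add: divide_inverse)
qed

lemma Cb_matrix_inv:
 fixes M :: "'a::euclidean_space => real ^ 'n::finite ^ 'n"
 assumes M: "!!i j. Cb (%x. M x $ i $ j)" and c: "c > 0" "!!x. \<bar>det (M x)\<bar> >= c"
 shows "Cb (%x. matrix_inv (M x) $ k $ l)"
proof -
 have "det (M x) ~= 0" for x using c(2)[of x] c(1) by auto
 then have "(%x. matrix_inv (M x) $ k $ l) = (%x. det (\<chi> i j. if j = k then axis l 1 $ i else M x $ i $ j) * inverse (det (M x)))"
  using matrix_inv_cofactor by blast
 moreover have "Cb (%x. det (\<chi> i j. if j = k then axis l 1 $ i else M x $ i $ j) * inverse (det (M x)))"
 proof (intro Cb_mult Cb_det Cb_inverse[OF _ c(1)])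
  show "Cb (%x. (\<chi> i j. if j = k then axis l 1 $ i else M x $ i $ j) $ i $ j)" for i j
   by (cases "j = k") (simp_all add: Cb_const M)
 qed (use M c in auto)
 ultimately show ?thesis by simp
qed

lemma jacobian_nth: "jacobian h (at y) $ i $ j = pderiv_dir (axis j 1) h y $ i"
 by (simp add: jacobian_def matrix_def pderiv_dir_def)

lemma pderiv_dir_jacobian:
 fixes h :: "real ^ 'n::finite => real ^ 'm::finite"
 assumes "h differentiable (at y)" shows "pderiv_dir d h y = jacobian h (at y) *v d"
 by (rule pderiv_dir_eq) (use assms in \<open>simp add: jacobian_works\<close>)

lemma Cb_jacobian:
 fixes h :: "real ^ 'n::finite => real ^ 'm::finite"
 assumes "bder h" shows "Cb (%y. jacobian h (at y) $ i $ j)"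
 unfolding jacobian_nth using assms by (intro Cb_nth) (auto simp: bder_def Basis_vec_range)

locale diffeo =
 fixes h :: "real ^ 'n::finite => real ^ 'n"
 assumes h: "smooth_regular_diffeo h"
begin

abbreviation "J y \<equiv> jacobian h (at y)"
abbreviation "k \<equiv> inv h"

lemma bij_h: "bij h" and hk [simp]: "h (k x) = x" and kh [simp]: "k (h y) = y"
 using h by (auto simp: smooth_regular_diffeo_def bij_is_surj surj_f_inv_f bij_is_inj inv_f_f)

lemma bder_h: "bder h"
 unfolding bder_def
proof (intro conjI ballI)
 have s: "all_derivs (%_. True) h" using h by (simp add: smooth_regular_diffeo_def smooth_iff)
 show "h differentiable_on UNIV" by (rule all_derivsD(1)[OF s])
 fix b :: "real ^ 'n" assume b: "b \<in> Basis"
 show "Cb (pderiv_dir b h)"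
  unfolding all_derivs_def
 proof (intro ballI conjI)
  fix al :: "(real ^ 'n) list" assume al: "al \<in> lists Basis"
  show "mpderiv al (pderiv_dir b h) differentiable_on UNIV"
   using all_derivs_pderiv[OF s b] al by (auto simp: all_derivs_def)
  have "mpderiv al (pderiv_dir b h) = mpderiv (al @ [b]) h" by (simp add: mpderiv_append)
  moreover have "bounded (range (mpderiv (al @ [b]) h))"
   using h b al unfolding smooth_regular_diffeo_def by (auto simp: lists_eq_set)
  ultimately show "bounded (range (mpderiv al (pderiv_dir b h)))" by simp
 qed
qed

lemma det_bound: obtains c where "c > 0" "!!y. \<bar>det (J y)\<bar> >= c"
 using h unfolding smooth_regular_diffeo_def by (metis positive_imp_inverse_positive)

lemma Cb_det_J: "Cb (%y. det (J y))"
 by (intro Cb_det Cb_jacobian bder_h)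

text \<open>The determinant is continuous and nonvanishing on a connected space. The constant sign
  makes its absolute value as smooth as the determinant itself.\<close>

lemma det_J_sign: obtains s :: real where "s = 1 \<or> s = - 1" "!!y. \<bar>det (J y)\<bar> = s * det (J y)"
proof -
 obtain c where c: "c > 0" "!!y. \<bar>det (J y)\<bar> >= c" using det_bound by blast
 have "connected ((%y. det (J y)) ` UNIV)"
  by (intro connected_continuous_image Cb_D(3)[OF Cb_det_J] connected_UNIV)
 then have iv: "is_interval (range (%y. det (J y)))" by (simp add: is_interval_connected_1)
 have "\<not> (det (J y) < 0 & 0 < det (J z))" for y z
 proof
  assume *: "det (J y) < 0 & 0 < det (J z)"
  then have "0 \<in> range (%y. det (J y))"
   using iv[unfolded is_interval_1, rule_format, of "det (J y)" "det (J z)" 0] by auto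
  then obtain x where "0 = det (J x)" by (rule rangeE)
  with c(1) c(2)[of x] show False by simp
 qed
 moreover have "det (J y) ~= 0" for y using c(1) c(2)[of y] by auto
 ultimately have "(\<forall>y. det (J y) > 0) \<or> (\<forall>y. det (J y) < 0)" by (meson linorder_neqE)
 then show ?thesis
 proof
  assume "\<forall>y. det (J y) > 0" then show ?thesis by (intro that[of 1]) (auto simp: less_imp_le)
 next
  assume "\<forall>y. det (J y) < 0" then show ?thesis by (intro that[of "-1"]) (auto simp: abs_of_neg)
 qed
qed

lemma Cb_abs_det_J: "Cb (%y. \<bar>det (J y)\<bar>)"
proof -
 obtain s :: real where s: "!!y. \<bar>det (J y)\<bar> = s * det (J y)" using det_J_sign by blast
 have "Cb (%y. s * det (J y))" by (intro Cb_mult Cb_const Cb_det_J)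
 then show ?thesis by (simp add: s)
qed

lemma h_diff: "h differentiable (at y)"
 using bder_h by (auto simp: bder_def intro: differentiable_on_UNIV_D)

text \<open>The derivative of the inverse map is the inverse Jacobian, a function of class
  \<open>Cb\<close>, composed with the inverse map. Only differentiability of \<open>inv h\<close>
  is taken from the definition; the bounds follow from those of h.\<close>

lemma bder_k: "bder k"
proof -
 have kd: "k differentiable_on UNIV"
  using h all_derivsD(1)[of "%_. True" k] by (simp add: smooth_regular_diffeo_def smooth_iff)
 obtain c where c: "c > 0" "!!y. \<bar>det (J y)\<bar> >= c" using det_bound by blast
 have inv: "invertible (J y)" for y using c(1) c(2)[of y] by (auto simp: invertible_det_nz)
 have dk: "pderiv_dir b k x = matrix_inv (J (k x)) *v b" for b x
 proof -
  have "((%x. h (k x)) has_derivative (%v. J (k x) *v pderiv_dir v k x)) (at x)"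
   by (rule has_derivative_compose[OF has_derivative_pderiv'[OF differentiable_on_UNIV_D[OF kd]]])
    (use h_diff in \<open>simp add: jacobian_works\<close>)
  from pderiv_dir_eq[OF this, of b] fun_cong[OF pderiv_dir_of_bounded_linear[OF bounded_linear_ident, of b], of x]
  have "J (k x) *v pderiv_dir b k x = b" by simp
  then have "matrix_inv (J (k x)) *v (J (k x) *v pderiv_dir b k x) = matrix_inv (J (k x)) *v b" by simp
  then show ?thesis using matrix_inv_left[OF inv] by (simp add: matrix_vector_mul_assoc)
 qed
 have N: "Cb (%y. matrix_inv (J y) $ i $ j)" for i j
  by (rule Cb_matrix_inv[OF Cb_jacobian[OF bder_h] c])
 have dk': "pderiv_dir b k x \<bullet> i = (matrix_inv (J (k x)) *v b) \<bullet> i" for b x i by (simp add: dk)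
 have Nb: "Cb (%y. (matrix_inv (J y) *v b) \<bullet> i)" for b i
  unfolding matrix_vector_mult_def inner_vec_def by (simp, intro Cb_sum Cb_mult Cb_const N)
 \<comment> \<open>Bootstrapping: derivatives of c o k are sums of products of functions of the same
   form, so no prior bound on the derivatives of k enters.\<close>
 have ck: "Cb (%x. c (k x))" if "Cb c" for c :: "real ^ 'n => real"
 proof (rule Cb_coinduct_alg[where X = "%f. \<exists>c::real ^ 'n => real. Cb c & f = (%x. c (k x))"])
  let ?Y = "%f. (\<exists>c::real ^ 'n => real. Cb c & f = (%x. c (k x))) \<or> Cb f"
  show "alg ?Y (%x. c (k x))" by (rule alg_gen) (use that in blast)
  fix f assume "\<exists>c::real ^ 'n => real. Cb c & f = (%x. c (k x))"
  then obtain c :: "real ^ 'n => real" where c: "Cb c" and f: "f = (%x. c (k x))" by blast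
  have "bounded (range f)" unfolding f using Cb_D(2)[OF c] by (rule bounded_subset) auto
  then show "f differentiable_on UNIV & bounded (range f)"
   unfolding f using differentiable_on_compose_UNIV[OF Cb_D(1)[OF c] kd] by simp
  fix b :: "real ^ 'n" assume b: "b \<in> Basis"
  have eq: "pderiv_dir b f = (%x. \<Sum>i\<in>Basis. ((matrix_inv (J (k x)) *v b) \<bullet> i) * pderiv_dir i c (k x))"
   unfolding f pderiv_dir_compose[OF Cb_D(1)[OF c] kd] dk by simp
  show "alg ?Y (pderiv_dir b f)" unfolding eq
  proof (intro alg_sum alg_mult alg_gen disjI1)
   fix i :: "real ^ 'n" assume "i \<in> Basis"
   then show "\<exists>ca::real ^ 'n => real. Cb ca & (%x. pderiv_dir i c (k x)) = (%x. ca (k x))"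
    using Cb_pderiv[OF c] by blast
   show "\<exists>c::real ^ 'n => real. Cb c & (%x. (matrix_inv (J (k x)) *v b) \<bullet> i) = (%x. c (k x))"
    using Nb[of b i] by (intro exI[of _ "%y. (matrix_inv (J y) *v b) \<bullet> i"]) simp
  qed
 qed
 show ?thesis unfolding bder_def
 proof (intro conjI ballI)
  show "k differentiable_on UNIV" by (rule kd)
  show "Cb (pderiv_dir b k)" for b
  proof (rule Cb_componentwise)
   show "Cb (%x. pderiv_dir b k x \<bullet> i)" for i unfolding dk' by (rule ck[OF Nb])
  qed
 qed
qed

text \<open>The inverse of the substituted map is Lipschitz, which yields the linear growth that
  \<open>Sch_compose\<close> asks for.\<close>

lemma Sch_compose_h: "Sch (u :: real ^ 'n => complex) ==> Sch (%y. u (h y))" and Sch_compose_k: "Sch (v :: real ^ 'n => complex) ==> Sch (%x. v (k x))"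
proof -
 have aux: "1 + norm x <= (1 + norm (g (0 :: real ^ 'n)) + L) * (1 + norm (f x))"
  if "L > 0" "!!x y. norm (g x - g y) <= L * norm (x - y)" "!!x. g (f x) = x" for f g :: "real ^ 'n => real ^ 'n" and L x
 proof -
  have "norm x <= norm (g 0) + L * norm (f x)"
   using that(2)[of "f x" 0] norm_triangle_ineq[of "g 0" "g (f x) - g 0"] that(3) by simp
  moreover have "0 <= norm (g 0) * norm (f x)" by simp
  moreover have "(1 + norm (g 0) + L) * (1 + norm (f x)) = 1 + norm (g 0) + L + norm (f x) + norm (g 0) * norm (f x) + L * norm (f x)"
   by (simp add: algebra_simps)
  ultimately show ?thesis using that(1) norm_ge_zero[of "f x"] by linarith
 qed
 obtain L where L: "L > 0" "!!x y. norm (k x - k y) <= L * norm (x - y)" using bder_lipschitz[OF bder_k] by blast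
 obtain L' where L': "L' > 0" "!!x y. norm (h x - h y) <= L' * norm (x - y)" using bder_lipschitz[OF bder_h] by blast
 show "Sch (%y. u (h y))" if "Sch u" by (rule Sch_compose[OF that bder_h]) (rule aux[OF L kh])
 show "Sch (%x. v (k x))" if "Sch v" by (rule Sch_compose[OF that bder_k]) (rule aux[OF L' hk])
qed

end

subsection \<open>The mean Jacobian\<close>

text \<open>Differentiating the integrand in the first or second variable multiplies it by t or 1 -
  t. The candidates are therefore averages with an arbitrary continuous weight.\<close>

lemma Cb_average:
 fixes c :: "'a::euclidean_space => complex"
 assumes "Cb c"
 shows "Cb (%p::'a \<times> 'a. integral\<^sup>L (lebesgue_on {0..1}) (%t::real. c (snd p + t *\<^sub>R (fst p - snd p))))"
proof -
 let ?M = "lebesgue_on {0..1::real}"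
 define \<Phi> where "\<Phi> e c p = integral\<^sup>L ?M (%t. complex_of_real (e t) * c (snd p + t *\<^sub>R (fst p - snd p)))"
  for e :: "real => real" and c :: "'a => complex" and p :: "'a \<times> 'a"
 let ?X = "%f. \<exists>e c. continuous_on UNIV e & Cb c & f = \<Phi> e c"
 have key: "\<Phi> e c differentiable_on UNIV & bounded (range (\<Phi> e c)) & (\<forall>b\<in>Basis. ?X (pderiv_dir b (\<Phi> e c)))"
  if e: "continuous_on UNIV e" and c: "Cb c" for e and c :: "'a => complex"
 proof -
  let ?f = "%p t. complex_of_real (e t) * c (snd p + t *\<^sub>R (fst p - snd p))"
  have "compact (e ` {0..1})" by (intro compact_continuous_image continuous_on_subset[OF e]) auto
  then have "bounded (e ` {0..1})" by (rule compact_imp_bounded)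
  then obtain E where E: "E > 0" "!!t. t \<in> {0..1} ==> \<bar>e t\<bar> <= E" by (auto simp: bounded_pos)
  obtain C where C: "C > 0" "!!x. norm (c x) <= C" using Cb_boundE[OF c] by blast
  have meas: "(%t. complex_of_real (e' t) * c' (snd p + t *\<^sub>R (fst p - snd p))) \<in> borel_measurable ?M"
   if "continuous_on UNIV e'" "Cb c'" for e' and c' :: "'a => complex" and p
  proof (rule continuous_imp_measurable_on_sets_lebesgue)
   show "continuous_on {0..1} (%t. complex_of_real (e' t) * c' (snd p + t *\<^sub>R (fst p - snd p)))"
    by (intro continuous_intros continuous_on_subset[OF that(1)] continuous_on_compose2[OF Cb_D(3)[OF that(2)]]) auto
  qed auto
  have ci: "integrable ?M (%t. K :: real)" for K by (rule finite_measure.integrable_const) (auto intro!: finite_measure_lebesgue_on)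
  have int: "integrable ?M (?f p)" for p
  proof (rule Bochner_Integration.integrable_bound[OF ci[of "E * C"] meas[OF e c]])
   show "AE t in ?M. norm (?f p t) <= norm (E * C)"
    using E C by (intro AE_I2) (auto simp: norm_mult abs_mult intro!: mult_mono)
  qed
  have bnd: "norm (\<Phi> e c p) <= (\<integral>t. E * C \<partial>?M)" for p
   unfolding \<Phi>_def
  proof (rule Bochner_Integration.integral_norm_bound_integral[OF int ci])
   show "norm (?f p t) <= E * C" if "t \<in> space ?M" for t
    using that E C by (auto simp: norm_mult intro!: mult_mono)
  qed
  have der: "((%p. ?f p t) has_derivative (%v. complex_of_real (e t) * pderiv_dir (snd v + t *\<^sub>R (fst v - snd v)) c (snd p + t *\<^sub>R (fst p - snd p)))) (at p)" for p t
  proof -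
   have "((%p::'a \<times> 'a. snd p + t *\<^sub>R (fst p - snd p)) has_derivative (%v. snd v + t *\<^sub>R (fst v - snd v))) (at p)"
    by (auto intro!: derivative_eq_intros)
   from has_derivative_compose[OF this has_derivative_pderiv'[OF differentiable_on_UNIV_D[OF Cb_D(1)[OF c]]]]
   show ?thesis by (rule has_derivative_mult_right)
  qed
  have lin: "pderiv_dir (t *\<^sub>R b) c x = of_real t * pderiv_dir b c x" for t b x
   using linear_scale[OF pderiv_dir_linear[OF differentiable_on_UNIV_D[OF Cb_D(1)[OF c]]]] by (simp add: scaleR_conv_of_real)
  have pb: "\<exists>e' c'. continuous_on UNIV e' & Cb c' & (\<forall>p t. pderiv_dir b (%p. ?f p t) p = complex_of_real (e' t) * c' (snd p + t *\<^sub>R (fst p - snd p)))"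
   if b: "b \<in> Basis" for b
  proof -
   have f: "pderiv_dir b (%p. ?f p t) p = complex_of_real (e t) * pderiv_dir (snd b + t *\<^sub>R (fst b - snd b)) c (snd p + t *\<^sub>R (fst p - snd p))" for p t
    by (rule pderiv_dir_eq[OF der])
   from b consider (1) b1 where "b = (b1, 0)" "b1 \<in> Basis" | (2) b2 where "b = (0, b2)" "b2 \<in> Basis"
    by (auto simp: Basis_prod_def)
   then show ?thesis
   proof cases
    case 1
    have "snd b + t *\<^sub>R (fst b - snd b) = t *\<^sub>R b1" for t using 1 by simp
    then show ?thesis unfolding f using Cb_pderiv[OF c 1(2)] e
     by (intro exI[of _ "%t. e t * t"] exI[of _ "pderiv_dir b1 c"] conjI allI continuous_intros)
      (simp_all only: lin of_real_mult mult.assoc)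
   next
    case 2
    have "snd b + t *\<^sub>R (fst b - snd b) = (1 - t) *\<^sub>R b2" for t using 2 by (simp add: scaleR_diff_left)
    then show ?thesis unfolding f using Cb_pderiv[OF c 2(2)] e
     by (intro exI[of _ "%t. e t * (1 - t)"] exI[of _ "pderiv_dir b2 c"] conjI allI continuous_intros)
      (simp_all only: lin of_real_mult mult.assoc)
   qed
  qed
  have "\<forall>b\<in>Basis. \<exists>q. continuous_on UNIV (fst q) & Cb (snd q) & (\<forall>p t. pderiv_dir b (%p. ?f p t) p = complex_of_real (fst q t) * snd q (snd p + t *\<^sub>R (fst p - snd p)))"
   using pb unfolding split_paired_Ex fst_conv snd_conv by blast
  from bchoice[OF this] obtain q where q: "\<forall>b\<in>Basis. continuous_on UNIV (fst (q b)) & Cb (snd (q b)) & (\<forall>p t. pderiv_dir b (%p. ?f p t) p = complex_of_real (fst (q b) t) * snd (q b) (snd p + t *\<^sub>R (fst p - snd p)))" by blast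
  define e' where "e' b = fst (q b)" for b
  define c' where "c' b = snd (q b)" for b
  have ec: "!!b. b \<in> Basis ==> continuous_on UNIV (e' b) & Cb (c' b)"
   "!!b p t. b \<in> Basis ==> pderiv_dir b (%p. ?f p t) p = complex_of_real (e' b t) * c' b (snd p + t *\<^sub>R (fst p - snd p))"
   using q unfolding e'_def c'_def by blast+
  have "\<exists>D. \<forall>p. \<forall>t\<in>{0..1}. norm (pderiv_dir b (%p. ?f p t) p) <= D" if b: "b \<in> Basis" for b
  proof -
   have "compact (e' b ` {0..1})" by (rule compact_continuous_image[OF continuous_on_subset[OF conjunct1[OF ec(1)[OF b]] subset_UNIV] compact_Icc])
   then have "bounded (e' b ` {0..1})" by (rule compact_imp_bounded)
   then obtain E' where E': "E' > 0" "!!t. t \<in> {0..1} ==> \<bar>e' b t\<bar> <= E'" by (auto simp: bounded_pos)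
   obtain C' where C': "C' > 0" "!!x. norm (c' b x) <= C'" using Cb_boundE[OF conjunct2[OF ec(1)[OF b]]] by blast
   have "norm (pderiv_dir b (%p. ?f p t) p) <= E' * C'" if "t \<in> {0..1}" for p t
    unfolding ec(2)[OF b] norm_mult using E'(2)[OF that] C' by (intro mult_mono) (auto intro: less_imp_le E'(1))
   then show ?thesis by (intro exI[of _ "E' * C'"]) blast
  qed
  then have "\<forall>b\<in>Basis. \<exists>D. \<forall>p. \<forall>t\<in>{0..1}. norm (pderiv_dir b (%p. ?f p t) p) <= D" by blast
  from bchoice[OF this] obtain D where D: "!!b p t. b \<in> Basis ==> t \<in> {0..1} ==> norm (pderiv_dir b (%p. ?f p t) p) <= D b" by blast
  define D' where "D' = (\<Sum>b\<in>(Basis :: ('a \<times> 'a) set). \<bar>D b\<bar>)"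
  have D': "norm (pderiv_dir b (%p. ?f p t) p) <= D'" if "b \<in> Basis" "t \<in> space ?M" for b p t
  proof -
   have "D b <= \<bar>D b\<bar>" by simp
   also have "\<dots> <= D'" unfolding D'_def using that by (intro member_le_sum) auto
   finally show ?thesis using D[OF that(1), of t p] that(2) by simp
  qed
  have m: "(%t. pderiv_dir b (%p. ?f p t) p) \<in> borel_measurable ?M" if "b \<in> Basis" for b p
   unfolding ec(2)[OF that] using ec(1)[OF that] by (intro meas) auto
  have df: "(%p. ?f p t) differentiable (at p)" for p t unfolding differentiable_def using der by blast
  have D2: "norm (pderiv_dir b (%p. ?f p t) p) <= D'" if "b \<in> Basis" "p \<in> ball p0 1" "t \<in> space ?M" for b p t p0
   by (rule D'[OF that(1,3)])
  have P1: "(%p. integral\<^sup>L ?M (?f p)) differentiable (at p0)" for p0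
   by (rule pderiv_integral(1)[OF zero_less_one int df _ ci D2]) (rule m)
  have P2: "pderiv_dir b (%p. integral\<^sup>L ?M (?f p)) p0 = integral\<^sup>L ?M (%t. pderiv_dir b (%p. ?f p t) p0)" if "b \<in> Basis" for b p0
   by (rule pderiv_integral(2)[OF zero_less_one int df _ ci D2 that]) (rule m)
  have "\<Phi> e c differentiable_on UNIV" using P1 unfolding \<Phi>_def[abs_def] differentiable_on_def by simp
  moreover have "?X (pderiv_dir b (\<Phi> e c))" if b: "b \<in> Basis" for b
  proof -
   have "pderiv_dir b (\<Phi> e c) = \<Phi> (e' b) (c' b)"
    using P2[OF b] unfolding \<Phi>_def[abs_def] by (simp add: fun_eq_iff ec(2)[OF b])
   then show ?thesis using ec(1)[OF b] by blast
  qed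
  moreover have "bounded (range (\<Phi> e c))" using bnd unfolding bounded_iff by blast
  ultimately show ?thesis by blast
 qed
 have "Cb (\<Phi> (%_. 1) c)"
 proof (rule all_derivs_coinduct[where X = ?X])
  show "?X (\<Phi> (%_. 1) c)" using assms by (intro exI[of _ "%_. 1"] exI[of _ c]) auto
 qed (use key in blast)+
 then show ?thesis by (simp add: \<Phi>_def[abs_def])
qed


lemma continuous_on_jacobian_nth:
 fixes g :: "real ^ 'n::finite => real ^ 'm::finite"
 assumes "bder g"
 shows "continuous_on S (%th::real. jacobian g (at (y' + th *\<^sub>R (y - y'))) $ i $ j)"
 by (rule continuous_on_compose2[OF Cb_D(3)[OF Cb_jacobian[OF assms], of UNIV]]) (auto intro!: continuous_intros)

lemma integrable_jacobian:
 fixes g :: "real ^ 'n::finite => real ^ 'm::finite"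
 assumes "bder g"
 shows "(%th::real. jacobian g (at (y' + th *\<^sub>R (y - y')))) integrable_on {0..1}"
proof (rule integrable_continuous_real)
 have "continuous_on {0..1} (%th::real. \<chi> i j. jacobian g (at (y' + th *\<^sub>R (y - y'))) $ i $ j)"
  by (intro continuous_on_vec_lambda continuous_on_jacobian_nth assms)
 then show "continuous_on {0..1} (%th::real. jacobian g (at (y' + th *\<^sub>R (y - y'))))" by simp
qed

lemma Xi_nth:
 assumes "bder g"
 shows "Xi g y y' $ i $ j = integral {0..1} (%th::real. jacobian g (at (y' + th *\<^sub>R (y - y'))) $ i $ j)"
proof -
 have "bounded_linear (%A::real ^ 'a ^ 'a. A $ i $ j)"
  by (rule bounded_linear_compose[OF bounded_linear_vec_nth bounded_linear_vec_nth])
 from integral_linear[OF integrable_jacobian[OF assms] this, of y' y] show ?thesis by (simp add: Xi_def o_def)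
qed

lemma Cb_Xi:
 assumes "bder g" shows "Cb (%p. Xi g (fst p) (snd p) $ i $ j)"
proof -
 let ?c = "%x. complex_of_real (jacobian g (at x) $ i $ j)"
 have "Cb ?c" by (intro Cb_of_real Cb_jacobian assms)
 from Cb_bounded_linear[OF bounded_linear_Re Cb_average[OF this]]
 have *: "Cb (%p. Re (integral\<^sup>L (lebesgue_on {0..1}) (%t::real. ?c (snd p + t *\<^sub>R (fst p - snd p)))))" .
 have "Re (integral\<^sup>L (lebesgue_on {0..1}) (%t::real. ?c (snd p + t *\<^sub>R (fst p - snd p)))) = Xi g (fst p) (snd p) $ i $ j" for p
 proof -
  have "integral\<^sup>L (lebesgue_on {0..1}) (%t::real. jacobian g (at (snd p + t *\<^sub>R (fst p - snd p))) $ i $ j)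
   = integral {0..1} (%t::real. jacobian g (at (snd p + t *\<^sub>R (fst p - snd p))) $ i $ j)"
   by (rule lebesgue_integral_eq_integral[OF continuous_imp_integrable_real[OF continuous_on_jacobian_nth[OF assms]]]) auto
  then show ?thesis by (simp add: Xi_nth[OF assms])
 qed
 with * show ?thesis by simp
qed

lemma Xi_mean_value:
 assumes g: "bder g" shows "g y - g y' = Xi g y y' *v (y - y')"
proof -
 let ?J = "%th::real. jacobian g (at (y' + th *\<^sub>R (y - y')))"
 have gd: "g differentiable (at x)" for x
  using g by (intro differentiable_on_UNIV_D) (simp add: bder_def)
 have "((%th. g (y' + th *\<^sub>R (y - y'))) has_vector_derivative ?J th *v (y - y')) (at th within {0..1})" for th
 proof -
  have d0: "((%th::real. y' + th *\<^sub>R (y - y')) has_derivative (%t. t *\<^sub>R (y - y'))) (at th within {0..1})"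
   by (auto intro!: derivative_eq_intros)
  from has_derivative_compose[OF d0 iffD1[OF jacobian_works gd]]
  show ?thesis unfolding has_vector_derivative_def by (simp add: matrix_vector_mult_scaleR)
 qed
 from fundamental_theorem_of_calculus[OF zero_le_one this]
 have "((%th. ?J th *v (y - y')) has_integral (g y - g y')) {0..1}" by simp
 moreover have "integral {0..1} (%th. ?J th *v (y - y')) = Xi g y y' *v (y - y')"
 proof -
  have "linear (%A::real ^ 'a ^ 'a. A *v (y - y'))"
   by (auto intro!: linearI simp: matrix_vector_mult_add_rdistrib scaleR_matrix_vector_assoc)
  then have "bounded_linear (%A::real ^ 'a ^ 'a. A *v (y - y'))" by (simp add: linear_conv_bounded_linear)
  from integral_linear[OF integrable_jacobian[OF g] this, of y' y] show ?thesis by (simp add: Xi_def o_def)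
 qed
 ultimately show ?thesis by (simp add: integral_unique)
qed

lemma Xi_diagonal: "Xi g y y = jacobian g (at y)"
 by (simp add: Xi_def)

text \<open>By \<open>Cb_Xi\<close> the mean Jacobian is Lipschitz in the pair of points, and on the
  diagonal it is the Jacobian.\<close>

lemma Xi_near_jacobian:
 assumes "bder g"
 obtains L where "L > 0" "!!y y' i j. \<bar>Xi g y y' $ i $ j - jacobian g (at y') $ i $ j\<bar> <= L * norm (y - y')"
proof -
 have "\<exists>L. L > 0 & (\<forall>y y'. \<bar>Xi g y y' $ i $ j - jacobian g (at y') $ i $ j\<bar> <= L * norm (y - y'))" for i j
 proof -
  obtain L where L: "L > 0" "!!p q. norm (Xi g (fst p) (snd p) $ i $ j - Xi g (fst q) (snd q) $ i $ j) <= L * norm (p - q)"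
   using bder_lipschitz[OF Cb_imp_bder[OF Cb_Xi[OF assms]]] by blast
  have "\<bar>Xi g y y' $ i $ j - jacobian g (at y') $ i $ j\<bar> <= L * norm (y - y')" for y y'
   using L(2)[of "(y, y')" "(y', y')"] by (simp add: Xi_diagonal norm_Pair)
  with L(1) show ?thesis by blast
 qed
 then obtain L where L: "!!i j. L i j > 0" "!!i j y y'. \<bar>Xi g y y' $ i $ j - jacobian g (at y') $ i $ j\<bar> <= L i j * norm (y - y')"
  by metis
 show ?thesis
 proof (rule that)
  show "(\<Sum>i\<in>UNIV. \<Sum>j\<in>UNIV. L i j) > 0" by (simp add: sum_pos L)
  fix y y' i j
  have "L i j <= (\<Sum>j\<in>UNIV. L i j)" using L(1) by (intro member_le_sum) (auto intro: less_imp_le)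
  also have "\<dots> <= (\<Sum>i\<in>UNIV. \<Sum>j\<in>UNIV. L i j)"
   by (intro member_le_sum[of i UNIV "%i. \<Sum>j\<in>UNIV. L i j"] sum_nonneg less_imp_le[OF L(1)]) auto
  finally show "\<bar>Xi g y y' $ i $ j - jacobian g (at y') $ i $ j\<bar> <= (\<Sum>i\<in>UNIV. \<Sum>j\<in>UNIV. L i j) * norm (y - y')"
   by (rule order_trans[OF L(2) mult_right_mono]) simp
 qed
qed

lemma norm_matrix_le:
 fixes A :: "real ^ 'n::finite ^ 'm::finite" and M :: real
 assumes "!!i j. \<bar>A $ i $ j\<bar> <= M" shows "norm A <= CARD('m) * CARD('n) * M"
proof -
 have "norm A <= (\<Sum>i\<in>UNIV. norm (A $ i))" unfolding norm_vec_def by (rule L2_set_le_sum) simp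
 also have "\<dots> <= (\<Sum>i\<in>(UNIV::'m set). CARD('n) * M)"
 proof (rule sum_mono)
  fix i show "norm (A $ i) <= CARD('n) * M"
   using norm_le_l1_cart[of "A $ i"] sum_bounded_above[of "UNIV :: 'n set" "%j. \<bar>A $ i $ j\<bar>" M] assms by simp
 qed
 finally show ?thesis by (simp add: mult.assoc)
qed

text \<open>The determinant is uniformly continuous on the compact set of matrices with entries at
  most M + 1; \<epsilon> <= 1 keeps B in this set.\<close>

lemma det_perturb:
 fixes M e :: real
 assumes "e > 0"
 obtains \<epsilon> where "\<epsilon> > 0" "!!A B :: real ^ 'n::finite ^ 'n. (!!i j. \<bar>A $ i $ j\<bar> <= M) ==> (!!i j. \<bar>B $ i $ j - A $ i $ j\<bar> <= \<epsilon>) ==> \<bar>det B - det A\<bar> <= e"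
proof -
 define K where "K = {A :: real ^ 'n ^ 'n. \<forall>i j. \<bar>A $ i $ j\<bar> <= M + 1}"
 have "bounded K" unfolding bounded_iff K_def using norm_matrix_le[where M = "M + 1"] by blast
 moreover have "closed K" unfolding K_def by (intro closed_Collect_all closed_Collect_le continuous_intros)
 moreover have "continuous_on K (det :: real ^ 'n ^ 'n => real)" unfolding det_def by (intro continuous_intros)
 ultimately have "uniformly_continuous_on K (det :: real ^ 'n ^ 'n => real)"
  by (intro compact_uniformly_continuous) (simp_all add: compact_eq_bounded_closed)
 then obtain d where d: "d > 0" "!!A B :: real ^ 'n ^ 'n. A \<in> K ==> B \<in> K ==> dist B A < d ==> dist (det B) (det A) < e"
  unfolding uniformly_continuous_on_def using assms by meson
 let ?n = "real CARD('n)"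
 define \<epsilon> where "\<epsilon> = min 1 (d / (2 * (?n * ?n)))"
 show ?thesis
 proof (rule that[of \<epsilon>])
  show "\<epsilon> > 0" using d(1) by (simp add: \<epsilon>_def)
  fix A B :: "real ^ 'n ^ 'n" assume A: "!!i j. \<bar>A $ i $ j\<bar> <= M" and B: "!!i j. \<bar>B $ i $ j - A $ i $ j\<bar> <= \<epsilon>"
  have "\<epsilon> <= 1" by (simp add: \<epsilon>_def)
  have b: "\<bar>B $ i $ j\<bar> <= M + 1" and a: "\<bar>A $ i $ j\<bar> <= M + 1" for i j
   using A[of i j] B[of i j] \<open>\<epsilon> <= 1\<close> by linarith+
  have "norm (B - A) <= ?n * ?n * \<epsilon>" using B norm_matrix_le[of "B - A" \<epsilon>] by simp
  also have "\<dots> <= ?n * ?n * (d / (2 * (?n * ?n)))" by (intro mult_left_mono) (simp_all add: \<epsilon>_def)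
  also have "\<dots> < d" using d(1) by simp
  finally have "dist (det B) (det A) < e" using a b by (intro d(2)) (simp_all add: K_def dist_norm)
  then show "\<bar>det B - det A\<bar> <= e" by (simp add: dist_real_def)
 qed
qed

context diffeo
begin

text \<open>The mean Jacobian is invertible near the diagonal only. \<open>mid c\<close> interpolates between it, where
 \<open>c = 1\<close>, and the Jacobian, where \<open>c = 0\<close>.\<close>

definition mid :: "((real ^ 'n) \<times> (real ^ 'n) => complex) => real ^ 'n => real ^ 'n => real ^ 'n ^ 'n" where
 "mid c y y' = J y' + Re (c (h y, h y')) *\<^sub>R (Xi h y y' - J y')"

lemma mid_eq_Xi: "c (h y, h y') = 1 ==> mid c y y' = Xi h y y'"
 by (simp add: mid_def)

lemma bder_hh: "bder (%p. (h (fst p), h (snd p)))"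
 by (intro bder_Pair bder_compose[OF bder_h] bder_fst bder_snd bder_ident)

lemma Cb_J_snd: "Cb (%p :: (real ^ 'n) \<times> (real ^ 'n). J (snd p) $ i $ j)"
 by (rule Cb_compose[OF Cb_jacobian[OF bder_h] bder_snd[OF bder_ident]])

lemma Cb_mid:
 assumes "Cb c" shows "Cb (%p. mid c (fst p) (snd p) $ i $ j)"
proof -
 have "Cb (%p. Re (c (h (fst p), h (snd p))))"
  by (rule Cb_bounded_linear[OF bounded_linear_Re Cb_compose[OF assms bder_hh]])
 then have "Cb (%p. J (snd p) $ i $ j + Re (c (h (fst p), h (snd p))) * (Xi h (fst p) (snd p) $ i $ j - J (snd p) $ i $ j))"
  by (intro Cb_add Cb_mult Cb_diff Cb_Xi Cb_J_snd bder_h)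
 then show ?thesis by (simp add: mid_def)
qed

text \<open>Where the cut-off is nonzero, |h y - h y'| < 4 s and hence |y - y'| <= 4 s Lk. There the
  entries of \<open>mid\<close> differ from those of the Jacobian by a multiple of s; elsewhere
  \<open>mid\<close> is the Jacobian. The threshold s0 depends on c only through the bound
  M.\<close>

lemma mid_det_bound:
 obtains s0 c0 \<sigma> where "s0 > 0" "c0 > 0" "\<sigma> = 1 \<or> \<sigma> = - 1" "!!y. \<bar>det (J y)\<bar> = \<sigma> * det (J y)"
  "!!s c y y'. s < s0 ==> (!!p. norm (c p) <= M) ==> (!!x x'. norm (x - x') >= 4 * s ==> c (x, x') = 0) ==>
   \<sigma> * det (mid c y y') >= c0"
proof -
 obtain c1 where c1: "c1 > 0" "!!y. \<bar>det (J y)\<bar> >= c1" by (rule det_bound) blast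
 obtain \<sigma> :: real where \<sigma>: "\<sigma> = 1 \<or> \<sigma> = - 1" "!!y. \<bar>det (J y)\<bar> = \<sigma> * det (J y)" by (rule det_J_sign) blast
 have "\<exists>D. \<forall>y. \<bar>J y $ i $ j\<bar> <= D" for i j
  using Cb_D(2)[OF Cb_jacobian[OF bder_h, of i j]] unfolding bounded_iff by auto
 then obtain D where D: "!!y i j. \<bar>J y $ i $ j\<bar> <= D i j" by metis
 define D' where "D' = Max (range (%(i, j). D i j))"
 have D': "\<bar>J y $ i $ j\<bar> <= D'" for y i j
  by (rule order_trans[OF D]) (auto simp: D'_def intro!: Max_ge image_eqI[of _ _ "(i, j)"])
 have "c1 / 2 > 0" using c1 by simp
 then obtain \<epsilon> where \<epsilon>: "\<epsilon> > 0" "!!A B :: real ^ 'n ^ 'n. (!!i j. \<bar>A $ i $ j\<bar> <= D') ==> (!!i j. \<bar>B $ i $ j - A $ i $ j\<bar> <= \<epsilon>) ==> \<bar>det B - det A\<bar> <= c1 / 2"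
  by (rule det_perturb) blast
 obtain L where L: "L > 0" "!!y y' i j. \<bar>Xi h y y' $ i $ j - J y' $ i $ j\<bar> <= L * norm (y - y')"
  by (rule Xi_near_jacobian[OF bder_h]) blast
 obtain Lk where Lk: "Lk > 0" "!!x x'. norm (k x - k x') <= Lk * norm (x - x')" using bder_lipschitz[OF bder_k] by blast
 \<comment> \<open>M' is positive even if M is not. The next constant is chosen such that 4 M' L Lk
   s0 = \<epsilon>.\<close>
 define M' where "M' = max M 1"
 define s0 where "s0 = \<epsilon> / (4 * (M' * (L * Lk)))"
 have pos: "M' * (L * Lk) > 0" using L(1) Lk(1) by (simp add: M'_def)
 show ?thesis
 proof (rule that[of s0 "c1 / 2" \<sigma>])
  show "s0 > 0" using pos \<epsilon>(1) by (simp add: s0_def)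
  fix s :: real and c :: "(real ^ 'n) \<times> (real ^ 'n) => complex" and y y'
  assume s: "s < s0" and M: "!!p. norm (c p) <= M" and c: "!!x x'. norm (x - x') >= 4 * s ==> c (x, x') = 0"
  have "\<bar>mid c y y' $ i $ j - J y' $ i $ j\<bar> <= \<epsilon>" for i j
  proof (cases "norm (h y - h y') >= 4 * s")
   case True then show ?thesis using c \<epsilon>(1) by (simp add: mid_def)
  next
   case False
   have "norm (y - y') <= Lk * norm (h y - h y')" using Lk(2)[of "h y" "h y'"] by simp
   also have "\<dots> <= Lk * (4 * s)" using False Lk(1) by (intro mult_left_mono) auto
   finally have y: "norm (y - y') <= Lk * (4 * s)" .
   have "\<bar>mid c y y' $ i $ j - J y' $ i $ j\<bar> = \<bar>Re (c (h y, h y'))\<bar> * \<bar>Xi h y y' $ i $ j - J y' $ i $ j\<bar>"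
    by (simp add: mid_def abs_mult)
   also have "\<dots> <= M' * (L * (Lk * (4 * s)))"
   proof (intro mult_mono)
    show "\<bar>Re (c (h y, h y'))\<bar> <= M'" using abs_Re_le_cmod[of "c (h y, h y')"] M[of "(h y, h y')"] by (simp add: M'_def)
    show "\<bar>Xi h y y' $ i $ j - J y' $ i $ j\<bar> <= L * (Lk * (4 * s))"
     by (rule order_trans[OF L(2) mult_left_mono[OF y]]) (use L(1) in simp)
   qed (auto simp: M'_def)
   also have "\<dots> = 4 * (M' * (L * Lk)) * s" by simp
   also have "\<dots> <= 4 * (M' * (L * Lk)) * s0" using s pos by (intro mult_left_mono) auto
   also have "\<dots> = \<epsilon>" using pos unfolding s0_def times_divide_eq_right by (intro nonzero_mult_div_cancel_left) linarith
   finally show ?thesis .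
  qed
  from \<epsilon>(2)[OF D' this] have "\<bar>det (mid c y y') - det (J y')\<bar> <= c1 / 2" by simp
  moreover have "\<sigma> * det (J y') >= c1" using c1(2)[of y'] \<sigma>(2)[of y'] by simp
  ultimately show "c1 / 2 <= \<sigma> * det (mid c y y')"
   using \<sigma>(1) by (auto, linarith+)
 qed (use c1 \<sigma> in auto)
qed

end

section \<open>Cut-offs from the partition of unity\<close>

lemma finite_bounded_lattice: "finite {z :: real ^ 'n::finite. \<forall>i. z $ i \<in> \<int> & \<bar>z $ i\<bar> <= s}"
proof -
 let ?F = "real_of_int ` {- \<lceil>s\<rceil>..\<lceil>s\<rceil>}"
 have "z $ i \<in> ?F" if z: "z $ i \<in> \<int>" "\<bar>z $ i\<bar> <= s" for z :: "real ^ 'n" and i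
 proof -
  from z(1) obtain m where m: "z $ i = real_of_int m" by (rule Ints_cases)
  have "\<bar>m\<bar> <= \<lceil>s\<rceil>" using z(2) unfolding m by linarith
  then show ?thesis unfolding m by (intro imageI) auto
 qed
 then have F: "vec_nth z \<in> PiE UNIV (%_. ?F)" if "\<forall>i. z $ i \<in> \<int> & \<bar>z $ i\<bar> <= s" for z :: "real ^ 'n"
  using \<open>\<forall>i. _\<close> by (simp add: PiE_UNIV_domain)
 have "{z :: real ^ 'n. \<forall>i. z $ i \<in> \<int> & \<bar>z $ i\<bar> <= s} \<subseteq> vec_lambda ` (PiE UNIV (%_. ?F))"
 proof
  fix z :: "real ^ 'n" assume "z \<in> {z. \<forall>i. z $ i \<in> \<int> & \<bar>z $ i\<bar> <= s}"
  then have "vec_nth z \<in> PiE UNIV (%_. ?F)" using F[of z] by blast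
  then show "z \<in> vec_lambda ` (PiE UNIV (%_. ?F))" by (rule image_eqI[rotated]) (simp add: vec_nth_inverse)
 qed
 moreover have "finite (PiE (UNIV :: 'n set) (%_. ?F))" by (rule finite_PiE) simp_all
 ultimately show ?thesis by (rule finite_subset[OF _ finite_imageI])
qed

text \<open>After division by r, subtracting the integer part of x / r maps the lattice points in
  question injectively into a fixed finite set. The integer part moves a coordinate by at most 1,
  hence s + 1. That N is independent of r makes the bounds on the cut-offs uniform in the
  scale.\<close>

lemma lattice_ball_count:
 assumes "lattice_enumeration (\<gamma> :: nat => real ^ 'n::finite)"
 obtains N :: nat where "!!r x. r > 0 ==> finite {j. norm (x - r *\<^sub>R \<gamma> j) <= r * s} & card {j. norm (x - r *\<^sub>R \<gamma> j) <= r * s} <= N"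
proof -
 let ?S = "{z :: real ^ 'n. \<forall>i. z $ i \<in> \<int> & \<bar>z $ i\<bar> <= s + 1}"
 have g: "inj \<gamma>" "\<gamma> j $ i \<in> \<int>" for j i
  using assms by (auto simp: lattice_enumeration_def bij_betw_def)
 show ?thesis
 proof (rule that[of "card ?S"])
  fix r :: real and x :: "real ^ 'n" assume r: "r > 0"
  let ?A = "{j. norm (x - r *\<^sub>R \<gamma> j) <= r * s}"
  let ?f = "%j. \<gamma> j - (\<chi> i. real_of_int \<lfloor>x $ i / r\<rfloor>)"
  have inj: "inj_on ?f ?A" using g(1) by (auto simp: inj_on_def)
  have im: "?f ` ?A \<subseteq> ?S"
  proof (rule image_subsetI, rule CollectI, intro allI conjI)
   fix j i assume j: "j \<in> ?A"
   show "?f j $ i \<in> \<int>" using g(2) by simp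
   have "\<bar>(x - r *\<^sub>R \<gamma> j) $ i\<bar> <= r * s" using j component_le_norm_cart[of "x - r *\<^sub>R \<gamma> j" i] by simp
   then have "\<bar>x $ i / r - \<gamma> j $ i\<bar> <= s" using r by (simp add: abs_le_iff field_simps)
   then show "\<bar>?f j $ i\<bar> <= s + 1" by (simp, linarith)
  qed
  show "finite ?A & card ?A <= card ?S"
   using inj_on_finite[OF inj im finite_bounded_lattice] card_inj_on_le[OF inj im finite_bounded_lattice] by blast
 qed
qed

lemma mpderiv_outside_supp:
 fixes f :: "'a::euclidean_space => 'b::real_normed_vector"
 shows "x \<notin> supp f ==> mpderiv al f x = 0"
proof (induction al arbitrary: x)
 case Nil then show ?case using closure_subset[of "{x. f x ~= 0}"] by (auto simp: supp_def)
next
 case (Cons b al)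
 have "((%_. 0) has_derivative (%_. 0)) (at x)" by simp
 then have "(mpderiv al f has_derivative (%_. 0)) (at x)"
  by (rule has_derivative_transform_within_open[of _ _ _ _ "- supp f"])
   (use Cons in \<open>auto simp: supp_def open_Compl\<close>)
 then show ?case by (simp add: pderiv_dir_eq)
qed

locale partition_of_unity =
 fixes \<gamma> :: "nat => real ^ 'n::finite" and c\<^sub>\<phi> c\<^sub>\<psi> r \<phi> \<psi>
 assumes lattice: "lattice_enumeration \<gamma>" and r: "r > 0"
  and partition: "adapted_partition \<gamma> c\<^sub>\<phi> c\<^sub>\<psi> r \<phi> \<psi>"
begin

definition near :: "real => real ^ 'n => nat set" where
 "near s x = {j. norm (x - r *\<^sub>R \<gamma> j) <= r * s}"

text \<open>For empty lists this is the cut-off; the lists are there because its derivatives are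
  again of this form.\<close>

definition psum :: "(real ^ 'n) list => (real ^ 'n) list => (real ^ 'n) \<times> (real ^ 'n) => complex" where
 "psum al \<beta> p = (\<Sum>j. mpderiv al (\<phi> j) (fst p) * mpderiv \<beta> (\<psi> j) (snd p))"

lemma finite_near: "finite (near s x)"
 by (rule lattice_ball_count[OF lattice, of s]) (use r in \<open>auto simp: near_def\<close>)

lemma phi_active: "mpderiv al (\<phi> j) x ~= 0 ==> norm (x - r *\<^sub>R \<gamma> j) < r * sqrt CARD('n)"
 and psi_active: "\<psi> j x ~= 0 ==> norm (x - r *\<^sub>R \<gamma> j) < 3 * r * sqrt CARD('n)"
 and psi_one: "norm (x - r *\<^sub>R \<gamma> j) < 2 * r * sqrt CARD('n) ==> \<psi> j x = 1"
 and phi_sums: "(%j. \<phi> j x) sums 1"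
proof -
 have P: "supp (\<phi> j) \<subseteq> ball (r *\<^sub>R \<gamma> j) (r * sqrt CARD('n))" "supp (\<psi> j) \<subseteq> ball (r *\<^sub>R \<gamma> j) (3 * r * sqrt CARD('n))"
  "\<forall>x \<in> ball (r *\<^sub>R \<gamma> j) (2 * r * sqrt CARD('n)). \<psi> j x = 1"
  using partition unfolding adapted_partition_def by blast+
 show "norm (x - r *\<^sub>R \<gamma> j) < r * sqrt CARD('n)" if a: "mpderiv al (\<phi> j) x ~= 0"
 proof -
  have "x \<in> supp (\<phi> j)" using mpderiv_outside_supp[of x "\<phi> j" al] a by blast
  with P(1) show ?thesis by (auto simp: dist_norm norm_minus_commute)
 qed
 show "norm (x - r *\<^sub>R \<gamma> j) < 3 * r * sqrt CARD('n)" if a: "\<psi> j x ~= 0"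
 proof -
  have "x \<in> supp (\<psi> j)" using mpderiv_outside_supp[of x "\<psi> j" "[]"] a by auto
  with P(2) show ?thesis by (auto simp: dist_norm norm_minus_commute)
 qed
 show "\<psi> j x = 1" if "norm (x - r *\<^sub>R \<gamma> j) < 2 * r * sqrt CARD('n)"
  using P(3) that by (simp add: dist_norm norm_minus_commute)
 show "(%j. \<phi> j x) sums 1" using partition unfolding adapted_partition_def by blast
qed

text \<open>Enlarging the radius from sqrt n to sqrt n + 1, in units of r, makes one finite index
  set serve all x in a ball of radius r, as differentiation requires.\<close>

lemma psum_eq:
 assumes "norm (x - x0) <= r"
 shows "psum al \<beta> (x, x') = (\<Sum>j\<in>near (sqrt CARD('n) + 1) x0. mpderiv al (\<phi> j) x * mpderiv \<beta> (\<psi> j) x')"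
 unfolding psum_def fst_conv snd_conv
proof (rule suminf_finite[OF finite_near])
 fix j assume j: "j \<notin> near (sqrt CARD('n) + 1) x0"
 have "\<not> norm (x - r *\<^sub>R \<gamma> j) < r * sqrt CARD('n)"
  using j assms norm_triangle_ineq[of "x0 - x" "x - r *\<^sub>R \<gamma> j"] by (auto simp: near_def norm_minus_commute algebra_simps)
 then show "mpderiv al (\<phi> j) x * mpderiv \<beta> (\<psi> j) x' = 0" using phi_active by auto
qed

lemma psum_bound:
 assumes N: "!!x. card (near (sqrt CARD('n) + 1) x) <= N" and ab: "al \<in> lists Basis" "\<beta> \<in> lists Basis"
 shows "norm (psum al \<beta> p) <= N * ((c\<^sub>\<phi> al * r powr (- real (length al))) * (c\<^sub>\<psi> \<beta> * r powr (- real (length \<beta>))))"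
proof -
 have b: "norm (mpderiv al (\<phi> j) x) <= c\<^sub>\<phi> al * r powr (- real (length al))"
  "norm (mpderiv \<beta> (\<psi> j) x) <= c\<^sub>\<psi> \<beta> * r powr (- real (length \<beta>))" for j x
  using partition ab unfolding adapted_partition_def by blast+
 let ?B = "(c\<^sub>\<phi> al * r powr (- real (length al))) * (c\<^sub>\<psi> \<beta> * r powr (- real (length \<beta>)))"
 have nn: "0 <= c\<^sub>\<phi> al * r powr (- real (length al))" "0 <= c\<^sub>\<psi> \<beta> * r powr (- real (length \<beta>))"
  using order_trans[OF norm_ge_zero b(1)] order_trans[OF norm_ge_zero b(2)] by blast+
 obtain x x' where p: "p = (x, x')" by (cases p)
 have e: "psum al \<beta> p = (\<Sum>j\<in>near (sqrt CARD('n) + 1) x. mpderiv al (\<phi> j) x * mpderiv \<beta> (\<psi> j) x')"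
  unfolding p by (rule psum_eq) (use r in simp)
 have "norm (psum al \<beta> p) <= (\<Sum>j\<in>near (sqrt CARD('n) + 1) x. ?B)"
  unfolding e by (rule sum_norm_le) (simp only: norm_mult, rule mult_mono[OF b nn(1) norm_ge_zero])
 also have "\<dots> <= N * ?B"
  using N[of x] nn by (simp only: sum_constant) (intro mult_right_mono; simp)
 finally show ?thesis .
qed

lemma smooth_pieces: "all_derivs (%_. True) (\<phi> j)" "all_derivs (%_. True) (\<psi> j)"
 using partition unfolding adapted_partition_def smooth_iff by blast+

lemma psum_has_derivative:
 assumes ab: "al \<in> lists Basis" "\<beta> \<in> lists Basis"
 shows "(psum al \<beta> has_derivative (%v. \<Sum>j\<in>near (sqrt CARD('n) + 1) (fst p).
  mpderiv al (\<phi> j) (fst p) * pderiv_dir (snd v) (mpderiv \<beta> (\<psi> j)) (snd p)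
  + pderiv_dir (fst v) (mpderiv al (\<phi> j)) (fst p) * mpderiv \<beta> (\<psi> j) (snd p))) (at p)"
proof -
 let ?F = "near (sqrt CARD('n) + 1) (fst p)"
 have d: "mpderiv al (\<phi> j) differentiable (at x)" "mpderiv \<beta> (\<psi> j) differentiable (at x)" for j x
  using smooth_pieces[of j] ab unfolding all_derivs_def by (auto intro: differentiable_on_UNIV_D)
 have "((%q. \<Sum>j\<in>?F. mpderiv al (\<phi> j) (fst q) * mpderiv \<beta> (\<psi> j) (snd q)) has_derivative (%v. \<Sum>j\<in>?F.
  mpderiv al (\<phi> j) (fst p) * pderiv_dir (snd v) (mpderiv \<beta> (\<psi> j)) (snd p)
  + pderiv_dir (fst v) (mpderiv al (\<phi> j)) (fst p) * mpderiv \<beta> (\<psi> j) (snd p))) (at p)"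
  by (intro has_derivative_sum has_derivative_mult
    has_derivative_compose[OF bounded_linear.has_derivative[OF bounded_linear_fst has_derivative_ident] has_derivative_pderiv'[OF d(1)]]
    has_derivative_compose[OF bounded_linear.has_derivative[OF bounded_linear_snd has_derivative_ident] has_derivative_pderiv'[OF d(2)]])
 then show ?thesis
 proof (rule has_derivative_transform_within_open[of _ _ _ _ "ball (fst p) r \<times> UNIV"])
  show "open (ball (fst p) r \<times> (UNIV :: (real ^ 'n) set))" by (intro open_Times) auto
  show "p \<in> ball (fst p) r \<times> UNIV" using r by (cases p) auto
  fix q :: "(real ^ 'n) \<times> (real ^ 'n)" assume "q \<in> ball (fst p) r \<times> UNIV"
  then show "(\<Sum>j\<in>?F. mpderiv al (\<phi> j) (fst q) * mpderiv \<beta> (\<psi> j) (snd q)) = psum al \<beta> q"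
   by (cases q) (auto simp: dist_norm norm_minus_commute intro!: psum_eq[symmetric])
 qed
qed

lemma Cb_psum:
 assumes "al \<in> lists Basis" "\<beta> \<in> lists Basis" shows "Cb (psum al \<beta>)"
proof (rule all_derivs_coinduct[where X = "%f. \<exists>al\<in>lists Basis. \<exists>\<beta>\<in>lists Basis. f = psum al \<beta>"])
 show "\<exists>al'\<in>lists Basis. \<exists>\<beta>'\<in>lists Basis. psum al \<beta> = psum al' \<beta>'" using assms by blast
next
 fix f assume "\<exists>al\<in>lists Basis. \<exists>\<beta>\<in>lists Basis. f = psum al \<beta>"
 then obtain al \<beta> where ab: "al \<in> lists Basis" "\<beta> \<in> lists Basis" and f: "f = psum al \<beta>" by blast
 obtain N where N: "!!r x. r > 0 ==> finite {j. norm (x - r *\<^sub>R \<gamma> j) <= r * (sqrt CARD('n) + 1)} & card {j. norm (x - r *\<^sub>R \<gamma> j) <= r * (sqrt CARD('n) + 1)} <= N"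
  by (rule lattice_ball_count[OF lattice]) blast
 have "card (near (sqrt CARD('n) + 1) x) <= N" for x using N[OF r, of x] by (simp add: near_def)
 from psum_bound[OF this ab] have "bounded (range f)" unfolding f bounded_iff by blast
 moreover have "f differentiable_on UNIV"
  unfolding f by (rule has_derivative_differentiable_on) (rule psum_has_derivative[OF ab])
 ultimately show "f differentiable_on UNIV & bounded (range f)" by blast
 fix b :: "(real ^ 'n) \<times> (real ^ 'n)" assume b: "b \<in> Basis"
 have d: "pderiv_dir b f p = (\<Sum>j\<in>near (sqrt CARD('n) + 1) (fst p).
  mpderiv al (\<phi> j) (fst p) * pderiv_dir (snd b) (mpderiv \<beta> (\<psi> j)) (snd p)
  + pderiv_dir (fst b) (mpderiv al (\<phi> j)) (fst p) * mpderiv \<beta> (\<psi> j) (snd p))" for p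
  unfolding f by (rule pderiv_dir_eq[OF psum_has_derivative[OF ab]])
 have z: "pderiv_dir 0 (mpderiv al (\<phi> j)) x = 0" "pderiv_dir 0 (mpderiv \<beta> (\<psi> j)) x = 0" for j x
 proof -
  have "mpderiv al (\<phi> j) differentiable (at x)" "mpderiv \<beta> (\<psi> j) differentiable (at x)"
   using smooth_pieces[of j] ab unfolding all_derivs_def by (auto intro: differentiable_on_UNIV_D)
  then show "pderiv_dir 0 (mpderiv al (\<phi> j)) x = 0" "pderiv_dir 0 (mpderiv \<beta> (\<psi> j)) x = 0"
   using linear_0[OF pderiv_dir_linear] by blast+
 qed
 have e: "psum al' \<beta>' p = (\<Sum>j\<in>near (sqrt CARD('n) + 1) (fst p). mpderiv al' (\<phi> j) (fst p) * mpderiv \<beta>' (\<psi> j) (snd p))" for al' \<beta>' p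
  using psum_eq[of "fst p" "fst p" al' \<beta>' "snd p"] r by simp
 from b consider b1 where "b = (b1, 0)" "b1 \<in> Basis" | b2 where "b = (0, b2)" "b2 \<in> Basis"
  by (auto simp: Basis_prod_def)
 then show "\<exists>al\<in>lists Basis. \<exists>\<beta>\<in>lists Basis. pderiv_dir b f = psum al \<beta>"
 proof cases
  case 1
  have "pderiv_dir b f = psum (b1 # al) \<beta>" by (rule ext) (simp add: d[unfolded 1(1)] 1(1) e z)
  moreover have "b1 # al \<in> lists Basis" using 1 ab by simp
  ultimately show ?thesis using ab(2) by blast
 next
  case 2
  have "pderiv_dir b f = psum al (b2 # \<beta>)" by (rule ext) (simp add: d[unfolded 2(1)] 2(1) e z)
  moreover have "b2 # \<beta> \<in> lists Basis" using 2 ab by simp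
  ultimately show ?thesis using ab(1) by blast
 qed
qed

abbreviation "cutoff \<equiv> psum [] []"

lemma Cb_cutoff: "Cb cutoff"
 by (rule Cb_psum) auto

text \<open>Both points lie near the same lattice point, within 1 and 3 radii r sqrt n.\<close>

lemma cutoff_active: "\<phi> j x * \<psi> j x' ~= 0 ==> norm (x - x') < 4 * r * sqrt CARD('n)"
 using phi_active[of "[]" j x] psi_active[of j x'] norm_triangle_ineq4[of "x - r *\<^sub>R \<gamma> j" "x' - r *\<^sub>R \<gamma> j"] by auto

text \<open>If \<phi>_j is nonzero at x, then x' is within 1 + 1 = 2 radii of the lattice point,
  where \<psi>_j = 1. What remains is the partition of unity in x.\<close>

lemma cutoff_one:
 assumes "norm (x - x') < r * sqrt CARD('n)" shows "cutoff (x, x') = 1"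
proof -
 have "\<phi> j x * \<psi> j x' = \<phi> j x" for j
 proof (cases "\<phi> j x = 0")
  case False
  then have "norm (x' - r *\<^sub>R \<gamma> j) < 2 * r * sqrt CARD('n)"
   using phi_active[of "[]" j x] assms norm_triangle_ineq[of "x' - x" "x - r *\<^sub>R \<gamma> j"] by (simp add: norm_minus_commute)
  then show ?thesis by (simp add: psi_one)
 qed simp
 then have "(%j. \<phi> j x * \<psi> j x') = (%j. \<phi> j x)" by (rule ext)
 then show ?thesis unfolding psum_def mpderiv_Nil fst_conv snd_conv using sums_unique[OF phi_sums[of x]] by (simp only:)
qed

lemma cutoff_zero:
 assumes "norm (x - x') >= 4 * (r * sqrt CARD('n))" shows "cutoff (x, x') = 0"
proof -
 have "\<phi> j x * \<psi> j x' = 0" for j using cutoff_active[of j x x'] assms by (auto simp: mult.assoc)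
 then have "(%j. \<phi> j x * \<psi> j x') = (%_. 0)" by (rule ext)
 then show ?thesis unfolding psum_def mpderiv_Nil fst_conv snd_conv by (simp only: suminf_zero)
qed

end


section \<open>Change of variables in oscillatory integrals\<close>

text \<open>For x0 = x the integral kernel of the operator, up to the factor (2 pi)^n; it is used
  once the order is so low that the integral converges absolutely.\<close>

definition Ker :: "('x => 'v::euclidean_space \<times> 'v => complex) => 'x => 'v => 'v => complex" where
 "Ker f x x0 y = (\<integral>xi. cis ((x0 - y) \<bullet> xi) * f x (xi, y) \<partial>lborel)"

lemma (in symbols) SI_swap:
 fixes f :: "'x::euclidean_space => 'v::euclidean_space \<times> 'v => complex"
 assumes f: "symb th \<rho> \<delta> k w f" and v: "Sch v" and C: "!!xi y. norm (f x (xi, y)) <= C * dw xi"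
 shows "SI f v x x0 = (\<integral>y. Ker f x x0 y * v y \<partial>lborel)"
  and "integrable lborel (%y. Ker f x x0 y * v y)"
proof -
 let ?I = "%xi y. cis ((x0 - y) \<bullet> xi) * f x (xi, y) * v y"
 obtain D where D: "D > 0" "!!y. norm (v y) <= D * dw y" using Sch_dw[OF v] by blast
 have int: "integrable (lborel \<Otimes>\<^sub>M lborel) (%p. ?I (fst p) (snd p))"
 proof (rule continuous_integrable_prod)
  show "continuous_on UNIV (%p. ?I (fst p) (snd p))"
   by (intro continuous_intros symb_joint_cont[OF f] continuous_on_compose2[OF Cb_D(3)[OF Sch_Cb[OF v], of UNIV]]) auto
  fix xi y :: 'v
  have "norm (?I xi y) <= (C * dw xi) * (D * dw y)"
   using mult_mono[OF C[of xi y] D(2)[of y]] order_trans[OF norm_ge_zero C[of xi y]] by (simp add: norm_mult)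
  then show "norm (?I (fst (xi, y)) (snd (xi, y))) <= (C * D) * (dw xi * dw y)" by (simp add: mult_ac)
 qed
 have 1: "(\<integral>y. ?I xi y \<partial>lborel) = cis (x0 \<bullet> xi) * FT f v x xi" for xi
 proof -
  have "?I xi y = cis (x0 \<bullet> xi) * (cis (- (y \<bullet> xi)) * f x (xi, y) * v y)" for y
  proof -
   have "cis ((x0 - y) \<bullet> xi) = cis (x0 \<bullet> xi) * cis (- (y \<bullet> xi))" by (simp add: cis_mult inner_diff_left)
   then show ?thesis by (simp only: mult.assoc)
  qed
  then show ?thesis unfolding FT_def by (simp only: integral_mult_right_zero)
 qed
 have 2: "(\<integral>xi. ?I xi y \<partial>lborel) = Ker f x x0 y * v y" for y
  unfolding Ker_def by (rule integral_mult_left_zero)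
 have "(\<integral>y. (\<integral>xi. ?I xi y \<partial>lborel) \<partial>lborel) = (\<integral>xi. (\<integral>y. ?I xi y \<partial>lborel) \<partial>lborel)"
  by (rule lborel_pair.Fubini_integral) (use int in \<open>simp add: split_beta'\<close>)
 then show "SI f v x x0 = (\<integral>y. Ker f x x0 y * v y \<partial>lborel)"
  unfolding SI_def by (simp only: 1 2)
 have "integrable lborel (%y. \<integral>xi. ?I xi y \<partial>lborel)"
  by (rule lborel_pair.integrable_snd) (use int in \<open>simp add: split_beta'\<close>)
 then show "integrable lborel (%y. Ker f x x0 y * v y)" by (simp only: 2)
qed

lemma integral_linear_change:
 fixes N :: "real ^ 'n::finite ^ 'n" and f :: "real ^ 'n => complex"
 assumes N: "invertible N" and f: "f \<in> borel_measurable borel"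
 shows "integral\<^sup>L lborel f = of_real \<bar>det N\<bar> * (\<integral>\<eta>. f (N *v \<eta>) \<partial>lborel)"
proof -
 have J: "jacobian ((*v) N) (at y) = N" for y
 proof -
  have "(*v) N = frechet_derivative ((*v) N) (at y)"
   by (rule frechet_derivative_at[OF bounded_linear_imp_has_derivative[OF matrix_vector_mul_bounded_linear]])
  then show ?thesis unfolding jacobian_def by (metis matrix_of_matrix_vector_mul)
 qed
 have "bij ((*v) N)" using N invertible_eq_bij by blast
 moreover have "((*v) N) differentiable_on UNIV" by (rule bounded_linear_differentiable_on) simp
 moreover have "continuous_on UNIV (%y. det (jacobian ((*v) N) (at y)))" unfolding J by (rule continuous_on_const)
 ultimately have "integral\<^sup>L lborel f = (\<integral>\<eta>. of_real \<bar>det (jacobian ((*v) N) (at \<eta>))\<bar> * f (N *v \<eta>) \<partial>lborel)"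
  by (rule integral_change_of_variables_lborel[OF _ _ _ f])
 then show ?thesis unfolding J by simp
qed

text \<open>The invariance of the phase: with A the mean Jacobian and x = y - y', the first factor
  is h y - h y'.\<close>

lemma transpose_inv_inner:
 fixes A :: "real ^ 'n::finite ^ 'n"
 assumes "invertible A" shows "(A *v x) \<bullet> (transpose (matrix_inv A) *v \<eta>) = x \<bullet> \<eta>"
proof -
 have "(A *v x) \<bullet> (transpose (matrix_inv A) *v \<eta>) = (matrix_inv A *v (A *v x)) \<bullet> \<eta>"
  unfolding transpose_matrix_vector inner_commute[of "A *v x"] dot_lmul_matrix by (rule inner_commute)
 then show ?thesis using matrix_inv_left[OF assms] by (simp add: matrix_vector_mul_assoc)
qed

lemma matrix_vector_norm_bound:
 fixes A :: "'a => real ^ 'n::finite ^ 'm::finite"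
 assumes "!!i j. bounded (range (%p. A p $ i $ j))"
 obtains K where "K >= 1" "!!p x. norm (A p *v x) <= K * norm x"
proof -
 obtain D where D: "!!i j p. \<bar>A p $ i $ j\<bar> <= D i j" using assms unfolding bounded_iff by (simp, metis)
 define D' where "D' = Max (range (%(i, j). D i j))"
 have D': "\<bar>A p $ i $ j\<bar> <= D'" for p i j
  by (rule order_trans[OF D]) (auto simp: D'_def intro!: Max_ge image_eqI[of _ _ "(i, j)"])
 show ?thesis
 proof (rule that[of "max 1 (real CARD('m) * real CARD('n) * D')"])
  fix p x
  have "norm (A p *v x) <= onorm ((*v) (A p)) * norm x" by (rule onorm[OF matrix_vector_mul_bounded_linear])
  also have "\<dots> <= (real CARD('m) * real CARD('n) * D') * norm x"
   by (intro mult_right_mono onorm_le_matrix_component D') simp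
  also have "\<dots> <= max 1 (real CARD('m) * real CARD('n) * D') * norm x" by (intro mult_right_mono) auto
  finally show "norm (A p *v x) <= max 1 (real CARD('m) * real CARD('n) * D') * norm x" .
 qed simp
qed

text \<open>A left inverse with bounded entries gives the lower bound on |N \<eta>| that keeps the
  weights in xi and \<eta> comparable.\<close>

lemma (in symbols) symb_compose_matrix:
 fixes g :: "'x2::euclidean_space => (real ^ 'n::finite) \<times> 'y2::euclidean_space => complex"
  and N N' :: "'x::euclidean_space \<times> 'y::euclidean_space => real ^ 'n ^ 'n"
 assumes g: "symb th \<rho> \<delta> k w g" and s: "bder s" and h: "bder h"
  and N: "!!i j. Cb (%p. N p $ i $ j)" and N': "!!i j. Cb (%p. N' p $ i $ j)" "!!p. N' p ** N p = mat 1"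
 shows "symb th \<rho> \<delta> k w (%x z. g (s x) (N (x, snd z) *v fst z, h (snd z)))"
proof -
 obtain K where K: "K >= 1" "!!p x. norm (N p *v x) <= K * norm x" using matrix_vector_norm_bound[OF Cb_D(2)[OF N]] by blast
 obtain K' where K': "K' >= 1" "!!p x. norm (N' p *v x) <= K' * norm x" using matrix_vector_norm_bound[OF Cb_D(2)[OF N'(1)]] by blast
 show ?thesis
 proof (rule symb_compose[where \<beta> = "%x y \<eta>. N (x, y) *v \<eta>" and K = "max K K'" and B = "%i l p. (N p *v l) \<bullet> i", OF g s h])
  show "Cb (%p. (N p *v l) \<bullet> i)" for i l :: "real ^ 'n"
   unfolding matrix_vector_mult_def inner_vec_def by (simp, intro Cb_sum Cb_mult Cb_const N)
  fix x y and \<eta> i :: "real ^ 'n"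
  have "N (x, y) *v \<eta> = N (x, y) *v (\<Sum>l\<in>Basis. (\<eta> \<bullet> l) *\<^sub>R l)" by (simp add: euclidean_representation)
  also have "\<dots> = (\<Sum>l\<in>Basis. (\<eta> \<bullet> l) *\<^sub>R (N (x, y) *v l))" by (simp add: linear_sum linear_scale)
  finally show "(N (x, y) *v \<eta>) \<bullet> i = (\<Sum>l\<in>Basis. ((N (x, y) *v l) \<bullet> i) * (\<eta> \<bullet> l))"
   by (simp add: inner_sum_left mult.commute)
  show "norm (N (x, y) *v \<eta>) <= max K K' * norm \<eta>"
   by (rule order_trans[OF K(2)]) (intro mult_right_mono; simp)
  have "\<eta> = N' (x, y) *v (N (x, y) *v \<eta>)" using N'(2) by (simp add: matrix_vector_mul_assoc)
  then have "norm \<eta> <= K' * norm (N (x, y) *v \<eta>)" using K'(2) by metis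
  then show "norm \<eta> <= max K K' * norm (N (x, y) *v \<eta>)"
   by (rule order_trans) (intro mult_right_mono; simp)
 qed (use K in auto)
qed

section \<open>Transformation of the part near the diagonal\<close>

text \<open>\<open>c\<close> truncates the symbol and \<open>C\<close> truncates the deviation of
  the mean Jacobian from the Jacobian. \<open>mid C\<close> is invertible everywhere, and because C
  = 1 where c is nonzero it is the mean Jacobian wherever the symbol is felt.\<close>

locale transformed_symbols = diffeo h + symbols th \<rho> \<delta>
 for h :: "real ^ 'n::finite => real ^ 'n" and th \<rho> \<delta> :: real +
 fixes c C :: "(real ^ 'n) \<times> (real ^ 'n) => complex" and sg c0 :: real
 assumes c: "Cb c" and C: "Cb C" and cC: "!!p. c p ~= 0 ==> C p = 1"
  and c0: "c0 > 0" and sg: "sg = 1 \<or> sg = - 1" "!!y y'. sg * det (mid C y y') >= c0"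
begin

definition "N y y' = transpose (matrix_inv (mid C y y'))"
definition "W y y' = inverse \<bar>det (mid C y y')\<bar> * \<bar>det (J y')\<bar>"
text \<open>A globally defined form of the symbol of the statement: no matrix in it is ever
  singular.\<close>

definition "transf f y z = c (h y, h (snd z)) * f (h y) (N y (snd z) *v fst z, h (snd z)) * of_real (W y (snd z))"

lemma abs_det_mid: "\<bar>det (mid C y y')\<bar> = sg * det (mid C y y')"
 using sg(1) sg(2)[of y y'] c0 by auto

lemma invertible_mid: "invertible (mid C y y')"
 using sg(2)[of y y'] c0 by (auto simp: invertible_det_nz)

lemma Cb_W: "Cb (%p. W (fst p) (snd p))"
 unfolding W_def abs_det_mid
proof (intro Cb_mult)
 show "Cb (%p. inverse (sg * det (mid C (fst p) (snd p))))"
 proof (rule Cb_inverse[OF _ c0])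
  show "Cb (%p. sg * det (mid C (fst p) (snd p)))" by (intro Cb_mult Cb_const Cb_det Cb_mid C)
  show "c0 <= norm (sg * det (mid C (fst p) (snd p)))" for p using sg(2)[of "fst p" "snd p"] by simp
 qed
 show "Cb (%p :: (real ^ 'n) \<times> (real ^ 'n). \<bar>det (J (snd p))\<bar>)"
  by (rule Cb_compose[OF Cb_abs_det_J bder_snd[OF bder_ident]])
qed

lemma Cb_N: "Cb (%p. N (fst p) (snd p) $ i $ j)"
proof -
 have "c0 <= \<bar>det (mid C (fst p) (snd p))\<bar>" for p using sg(2)[of "fst p" "snd p"] abs_det_mid by simp
 from Cb_matrix_inv[OF Cb_mid[OF C] c0 this] show ?thesis by (simp add: N_def transpose_def)
qed

lemma Cb_N_inverse: "Cb (%p. transpose (mid C (fst p) (snd p)) $ i $ j)"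
 using Cb_mid[OF C] by (simp add: transpose_def)

lemma N_inverse: "transpose (mid C y y') ** N y y' = mat 1"
 unfolding N_def matrix_transpose_mul[symmetric] using matrix_inv_left[OF invertible_mid] by (simp add: transpose_mat)

lemma bder_freeze: "bder (%p::'a::euclidean_space \<times> (real ^ 'n). (y, snd p))"
 by (intro bder_Pair bder_snd bder_ident Cb_imp_bder Cb_const)

lemma symb_transf:
 assumes f: "symb th \<rho> \<delta> d w f" shows "symb th \<rho> \<delta> d w (transf f)"
proof -
 have "symb th \<rho> \<delta> d w (%y z. f (h y) (N (fst (y, snd z)) (snd (y, snd z)) *v fst z, h (snd z)))"
  by (rule symb_compose_matrix[where N = "%p. N (fst p) (snd p)", OF f bder_h bder_h Cb_N Cb_N_inverse]) (rule N_inverse)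
 then have "symb th \<rho> \<delta> d w (%y z. f (h y) (N y (snd z) *v fst z, h (snd z)))" by simp
 moreover have "symb th \<rho> \<delta> d 0 (%y (z :: (real ^ 'n) \<times> (real ^ 'n)). complex_of_real (W y (snd z)))"
  using symb_Cb[OF Cb_of_real[OF Cb_W]] by simp
 moreover have "symb th \<rho> \<delta> d 0 (%y (z :: (real ^ 'n) \<times> (real ^ 'n)). c (h y, h (snd z)))"
  using symb_Cb[OF Cb_compose[OF c bder_hh]] by simp
 ultimately show ?thesis
  unfolding transf_def[abs_def] by (intro symb_mult[where ?w1.0 = w and ?w2.0 = 0] symb_mult[where ?w1.0 = 0 and ?w2.0 = w]) auto
qed

theorem SI_change_of_variables:
 assumes f: "symb th \<rho> \<delta> d w f" and u: "Sch u"
 shows "SI (%x z. c (x, snd z) * f x z) u (h y0) (h y0) = SI (transf f) (%y. u (h y)) y0 y0"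
proof -
 let ?x0 = "h y0" and ?v = "%y. u (h y)"
 have v: "Sch ?v" by (rule Sch_compose_h[OF u])
 define \<kappa> :: "(real ^ 'n) \<times> (real ^ 'n) => complex" where "\<kappa> = gauss"
 have \<kappa>: "Sch \<kappa>" unfolding \<kappa>_def by (rule Sch_gauss)
 define e where "e t = min 1 (norm t)" for t :: "real ^ 'n"
 have e: "continuous_on UNIV e" "!!t. 0 <= e t" "!!t. e t <= 1" unfolding e_def by (auto intro!: continuous_intros)
 \<comment> \<open>The first argument is frozen at h y0 and its slot carries the regularisation
   parameter t; at t = 0 no regularisation is left.\<close>
 define F where "F t z = \<kappa> (e t *\<^sub>R fst z, e t *\<^sub>R (snd z - ?x0)) * (c (?x0, snd z) * f ?x0 z)" for t z
 define G where "G t z = F t (N y0 (snd z) *v fst z, h (snd z)) * of_real (W y0 (snd z))" for t z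
 interpret z: symbols 0 \<rho> \<delta> by unfold_locales (use orders in auto)
 have cf: "symb th \<rho> \<delta> d w (%x z. c (x, snd z) * f x z)"
  by (rule symb_mult[OF symb_Cb[OF c] f]) simp
 have F: "symb 0 \<rho> \<delta> 0 w F" unfolding F_def[abs_def]
  by (rule symb_mult[OF symb_param_mono[OF symb_cutoff[OF \<kappa> e]] symb_freeze_x[OF cf]]) (use orders delta_nonneg in auto)
 have NC: "Cb (%p :: (real ^ 'n) \<times> (real ^ 'n). N y0 (snd p) $ i $ j)" for i j using Cb_compose[OF Cb_N bder_freeze[of y0]] by simp
 have N'C: "Cb (%p :: (real ^ 'n) \<times> (real ^ 'n). transpose (mid C y0 (snd p)) $ i $ j)" for i j
  using Cb_compose[OF Cb_N_inverse bder_freeze[of y0]] by simp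
 have WC: "Cb (%p :: (real ^ 'n) \<times> (real ^ 'n). complex_of_real (W y0 (snd p)))"
  using Cb_of_real[OF Cb_compose[OF Cb_W bder_freeze[of y0]]] by simp
 have "symb 0 \<rho> \<delta> 0 w (%t z. F t (N y0 (snd (t, snd z)) *v fst z, h (snd z)))"
  by (rule z.symb_compose_matrix[where N = "%p. N y0 (snd p)", OF F bder_ident bder_h NC N'C N_inverse])
 then have G: "symb 0 \<rho> \<delta> 0 w G"
  unfolding G_def[abs_def] using z.symb_Cb[OF WC, of 0] by (intro symb_mult[where ?w1.0 = w and ?w2.0 = 0]) simp_all
 obtain K where K: "K >= 1" "!!p x. norm (transpose (mid C y0 (snd (p :: (real ^ 'n) \<times> (real ^ 'n)))) *v x) <= K * norm x"
  using matrix_vector_norm_bound[OF Cb_D(2)[OF N'C]] by blast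
 obtain C1 where C1: "C1 >= 0" "!!x z. norm (c (x, snd z) * f x z) <= C1 * jb (fst z) powr w" using symb_bound[OF cf] by blast
 obtain D where D: "D > 0" "!!p :: (real ^ 'n) \<times> (real ^ 'n). norm (complex_of_real (W y0 (snd p))) <= D" using Cb_boundE[OF WC] by blast
 \<comment> \<open>For t ~= 0 everything is absolutely integrable in xi, so Fubini, the linear
   substitution xi = N \<eta> and the substitution by h are all legitimate. The identity passes to t
   = 0 by continuity of both sides.\<close>
 have eq: "SI F u t ?x0 = SI G ?v t y0" if t: "t ~= 0" for t
 proof -
  have "e t > 0" using t by (simp add: e_def)
  obtain E where E: "E >= 0" "!!xi y. norm (\<kappa> (e t *\<^sub>R xi, y)) <= E * (jb xi powr (- w) * dw xi)"
   using cutoff_decay[OF \<kappa> \<open>e t > 0\<close>] by blast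
  have Fb: "norm (F t (xi, y)) <= (E * C1) * dw xi" for xi y
  proof -
   have "norm (F t (xi, y)) <= (E * (jb xi powr (- w) * dw xi)) * (C1 * jb xi powr w)"
    unfolding F_def norm_mult[of "\<kappa> _"] using E C1(2)[of ?x0 "(xi, y)"] by (intro mult_mono) auto
   then show ?thesis by (simp add: powr_minus field_simps)
  qed
  have Gb: "norm (G t (\<eta>, y)) <= (E * C1 * K ^ (DIM(real ^ 'n) + 2) * D) * dw \<eta>" for \<eta> y
  proof -
   let ?xi = "N y0 y *v \<eta>"
   have "\<eta> = transpose (mid C y0 y) *v ?xi" by (simp add: matrix_vector_mul_assoc N_inverse)
   then have "norm \<eta> <= K * norm ?xi" using K(2)[of "(0, y)" ?xi] by simp
   then have "1 + norm \<eta> <= K * (1 + norm ?xi)" using K(1) by (simp add: distrib_left)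
   then have "(1 + norm \<eta>) ^ (DIM(real ^ 'n) + 2) <= (K * (1 + norm ?xi)) ^ (DIM(real ^ 'n) + 2)"
    by (intro power_mono) auto
   moreover have "(1 + norm \<eta>) ^ (DIM(real ^ 'n) + 2) > 0" "(1 + norm ?xi) ^ (DIM(real ^ 'n) + 2) > 0"
    by (auto intro!: zero_less_power simp: add_pos_nonneg)
   ultimately have dw: "dw ?xi <= K ^ (DIM(real ^ 'n) + 2) * dw \<eta>"
    unfolding dw_def power_mult_distrib by (simp add: field_simps)
   have "norm (F t (?xi, h y)) <= (E * C1) * (K ^ (DIM(real ^ 'n) + 2) * dw \<eta>)"
    by (rule order_trans[OF Fb mult_left_mono[OF dw]]) (use E(1) C1(1) in simp)
   then have "norm (G t (\<eta>, y)) <= ((E * C1) * (K ^ (DIM(real ^ 'n) + 2) * dw \<eta>)) * D"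
    unfolding G_def norm_mult fst_conv snd_conv using D(2)[of "(0, y)"] by (intro mult_mono) (auto intro: order_trans[OF norm_ge_zero])
   then show ?thesis by (simp add: mult_ac)
  qed
  have kern: "complex_of_real \<bar>det (J y)\<bar> * Ker F t ?x0 (h y) = Ker G t y0 y" for y
  proof -
   have inv: "invertible (N y0 y)" by (metis N_inverse invertible_left_inverse)
   have "det (transpose (mid C y0 y) ** N y0 y) = 1" by (simp add: N_inverse)
   then have "det (mid C y0 y) * det (N y0 y) = 1" by (simp add: det_mul)
   then have dN: "\<bar>det (N y0 y)\<bar> = inverse \<bar>det (mid C y0 y)\<bar>"
    by (metis abs_inverse inverse_unique)
   have m: "(%xi. cis ((?x0 - h y) \<bullet> xi) * F t (xi, h y)) \<in> borel_measurable borel"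
    by (intro borel_measurable_continuous_onI continuous_intros symb_joint_cont[OF F])
   \<comment> \<open>Where c is nonzero, \<open>mid C\<close> is the mean Jacobian and the phases
     agree; where c vanishes, both sides are 0.\<close>
   have ph: "cis ((?x0 - h y) \<bullet> (N y0 y *v \<eta>)) * F t (N y0 y *v \<eta>, h y) = cis ((y0 - y) \<bullet> \<eta>) * F t (N y0 y *v \<eta>, h y)" for \<eta>
   proof (cases "c (?x0, h y) = 0")
    case False
    then have "mid C y0 y = Xi h y0 y" by (intro mid_eq_Xi cC)
    then have "?x0 - h y = mid C y0 y *v (y0 - y)" using Xi_mean_value[OF bder_h] by simp
    then show ?thesis using transpose_inv_inner[OF invertible_mid] by (simp add: N_def)
   qed (simp add: F_def)
   have "Ker F t ?x0 (h y) = of_real \<bar>det (N y0 y)\<bar> * (\<integral>\<eta>. cis ((y0 - y) \<bullet> \<eta>) * F t (N y0 y *v \<eta>, h y) \<partial>lborel)"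
    unfolding Ker_def integral_linear_change[OF inv m] by (simp only: ph)
   moreover have "Ker G t y0 y = (\<integral>\<eta>. cis ((y0 - y) \<bullet> \<eta>) * F t (N y0 y *v \<eta>, h y) \<partial>lborel) * of_real (W y0 y)"
    unfolding Ker_def G_def fst_conv snd_conv mult.assoc[symmetric] by (rule integral_mult_left_zero)
   ultimately show ?thesis by (simp add: dN W_def mult_ac)
  qed
  have "SI F u t ?x0 = (\<integral>y. Ker F t ?x0 y * u y \<partial>lborel)" by (rule z.SI_swap(1)[OF F u Fb])
  also have "\<dots> = (\<integral>y. of_real \<bar>det (J y)\<bar> * (Ker F t ?x0 (h y) * u (h y)) \<partial>lborel)"
   using borel_measurable_integrable[OF z.SI_swap(2)[OF F u Fb]]
   by (intro integral_change_of_variables_lborel bij_h Cb_D(3)[OF Cb_det_J]) (use bder_h in \<open>auto simp: bder_def\<close>)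
  also have "\<dots> = (\<integral>y. Ker G t y0 y * ?v y \<partial>lborel)" by (simp only: kern mult.assoc[symmetric])
  also have "\<dots> = SI G ?v t y0" by (rule z.SI_swap(1)[OF G v Gb, symmetric])
  finally show ?thesis .
 qed
 have "continuous_on UNIV (%t. SI F u t ?x0)" by (rule z.SI_cont[OF F u continuous_on_id continuous_on_const])
 moreover have "continuous_on UNIV (%t. SI G ?v t y0)" by (rule z.SI_cont[OF G v continuous_on_id continuous_on_const])
 ultimately have "isCont (%t. SI F u t ?x0) 0" "isCont (%t. SI G ?v t y0) 0"
  by (simp_all add: continuous_on_eq_continuous_at)
 then have lim: "((%t. SI F u t ?x0) \<longlongrightarrow> SI F u 0 ?x0) (at 0)" "((%t. SI G ?v t y0) \<longlongrightarrow> SI G ?v 0 y0) (at 0)"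
  by (simp_all add: isCont_def)
 have "\<forall>\<^sub>F t in at 0. SI G ?v t y0 = SI F u t ?x0" by (auto simp: eventually_at_filter eq)
 from Lim_transform_eventually[OF lim(2) this] have "SI F u 0 ?x0 = SI G ?v 0 y0"
  by (rule tendsto_unique[OF trivial_limit_at lim(1)])
 moreover have k0: "\<kappa> (0, 0) = 1" by (simp add: \<kappa>_def gauss_0 flip: zero_prod_def)
 have "F 0 = (%z. c (?x0, snd z) * f ?x0 z)" by (simp add: F_def e_def fun_eq_iff k0)
 then have "SI F u 0 ?x0 = SI (%x z. c (x, snd z) * f x z) u ?x0 ?x0" by (simp add: SI_def FT_def)
 moreover have "G 0 = transf f y0" by (simp add: G_def F_def e_def transf_def k0 fun_eq_iff)
 then have "SI G ?v 0 y0 = SI (transf f) ?v y0 y0" by (simp add: SI_def FT_def)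
 ultimately show ?thesis by simp
qed

end


section \<open>Off-diagonal symbols\<close>

lemma cis_has_derivative:
 assumes "(g has_derivative g') (at x)"
 shows "((%x. cis (g x)) has_derivative (%v. \<i> * of_real (g' v) * cis (g x))) (at x)"
proof -
 have "((%x. \<i> * complex_of_real (g x)) has_derivative (%v. \<i> * of_real (g' v))) (at x)"
  by (intro has_derivative_mult_right bounded_linear.has_derivative[OF bounded_linear_of_real assms])
 from has_derivative_compose[OF this DERIV_exp[unfolded has_field_derivative_def]]
 show ?thesis by (simp add: cis_conv_exp mult_ac)
qed

lemma fourier_by_parts:
 fixes g :: "'v::euclidean_space => complex"
 assumes d: "g differentiable_on UNIV" and b: "b \<in> Basis" and c: "continuous_on UNIV (pderiv_dir b g)"
  and C: "!!xi. norm (g xi) <= C * dw xi" and D: "!!xi. norm (pderiv_dir b g xi) <= D * dw xi"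
 shows "of_real (a \<bullet> b) * (\<integral>xi. cis (a \<bullet> xi) * g xi \<partial>lborel) = \<i> * (\<integral>xi. cis (a \<bullet> xi) * pderiv_dir b g xi \<partial>lborel)"
proof -
 let ?P = "%xi. cis (a \<bullet> xi) * g xi" and ?Q = "%xi. cis (a \<bullet> xi) * pderiv_dir b g xi"
 have gc: "continuous_on UNIV g" using d by (rule differentiable_imp_continuous_on)
 have "((%xi. a \<bullet> xi) has_derivative (%v. a \<bullet> v)) (at xi)" for xi by (auto intro!: derivative_eq_intros)
 note dP = has_derivative_mult[OF cis_has_derivative[OF this] has_derivative_pderiv'[OF differentiable_on_UNIV_D[OF d]]]
 have pP: "pderiv_dir b ?P = (%xi. ?Q xi + \<i> * of_real (a \<bullet> b) * ?P xi)"
  by (rule ext, subst pderiv_dir_eq[OF dP]) (simp add: mult_ac)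
 have ip: "integrable lborel ?P" by (rule continuous_integrable[where C = C]) (intro continuous_intros gc, simp add: norm_mult C)
 have iq: "integrable lborel ?Q" by (rule continuous_integrable[where C = D]) (intro continuous_intros c, simp add: norm_mult D)
 have C0: "0 <= C" "0 <= D"
  using order_trans[OF norm_ge_zero C[of 0]] order_trans[OF norm_ge_zero D[of 0]] by (simp_all add: dw_def)
 have "integral\<^sup>L lborel (pderiv_dir b ?P) = 0"
 proof (rule integral_pderiv_zero[OF _ b, where C = "C + D + \<bar>a \<bullet> b\<bar> * C"])
  show "?P differentiable_on UNIV" by (rule has_derivative_differentiable_on[OF dP])
  show "continuous_on UNIV (pderiv_dir b ?P)" unfolding pP by (intro continuous_intros c gc)
  fix xi :: 'v
  have w: "0 <= dw xi" by (simp add: dw_def)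
  have "norm (?P xi) <= C * dw xi" by (simp add: norm_mult C)
  also have "\<dots> <= (C + D + \<bar>a \<bullet> b\<bar> * C) * dw xi" using w C0 by (intro mult_right_mono) auto
  finally show "norm (?P xi) <= (C + D + \<bar>a \<bullet> b\<bar> * C) * dw xi" .
  have "norm (pderiv_dir b ?P xi) <= norm (?Q xi) + norm (\<i> * of_real (a \<bullet> b) * ?P xi)"
   unfolding pP by (rule norm_triangle_ineq)
  also have "\<dots> <= D * dw xi + \<bar>a \<bullet> b\<bar> * (C * dw xi)"
   using C[of xi] D[of xi] by (intro add_mono) (auto simp: norm_mult intro!: mult_left_mono)
  also have "\<dots> <= (C + D + \<bar>a \<bullet> b\<bar> * C) * dw xi" using w C0 by (simp add: algebra_simps)
  finally show "norm (pderiv_dir b ?P xi) <= (C + D + \<bar>a \<bullet> b\<bar> * C) * dw xi" .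
 qed
 moreover have "integral\<^sup>L lborel (pderiv_dir b ?P) = integral\<^sup>L lborel ?Q + \<i> * of_real (a \<bullet> b) * integral\<^sup>L lborel ?P"
  unfolding pP by (subst Bochner_Integration.integral_add[OF iq integrable_mult_right[OF ip]]) (simp only: integral_mult_right_zero)
 ultimately have "\<i> * (integral\<^sup>L lborel ?Q + \<i> * of_real (a \<bullet> b) * integral\<^sup>L lborel ?P) = 0" by simp
 then show ?thesis by (simp add: distrib_left flip: mult.assoc)
qed

lemma symb_dw:
 fixes f :: "'x::euclidean_space => 'w::euclidean_space \<times> 'y::euclidean_space => complex"
 assumes f: "symb th' \<rho>' \<delta>' k w f" and w: "w <= - real (DIM('w) + 2)"
 obtains C where "C >= 0" "!!x xi y. norm (f x (xi, y)) <= C * dw xi"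
proof -
 obtain C where C: "C >= 0" "!!x z. norm (f x z) <= C * jb (fst z) powr w" using symb_bound[OF f] by blast
 have "norm (f x (xi, y)) <= C * 2 ^ (DIM('w) + 2) * dw xi" for x xi y
  using order_trans[OF C(2)[of x "(xi, y)", unfolded fst_conv] mult_left_mono[OF jb_powr_dw[OF w, of xi] C(1)]] by (simp add: mult_ac)
 then show ?thesis using C(1) by (intro that[of "C * 2 ^ (DIM('w) + 2)"]) auto
qed

section \<open>Integration by parts in the covariable\<close>

context symbols
begin

text \<open>A xi derivative that falls on the phase produces the factor -i y_b. It is absorbed into
  \<open>v\<close>, which remains a Schwartz function.\<close>

lemma FT_pderiv:
 fixes f :: "'x::euclidean_space => 'v::euclidean_space \<times> 'v => complex"
 assumes f: "symb th \<rho> \<delta> k w f" and v: "Sch v"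
 shows "FT f v x differentiable_on UNIV"
  and "b \<in> Basis ==> pderiv_dir b (FT f v x) = (%xi. FT (dZ (b, 0) f) v x xi + FT f (%y. (- \<i> * of_real (y \<bullet> b)) * v y) x xi)"
proof -
 let ?I = "%xi y. cis (- (y \<bullet> xi)) * f x (xi, y) * v y"
 let ?v = "%b y. (- \<i> * of_real (y \<bullet> b)) * v y"
 let ?g1 = "%b xi y. cis (- (y \<bullet> xi)) * dZ (b, 0) f x (xi, y) * v y" and ?g2 = "%b xi y. cis (- (y \<bullet> xi)) * f x (xi, y) * ?v b y"
 have v': "Sch (?v b)" for b by (intro OM_Sch_mult OM_mult OM_coord Cb_OM Cb_const v)
 have f': "symb th \<rho> \<delta> k (w + wt \<rho> \<delta> (b, 0 :: 'v)) (dZ (b, 0) f)" if "b \<in> Basis" for b :: 'v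
  by (rule symb_dZ[OF f]) (use that in \<open>simp add: Basis_prod_def\<close>)
 have dI: "((%xi. ?I xi y) has_derivative (%u. (cis (- (y \<bullet> xi)) * pderiv_dir (u, 0) (f x) (xi, y) + \<i> * of_real (- (y \<bullet> u)) * cis (- (y \<bullet> xi)) * f x (xi, y)) * v y)) (at xi)" for xi y
 proof -
  have "((%xi. - (y \<bullet> xi)) has_derivative (%u. - (y \<bullet> u))) (at xi)" by (auto intro!: derivative_eq_intros)
  moreover have "((%xi. (xi, y)) has_derivative (%u. (u, 0))) (at xi)" by (auto intro!: derivative_eq_intros)
  ultimately show ?thesis
   by (intro has_derivative_mult_left has_derivative_mult cis_has_derivative
     has_derivative_compose[OF _ has_derivative_pderiv'[OF differentiable_on_UNIV_D[OF symb_diff[OF f]]]])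
 qed
 have p: "pderiv_dir b (%xi. ?I xi y) xi = ?g1 b xi y + ?g2 b xi y" for b xi y
  by (subst pderiv_dir_eq[OF dI]) (simp add: dZ_def algebra_simps)
 have int: "integrable lborel (?I xi)" for xi by (rule FT_integrable[OF f v])
 have bnd: "\<exists>K. \<forall>xi\<in>ball xi0 1. \<forall>y. norm (pderiv_dir b (%xi. ?I xi y) xi) <= K * dw y" if b: "b \<in> Basis" for b xi0
 proof -
  let ?w = "w + wt \<rho> \<delta> (b, 0 :: 'v)"
  obtain C1 where C1: "C1 >= 0" "!!xi y. norm (?g1 b xi y) <= C1 * jb xi powr ?w * dw y"
   by (rule FT_integrand[OF f'[OF b] v]) blast
  obtain C2 where C2: "C2 >= 0" "!!xi y. norm (?g2 b xi y) <= C2 * jb xi powr w * dw y"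
   by (rule FT_integrand[OF f v'[of b]]) blast
  obtain M1 where M1: "M1 > 0" "!!z. z \<in> ball (xi0, 0 :: 'v) 1 ==> jb (fst z) powr ?w <= M1" by (rule jb_powr_locally_bounded) blast
  obtain M2 where M2: "M2 > 0" "!!z. z \<in> ball (xi0, 0 :: 'v) 1 ==> jb (fst z) powr w <= M2" by (rule jb_powr_locally_bounded) blast
  have "norm (pderiv_dir b (%xi. ?I xi y) xi) <= (C1 * M1 + C2 * M2) * dw y" if xi: "xi \<in> ball xi0 1" for xi y
  proof -
   have w: "0 <= dw y" by (simp add: dw_def)
   have "(xi, 0 :: 'v) \<in> ball (xi0, 0) 1" using xi by (simp add: dist_Pair_Pair)
   then have M: "jb xi powr ?w <= M1" "jb xi powr w <= M2" using M1(2) M2(2) by force+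
   have "norm (pderiv_dir b (%xi. ?I xi y) xi) <= norm (?g1 b xi y) + norm (?g2 b xi y)" unfolding p by (rule norm_triangle_ineq)
   also have "\<dots> <= C1 * jb xi powr ?w * dw y + C2 * jb xi powr w * dw y" by (rule add_mono[OF C1(2) C2(2)])
   also have "\<dots> <= C1 * M1 * dw y + C2 * M2 * dw y" using M w C1(1) C2(1) by (intro add_mono mult_right_mono mult_left_mono) auto
   finally show ?thesis by (simp add: distrib_right)
  qed
  then show ?thesis by blast
 qed
 have df: "(%xi. ?I xi y) differentiable (at xi)" for y xi unfolding differentiable_def using dI by blast
 have i1: "integrable lborel (?g1 b xi)" and i2: "integrable lborel (?g2 b xi)" if "b \<in> Basis" for b xi
  by (rule FT_integrable[OF f'[OF that] v], rule FT_integrable[OF f v'])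
 have m: "(%y. pderiv_dir b (%xi. ?I xi y) xi) \<in> borel_measurable borel" if "b \<in> Basis" for b xi
  unfolding p using borel_measurable_integrable[OF i1[OF that, of xi]] borel_measurable_integrable[OF i2[OF that, of xi]] by simp
 have P: "(%xi. integral\<^sup>L lborel (?I xi)) differentiable_on UNIV"
  by (rule pderiv_integral_dw(1)[OF int df m bnd])
 have P2: "pderiv_dir b (%xi. integral\<^sup>L lborel (?I xi)) = (%xi. \<integral>y. pderiv_dir b (%xi. ?I xi y) xi \<partial>lborel)" if "b \<in> Basis" for b
  by (rule pderiv_integral_dw(2)[OF int df m bnd that])
 show "FT f v x differentiable_on UNIV" unfolding FT_def[abs_def] by (rule P)
 assume b: "b \<in> Basis"
 show "pderiv_dir b (FT f v x) = (%xi. FT (dZ (b, 0) f) v x xi + FT f (?v b) x xi)"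
  unfolding FT_def[abs_def] P2[OF b] p using Bochner_Integration.integral_add[OF i1[OF b] i2[OF b]] by simp
qed

text \<open>Partial integration in the outer integral. The factor (x0 - y)_b is unbounded in y: its
  part x0_b is taken out and its part y_b is put into \<open>v\<close>. Integrability is stated
  separately because the integrability lemma for \<open>SI\<close> requires a symbol.\<close>

lemma SI_by_parts:
 fixes f :: "'x::euclidean_space => 'v::euclidean_space \<times> 'v => complex"
 assumes f: "symb th \<rho> \<delta> k w f" and v: "Sch v" and b: "b \<in> Basis"
 shows "SI (%x z. of_real ((x0 - snd z) \<bullet> b) * f x z) v x x0 = \<i> * SI (dZ (b, 0) f) v x x0"
  and "integrable lborel (%xi. cis (x0 \<bullet> xi) * FT (%x z. of_real ((x0 - snd z) \<bullet> b) * f x z) v x xi)"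
proof -
 let ?v = "%y. (- \<i> * of_real (y \<bullet> b)) * v y"
 have v': "Sch ?v" by (intro OM_Sch_mult OM_mult OM_coord Cb_OM Cb_const v)
 have f': "symb th \<rho> \<delta> k (w + wt \<rho> \<delta> (b, 0 :: 'v)) (dZ (b, 0) f)"
  by (rule symb_dZ[OF f]) (use b in \<open>simp add: Basis_prod_def\<close>)
 obtain C where C: "!!x xi. norm (FT f v x xi) <= C * dw xi" by (rule FT_decay[OF f v]) blast
 obtain C1 where C1: "!!x xi. norm (FT (dZ (b, 0) f) v x xi) <= C1 * dw xi" by (rule FT_decay[OF f' v]) blast
 obtain C2 where C2: "!!x xi. norm (FT f ?v x xi) <= C2 * dw xi" by (rule FT_decay[OF f v']) blast
 note P = FT_pderiv(2)[OF f v b]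
 have parts: "of_real (x0 \<bullet> b) * SI f v x x0 = \<i> * (\<integral>xi. cis (x0 \<bullet> xi) * pderiv_dir b (FT f v x) xi \<partial>lborel)"
  unfolding SI_def
 proof (rule fourier_by_parts[OF FT_pderiv(1)[OF f v] b _ C])
  show "continuous_on UNIV (pderiv_dir b (FT f v x))" unfolding P
   by (intro continuous_intros FT_cont[OF f' v] FT_cont[OF f v'])
  show "norm (pderiv_dir b (FT f v x) xi) <= (C1 + C2) * dw xi" for xi
   unfolding P distrib_right by (rule order_trans[OF norm_triangle_ineq add_mono[OF C1 C2]])
 qed
 have i1: "integrable lborel (%xi. cis (x0 \<bullet> xi) * FT (dZ (b, 0) f) v x xi)"
  and i2: "integrable lborel (%xi. cis (x0 \<bullet> xi) * FT f ?v x xi)" and i0: "integrable lborel (%xi. cis (x0 \<bullet> xi) * FT f v x xi)"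
  by (rule SI_integrable[OF f' v] SI_integrable[OF f v'] SI_integrable[OF f v])+
 have "(\<integral>xi. cis (x0 \<bullet> xi) * pderiv_dir b (FT f v x) xi \<partial>lborel) = SI (dZ (b, 0) f) v x x0 + SI f ?v x x0"
  unfolding P SI_def distrib_left by (rule Bochner_Integration.integral_add[OF i1 i2])
 with parts have eq: "of_real (x0 \<bullet> b) * SI f v x x0 - \<i> * SI f ?v x x0 = \<i> * SI (dZ (b, 0) f) v x x0"
  by (simp add: distrib_left)
 have FTe: "FT (%x z. of_real ((x0 - snd z) \<bullet> b) * f x z) v x xi = of_real (x0 \<bullet> b) * FT f v x xi - \<i> * FT f ?v x xi" for xi
 proof -
  have "of_real (x0 \<bullet> b) * FT f v x xi - \<i> * FT f ?v x xi =
   (\<integral>y. of_real (x0 \<bullet> b) * (cis (- (y \<bullet> xi)) * f x (xi, y) * v y) - \<i> * (cis (- (y \<bullet> xi)) * f x (xi, y) * ?v y) \<partial>lborel)"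
   unfolding FT_def
   by (subst Bochner_Integration.integral_diff[OF integrable_mult_right[OF FT_integrable[OF f v]] integrable_mult_right[OF FT_integrable[OF f v']]])
    (simp only: integral_mult_right_zero)
  also have "\<dots> = FT (%x z. of_real ((x0 - snd z) \<bullet> b) * f x z) v x xi"
   unfolding FT_def by (rule Bochner_Integration.integral_cong[OF refl]) (simp add: inner_diff_left algebra_simps)
  finally show ?thesis by simp
 qed
 have e: "(%xi. cis (x0 \<bullet> xi) * FT (%x z. of_real ((x0 - snd z) \<bullet> b) * f x z) v x xi)
  = (%xi. of_real (x0 \<bullet> b) * (cis (x0 \<bullet> xi) * FT f v x xi) - \<i> * (cis (x0 \<bullet> xi) * FT f ?v x xi))"
  unfolding FTe by (simp add: algebra_simps)
 show "integrable lborel (%xi. cis (x0 \<bullet> xi) * FT (%x z. of_real ((x0 - snd z) \<bullet> b) * f x z) v x xi)"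
  unfolding e by (intro Bochner_Integration.integrable_diff integrable_mult_right i0 i2)
 show "SI (%x z. of_real ((x0 - snd z) \<bullet> b) * f x z) v x x0 = \<i> * SI (dZ (b, 0) f) v x x0"
  unfolding eq[symmetric] unfolding SI_def e
  by (subst Bochner_Integration.integral_diff[OF integrable_mult_right[OF i0] integrable_mult_right[OF i2]])
   (simp only: integral_mult_right_zero)
qed

end

text \<open>On symbols supported away from the diagonal, \<open>Lop d\<close> is the transpose of
 \<open>\<Sum>\<^sub>b d\<^sub>b D\<^bsub>xi\<^sub>b\<^esub>\<close>, which fixes the phase if \<open>\<Sum>\<^sub>b (x - y)\<^sub>b d\<^sub>b = 1\<close>.\<close>

definition Lop :: "('v => 'v \<times> 'v => complex) => ('v::euclidean_space => 'v \<times> 'v => complex) => 'v => 'v \<times> 'v => complex" where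
 "Lop d f x z = (\<Sum>b\<in>Basis. d b (x, snd z) * (\<i> * dZ (b, 0) f x z))"

locale off_diagonal = symbols +
 fixes d :: "'v::euclidean_space => 'v \<times> 'v => complex" and s :: real
 assumes Cb_d: "b \<in> Basis ==> Cb (d b)"
  and d_sum: "norm (x - y) >= s ==> (\<Sum>b\<in>Basis. of_real ((x - y) \<bullet> b) * d b (x, y)) = 1"
begin

definition off :: "('v => 'v \<times> 'v => complex) => bool" where
 "off f \<longleftrightarrow> (\<forall>x xi y. norm (x - y) < s --> f x (xi, y) = 0)"

lemma symb_dZ_fst:
 fixes f :: "'v => 'v \<times> 'v => complex"
 assumes "symb th \<rho> \<delta> k w f" "b \<in> Basis" shows "symb th \<rho> \<delta> k (w - \<rho>) (dZ (b, 0) f)"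
 using symb_dZ[OF assms(1), of "(b, 0)"] assms(2) nonzero_Basis[of b] by (auto simp: Basis_prod_def wt_def)

lemma dZ_fst:
 assumes "symb th \<rho> \<delta> k w f" shows "dZ (b, 0) f x (xi, y) = pderiv_dir b (%xi. f x (xi, y)) xi"
 unfolding dZ_def by (rule pderiv_dir_fst[OF differentiable_on_UNIV_D[OF symb_diff[OF assms]]])

lemma symb_d: "b \<in> Basis ==> symb th \<rho> \<delta> k 0 (%x z. d b (x, snd z))"
 by (rule symb_Cb[OF Cb_d])

lemma symb_Lop:
 assumes f: "symb th \<rho> \<delta> k w f" shows "symb th \<rho> \<delta> k (w - \<rho>) (Lop d f)"
 unfolding Lop_def[abs_def]
 by (rule symb_sum, rule symb_mult[OF symb_d symb_cmult[OF symb_dZ_fst[OF f]]]) auto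

lemma off_Lop:
 assumes f: "symb th \<rho> \<delta> k w f" "off f" shows "off (Lop d f)"
 unfolding off_def
proof (intro allI impI)
 fix x xi y :: 'v assume "norm (x - y) < s"
 then have "(%xi. f x (xi, y)) = (%_. 0)" using f(2) by (auto simp: off_def)
 then show "Lop d f x (xi, y) = 0" by (simp add: Lop_def dZ_fst[OF f(1)])
qed

text \<open>f is the sum over b of (x - y)_b d_b f: off the diagonal by \<open>d_sum\<close>, near
  it because f vanishes. \<open>SI_by_parts\<close> turns each factor (x - y)_b into a xi
  derivative, and d_b does not depend on xi.\<close>

lemma SI_Lop:
 assumes f: "symb th \<rho> \<delta> k w f" "off f" and v: "Sch v" shows "SI (Lop d f) v x x = SI f v x x"
proof -
 define g where "g b x z = d b (x, snd z) * f x z" for b x z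
 have g: "symb th \<rho> \<delta> k w (g b)" if "b \<in> Basis" for b
  unfolding g_def[abs_def] by (rule symb_mult[OF symb_d[OF that] f(1)]) simp
 have dg: "dZ (b, 0) (g b) x' z = d b (x', snd z) * dZ (b, 0) f x' z" if b: "b \<in> Basis" for b x' z
 proof -
  obtain xi y where z: "z = (xi, y)" by (cases z)
  have "(%xi. f x' (xi, y)) differentiable_on UNIV"
   by (rule differentiable_on_compose_UNIV[OF symb_diff[OF f(1)]])
    (auto intro!: has_derivative_differentiable_on derivative_eq_intros)
  from fun_cong[OF pderiv_dir_bounded_linear[OF bounded_linear_mult_right[of "d b (x', y)"] this, of b], of xi]
  show ?thesis unfolding z dZ_fst[OF g[OF b]] dZ_fst[OF f(1)] by (simp add: g_def)
 qed
 let ?p = "%b x' z. of_real ((x - snd z) \<bullet> b) * g b x' z"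
 have sum: "(\<Sum>b\<in>Basis. ?p b x z) = f x z" for z
 proof (cases "norm (x - snd z) < s")
  case True then show ?thesis using f(2) by (cases z) (simp add: off_def g_def)
 next
  case False
  have "(\<Sum>b\<in>Basis. ?p b x z) = (\<Sum>b\<in>Basis. of_real ((x - snd z) \<bullet> b) * d b (x, snd z)) * f x z"
   unfolding g_def sum_distrib_right by (simp only: mult.assoc)
  then show ?thesis using d_sum False by simp
 qed
 have FTsum: "FT f v x xi = (\<Sum>b\<in>Basis. FT (?p b) v x xi)" for xi
 proof -
  have "integrable lborel (%y. cis (- (y \<bullet> xi)) * ?p b x (xi, y) * v y)" if b: "b \<in> Basis" for b
  proof -
   have "Sch (%y. (of_real (x \<bullet> b) + (- 1) * of_real (y \<bullet> b)) * v y)"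
    by (intro OM_Sch_mult OM_add OM_mult OM_coord v Cb_OM[OF Cb_const])
   then have "Sch (%y. of_real ((x - y) \<bullet> b) * v y)" by (simp add: inner_diff_left)
   from FT_integrable[OF g[OF b] this, where x = x and xi = xi] show ?thesis by (simp add: mult_ac)
  qed
  then have "(\<Sum>b\<in>Basis. FT (?p b) v x xi) = (\<integral>y. (\<Sum>b\<in>Basis. cis (- (y \<bullet> xi)) * ?p b x (xi, y) * v y) \<partial>lborel)"
   unfolding FT_def by (subst Bochner_Integration.integral_sum) auto
  also have "\<dots> = FT f v x xi" unfolding FT_def
   by (simp only: sum_distrib_right[symmetric] sum_distrib_left[symmetric] sum)
  finally show ?thesis by simp
 qed
 have FTL: "FT (Lop d f) v x xi = (\<Sum>b\<in>Basis. \<i> * FT (dZ (b, 0) (g b)) v x xi)" for xi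
 proof -
  have "(\<Sum>b\<in>Basis. \<i> * FT (dZ (b, 0) (g b)) v x xi) = (\<integral>y. (\<Sum>b\<in>Basis. \<i> * (cis (- (y \<bullet> xi)) * dZ (b, 0) (g b) x (xi, y) * v y)) \<partial>lborel)"
   unfolding FT_def using FT_integrable[OF symb_dZ_fst[OF g] v]
   by (subst Bochner_Integration.integral_sum) (auto simp only: integrable_mult_right integral_mult_right_zero)
  also have "\<dots> = FT (Lop d f) v x xi" unfolding FT_def
   by (rule Bochner_Integration.integral_cong[OF refl]) (simp add: Lop_def dg sum_distrib_left sum_distrib_right mult_ac)
  finally show ?thesis by simp
 qed
 have "SI f v x x = (\<Sum>b\<in>Basis. SI (?p b) v x x)"
  unfolding SI_def FTsum sum_distrib_left using SI_by_parts(2)[OF g v] by (intro Bochner_Integration.integral_sum) blast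
 also have "\<dots> = (\<Sum>b\<in>Basis. \<i> * SI (dZ (b, 0) (g b)) v x x)"
  by (intro sum.cong refl SI_by_parts(1)[OF g v])
 also have "\<dots> = (\<Sum>b\<in>Basis. (\<integral>xi. \<i> * (cis (x \<bullet> xi) * FT (dZ (b, 0) (g b)) v x xi) \<partial>lborel))"
  unfolding SI_def by (simp only: integral_mult_right_zero)
 also have "\<dots> = (\<integral>xi. (\<Sum>b\<in>Basis. \<i> * (cis (x \<bullet> xi) * FT (dZ (b, 0) (g b)) v x xi)) \<partial>lborel)"
  by (rule Bochner_Integration.integral_sum[symmetric]) (intro integrable_mult_right SI_integrable[OF symb_dZ_fst[OF g] v])
 also have "\<dots> = SI (Lop d f) v x x" unfolding SI_def FTL by (simp add: sum_distrib_left mult_ac)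
 finally show ?thesis by simp
qed

text \<open>The analogue for kernels that converge absolutely. It shows that lowering the order
  further leaves the kernel unchanged.\<close>

lemma Ker_Lop:
 assumes f: "symb th \<rho> \<delta> k w f" "off f" and w: "w <= - real (DIM('v) + 2)"
 shows "Ker (Lop d f) x x y = Ker f x x y"
proof (cases "norm (x - y) < s")
 case True
 then show ?thesis using f(2) off_Lop[OF f] by (simp add: Ker_def off_def)
next
 case False
 obtain C where C: "C >= 0" "!!x xi y. norm (f x (xi, y)) <= C * dw xi" by (rule symb_dw[OF f(1) w]) blast
 have w': "w - \<rho> <= - real (DIM('v) + 2)" using w rho_pos by linarith
 have i: "integrable lborel (%xi. cis ((x - y) \<bullet> xi) * dZ (b, 0) f x (xi, y))"
  and p: "of_real ((x - y) \<bullet> b) * Ker f x x y = \<i> * (\<integral>xi. cis ((x - y) \<bullet> xi) * dZ (b, 0) f x (xi, y) \<partial>lborel)"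
  if b: "b \<in> Basis" for b
 proof -
  note fb = symb_dZ_fst[OF f(1) b]
  obtain D where D: "D >= 0" "!!x xi y. norm (dZ (b, 0) f x (xi, y)) <= D * dw xi" by (rule symb_dw[OF fb w']) blast
  show "integrable lborel (%xi. cis ((x - y) \<bullet> xi) * dZ (b, 0) f x (xi, y))"
   by (rule continuous_integrable[where C = D]) (intro continuous_intros symb_joint_cont[OF fb], simp add: norm_mult D)
  show "of_real ((x - y) \<bullet> b) * Ker f x x y = \<i> * (\<integral>xi. cis ((x - y) \<bullet> xi) * dZ (b, 0) f x (xi, y) \<partial>lborel)"
   unfolding Ker_def dZ_fst[OF f(1)]
  proof (rule fourier_by_parts[OF _ b])
   show "(%xi. f x (xi, y)) differentiable_on UNIV"
    by (rule differentiable_on_compose_UNIV[OF symb_diff[OF f(1)]])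
     (auto intro!: has_derivative_differentiable_on derivative_eq_intros)
   show "continuous_on UNIV (pderiv_dir b (%xi. f x (xi, y)))"
    unfolding dZ_fst[OF f(1), symmetric, abs_def] by (intro symb_joint_cont[OF fb] continuous_intros)
   show "norm (pderiv_dir b (%xi. f x (xi, y)) xi) <= D * dw xi" for xi using D(2) by (simp add: dZ_fst[OF f(1)])
  qed (rule C(2))
 qed
 have "Ker f x x y = (\<Sum>b\<in>Basis. of_real ((x - y) \<bullet> b) * d b (x, y)) * Ker f x x y" using d_sum False by simp
 also have "\<dots> = (\<Sum>b\<in>Basis. d b (x, y) * (of_real ((x - y) \<bullet> b) * Ker f x x y))"
  unfolding sum_distrib_right by (rule sum.cong[OF refl]) (simp only: mult_ac)
 also have "\<dots> = (\<Sum>b\<in>Basis. (\<integral>xi. (d b (x, y) * \<i>) * (cis ((x - y) \<bullet> xi) * dZ (b, 0) f x (xi, y)) \<partial>lborel))"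
  by (intro sum.cong refl) (simp only: p integral_mult_right_zero mult.assoc)
 also have "\<dots> = (\<integral>xi. (\<Sum>b\<in>Basis. (d b (x, y) * \<i>) * (cis ((x - y) \<bullet> xi) * dZ (b, 0) f x (xi, y))) \<partial>lborel)"
  by (rule Bochner_Integration.integral_sum[symmetric]) (intro integrable_mult_right i)
 also have "\<dots> = Ker (Lop d f) x x y" unfolding Ker_def
  by (rule Bochner_Integration.integral_cong[OF refl]) (simp add: Lop_def sum_distrib_left mult_ac)
 finally show ?thesis by simp
qed

text \<open>Each application of \<open>Lop\<close> lowers the order by \<rho> > 0. After j0 steps
  the kernel converges absolutely, and all further steps represent this same kernel by amplitudes of
  ever lower order.\<close>

theorem off_diagonal_kernel:
 assumes f: "symb th \<rho> \<delta> k w f" "off f"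
 obtains K where "!!w'. \<exists>q. symb th \<rho> \<delta> k w' q & K = (%x y. Ker q x x y)"
  "!!v x. Sch v ==> SI f v x x = (\<integral>y. K x y * v y \<partial>lborel) & (%y. K x y * v y) \<in> borel_measurable borel"
proof -
 define q where "q j = (Lop d ^^ j) f" for j
 have q: "symb th \<rho> \<delta> k (w - real j * \<rho>) (q j) & off (q j)" for j
 proof (induction j)
  case (Suc j)
  have "q (Suc j) = Lop d (q j)" "w - real (Suc j) * \<rho> = w - real j * \<rho> - \<rho>" by (simp_all add: q_def algebra_simps)
  then show ?case using Suc symb_Lop[of k "w - real j * \<rho>" "q j"] off_Lop[of k "w - real j * \<rho>" "q j"] by metis
 qed (use f in \<open>simp add: q_def\<close>)
 have S: "SI (q j) v x x = SI f v x x" if "Sch v" for j v x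
 proof (induction j)
  case (Suc j)
  have "q (Suc j) = Lop d (q j)" by (simp add: q_def)
  then show ?case using Suc SI_Lop[OF conjunct1[OF q] conjunct2[OF q] that] by simp
 qed (simp add: q_def)
 have ex: "\<exists>j. w - real j * \<rho> <= w'" for w'
 proof -
  obtain j :: nat where "(w - w') / \<rho> < real j" using reals_Archimedean2 by blast
  then show ?thesis using rho_pos by (intro exI[of _ j]) (simp add: field_simps)
 qed
 obtain j0 where j0: "w - real j0 * \<rho> <= - real (DIM('v) + 2)" using ex by blast
 have mono: "w - real (j0 + i) * \<rho> <= w - real j0 * \<rho>" for i using rho_pos by (simp add: mult_right_mono)
 have K: "Ker (q (j0 + i)) x x y = Ker (q j0) x x y" for i x y
 proof (induction i)
  case (Suc i)
  have "q (j0 + Suc i) = Lop d (q (j0 + i))" by (simp add: q_def)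
  then show ?case using Suc Ker_Lop[OF conjunct1[OF q] conjunct2[OF q] order_trans[OF mono j0]] by simp
 qed simp
 show ?thesis
 proof (rule that[of "%x y. Ker (q j0) x x y"])
  fix w'
  obtain j where j: "w - real j * \<rho> <= w'" using ex by blast
  have "w - real (j0 + j) * \<rho> <= w - real j * \<rho>" using rho_pos by (simp add: mult_right_mono)
  then have "symb th \<rho> \<delta> k w' (q (j0 + j))" using j by (intro symb_mono[OF conjunct1[OF q] order_refl]) linarith
  then show "\<exists>q'. symb th \<rho> \<delta> k w' q' & (%x y. Ker (q j0) x x y) = (%x y. Ker q' x x y)"
   using K[of j] by metis
 next
  fix v :: "'v => complex" and x assume v: "Sch v"
  obtain C where C: "!!x xi y. norm (q j0 x (xi, y)) <= C * dw xi" by (rule symb_dw[OF conjunct1[OF q] j0]) blast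
  note sw = SI_swap[OF conjunct1[OF q] v C]
  have "(%y. Ker (q j0) x x y * v y) \<in> borel_measurable borel" using borel_measurable_integrable[OF sw(2)] by simp
  then show "SI f v x x = (\<integral>y. Ker (q j0) x x y * v y \<partial>lborel) & (%y. Ker (q j0) x x y * v y) \<in> borel_measurable borel"
   using sw(1) S[OF v, of j0 x] by simp
 qed
qed

end


section \<open>Smoothing operators\<close>

lemma cis_hoelder:
 assumes "0 <= th" "th <= 1" shows "norm (cis a - cis b) <= 2 * \<bar>a - b\<bar> powr th"
proof -
 have "cis a - cis b = cis b * (cis (a - b) - 1)" by (simp add: right_diff_distrib cis_mult)
 then have n: "norm (cis a - cis b) = 2 * \<bar>sin ((a - b) / 2)\<bar>"
  using dist_exp_i_1[of "a - b"] by (simp add: norm_mult cis_conv_exp dist_norm)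
 have "\<bar>sin ((a - b) / 2)\<bar> <= \<bar>(a - b) / 2\<bar>" by (rule abs_sin_x_le_abs_x)
 moreover have "\<bar>sin ((a - b) / 2)\<bar> <= 1" by simp
 ultimately have "norm (cis a - cis b) <= 2 * (\<bar>a - b\<bar> powr th * 1 powr th)"
  unfolding n using assms by (intro hoelder_min) auto
 then show ?thesis by simp
qed

lemma Sch_jb:
 assumes "Sch (u :: 'v::euclidean_space => complex)"
 obtains C where "C > 0" "!!x. norm (u x) <= C * jb x powr w"
proof -
 obtain M :: nat where M: "- w <= real M" using real_arch_simple by blast
 obtain C where C: "C > 0" "!!x. norm (u x) <= C / (1 + norm x) ^ M" using Sch_bound[OF assms] by blast
 have "norm (u x) <= C * jb x powr w" for x
 proof -
  have "norm (u x) <= C / jb x ^ M"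
   by (rule order_trans[OF C(2) divide_left_mono]) (use C(1) jb_le[of x] in \<open>auto intro!: power_mono mult_pos_pos zero_less_power add_pos_nonneg\<close>)
  also have "\<dots> = C * jb x powr (- real M)" using jb_pos[of x] by (simp add: powr_minus_divide powr_realpow)
  also have "\<dots> <= C * jb x powr w" using M C(1) by (intro mult_left_mono jb_powr_mono) auto
  finally show ?thesis .
 qed
 with C(1) show ?thesis by (rule that)
qed

section \<open>Kernels in the coordinates of the diffeomorphism\<close>

locale diffeo_symbols = diffeo h + symbols th \<rho> \<delta>
 for h :: "real ^ 'n::finite => real ^ 'n" and th \<rho> \<delta> :: real
begin

text \<open>The amplitude is already pulled back to the variables y and y', while the phase still
  contains h. A derivative in y or y' therefore brings down a factor linear in xi.\<close>

definition KerH :: "(real ^ 'n => (real ^ 'n) \<times> (real ^ 'n) => complex) => real ^ 'n => real ^ 'n => complex" where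
 "KerH q y y' = (\<integral>xi. cis ((h y - h y') \<bullet> xi) * q y (xi, y') \<partial>lborel)"

lemma hd: "h differentiable_on UNIV" and h_cont: "continuous_on S h"
 using bder_h by (auto simp: bder_def intro: continuous_on_subset[OF differentiable_imp_continuous_on])

lemma KerH_integrable:
 assumes q: "symb th \<rho> \<delta> d w q" and w: "w <= (- real (DIM(real ^ 'n) + 2))"
 shows "integrable lborel (%xi :: real ^ 'n. cis (a \<bullet> xi) * q y (xi, y' :: 'b::euclidean_space))"
proof -
 obtain C where C: "!!y xi y'. norm (q y (xi, y')) <= C * dw xi" by (rule symb_dw[OF q w]) blast
 show ?thesis by (rule continuous_integrable[where C = C]) (intro continuous_intros symb_joint_cont[OF q], simp add: norm_mult C)
qed

lemma KerH_bound:
 assumes q: "symb th \<rho> \<delta> d w q" and w: "w <= (- real (DIM(real ^ 'n) + 2))"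
 obtains C where "C >= 0" "!!y y'. norm (KerH q y y') <= C"
proof -
 obtain C where C: "C >= 0" "!!y xi y'. norm (q y (xi, y')) <= C * dw xi" by (rule symb_dw[OF q w]) blast
 have b: "norm (KerH q y y') <= (\<integral>xi. C * dw (xi :: real ^ 'n) \<partial>lborel)" for y y'
  unfolding KerH_def
  by (rule Bochner_Integration.integral_norm_bound_integral[OF KerH_integrable[OF q w] integrable_cmult_dw])
   (simp add: norm_mult C)
 show ?thesis by (rule that[OF order_trans[OF norm_ge_zero b] b])
qed

lemma KerH_cont:
 assumes q: "symb th \<rho> \<delta> d w q" and w: "w <= (- real (DIM(real ^ 'n) + 2))"
 shows "continuous_on UNIV (%y. KerH q y y')"
proof -
 obtain C where C: "!!y xi y'. norm (q y (xi, y')) <= C * dw xi" by (rule symb_dw[OF q w]) blast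
 have "continuous (at y0) (%y. KerH q y y')" for y0
  unfolding KerH_def
 proof (rule continuous_at_integral[where r = 1])
  show "integrable lborel (%xi::real ^ 'n. C * dw xi)" by (rule integrable_cmult_dw)
  show "norm (cis ((h y - h y') \<bullet> xi) * q y (xi, y')) <= C * dw xi" for y xi by (simp add: norm_mult C)
  fix xi
  have "continuous_on UNIV (%y. cis ((h y - h y') \<bullet> xi) * q y (xi, y'))"
   by (intro continuous_intros symb_joint_cont[OF q] h_cont)
  then show "continuous (at y0) (%y. cis ((h y - h y') \<bullet> xi) * q y (xi, y'))"
   using continuous_on_eq_continuous_at[OF open_UNIV] by blast
 qed (use borel_measurable_integrable[OF KerH_integrable[OF q w]] in auto)
 then show ?thesis using continuous_on_eq_continuous_at[OF open_UNIV] by blast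
qed

text \<open>The Hoelder quotient costs a power th of jb xi for the phase and \<delta> th for the
  amplitude. Both are at most 1, which is the reserve in the assumption on w.\<close>

lemma KerH_hoelder:
 assumes q: "symb th \<rho> \<delta> d w q" and w: "w + 1 <= (- real (DIM(real ^ 'n) + 2))"
 obtains C where "C >= 0" "!!y y0 y'. norm (KerH q y y' - KerH q y0 y') <= C * dist y y0 powr th"
proof -
 have w': "w <= (- real (DIM(real ^ 'n) + 2))" using w by linarith
 obtain C1 where C1: "C1 >= 0" "!!y z. norm (q y z) <= C1 * jb (fst z) powr w" using symb_bound[OF q] by blast
 obtain C2 where C2: "C2 >= 0" "!!y y0 z. norm (q y z - q y0 z) <= C2 * (dist y y0 powr th * jb (fst z) powr (w + \<delta> * th))"
  using symb_shol[OF q] unfolding shol_def by blast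
 obtain L where L: "L > 0" "!!y y0. norm (h y - h y0) <= L * norm (y - y0)" using bder_lipschitz[OF bder_h] by blast
 define M where "M = (2 * L powr th * C1 + C2) * 2 ^ (DIM(real ^ 'n) + 2)"
 have M0: "M >= 0" using C1(1) C2(1) by (simp add: M_def)
 have key: "norm (cis ((h y - h y') \<bullet> xi) * q y (xi, y') - cis ((h y0 - h y') \<bullet> xi) * q y0 (xi, y')) <= dist y y0 powr th * M * dw xi" for y y0 y' xi
 proof -
  let ?a = "(h y - h y') \<bullet> xi" and ?b = "(h y0 - h y') \<bullet> xi" and ?D = "dist y y0 powr th"
  have "\<bar>?a - ?b\<bar> = \<bar>(h y - h y0) \<bullet> xi\<bar>" by (simp add: inner_diff_left)
  also have "\<dots> <= norm (h y - h y0) * norm xi" by (rule Cauchy_Schwarz_ineq2)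
  also have "\<dots> <= (L * dist y y0) * jb xi" using L jb_ge_norm[of xi] by (intro mult_mono) (auto simp: dist_norm)
  finally have "\<bar>?a - ?b\<bar> powr th <= (L * dist y y0 * jb xi) powr th" using theta by (intro powr_mono2) auto
  also have "\<dots> = L powr th * ?D * jb xi powr th" using L by (simp add: powr_mult)
  finally have c: "norm (cis ?a - cis ?b) <= 2 * (L powr th * ?D * jb xi powr th)"
   using cis_hoelder[OF theta, of ?a ?b] by linarith
  have "cis ?a * q y (xi, y') - cis ?b * q y0 (xi, y') = (cis ?a - cis ?b) * q y (xi, y') + cis ?b * (q y (xi, y') - q y0 (xi, y'))"
   by (simp add: algebra_simps)
  then have "norm (cis ?a * q y (xi, y') - cis ?b * q y0 (xi, y')) <= norm (cis ?a - cis ?b) * norm (q y (xi, y')) + norm (q y (xi, y') - q y0 (xi, y'))"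
   using norm_triangle_ineq[of "(cis ?a - cis ?b) * q y (xi, y')" "cis ?b * (q y (xi, y') - q y0 (xi, y'))"] by (simp add: norm_mult)
  also have "\<dots> <= 2 * (L powr th * ?D * jb xi powr th) * (C1 * jb xi powr w) + C2 * (?D * jb xi powr (w + \<delta> * th))"
   using c C1(2)[of y "(xi, y')"] C2(2)[of y "(xi, y')" y0] by (intro add_mono mult_mono) auto
  also have "\<dots> = 2 * L powr th * C1 * ?D * jb xi powr (w + th) + C2 * ?D * jb xi powr (w + \<delta> * th)"
   by (simp add: powr_add)
  also have "\<dots> <= 2 * L powr th * C1 * ?D * jb xi powr (w + 1) + C2 * ?D * jb xi powr (w + 1)"
  proof -
   have "\<delta> * th <= 1" using theta delta_nonneg orders by (intro mult_le_one) auto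
   then show ?thesis using C1(1) C2(1) theta by (intro add_mono mult_left_mono jb_powr_mono) auto
  qed
  also have "\<dots> = (2 * L powr th * C1 + C2) * ?D * jb xi powr (w + 1)" by (simp add: distrib_right)
  also have "\<dots> <= (2 * L powr th * C1 + C2) * ?D * (2 ^ (DIM(real ^ 'n) + 2) * dw xi)"
   using C1(1) C2(1) by (intro mult_left_mono jb_powr_dw[OF w]) auto
  finally show ?thesis by (simp add: M_def mult_ac)
 qed
 have "norm (KerH q y y' - KerH q y0 y') <= (M * (\<integral>xi. dw (xi :: real ^ 'n) \<partial>lborel)) * dist y y0 powr th" for y y0 y'
 proof -
  have "KerH q y y' - KerH q y0 y' = (\<integral>xi. cis ((h y - h y') \<bullet> xi) * q y (xi, y') - cis ((h y0 - h y') \<bullet> xi) * q y0 (xi, y') \<partial>lborel)"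
   unfolding KerH_def by (rule Bochner_Integration.integral_diff[symmetric]) (rule KerH_integrable[OF q w'])+
  also have "norm \<dots> <= (\<integral>xi. dist y y0 powr th * M * dw (xi :: real ^ 'n) \<partial>lborel)"
   by (rule Bochner_Integration.integral_norm_bound_integral[OF Bochner_Integration.integrable_diff[OF KerH_integrable[OF q w'] KerH_integrable[OF q w']] integrable_cmult_dw key])
  finally show ?thesis by (simp add: mult_ac)
 qed
 moreover have "M * (\<integral>xi. dw (xi :: real ^ 'n) \<partial>lborel) >= 0"
  using M0 by (intro mult_nonneg_nonneg Bochner_Integration.integral_nonneg) (auto simp: dw_def)
 ultimately show ?thesis by (rule that[rotated])
qed

lemma symb_phase:
 assumes q: "symb th \<rho> \<delta> d w q" and c: "Cb (c :: (real ^ 'n) \<times> (real ^ 'n) => real ^ 'n)"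
 shows "symb th \<rho> \<delta> d (w + 1) (%y z. of_real (c (y, snd z) \<bullet> fst z) * q y z)"
proof -
 have "symb th \<rho> \<delta> d 1 (%y (z :: (real ^ 'n) \<times> (real ^ 'n)). \<Sum>m\<in>Basis. complex_of_real (c (y, snd z) \<bullet> m) * complex_of_real (fst z \<bullet> m))"
  by (rule symb_sum, rule symb_mult[OF symb_Cb[OF Cb_of_real[OF Cb_inner[OF c]]] symb_coord]) auto
 moreover have "complex_of_real (c (y, snd z) \<bullet> fst z) = (\<Sum>m\<in>Basis. complex_of_real (c (y, snd z) \<bullet> m) * complex_of_real (fst z \<bullet> m))" for y z
  by (subst euclidean_inner) simp
 ultimately have "symb th \<rho> \<delta> d 1 (%y (z :: (real ^ 'n) \<times> (real ^ 'n)). complex_of_real (c (y, snd z) \<bullet> fst z))" by simp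
 from symb_mult[OF this q] show ?thesis by simp
qed

lemma Cb_pderiv_h: "b \<in> Basis ==> Cb (%p :: (real ^ 'n) \<times> (real ^ 'n). pderiv_dir b h (fst p))"
 "b \<in> Basis ==> Cb (%p :: (real ^ 'n) \<times> (real ^ 'n). pderiv_dir b h (snd p))"
 using bder_h by (auto simp: bder_def intro!: Cb_compose_vec[OF _ bder_fst[OF bder_ident]] Cb_compose_vec[OF _ bder_snd[OF bder_ident]])

text \<open>\<open>q2\<close> and \<open>q1\<close> are the amplitudes of the derivatives of
  \<open>KerH q\<close> in y' and in y; their first terms come from the phase.\<close>

definition q2 :: "real ^ 'n => (real ^ 'n => (real ^ 'n) \<times> (real ^ 'n) => complex) => real ^ 'n => (real ^ 'n) \<times> (real ^ 'n) => complex" where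
 "q2 b q y z = - \<i> * (of_real (pderiv_dir b h (snd z) \<bullet> fst z) * q y z) + dZ (0, b) q y z"

definition q1 :: "real ^ 'n => (real ^ 'n => (real ^ 'n) \<times> (real ^ 'n) => complex) => real ^ 'n => (real ^ 'n) \<times> (real ^ 'n) => complex" where
 "q1 b q y z = \<i> * (of_real (pderiv_dir b h y \<bullet> fst z) * q y z) + dX b q y z"

lemma symb_q2:
 assumes q: "symb th \<rho> \<delta> d w q" and b: "b \<in> Basis" shows "symb th \<rho> \<delta> d (w + 1) (q2 b q)"
 unfolding q2_def[abs_def]
proof (rule symb_add[OF symb_cmult])
 show "symb th \<rho> \<delta> d (w + 1) (%y z. of_real (pderiv_dir b h (snd z) \<bullet> fst z) * q y z)"
  using symb_phase[OF q Cb_pderiv_h(2)[OF b]] by simp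
 have "symb th \<rho> \<delta> d (w + wt \<rho> \<delta> (0 :: real ^ 'n, b)) (dZ (0, b) q)" by (rule symb_dZ[OF q]) (use b in \<open>simp add: Basis_prod_def\<close>)
 then show "symb th \<rho> \<delta> d (w + 1) (dZ (0, b) q)"
  by (rule symb_mono) (use orders in \<open>auto simp: wt_def\<close>)
qed

lemma symb_q1:
 assumes q: "symb th \<rho> \<delta> d w q" and d: "d > 0" and b: "b \<in> Basis" shows "symb th \<rho> \<delta> (d - 1) (w + 1) (q1 b q)"
 unfolding q1_def[abs_def]
proof (rule symb_add[OF symb_cmult])
 have "symb th \<rho> \<delta> d (w + 1) (%y z. of_real (pderiv_dir b h y \<bullet> fst z) * q y z)"
  using symb_phase[OF q Cb_pderiv_h(1)[OF b]] by simp
 then show "symb th \<rho> \<delta> (d - 1) (w + 1) (%y z. of_real (pderiv_dir b h y \<bullet> fst z) * q y z)" by (rule symb_mono) auto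
 show "symb th \<rho> \<delta> (d - 1) (w + 1) (dX b q)" by (rule symb_mono[OF symb_dX[OF q d b]]) (use orders in auto)
qed

lemma KerH_pderiv2:
 assumes q: "symb th \<rho> \<delta> d w q" and w: "w + 1 <= (- real (DIM(real ^ 'n) + 2))"
 shows "KerH q y differentiable_on UNIV" and "b \<in> Basis ==> pderiv_dir b (KerH q y) = KerH (q2 b q) y"
proof -
 have w': "w <= (- real (DIM(real ^ 'n) + 2))" using w by linarith
 let ?I = "%y' xi. cis ((h y - h y') \<bullet> xi) * q y (xi, y')"
 have d: "((%y'. ?I y' xi) has_derivative (%u. cis ((h y - h y') \<bullet> xi) * pderiv_dir (0, u) (q y) (xi, y')
   + \<i> * of_real ((0 - pderiv_dir u h y') \<bullet> xi) * cis ((h y - h y') \<bullet> xi) * q y (xi, y'))) (at y')" for y' xi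
 proof -
  have "((%y'. (xi, y')) has_derivative (%u. (0, u))) (at y')" by (auto intro!: derivative_eq_intros)
  note e = has_derivative_compose[OF this has_derivative_pderiv'[OF differentiable_on_UNIV_D[OF symb_diff[OF q]]]]
  show ?thesis
   by (rule has_derivative_mult[OF cis_has_derivative[OF bounded_linear.has_derivative[OF bounded_linear_inner_left
      has_derivative_diff[OF has_derivative_const has_derivative_pderiv'[OF differentiable_on_UNIV_D[OF hd]]]]] e])
 qed
 have p: "pderiv_dir b (%y'. ?I y' xi) y' = cis ((h y - h y') \<bullet> xi) * q2 b q y (xi, y')" for b y' xi
  by (subst pderiv_dir_eq[OF d]) (simp add: q2_def dZ_def algebra_simps)
 have df: "(%y'. ?I y' xi) differentiable (at y')" for y' xi unfolding differentiable_def using d by blast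
 have m: "(%xi. pderiv_dir b (%y'. ?I y' xi) y') \<in> borel_measurable borel" if "b \<in> Basis" for b y'
  unfolding p using borel_measurable_integrable[OF KerH_integrable[OF symb_q2[OF q that] w]] by simp
 have bnd: "\<exists>K. \<forall>y'\<in>ball y0 1. \<forall>xi. norm (pderiv_dir b (%y'. ?I y' xi) y') <= K * dw xi" if b: "b \<in> Basis" for b y0
 proof -
  obtain C where "!!y xi y'. norm (q2 b q y (xi, y')) <= C * dw xi" by (rule symb_dw[OF symb_q2[OF q b] w]) blast
  then show ?thesis unfolding p by (auto simp: norm_mult)
 qed
 show "KerH q y differentiable_on UNIV" unfolding KerH_def[abs_def]
  by (rule pderiv_integral_dw(1)[OF KerH_integrable[OF q w'] df m bnd])
 show "pderiv_dir b (KerH q y) = KerH (q2 b q) y" if "b \<in> Basis"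
  using pderiv_integral_dw(2)[OF KerH_integrable[OF q w'] df m bnd that] unfolding KerH_def[abs_def] p by simp
qed

lemma KerH_pderiv1:
 assumes q: "symb th \<rho> \<delta> d w q" and w: "w + 1 <= (- real (DIM(real ^ 'n) + 2))" and dpos: "d > 0"
 shows "(%y. KerH q y y') differentiable_on UNIV" and "b \<in> Basis ==> pderiv_dir b (%y. KerH q y y') = (%y. KerH (q1 b q) y y')"
proof -
 have w': "w <= (- real (DIM(real ^ 'n) + 2))" using w by linarith
 let ?I = "%y xi. cis ((h y - h y') \<bullet> xi) * q y (xi, y')"
 have d: "((%y. ?I y xi) has_derivative (%u. cis ((h y - h y') \<bullet> xi) * pderiv_dir u (%y. q y (xi, y')) y
   + \<i> * of_real ((pderiv_dir u h y - 0) \<bullet> xi) * cis ((h y - h y') \<bullet> xi) * q y (xi, y'))) (at y)" for y xi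
  by (rule has_derivative_mult[OF cis_has_derivative[OF bounded_linear.has_derivative[OF bounded_linear_inner_left
     has_derivative_diff[OF has_derivative_pderiv'[OF differentiable_on_UNIV_D[OF hd]] has_derivative_const]]]
     has_derivative_pderiv'[OF differentiable_on_UNIV_D[OF symb_diff_x[OF q dpos]]]])
 have p: "pderiv_dir b (%y. ?I y xi) y = cis ((h y - h y') \<bullet> xi) * q1 b q y (xi, y')" for b y xi
  by (subst pderiv_dir_eq[OF d]) (simp add: q1_def dX_def algebra_simps)
 have df: "(%y. ?I y xi) differentiable (at y)" for y xi unfolding differentiable_def using d by blast
 have m: "(%xi. pderiv_dir b (%y. ?I y xi) y) \<in> borel_measurable borel" if "b \<in> Basis" for b y
  unfolding p using borel_measurable_integrable[OF KerH_integrable[OF symb_q1[OF q dpos that] w]] by simp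
 have bnd: "\<exists>K. \<forall>y\<in>ball y0 1. \<forall>xi. norm (pderiv_dir b (%y. ?I y xi) y) <= K * dw xi" if b: "b \<in> Basis" for b y0
 proof -
  obtain C where "!!y xi y'. norm (q1 b q y (xi, y')) <= C * dw xi" by (rule symb_dw[OF symb_q1[OF q dpos b] w]) blast
  then show ?thesis unfolding p by (auto simp: norm_mult)
 qed
 show "(%y. KerH q y y') differentiable_on UNIV" unfolding KerH_def[abs_def]
  by (rule pderiv_integral_dw(1)[OF KerH_integrable[OF q w'] df m bnd])
 show "pderiv_dir b (%y. KerH q y y') = (%y. KerH (q1 b q) y y')" if "b \<in> Basis"
  using pderiv_integral_dw(2)[OF KerH_integrable[OF q w'] df m bnd that] unfolding KerH_def[abs_def] p by simp
qed

lemma KerH_shift: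
 assumes q: "symb th \<rho> \<delta> d w q" and w: "w <= (- real (DIM(real ^ 'n) + 2))" and b: "b \<in> Basis"
 shows "of_real ((h y - h y') \<bullet> b) * KerH q y y' = \<i> * KerH (dZ (b, 0) q) y y'"
proof -
 have q': "symb th \<rho> \<delta> d (w + wt \<rho> \<delta> (b, 0 :: real ^ 'n)) (dZ (b, 0) q)" by (rule symb_dZ[OF q]) (use b in \<open>simp add: Basis_prod_def\<close>)
 have w': "w + wt \<rho> \<delta> (b, 0 :: real ^ 'n) <= (- real (DIM(real ^ 'n) + 2))" using w rho_pos b nonzero_Basis[of b] by (auto simp: wt_def)
 obtain C where C: "!!y xi y'. norm (q y (xi, y')) <= C * dw xi" by (rule symb_dw[OF q w]) blast
 obtain D where D: "!!y xi y'. norm (dZ (b, 0) q y (xi, y')) <= D * dw xi" by (rule symb_dw[OF q' w']) blast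
 have e: "dZ (b, 0) q y (xi, y') = pderiv_dir b (%xi. q y (xi, y')) xi" for xi
  unfolding dZ_def by (rule pderiv_dir_fst[OF differentiable_on_UNIV_D[OF symb_diff[OF q]]])
 show ?thesis unfolding KerH_def e
 proof (rule fourier_by_parts[OF _ b _ C])
  show "(%xi. q y (xi, y')) differentiable_on UNIV"
   by (rule differentiable_on_compose_UNIV[OF symb_diff[OF q]]) (auto intro!: has_derivative_differentiable_on derivative_eq_intros)
  show "continuous_on UNIV (pderiv_dir b (%xi. q y (xi, y')))"
   unfolding e[symmetric, abs_def] by (intro symb_joint_cont[OF q'] continuous_intros)
  show "norm (pderiv_dir b (%xi. q y (xi, y')) xi) <= D * dw xi" for xi unfolding e[symmetric] by (rule D)
 qed
qed

text \<open>Kernels that decay rapidly off the diagonal together with their derivatives; the density \<open>q\<close>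
 may depend on the order, because integration by parts replaces it.\<close>

definition kern :: "nat => (real ^ 'n => real ^ 'n => complex) => bool" where
 "kern d F \<longleftrightarrow> (\<forall>w. \<exists>q. symb th \<rho> \<delta> d w q & F = KerH q)"

lemma kernE:
 assumes "kern d F" obtains q where "symb th \<rho> \<delta> d w q" "F = KerH q"
 using assms unfolding kern_def by blast

lemma kern_d2:
 assumes F: "kern d F" and b: "b \<in> Basis" shows "kern d (%y. pderiv_dir b (F y))"
 unfolding kern_def
proof
 fix w
 \<comment> \<open>The order is taken one below both the target and the limit of integrability: the
   derivative raises it by one.\<close>
 obtain q where q: "symb th \<rho> \<delta> d (min w (- real (DIM(real ^ 'n) + 2)) - 1) q" and F': "F = KerH q" by (rule kernE[OF F])
 have "symb th \<rho> \<delta> d (min w (- real (DIM(real ^ 'n) + 2)) - 1 + 1) (q2 b q)" by (rule symb_q2[OF q b])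
 then have "symb th \<rho> \<delta> d w (q2 b q)" by (rule symb_mono) auto
 moreover have "(%y. pderiv_dir b (F y)) = KerH (q2 b q)"
  unfolding F' by (rule ext, rule KerH_pderiv2(2)[OF q _ b]) simp
 ultimately show "\<exists>q. symb th \<rho> \<delta> d w q & (%y. pderiv_dir b (F y)) = KerH q" by blast
qed

lemma kern_d1:
 assumes F: "kern d F" and d: "d > 0" and b: "b \<in> Basis" shows "kern (d - 1) (%y y'. pderiv_dir b (%y. F y y') y)"
 unfolding kern_def
proof
 fix w
 obtain q where q: "symb th \<rho> \<delta> d (min w (- real (DIM(real ^ 'n) + 2)) - 1) q" and F': "F = KerH q" by (rule kernE[OF F])
 have "symb th \<rho> \<delta> (d - 1) (min w (- real (DIM(real ^ 'n) + 2)) - 1 + 1) (q1 b q)" by (rule symb_q1[OF q d b])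
 then have "symb th \<rho> \<delta> (d - 1) w (q1 b q)" by (rule symb_mono) auto
 moreover have "pderiv_dir b (%y. F y y') = (%y. KerH (q1 b q) y y')" for y'
  unfolding F' by (rule KerH_pderiv1(2)[OF q _ d b]) simp
 ultimately show "\<exists>q. symb th \<rho> \<delta> (d - 1) w q & (%y y'. pderiv_dir b (%y. F y y') y) = KerH q"
  by (intro exI[of _ "q1 b q"]) (simp add: fun_eq_iff)
qed

text \<open>The mean Jacobian of the inverse map expresses y - y' linearly through h y - h y', and
  each component of the latter becomes a xi derivative of the amplitude by
  \<open>KerH_shift\<close>.\<close>

lemma kern_coord:
 assumes F: "kern d F" and l: "l \<in> Basis" shows "kern d (%y y'. of_real ((y - y') \<bullet> l) * F y y')"
 unfolding kern_def
proof
 fix w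
 obtain q where q: "symb th \<rho> \<delta> d (min w (- real (DIM(real ^ 'n) + 2))) q" and F': "F = KerH q" by (rule kernE[OF F])
 define X where "X m p = complex_of_real ((Xi k (h (fst p)) (h (snd p)) *v m) \<bullet> l)" for m and p :: "(real ^ 'n) \<times> (real ^ 'n)"
 have X: "Cb (X m)" for m
 proof -
  have "Cb (%p. Xi k (h (fst p)) (h (snd p)) $ i $ j)" for i j using Cb_compose[OF Cb_Xi[OF bder_k] bder_hh] by simp
  then have "Cb (%p. (Xi k (h (fst p)) (h (snd p)) *v m) \<bullet> l)"
   unfolding matrix_vector_mult_def inner_vec_def by (simp, intro Cb_sum Cb_mult Cb_const)
  then show ?thesis unfolding X_def[abs_def] by (rule Cb_of_real)
 qed
 define r where "r y z = (\<Sum>m\<in>Basis. X m (y, snd z) * (\<i> * dZ (m, 0) q y z))" for y z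
 have q': "symb th \<rho> \<delta> d (min w (- real (DIM(real ^ 'n) + 2))) (dZ (m, 0) q)" if "m \<in> Basis" for m :: "real ^ 'n"
  by (rule symb_mono[OF symb_dZ[OF q]]) (use that nonzero_Basis[of m] rho_pos in \<open>auto simp: Basis_prod_def wt_def\<close>)
 have "symb th \<rho> \<delta> d (min w (- real (DIM(real ^ 'n) + 2))) r" unfolding r_def[abs_def]
  by (rule symb_sum, rule symb_mult[OF symb_Cb[OF X] symb_cmult[OF q']]) auto
 then have "symb th \<rho> \<delta> d w r" by (rule symb_mono) auto
 moreover have "of_real ((y - y') \<bullet> l) * F y y' = KerH r y y'" for y y'
 proof -
  let ?A = "Xi k (h y) (h y')" and ?u = "h y - h y'"
  have "(y - y') \<bullet> l = (?A *v ?u) \<bullet> l" using Xi_mean_value[OF bder_k, of "h y" "h y'"] by simp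
  also have "?A *v ?u = ?A *v (\<Sum>m\<in>Basis. (?u \<bullet> m) *\<^sub>R m)" by (simp add: euclidean_representation)
  also have "\<dots> \<bullet> l = (\<Sum>m\<in>Basis. (?u \<bullet> m) * ((?A *v m) \<bullet> l))" by (simp add: linear_sum linear_scale inner_sum_left)
  finally have "of_real ((y - y') \<bullet> l) * F y y' = (\<Sum>m\<in>Basis. X m (y, y') * (of_real (?u \<bullet> m) * F y y'))"
   by (simp only: of_real_sum of_real_mult sum_distrib_right X_def fst_conv snd_conv) (simp only: mult_ac)
  also have "\<dots> = (\<Sum>m\<in>Basis. X m (y, y') * (\<i> * KerH (dZ (m, 0) q) y y'))"
   unfolding F' by (intro sum.cong refl) (simp only: KerH_shift[OF q min.cobounded2])
  also have "\<dots> = (\<Sum>m\<in>Basis. (\<integral>xi. (X m (y, y') * \<i>) * (cis (?u \<bullet> xi) * dZ (m, 0) q y (xi, y')) \<partial>lborel))"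
   unfolding KerH_def by (simp only: integral_mult_right_zero mult.assoc)
  also have "\<dots> = (\<integral>xi. (\<Sum>m\<in>Basis. (X m (y, y') * \<i>) * (cis (?u \<bullet> xi) * dZ (m, 0) q y (xi, y'))) \<partial>lborel)"
   by (rule Bochner_Integration.integral_sum[symmetric]) (intro integrable_mult_right KerH_integrable[OF q' min.cobounded2])
  also have "\<dots> = KerH r y y'" unfolding KerH_def
   by (rule Bochner_Integration.integral_cong[OF refl]) (simp add: r_def sum_distrib_left mult_ac)
  finally show ?thesis .
 qed
 ultimately show "\<exists>q. symb th \<rho> \<delta> d w q & (%y y'. of_real ((y - y') \<bullet> l) * F y y') = KerH q"
  by (intro exI[of _ r]) (simp add: fun_eq_iff)
qed

lemma kern_sbase:
 assumes F: "kern d F" shows "sbase th \<delta> d 0 (%y (z :: (real ^ 'n) \<times> (real ^ 'n)). F y (snd z))"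
proof -
 obtain q where q: "symb th \<rho> \<delta> d ((- real (DIM(real ^ 'n) + 2)) - 1) q" and F': "F = KerH q" by (rule kernE[OF F])
 obtain C where C: "C >= 0" "!!y y'. norm (F y y') <= C" unfolding F' by (rule KerH_bound[OF q]) auto
 obtain D where D: "D >= 0" "!!y y0 y'. norm (F y y' - F y0 y') <= D * dist y y0 powr th" unfolding F' by (rule KerH_hoelder[OF q]) auto
 have "F y differentiable_on UNIV" for y unfolding F' by (rule KerH_pderiv2(1)[OF q]) simp
 then have dz: "(%z :: (real ^ 'n) \<times> (real ^ 'n). F y (snd z)) differentiable_on UNIV" for y
  by (rule differentiable_on_compose_UNIV) (rule bounded_linear_differentiable_on[OF bounded_linear_snd])
 have "shol th (0 + \<delta> * th) (%y (z :: (real ^ 'n) \<times> (real ^ 'n)). F y (snd z))"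
  unfolding shol_def
 proof (intro exI[of _ D] conjI allI D(1))
  fix y y0 :: "real ^ 'n" and z :: "(real ^ 'n) \<times> (real ^ 'n)"
  have "1 <= jb (fst z) powr (0 + \<delta> * th)" using jb_ge_1[of "fst z"] delta_nonneg theta by (intro ge_one_powr_ge_zero) auto
  then have "D * dist y y0 powr th * 1 <= D * dist y y0 powr th * jb (fst z) powr (0 + \<delta> * th)" using D(1) by (intro mult_left_mono) auto
  then show "norm (F y (snd z) - F y0 (snd z)) <= D * (dist y y0 powr th * jb (fst z) powr (0 + \<delta> * th))"
   using D(2)[of y "snd z" y0] by (simp add: mult.assoc)
 qed
 moreover have "sbd 0 (%y (z :: (real ^ 'n) \<times> (real ^ 'n)). F y (snd z))" using C unfolding sbd_def by auto
 moreover have "(%y. F y y') differentiable_on UNIV" if "d > 0" for y' unfolding F' by (rule KerH_pderiv1(1)[OF q _ that]) simp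
 moreover have "continuous_on UNIV (%y. F y y')" for y' unfolding F' by (rule KerH_cont[OF q]) simp
 ultimately show ?thesis using dz unfolding sbase_def by blast
qed

section \<open>From smooth kernels back to symbols\<close>

definition osc :: "(real ^ 'n => complex) => real ^ 'n => (real ^ 'n) \<times> (real ^ 'n) => complex" where
 "osc \<kappa> y z = cis (- ((y - snd z) \<bullet> fst z)) * \<kappa> (fst z)"

lemma osc_derivative:
 assumes "Sch \<kappa>"
 shows "(osc \<kappa> y has_derivative (%v. cis (- ((y - snd z) \<bullet> fst z)) * pderiv_dir (fst v) \<kappa> (fst z)
  + \<i> * of_real (- ((y - snd z) \<bullet> fst v + (0 - snd v) \<bullet> fst z)) * cis (- ((y - snd z) \<bullet> fst z)) * \<kappa> (fst z))) (at z)"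
 unfolding osc_def
 by (rule has_derivative_mult[OF cis_has_derivative[OF has_derivative_minus[OF has_derivative_inner[OF
    has_derivative_diff[OF has_derivative_const has_derivative_snd[OF has_derivative_ident]] has_derivative_fst[OF has_derivative_ident]]]]
   has_derivative_compose[OF has_derivative_fst[OF has_derivative_ident] has_derivative_pderiv'[OF differentiable_on_UNIV_D[OF all_derivsD(1)[OF assms]]]]])

lemma osc_derivative1:
 "((%y. osc \<kappa> y z) has_derivative (%v. \<i> * of_real (- ((v - 0) \<bullet> fst z)) * cis (- ((y - snd z) \<bullet> fst z)) * \<kappa> (fst z))) (at y)"
 unfolding osc_def
 by (rule has_derivative_mult_left[OF cis_has_derivative[OF has_derivative_minus[OF bounded_linear.has_derivative[OF bounded_linear_inner_left
    has_derivative_diff[OF has_derivative_ident has_derivative_const]]]]])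

lemma osc_sbase:
 assumes \<kappa>: "Sch \<kappa>" shows "sbase th \<delta> d w (osc \<kappa>)"
proof -
 obtain C where C: "C > 0" "!!x. norm (\<kappa> x) <= C * jb x powr w" by (rule Sch_jb[OF \<kappa>, where w = w]) blast
 \<comment> \<open>The exponent is lowered by th to make up for the factor jb xi powr th from the
   Hoelder estimate of the phase.\<close>
 obtain D where D: "D > 0" "!!x. norm (\<kappa> x) <= D * jb x powr (w + \<delta> * th - th)" by (rule Sch_jb[OF \<kappa>, where w = "w + \<delta> * th - th"]) blast
 have "sbd w (osc \<kappa>)" using C unfolding sbd_def osc_def by (intro exI[of _ C]) (auto simp: norm_mult)
 moreover have "shol th (w + \<delta> * th) (osc \<kappa>)" unfolding shol_def
 proof (intro exI[of _ "2 * D"] conjI allI)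
  fix y y0 :: "real ^ 'n" and z :: "(real ^ 'n) \<times> (real ^ 'n)"
  let ?a = "- ((y - snd z) \<bullet> fst z)" and ?b = "- ((y0 - snd z) \<bullet> fst z)"
  have "\<bar>?a - ?b\<bar> = \<bar>(y - y0) \<bullet> fst z\<bar>" by (simp add: inner_diff_left abs_minus_commute)
  also have "\<dots> <= norm (y - y0) * norm (fst z)" by (rule Cauchy_Schwarz_ineq2)
  also have "\<dots> <= dist y y0 * jb (fst z)" using jb_ge_norm[of "fst z"] by (intro mult_mono) (auto simp: dist_norm)
  finally have "\<bar>?a - ?b\<bar> powr th <= (dist y y0 * jb (fst z)) powr th" using theta by (intro powr_mono2) auto
  also have "\<dots> = dist y y0 powr th * jb (fst z) powr th" by (simp add: powr_mult)
  finally have c: "norm (cis ?a - cis ?b) <= 2 * (dist y y0 powr th * jb (fst z) powr th)"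
   using cis_hoelder[OF theta, of ?a ?b] by linarith
  have "norm (osc \<kappa> y z - osc \<kappa> y0 z) = norm (cis ?a - cis ?b) * norm (\<kappa> (fst z))"
   by (simp add: osc_def norm_mult flip: left_diff_distrib)
  also have "\<dots> <= (2 * (dist y y0 powr th * jb (fst z) powr th)) * (D * jb (fst z) powr (w + \<delta> * th - th))"
   by (intro mult_mono c D) auto
  also have "\<dots> = 2 * D * (dist y y0 powr th * (jb (fst z) powr th * jb (fst z) powr (w + \<delta> * th - th)))" by (simp add: mult_ac)
  also have "jb (fst z) powr th * jb (fst z) powr (w + \<delta> * th - th) = jb (fst z) powr (w + \<delta> * th)"
   by (simp flip: powr_add)
  finally show "norm (osc \<kappa> y z - osc \<kappa> y0 z) <= 2 * D * (dist y y0 powr th * jb (fst z) powr (w + \<delta> * th))" .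
 qed (use D in simp)
 moreover have "osc \<kappa> y differentiable_on UNIV" for y by (rule has_derivative_differentiable_on[OF osc_derivative[OF \<kappa>]])
 moreover have dy: "(%y. osc \<kappa> y z) differentiable_on UNIV" for z by (rule has_derivative_differentiable_on[OF osc_derivative1])
 ultimately show ?thesis unfolding sbase_def using differentiable_imp_continuous_on[OF dy] by blast
qed

text \<open>A derivative in \<eta> brings down a component of y - y', which is absorbed into the
  kernel by \<open>kern_coord\<close>; a derivative in y or y' brings down a component of \<eta>,
  which is absorbed into \<kappa>. The candidates are thus closed under derivatives, and the decay
  of \<kappa> makes them bounded for every order w.\<close>

theorem symb_smoothing:
 assumes "Sch \<kappa>" "kern d F" shows "symb th \<rho> \<delta> d w (%y z. osc \<kappa> y z * F y (snd z))"
proof -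
 define E where "E \<kappa> F y z = osc \<kappa> y z * F y (snd z)" for \<kappa> F y and z :: "(real ^ 'n) \<times> (real ^ 'n)"
 let ?X = "%d w f. \<exists>\<kappa> F. Sch \<kappa> & kern d F & f = E \<kappa> F"
 let ?Y = "%d w f. ?X d w f \<or> symb th \<rho> \<delta> d w f"
 have Xgen: "salg ?Y d w (E \<kappa> F)" if "Sch \<kappa>" "kern d F" for d w \<kappa> F
  by (rule salg_gen[where k = d and w = w]) (use that in blast)+
 have "symb th \<rho> \<delta> d w (E \<kappa> F)"
 proof (rule symb_coinduct_alg[where X = ?X])
  show "salg ?Y d w (E \<kappa> F)" by (rule Xgen[OF assms])
 next
  fix d and w :: real and f assume "?X d w f"
  then obtain \<kappa> F where \<kappa>: "Sch \<kappa>" and F: "kern d F" and f: "f = E \<kappa> F" by blast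
  show "sbase th \<delta> d w f"
   using sbase_mult[OF osc_sbase[OF \<kappa>, of d w] kern_sbase[OF F]] unfolding f E_def[abs_def] by simp
  have Fd: "F y differentiable_on UNIV" for y
  proof -
   obtain q where q: "symb th \<rho> \<delta> d ((- real (DIM(real ^ 'n) + 2)) - 1) q" and F': "F = KerH q" by (rule kernE[OF F])
   show ?thesis unfolding F' by (rule KerH_pderiv2(1)[OF q]) simp
  qed
  have Fs: "((%z :: (real ^ 'n) \<times> (real ^ 'n). F y (snd z)) has_derivative (%v. pderiv_dir (snd v) (F y) (snd z))) (at z)" for y z
   by (rule has_derivative_compose[OF has_derivative_snd[OF has_derivative_ident] has_derivative_pderiv'[OF differentiable_on_UNIV_D[OF Fd]]])
  have F0: "pderiv_dir 0 (F y) y' = 0" "pderiv_dir 0 \<kappa> \<eta> = 0" for y y' \<eta>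
   using linear_0[OF pderiv_dir_linear[OF differentiable_on_UNIV_D[OF Fd]]]
    linear_0[OF pderiv_dir_linear[OF differentiable_on_UNIV_D[OF all_derivsD(1)[OF \<kappa>]]]] by blast+
  have dz: "dZ b f y z = osc \<kappa> y z * pderiv_dir (snd b) (F y) (snd z) + (cis (- ((y - snd z) \<bullet> fst z)) * pderiv_dir (fst b) \<kappa> (fst z)
   + \<i> * of_real (- ((y - snd z) \<bullet> fst b + (0 - snd b) \<bullet> fst z)) * cis (- ((y - snd z) \<bullet> fst z)) * \<kappa> (fst z)) * F y (snd z)" for b y z
   unfolding dZ_def f E_def by (rule pderiv_dir_eq[OF has_derivative_mult[OF osc_derivative[OF \<kappa>] Fs]])
  show "salg ?Y d (w + wt \<rho> \<delta> b) (dZ b f)" if b: "b \<in> Basis" for b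
  proof -
   from b consider (1) b1 where "b = (b1, 0)" "b1 \<in> Basis" | (2) b2 where "b = (0, b2)" "b2 \<in> Basis"
    by (auto simp: Basis_prod_def)
   then show ?thesis
   proof cases
    case 1
    have "dZ b f = (%y z. E (pderiv_dir b1 \<kappa>) F y z + E (%\<eta>. - \<i> * \<kappa> \<eta>) (%y y'. of_real ((y - y') \<bullet> b1) * F y y') y z)"
     by (intro ext) (simp add: dz 1(1) F0 E_def osc_def algebra_simps)
    then show ?thesis
     by (simp only:) (intro salg_add Xgen Sch_pderiv[OF \<kappa> 1(2)] Cb_Sch_mult[OF Cb_const \<kappa>] F kern_coord[OF F 1(2)])
   next
    case 2
    have "dZ b f = (%y z. E \<kappa> (%y. pderiv_dir b2 (F y)) y z + E (%\<eta>. (\<i> * of_real (\<eta> \<bullet> b2)) * \<kappa> \<eta>) F y z)"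
     by (intro ext) (simp add: dz 2(1) F0 E_def osc_def algebra_simps inner_commute)
    then show ?thesis
     by (simp only:) (intro salg_add Xgen OM_Sch_mult OM_mult OM_coord Cb_OM[OF Cb_const] \<kappa> F kern_d2[OF F 2(2)])
   qed
  qed
  show "salg ?Y (d - 1) (w + \<delta>) (dX b f)" if d: "d > 0" and b: "b \<in> Basis" for b
  proof -
   have F1: "(%y. F y y') differentiable_on UNIV" for y'
   proof -
    obtain q where q: "symb th \<rho> \<delta> d ((- real (DIM(real ^ 'n) + 2)) - 1) q" and F': "F = KerH q" by (rule kernE[OF F])
    show ?thesis unfolding F' by (rule KerH_pderiv1(1)[OF q _ d]) simp
   qed
   have "dX b f y z = osc \<kappa> y z * pderiv_dir b (%y. F y (snd z)) y + (\<i> * of_real (- ((b - 0) \<bullet> fst z)) * cis (- ((y - snd z) \<bullet> fst z)) * \<kappa> (fst z)) * F y (snd z)" for y z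
    unfolding dX_def f E_def by (rule pderiv_dir_eq[OF has_derivative_mult[OF osc_derivative1 has_derivative_pderiv'[OF differentiable_on_UNIV_D[OF F1]]]])
   then have eq: "dX b f = (%y z. E \<kappa> (%y y'. pderiv_dir b (%y. F y y') y) y z + E (%\<eta>. (- \<i> * of_real (\<eta> \<bullet> b)) * \<kappa> \<eta>) F y z)"
    by (intro ext) (simp add: E_def osc_def algebra_simps inner_commute)
   have "kern (d - 1) F" using F unfolding kern_def by (meson diff_le_self order_refl symb_mono)
   then show ?thesis unfolding eq
    by (intro salg_add Xgen OM_Sch_mult OM_mult OM_coord Cb_OM[OF Cb_const] \<kappa> kern_d1[OF F d b])
  qed
 qed
 then show ?thesis by (simp add: E_def[abs_def])
qed

text \<open>Only the base points are transported by h; the covariable is left alone, which is the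
  substitution with the matrix \<open>mat 1\<close>. The phase of \<open>Ker\<close> then becomes
  that of \<open>KerH\<close>.\<close>

lemma kern_compose:
 fixes K :: "real ^ 'n => real ^ 'n => complex"
 assumes K: "!!w. \<exists>q. symb th \<rho> \<delta> d w q & K = (%x y. Ker q x x y)"
 shows "kern d (%y y'. K (h y) (h y') * of_real \<bar>det (J y')\<bar>)"
 unfolding kern_def
proof
 fix w
 obtain q where q: "symb th \<rho> \<delta> d w q" and Kq: "K = (%x y. Ker q x x y)" using K by blast
 have "symb th \<rho> \<delta> d w (%y z. q (h y) (mat 1 *v fst z, h (snd z)))"
  by (rule symb_compose_matrix[where N = "%_. mat 1" and N' = "%_. mat 1", OF q bder_h bder_h Cb_const Cb_const]) simp
 moreover have "symb th \<rho> \<delta> d 0 (%y (z :: (real ^ 'n) \<times> (real ^ 'n)). complex_of_real \<bar>det (J (snd z))\<bar>)"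
  using symb_Cb[OF Cb_of_real[OF Cb_compose[OF Cb_abs_det_J bder_snd[OF bder_ident]]]] by simp
 ultimately have "symb th \<rho> \<delta> d w (%y z. q (h y) (mat 1 *v fst z, h (snd z)) * of_real \<bar>det (J (snd z))\<bar>)"
  by (rule symb_mult) simp
 moreover have "K (h y) (h y') * of_real \<bar>det (J y')\<bar> = KerH (%y z. q (h y) (mat 1 *v fst z, h (snd z)) * of_real \<bar>det (J (snd z))\<bar>) y y'" for y y'
  unfolding Kq Ker_def KerH_def fst_conv snd_conv matrix_vector_mul_lid mult.assoc[symmetric] by (rule integral_mult_left_zero[symmetric])
 ultimately show "\<exists>q. symb th \<rho> \<delta> d w q & (%y y'. K (h y) (h y') * of_real \<bar>det (J y')\<bar>) = KerH q" by blast
qed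

end

lemma integral_gauss_nonzero: "integral\<^sup>L lborel (gauss :: 'a::euclidean_space => complex) ~= 0"
proof
 let ?g = "%x :: 'a. exp (- (x \<bullet> x))"
 obtain D where D: "D > 0" "!!x :: 'a. norm (gauss x) <= D * dw x" using Sch_dw[OF Sch_gauss] by blast
 have i: "integrable lborel ?g"
  by (rule continuous_integrable[where C = D]) (intro continuous_intros, use D(2) in \<open>simp add: gauss_def\<close>)
 assume "integral\<^sup>L lborel (gauss :: 'a => complex) = 0"
 then have "integral\<^sup>L lborel ?g = 0" by (simp add: gauss_def[abs_def])
 then have "AE x in lborel. ?g x = 0" using integral_nonneg_eq_0_iff_AE[OF i] by simp
 then have "AE x :: 'a in lborel. False" by simp
 then have "(UNIV :: 'a set) \<in> null_sets lborel" using AE_iff_null[of lborel "%_ :: 'a. False"] by simp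
 from null_setsD1[OF this] show False by simp
qed


section \<open>The transformed operator\<close>

text \<open>The derivatives of w and z_b w are polynomials in these functions themselves. As z_b
  alone is unbounded, the product z_b w serves as a generator.\<close>

lemma Cb_weights:
 defines "w \<equiv> %z :: 'v::euclidean_space. inverse (1 + z \<bullet> z)"
 shows "Cb w" and "b \<in> Basis ==> Cb (%z. (z \<bullet> b) * w z)"
proof -
 let ?X = "%f. f = w \<or> (\<exists>b\<in>Basis. f = (%z. (z \<bullet> b) * w z))"
 let ?Y = "%f. ?X f \<or> Cb f"
 have pos: "1 + z \<bullet> z > 0" for z :: 'v by (simp add: add_pos_nonneg)
 have dw: "(w has_derivative (%v. - (inverse (1 + z \<bullet> z) * (z \<bullet> v + v \<bullet> z) * inverse (1 + z \<bullet> z)))) (at z)" for z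
  unfolding w_def
 proof (rule Deriv.has_derivative_inverse)
  show "1 + z \<bullet> z ~= 0" using pos[of z] by simp
  show "((%z. 1 + z \<bullet> z) has_derivative (%v. z \<bullet> v + v \<bullet> z)) (at z)" by (auto intro!: derivative_eq_intros)
 qed
 have dzw: "((%z. (z \<bullet> b) * w z) has_derivative (%v. (z \<bullet> b) * (- (inverse (1 + z \<bullet> z) * (z \<bullet> v + v \<bullet> z) * inverse (1 + z \<bullet> z))) + (v \<bullet> b) * w z)) (at z)" for z b
  by (rule has_derivative_mult[OF bounded_linear.has_derivative[OF bounded_linear_inner_left has_derivative_ident] dw])
 have w1: "norm (w z) <= 1" for z
  using pos[of z] by (simp add: w_def inverse_le_1_iff)
 have w2: "norm ((z \<bullet> b) * w z) <= 1" if "b \<in> Basis" for z b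
 proof -
  have "\<bar>z \<bullet> b\<bar> <= norm z" using Basis_le_norm[OF that] .
  also have "\<dots> <= 1 + z \<bullet> z"
   using zero_le_power2[of "norm z - 1"] norm_ge_zero[of z] unfolding power2_norm_eq_inner[symmetric] power2_diff power_one mult_1_right by linarith
  finally show ?thesis using pos[of z] by (simp add: w_def norm_mult divide_inverse[symmetric])
 qed
 have step: "f differentiable_on UNIV & bounded (range f)" if "?X f" for f
  using that
 proof
  assume "f = w"
  then show ?thesis using w1 has_derivative_differentiable_on[OF dw] by (auto simp: bounded_iff)
 next
  assume "\<exists>b\<in>Basis. f = (%z. (z \<bullet> b) * w z)"
  then obtain b where b: "b \<in> Basis" and f: "f = (%z. (z \<bullet> b) * w z)" by blast
  show ?thesis unfolding f using w2[OF b] has_derivative_differentiable_on[OF dzw] unfolding bounded_iff by blast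
 qed
 have gw: "alg ?Y w" and gz: "b \<in> Basis ==> alg ?Y (%z. (z \<bullet> b) * w z)" for b by (rule alg_gen, blast)+
 have pw: "alg ?Y (pderiv_dir a f)" if "?X f" and a: "a \<in> Basis" for f a
  using that(1)
 proof
  assume f: "f = w"
  have "pderiv_dir a f = (%z. (- 2) * (((z \<bullet> a) * w z) * w z))"
   unfolding f by (rule ext, subst pderiv_dir_eq[OF dw]) (simp add: w_def inner_commute)
  then show ?thesis by (simp only:) (intro alg_mult alg_const gw gz a)
 next
  assume "\<exists>b\<in>Basis. f = (%z. (z \<bullet> b) * w z)"
  then obtain b where b: "b \<in> Basis" and f: "f = (%z. (z \<bullet> b) * w z)" by blast
  have "pderiv_dir a f = (%z. (- 2) * (((z \<bullet> b) * w z) * ((z \<bullet> a) * w z)) + (a \<bullet> b) * w z)"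
   unfolding f by (rule ext, subst pderiv_dir_eq[OF dzw]) (simp add: w_def inner_commute)
  then show ?thesis by (simp only:) (intro alg_add alg_mult alg_const gw gz a b)
 qed
 show "Cb w" by (rule Cb_coinduct_alg[where X = ?X, OF gw step pw])
 show "Cb (%z. (z \<bullet> b) * w z)" if "b \<in> Basis" by (rule Cb_coinduct_alg[where X = ?X, OF gz[OF that] step pw])
qed

text \<open>The vector field with components z_b / (|z|^2 + c^2), z = x - y and c the real part of
  the cut-off, is smooth and bounded: c = 1 near z = 0 keeps the denominator away from 0. For |z| >=
  s the cut-off vanishes and the field becomes z / |z|^2.\<close>

lemma (in symbols) off_diagonal_exists:
 fixes c :: "'v::euclidean_space \<times> 'v => complex"
 assumes c: "Cb c" and t: "t > 0" and s: "s > 0"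
  and c1: "!!x y. norm (x - y) < t ==> c (x, y) = 1" and c0: "!!x y. norm (x - y) >= s ==> c (x, y) = 0"
 obtains d :: "'v => 'v \<times> 'v => complex" where "off_diagonal th \<rho> \<delta> d s"
proof -
 define w where "w z = inverse (1 + z \<bullet> z)" for z :: 'v
 have pos: "1 + z \<bullet> z > 0" for z :: 'v by (simp add: add_pos_nonneg)
 \<comment> \<open>This is (|z|^2 + c^2) / (1 + |z|^2), written through the weight so that
   membership in \<open>Cb\<close> is evident.\<close>
 define D where "D p = 1 - w (fst p - snd p) + (Re (c p))\<^sup>2 * w (fst p - snd p)" for p
 have bz: "bder (%p :: 'v \<times> 'v. fst p - snd p)" by (intro bder_diff bder_fst bder_snd bder_ident)
 have Cw: "Cb (%p :: 'v \<times> 'v. w (fst p - snd p))" unfolding w_def by (rule Cb_compose[OF Cb_weights(1) bz])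
 have CD: "Cb D" unfolding D_def[abs_def] power2_eq_square
  by (intro Cb_add Cb_diff Cb_mult Cb_const Cw Cb_bounded_linear[OF bounded_linear_Re c])
 \<comment> \<open>The value of |z|^2 / (1 + |z|^2) at |z| = t. It bounds D from below for |z| >= t,
   whereas D = 1 for |z| < t.\<close>
 define e where "e = t\<^sup>2 / (1 + t\<^sup>2)"
 have e: "e > 0" "e <= 1" using t by (auto simp: e_def add_pos_nonneg divide_le_eq)
 have w01: "0 < w z" "w z <= 1" for z using pos[of z] by (simp_all add: w_def inverse_le_1_iff)
 have De: "e <= norm (D p)" for p
 proof (cases "norm (fst p - snd p) < t")
  case True
  then show ?thesis using c1[of "fst p" "snd p"] e by (simp add: D_def)
 next
  case False
  let ?z = "fst p - snd p"
  have zz: "t\<^sup>2 <= ?z \<bullet> ?z" using False t unfolding power2_norm_eq_inner[symmetric] by (intro power_mono) auto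
  have "w ?z <= inverse (1 + t\<^sup>2)" unfolding w_def using zz t by (intro le_imp_inverse_le) (auto intro: add_pos_nonneg)
  moreover have "1 + t\<^sup>2 ~= 0" using zero_le_power2[of t] by linarith
  then have "1 - inverse (1 + t\<^sup>2) = e" by (simp add: e_def field_simps)
  moreover have "0 <= (Re (c p))\<^sup>2 * w ?z" using w01(1)[of ?z] by simp
  ultimately have "e <= D p" unfolding D_def by linarith
  then show ?thesis by simp
 qed
 define d where "d b p = complex_of_real ((((fst p - snd p) \<bullet> b) * w (fst p - snd p)) * inverse (D p))" for b and p :: "'v \<times> 'v"
 show ?thesis
 proof (rule that[of d], unfold_locales)
  fix b :: 'v assume b: "b \<in> Basis"
  have "Cb (%p :: 'v \<times> 'v. ((fst p - snd p) \<bullet> b) * w (fst p - snd p))"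
   unfolding w_def by (rule Cb_compose[OF Cb_weights(2)[OF b] bz])
  then show "Cb (d b)" unfolding d_def[abs_def] by (rule Cb_of_real[OF Cb_mult[OF _ Cb_inverse[OF CD e(1) De]]])
 next
  fix x y :: 'v assume xy: "norm (x - y) >= s"
  let ?z = "x - y"
  have z: "?z \<bullet> ?z > 0" using xy s by auto
  have D: "D (x, y) = (?z \<bullet> ?z) * w ?z"
   using c0[OF xy] pos[of ?z] by (simp add: D_def w_def field_simps)
  have "(\<Sum>b\<in>Basis. of_real (?z \<bullet> b) * d b (x, y)) = complex_of_real ((\<Sum>b\<in>Basis. (?z \<bullet> b) * (?z \<bullet> b)) * (w ?z * inverse (D (x, y))))"
   by (simp only: d_def fst_conv snd_conv of_real_sum of_real_mult sum_distrib_right) (simp only: mult_ac)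
  also have "(\<Sum>b\<in>Basis. (?z \<bullet> b) * (?z \<bullet> b)) = ?z \<bullet> ?z" by (rule euclidean_inner[symmetric])
  also have "(?z \<bullet> ?z) * (w ?z * inverse (D (x, y))) = 1" unfolding D using z w01(1)[of ?z] by (simp add: field_simps)
  finally show "(\<Sum>b\<in>Basis. of_real (?z \<bullet> b) * d b (x, y)) = 1" by simp
 qed
qed

lemma (in diffeo_symbols) remainder:
 fixes dd :: "real ^ 'n => (real ^ 'n) \<times> (real ^ 'n) => complex"
 assumes od: "off_diagonal th \<rho> \<delta> dd s" and f: "symb th \<rho> \<delta> d w f"
  and off: "!!x xi y. norm (x - y) < s ==> f x (xi, y) = 0"
 obtains R where "!!w'. symb th \<rho> \<delta> d w' R"
  "!!u y. Sch u ==> SI f u (h y) (h y) = SI R (%y. u (h y)) y y"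
proof -
 interpret od: off_diagonal th \<rho> \<delta> dd s by (rule od)
 have "od.off f" using off unfolding od.off_def by blast
 then obtain K where K: "!!w'. \<exists>q. symb th \<rho> \<delta> d w' q & K = (%x y. Ker q x x y)"
  "!!v x. Sch v ==> SI f v x x = (\<integral>y. K x y * v y \<partial>lborel) & (%y. K x y * v y) \<in> borel_measurable borel"
  by (rule od.off_diagonal_kernel[OF f]) blast
 \<comment> \<open>The Jacobian determinant of the substitution by h becomes part of the kernel, so
   that the operator acts on u o h directly.\<close>
 define F where "F y y' = K (h y) (h y') * of_real \<bar>det (J y')\<bar>" for y y'
 have F: "kern d F" unfolding F_def[abs_def] by (rule kern_compose[OF K(1)])
 define \<kappa> where "\<kappa> \<eta> = inverse (integral\<^sup>L lborel (gauss :: real ^ 'n => complex)) * gauss \<eta>" for \<eta> :: "real ^ 'n"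
 have \<kappa>: "Sch \<kappa>" unfolding \<kappa>_def[abs_def] by (rule Cb_Sch_mult[OF Cb_const Sch_gauss])
 have \<kappa>1: "integral\<^sup>L lborel \<kappa> = 1" unfolding \<kappa>_def[abs_def] using integral_gauss_nonzero[where 'a = "real ^ 'n"] by simp
 define R where "R y z = osc \<kappa> y z * F y (snd z)" for y z
 have R: "symb th \<rho> \<delta> d w' R" for w' unfolding R_def[abs_def] by (rule symb_smoothing[OF \<kappa> F])
 show ?thesis
 proof (rule that[OF R])
  fix u :: "real ^ 'n => complex" and y assume u: "Sch u"
  let ?v = "%y. u (h y)"
  obtain C where C: "!!y xi y'. norm (R y (xi, y')) <= C * dw xi" by (rule symb_dw[OF R order_refl]) blast
  have KR: "Ker R y y y' = F y y'" for y'
  proof -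
   have "cis ((y - y') \<bullet> \<eta>) * R y (\<eta>, y') = \<kappa> \<eta> * F y y'" for \<eta>
    unfolding R_def osc_def fst_conv snd_conv by (simp add: cis_mult flip: mult.assoc)
   then have "Ker R y y y' = (\<integral>\<eta>. \<kappa> \<eta> * F y y' \<partial>lborel)" unfolding Ker_def by simp
   also have "\<dots> = integral\<^sup>L lborel \<kappa> * F y y'" by (rule integral_mult_left_zero)
   finally show ?thesis by (simp add: \<kappa>1)
  qed
  have "SI f u (h y) (h y) = (\<integral>x. K (h y) x * u x \<partial>lborel)" using K(2)[OF u] by blast
  also have "\<dots> = (\<integral>y'. of_real \<bar>det (J y')\<bar> * (K (h y) (h y') * u (h y')) \<partial>lborel)"
   using K(2)[OF u, of "h y"] by (intro integral_change_of_variables_lborel bij_h hd Cb_D(3)[OF Cb_det_J]) blast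
  also have "\<dots> = (\<integral>y'. Ker R y y y' * ?v y' \<partial>lborel)" unfolding KR F_def by (simp only: mult_ac)
  also have "\<dots> = SI R ?v y y" by (rule SI_swap(1)[OF R Sch_compose_h[OF u] C, symmetric])
  finally show "SI f u (h y) (h y) = SI R ?v y y" .
 qed
qed

theorem theorem4p19:
  fixes h :: "real ^ 'n::finite \<Rightarrow> real ^ 'n"
    and \<rho> \<delta> \<tau> m :: real
    and p :: "'n dsymbol"
    and A :: "(real ^ 'n \<Rightarrow> complex) \<Rightarrow> real ^ 'n \<Rightarrow> complex"
    and \<gamma> :: "nat \<Rightarrow> real ^ 'n"
    and c\<^sub>\<phi> c\<^sub>\<psi> :: "(real ^ 'n) list \<Rightarrow> real"
    and \<phi> \<psi> :: "real \<Rightarrow> nat \<Rightarrow> real ^ 'n \<Rightarrow> complex"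
  assumes h: "smooth_regular_diffeo h"
    and orders: "0 \<le> 1 - \<rho>" "1 - \<rho> \<le> \<delta>" "\<delta> \<le> \<rho>" "\<rho> \<le> 1" "\<delta> < 1"
    and \<tau>: "\<tau> > 0"
    and p: "p \<in> CS \<tau> m \<rho> \<delta>"
    and A: "\<And>u y. u \<in> schwartz_space \<Longrightarrow> A (u \<circ> h) y = pdo p u (h y)"
    and \<gamma>: "lattice_enumeration \<gamma>"
    and partition: "\<And>r. r > 0 \<Longrightarrow> adapted_partition \<gamma> c\<^sub>\<phi> c\<^sub>\<psi> r (\<phi> r) (\<psi> r)"
  shows "A ` schwartz_space \<subseteq> bcontfun \<and>
    A \<in> OP (CS \<tau> m \<rho> \<delta>) \<and>
    (\<exists>r\<^sub>0>0. \<forall>r. 0 < r \<and> r < r\<^sub>0 \<longrightarrow>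
       (\<forall>j y y'. \<phi> r j (h y) * \<psi> r j (h y') \<noteq> 0 \<longrightarrow> invertible (Xi h y y')) \<and>
       (\<forall>y \<eta> y'. summable (\<lambda>j. transformed_symbol_term h (\<phi> r) (\<psi> r) p j y \<eta> y')) \<and>
       transformed_symbol h (\<phi> r) (\<psi> r) p \<in> CS \<tau> m \<rho> \<delta> \<and>
       op_equiv_mod A (pdo (transformed_symbol h (\<phi> r) (\<psi> r) p))
         (OP (CS_minus_infinity \<tau> \<rho> \<delta>)))"
proof -
 let ?th = "frac \<tau>" and ?d = "nat \<lfloor>\<tau>\<rfloor>" and ?c = "(2 * of_real pi) ^ CARD('n) :: complex" and ?n = "sqrt CARD('n)"
 have \<tau>0: "\<tau> >= 0" and \<delta>0: "\<delta> >= 0" using \<tau> orders by auto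
 interpret diffeo_symbols h ?th \<rho> \<delta>
  by unfold_locales (use h orders in \<open>auto simp: frac_ge_0 less_imp_le[OF frac_lt_1]\<close>)
 have n: "?n > 0" by simp
 have f: "symb ?th \<rho> \<delta> ?d m (unc p)" by (rule CS_imp_symb[OF p \<tau>0 \<delta>0])
 have unc: "unc (%y \<eta> y'. g y (\<eta>, y')) = g" for g :: "real ^ 'n => (real ^ 'n) \<times> (real ^ 'n) => complex"
  by (simp add: unc_def fun_eq_iff)
 \<comment> \<open>Every Schwartz function v has the form u o h with u = v o k, so the assumption on
   \<open>A\<close> determines it on the whole Schwartz space.\<close>
 have Av: "A v y = SI (unc p) (%x. v (k x)) (h y) (h y) / ?c" if v: "Sch v" for v y
 proof -
  have u: "Sch (%x. v (k x))" by (rule Sch_compose_k[OF v])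
  have "(%x. v (k x)) \<circ> h = v" by (simp add: o_def)
  then show ?thesis using A[of "%x. v (k x)" y] u pdo_eq_SI[OF f u, of "h y"] by (simp add: schwartz_iff)
 qed
 have bc: "A ` schwartz_space \<subseteq> bcontfun"
 proof (rule image_subsetI)
  fix v :: "real ^ 'n => complex" assume "v \<in> schwartz_space"
  then have v: "Sch v" by (simp add: schwartz_iff)
  have u: "Sch (%x. v (k x))" by (rule Sch_compose_k[OF v])
  have e: "A v = (%y. SI (unc p) (%x. v (k x)) (h y) (h y) / ?c)" using Av[OF v] by (rule ext)
  obtain B where B: "!!x x0. norm (SI (unc p) (%x. v (k x)) x x0) <= B" by (rule SI_bounded[OF f u]) blast
  have "continuous_on UNIV (A v)" unfolding e by (intro continuous_intros SI_cont[OF f u] h_cont) simp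
  moreover have "bounded (range (A v))" unfolding e bounded_iff
   using B by (intro exI[of _ "B / norm ?c"]) (auto simp: norm_divide intro!: divide_right_mono)
  ultimately show "A v \<in> bcontfun" by (simp add: bcontfun_def)
 qed
 have part: "partition_of_unity \<gamma> c\<^sub>\<phi> c\<^sub>\<psi> r (\<phi> r) (\<psi> r)" if "r > 0" for r
  by unfold_locales (use \<gamma> that partition[OF that] in auto)
 obtain N where N: "!!r x. r > 0 ==> finite {j. norm (x - r *\<^sub>R \<gamma> j) <= r * (?n + 1)} & card {j. norm (x - r *\<^sub>R \<gamma> j) <= r * (?n + 1)} <= N"
  by (rule lattice_ball_count[OF \<gamma>]) blast
 \<comment> \<open>A bound for the cut-off at every scale: without derivatives the bounds of the
   partition contain no power of r, and N is independent of r. This allows M to be fixed before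
   r0.\<close>
 define M where "M = real N * (c\<^sub>\<phi> [] * c\<^sub>\<psi> [])"
 obtain s0 c0 \<sigma> where s0: "s0 > 0" and c0: "c0 > 0" and \<sigma>: "\<sigma> = 1 \<or> \<sigma> = - 1"
  and mid: "!!s c y y'. s < s0 ==> (!!p. norm (c p) <= M) ==> (!!x x'. norm (x - x') >= 4 * s ==> c (x, x') = 0) ==> \<sigma> * det (mid c y y') >= c0"
  by (rule mid_det_bound[of M]) blast
 \<comment> \<open>\<open>mid\<close> is applied below with s = 4 r sqrt n, since the auxiliary
   cut-off belongs to the scale 4 r; the condition s < s0 is r < r0.\<close>
 define r0 where "r0 = s0 / (4 * ?n)"
 have r0: "r0 > 0" using s0 n by (simp add: r0_def)
 have key: "(\<forall>j y y'. \<phi> r j (h y) * \<psi> r j (h y') ~= 0 --> invertible (Xi h y y')) \<and>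
   (\<forall>y \<eta> y'. summable (%j. transformed_symbol_term h (\<phi> r) (\<psi> r) p j y \<eta> y')) \<and>
   symb ?th \<rho> \<delta> ?d m (unc (transformed_symbol h (\<phi> r) (\<psi> r) p)) \<and>
   (\<exists>R. (\<forall>w. symb ?th \<rho> \<delta> ?d w R) & (\<forall>v y. Sch v \<longrightarrow>
     A v y = SI (unc (transformed_symbol h (\<phi> r) (\<psi> r) p)) v y y / ?c + SI R v y y / ?c))"
  if r: "0 < r" "r < r0" for r
 proof -
  \<comment> \<open>Three scales. P at scale r truncates the symbol. Q at scale 4 r is 1 for |x -
    x'| < 4 r sqrt n, hence wherever P is nonzero, and enters the matrix \<open>mid\<close>. S at
    scale r / 4 vanishes for |x - x'| >= r sqrt n, the region that contains the support of 1 - P,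
    and yields the vector field for the remainder.\<close>
  interpret P: partition_of_unity \<gamma> c\<^sub>\<phi> c\<^sub>\<psi> r "\<phi> r" "\<psi> r" by (rule part[OF r(1)])
  have r4: "4 * r > 0" "r / 4 > 0" using r by auto
  interpret Q: partition_of_unity \<gamma> c\<^sub>\<phi> c\<^sub>\<psi> "4 * r" "\<phi> (4 * r)" "\<psi> (4 * r)" by (rule part[OF r4(1)])
  interpret S: partition_of_unity \<gamma> c\<^sub>\<phi> c\<^sub>\<psi> "r / 4" "\<phi> (r / 4)" "\<psi> (r / 4)" by (rule part[OF r4(2)])
  have PQ: "Q.cutoff (x, x') = 1" if "norm (x - x') < 4 * r * ?n" for x x' using Q.cutoff_one that by simp
  have Qb: "norm (Q.cutoff p) <= M" for p
  proof -
   have "card (Q.near (?n + 1) x) <= N" for x using N[OF r4(1), of x] by (simp add: Q.near_def)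
   from Q.psum_bound[OF this, of "[]" "[]" p] show ?thesis using r by (simp add: M_def)
  qed
  have "4 * r * ?n < s0" using r(2) n unfolding r0_def by (simp add: field_simps)
  then have det: "\<sigma> * det (mid Q.cutoff y y') >= c0" for y y'
   by (rule mid) (rule Qb, rule Q.cutoff_zero)
  interpret T: transformed_symbols h ?th \<rho> \<delta> P.cutoff Q.cutoff \<sigma> c0
  proof unfold_locales
   show "Q.cutoff q = 1" if "P.cutoff q ~= 0" for q
   proof (cases q)
    case (Pair x x')
    have "norm (x - x') < 4 * (r * ?n)" using P.cutoff_zero[of x x'] that Pair by force
    then show ?thesis unfolding Pair by (intro PQ) simp
   qed
  qed (use P.Cb_cutoff Q.Cb_cutoff c0 \<sigma> det in auto)
  have act: "mid Q.cutoff y y' = Xi h y y'" if "\<phi> r j (h y) * \<psi> r j (h y') ~= 0" for j y y'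
   by (rule mid_eq_Xi[where c = Q.cutoff, OF PQ[OF P.cutoff_active[OF that]]])
  have inv: "invertible (Xi h y y')" if "\<phi> r j (h y) * \<psi> r j (h y') ~= 0" for j y y'
   using T.invertible_mid[of y y'] act[OF that] by simp
  let ?B = "%y \<eta> y'. unc p (h y) (T.N y y' *v \<eta>, h y') * of_real (T.W y y')"
  \<comment> \<open>In a term with active cut-offs \<open>mid\<close> is the mean Jacobian, and the
    other terms are 0 on both sides. The sum over j therefore acts on the cut-off factors
    alone.\<close>
  have term_eq: "transformed_symbol_term h (\<phi> r) (\<psi> r) p j y \<eta> y' = (\<phi> r j (h y) * \<psi> r j (h y')) * ?B y \<eta> y'" for j y \<eta> y'
  proof (cases "\<phi> r j (h y) * \<psi> r j (h y') = 0")
   case True then show ?thesis by (auto simp: transformed_symbol_term_def)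
  next
   case False
   show ?thesis unfolding transformed_symbol_term_def unc_def T.N_def T.W_def act[OF False] fst_conv snd_conv of_real_mult by (simp only: mult_ac)
  qed
  have sm: "summable (%j. \<phi> r j x * \<psi> r j x')" for x x'
  proof (rule summable_finite[OF P.finite_near[of ?n x]])
   show "\<phi> r j x * \<psi> r j x' = 0" if "j \<notin> P.near ?n x" for j
    using that P.phi_active[of "[]" j x] by (auto simp: P.near_def)
  qed
  have sumb: "summable (%j. transformed_symbol_term h (\<phi> r) (\<psi> r) p j y \<eta> y')" for y \<eta> y'
   unfolding term_eq by (rule summable_mult2[OF sm])
  have ts: "unc (transformed_symbol h (\<phi> r) (\<psi> r) p) = T.transf (unc p)"
  proof (intro ext)
   fix y and z :: "(real ^ 'n) \<times> (real ^ 'n)"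
   have "unc (transformed_symbol h (\<phi> r) (\<psi> r) p) y z = (\<Sum>j. \<phi> r j (h y) * \<psi> r j (h (snd z))) * ?B y (fst z) (snd z)"
    unfolding unc_def transformed_symbol_def term_eq by (rule suminf_mult2[OF sm, symmetric])
   then show "unc (transformed_symbol h (\<phi> r) (\<psi> r) p) y z = T.transf (unc p) y z"
    unfolding T.transf_def P.psum_def by (simp add: mult_ac)
  qed
  define f1 where "f1 x z = P.cutoff (x, snd z) * unc p x z" for x z
  define f2 where "f2 x z = (1 - P.cutoff (x, snd z)) * unc p x z" for x z
  have f1: "symb ?th \<rho> \<delta> ?d m f1" unfolding f1_def[abs_def] by (rule symb_mult[OF symb_Cb[OF P.Cb_cutoff] f]) simp
  have f2: "symb ?th \<rho> \<delta> ?d m f2" unfolding f2_def[abs_def]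
   by (rule symb_mult[OF symb_Cb[OF Cb_diff[OF Cb_const P.Cb_cutoff]] f]) simp
  have rn: "r / 4 * ?n > 0" "r * ?n > 0" using r n by simp_all
  obtain dd :: "real ^ 'n => (real ^ 'n) \<times> (real ^ 'n) => complex" where od: "off_diagonal ?th \<rho> \<delta> dd (r * ?n)"
  proof (rule off_diagonal_exists[OF S.Cb_cutoff rn S.cutoff_one])
   show "S.cutoff (x, y) = 0" if "r * ?n <= norm (x - y)" for x y by (rule S.cutoff_zero) (use that in simp)
  qed
  have off: "f2 x (xi, y) = 0" if "norm (x - y) < r * ?n" for x xi y using P.cutoff_one[OF that] by (simp add: f2_def)
  obtain R where R: "!!w. symb ?th \<rho> \<delta> ?d w R"
   "!!u y. Sch u ==> SI f2 u (h y) (h y) = SI R (%y. u (h y)) y y"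
  proof (rule remainder[OF od f2])
   show "f2 x (xi, y) = 0" if "norm (x - y) < r * ?n" for x xi y by (rule off[OF that])
   fix R assume "!!w. symb ?th \<rho> \<delta> ?d w R" "!!u y. Sch u ==> SI f2 u (h y) (h y) = SI R (%y. u (h y)) y y"
   then show thesis by (rule that)
  qed
  have "A v y = SI (T.transf (unc p)) v y y / ?c + SI R v y y / ?c" if v: "Sch v" for v y
  proof -
   let ?u = "%x. v (k x)"
   have u: "Sch ?u" by (rule Sch_compose_k[OF v])
   have "(%x z. f1 x z + f2 x z) = unc p" by (simp add: f1_def f2_def fun_eq_iff algebra_simps)
   then have "SI (unc p) ?u (h y) (h y) = SI f1 ?u (h y) (h y) + SI f2 ?u (h y) (h y)"
    using SI_add[OF f1 f2 u, of "h y" "h y"] by simp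
   moreover have "SI f1 ?u (h y) (h y) = SI (T.transf (unc p)) v y y"
    using T.SI_change_of_variables[OF f u, of y] unfolding f1_def[abs_def] by simp
   moreover have "SI f2 ?u (h y) (h y) = SI R v y y" using R(2)[OF u, of y] by simp
   ultimately show ?thesis using Av[OF v, of y] by (simp add: add_divide_distrib)
  qed
  then show ?thesis using inv sumb R(1) T.symb_transf[OF f] unfolding ts by blast
 qed
 have AOP: "A \<in> OP (CS \<tau> m \<rho> \<delta>)"
 proof -
  \<comment> \<open>Membership of \<open>A\<close> in the class needs one admissible radius only;
    the remainder, being of every order, is added to the symbol.\<close>
  have "0 < r0 / 2" "r0 / 2 < r0" using r0 by auto
  note key' = key[OF this]
  let ?a = "unc (transformed_symbol h (\<phi> (r0 / 2)) (\<psi> (r0 / 2)) p)"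
  from key' obtain R where a: "symb ?th \<rho> \<delta> ?d m ?a" and R: "!!w. symb ?th \<rho> \<delta> ?d w R"
   and eq: "!!v y. Sch v ==> A v y = SI ?a v y y / ?c + SI R v y y / ?c" by blast
  define q where "q = (%y \<eta> y'. ?a y (\<eta>, y') + R y (\<eta>, y'))"
  have q': "unc q = (%y z. ?a y z + R y z)" by (simp add: q_def unc_def fun_eq_iff)
  have q: "symb ?th \<rho> \<delta> ?d m (unc q)" unfolding q' by (rule symb_add[OF a R])
  have "A v = pdo q v" if "v \<in> schwartz_space" for v
  proof
   fix y
   have v: "Sch v" using that by (simp add: schwartz_iff)
   show "A v y = pdo q v y"
    unfolding pdo_eq_SI[OF q v] q' SI_add[OF a R v] add_divide_distrib by (rule eq[OF v])
  qed
  then show ?thesis unfolding OP_def using symb_imp_CS[OF q \<tau>0 \<delta>0] by blast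
 qed
 have equiv: "op_equiv_mod A (pdo (transformed_symbol h (\<phi> r) (\<psi> r) p)) (OP (CS_minus_infinity \<tau> \<rho> \<delta>))"
  and mem: "transformed_symbol h (\<phi> r) (\<psi> r) p \<in> CS \<tau> m \<rho> \<delta>" if r: "0 < r" "r < r0" for r
 proof -
  let ?a = "transformed_symbol h (\<phi> r) (\<psi> r) p"
  from key[OF r] obtain R where a: "symb ?th \<rho> \<delta> ?d m (unc ?a)" and R: "!!w. symb ?th \<rho> \<delta> ?d w R"
   and eq: "!!v y. Sch v ==> A v y = SI (unc ?a) v y y / ?c + SI R v y y / ?c" by blast
  show "?a \<in> CS \<tau> m \<rho> \<delta>" by (rule symb_imp_CS[OF a \<tau>0 \<delta>0])
  define q where "q = (%y \<eta> y'. R y (\<eta>, y'))"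
  have q: "symb ?th \<rho> \<delta> ?d w (unc q)" for w unfolding q_def unc by (rule R)
  have "q \<in> CS_minus_infinity \<tau> \<rho> \<delta>" unfolding CS_minus_infinity_def using symb_imp_CS[OF q \<tau>0 \<delta>0] by blast
  moreover have "(%y. A v y - pdo ?a v y) = pdo q v" if "v \<in> schwartz_space" for v
  proof
   fix y
   have v: "Sch v" using that by (simp add: schwartz_iff)
   show "A v y - pdo ?a v y = pdo q v y"
    unfolding pdo_eq_SI[OF q v] pdo_eq_SI[OF a v] eq[OF v] by (simp add: q_def unc)
  qed
  ultimately show "op_equiv_mod A (pdo ?a) (OP (CS_minus_infinity \<tau> \<rho> \<delta>))"
   unfolding op_equiv_mod_def OP_def by blast
 qed
 have fin: "(\<forall>j y y'. \<phi> r j (h y) * \<psi> r j (h y') ~= 0 --> invertible (Xi h y y')) \<and>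
   (\<forall>y \<eta> y'. summable (%j. transformed_symbol_term h (\<phi> r) (\<psi> r) p j y \<eta> y')) \<and>
   transformed_symbol h (\<phi> r) (\<psi> r) p \<in> CS \<tau> m \<rho> \<delta> \<and>
   op_equiv_mod A (pdo (transformed_symbol h (\<phi> r) (\<psi> r) p)) (OP (CS_minus_infinity \<tau> \<rho> \<delta>))"
  if "0 < r & r < r0" for r
  using key[OF conjunct1[OF that] conjunct2[OF that]] by (intro conjI mem equiv) (use that in \<open>blast+\<close>)
 show ?thesis
 proof (intro conjI)
  show "\<exists>r\<^sub>0>0. \<forall>r. 0 < r & r < r\<^sub>0 \<longrightarrow>
   (\<forall>j y y'. \<phi> r j (h y) * \<psi> r j (h y') ~= 0 --> invertible (Xi h y y')) \<and>
   (\<forall>y \<eta> y'. summable (%j. transformed_symbol_term h (\<phi> r) (\<psi> r) p j y \<eta> y')) \<and>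
   transformed_symbol h (\<phi> r) (\<psi> r) p \<in> CS \<tau> m \<rho> \<delta> \<and>
   op_equiv_mod A (pdo (transformed_symbol h (\<phi> r) (\<psi> r) p)) (OP (CS_minus_infinity \<tau> \<rho> \<delta>))"
   by (rule exI[of _ r0], rule conjI[OF r0], rule allI, rule impI, rule fin)
 qed (rule bc, rule AOP)
qed

end
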